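(* Let $N\ge 2$, let $\hat\Omega\subset\mathbb{R}^N$ be a domain, and let $\hat\Gamma\subset\partial\hat\Omega$ be a (relatively open) part of its boundary of class $C^{1,1}$ with outward unit normal $\boldsymbol n$. Let $\hat\phi\in H^3(\mathbb{R}^N)$ satisfy the homogeneous Neumann condition $\partial_{\boldsymbol n}\hat\phi=\boldsymbol n\cdot\nabla\hat\phi=0$ on $\hat\Gamma$. Then, (almost everywhere) on $\hat\Gamma$, $$\partial_{\boldsymbol n}\left(|\nabla\hat\phi|^2\right)=-2\,(\nabla_\Gamma\hat\phi)^T\,[\nabla_\Gamma\boldsymbol n]\,\nabla_\Gamma\hat\phi .$$
   Context: $\partial_{\boldsymbol n}(\cdot)=\boldsymbol n\cdot\nabla(\cdot)$ is the normal derivative. The tangential gradient on $\hat\Gamma$ is $\nabla_\Gamma(\cdot)=\nabla(\cdot)-\partial_{\boldsymbol n}(\cdot)\,\boldsymbol n$, with components denoted $\bar D_\alpha$, $\alpha=1,\dots,N$. The $N\times N$ matrix $[\nabla_\Gamma\boldsymbol n]$ (extended Weingarten map) has entries $[\nabla_\Gamma\boldsymbol n]_{\alpha i}=\bar D_\alpha n_i$, where $n_i$ is the $i$-th component of $\boldsymbol n$. Functions and derivatives on $\hat\Gamma$ are understood in the sense of traces. *)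

theory Defs
  imports "HOL-Analysis.Analysis"
begin

subsection \<open>Classical derivatives\<close>

definition partial_deriv :: "'n::finite \<Rightarrow> (real^'n \<Rightarrow> real) \<Rightarrow> real^'n \<Rightarrow> real" where
  "partial_deriv i f x = frechet_derivative f (at x) (axis i 1)"

definition grad :: "(real^'n \<Rightarrow> real) \<Rightarrow> real^'n \<Rightarrow> real^'n" where
  "grad f x = (\<chi> i. partial_deriv i f x)"

primrec C_k :: "nat \<Rightarrow> (real^'n \<Rightarrow> real) \<Rightarrow> bool" where
  "C_k 0 f \<longleftrightarrow> continuous_on UNIV f"
| "C_k (Suc k) f \<longleftrightarrow> (\<forall>x. f differentiable (at x)) \<and> (\<forall>i. C_k k (partial_deriv i f))"

definition test_function :: "(real^'n \<Rightarrow> real) \<Rightarrow> bool" where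
  "test_function f \<longleftrightarrow> (\<forall>k. C_k k f) \<and> compact (closure {x. f x \<noteq> 0})"


subsection \<open>Sobolev spaces on the whole space\<close>

definition locally_integrable :: "(real^'n \<Rightarrow> real) \<Rightarrow> bool" where
  "locally_integrable u \<longleftrightarrow> (\<forall>K. compact K \<longrightarrow> u absolutely_integrable_on K)"

definition has_weak_pderiv :: "'n::finite \<Rightarrow> (real^'n \<Rightarrow> real) \<Rightarrow> (real^'n \<Rightarrow> real) \<Rightarrow> bool" where
  "has_weak_pderiv i u w \<longleftrightarrow> locally_integrable u \<and> locally_integrable w \<and>
     (\<forall>\<eta>. test_function \<eta> \<longrightarrow>
        (LINT x|lebesgue. u x * partial_deriv i \<eta> x) = - (LINT x|lebesgue. w x * \<eta> x))"

text \<open>Weak derivatives are unique up to Lebesgue null sets; this picks a representative.\<close>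

definition weak_pderiv :: "'n::finite \<Rightarrow> (real^'n \<Rightarrow> real) \<Rightarrow> real^'n \<Rightarrow> real" where
  "weak_pderiv i u = (SOME w. has_weak_pderiv i u w)"

definition weak_grad :: "(real^'n \<Rightarrow> real) \<Rightarrow> real^'n \<Rightarrow> real^'n" where
  "weak_grad u x = (\<chi> i. weak_pderiv i u x)"

definition Lp :: "real \<Rightarrow> (real^'n \<Rightarrow> real) \<Rightarrow> bool" where
  "Lp p u \<longleftrightarrow> u \<in> borel_measurable lebesgue \<and> integrable lebesgue (\<lambda>x. \<bar>u x\<bar> powr p)"

primrec sobolev :: "nat \<Rightarrow> real \<Rightarrow> (real^'n \<Rightarrow> real) \<Rightarrow> bool" where
  "sobolev 0 p u \<longleftrightarrow> Lp p u"
| "sobolev (Suc k) p u \<longleftrightarrow> Lp p u \<and> (\<forall>i. \<exists>w. has_weak_pderiv i u w \<and> sobolev k p w)"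

definition sobolev_H :: "nat \<Rightarrow> (real^'n \<Rightarrow> real) set" where
  "sobolev_H k = {u. sobolev k 2 u}"

definition tendsto_W1 ::
    "real \<Rightarrow> (nat \<Rightarrow> real^'n \<Rightarrow> real) \<Rightarrow> (real^'n \<Rightarrow> real) \<Rightarrow> bool" where
  "tendsto_W1 p v u \<longleftrightarrow>
     (\<lambda>k. \<integral>\<^sup>+x. ennreal (\<bar>v k x - u x\<bar> powr p) \<partial>lebesgue) \<longlonglongrightarrow> 0 \<and>
     (\<forall>i. (\<lambda>k. \<integral>\<^sup>+x. ennreal (\<bar>partial_deriv i (v k) x - weak_pderiv i u x\<bar> powr p) \<partial>lebesgue)
        \<longlonglongrightarrow> 0)"


subsection \<open>Boundary charts, surface measure and outward normal\<close>

definition tangential :: "real^'n \<Rightarrow> real^'n \<Rightarrow> real^'n" where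
  "tangential \<nu> v = v - (\<nu> \<bullet> v) *\<^sub>R \<nu>"

definition C11 :: "(real^'n \<Rightarrow> real) \<Rightarrow> bool" where
  "C11 \<gamma> \<longleftrightarrow> (\<forall>x. \<gamma> differentiable (at x)) \<and> (\<exists>L. L-lipschitz_on UNIV (grad \<gamma>))"

text \<open>
  Near \<open>x0\<close>, the set lies strictly above the graph of \<open>\<gamma>\<close> over the hyperplane orthogonal to
  the unit vector \<open>e\<close>. Functions of \<open>N - 1\<close> variables are represented by functions on the
  whole space of which only the values on that hyperplane matter.
\<close>

definition C11_chart ::
    "(real^'n) set \<Rightarrow> real^'n \<Rightarrow> real \<Rightarrow> real^'n \<Rightarrow> (real^'n \<Rightarrow> real) \<Rightarrow> bool" where
  "C11_chart \<Omega> x0 r e \<gamma> \<longleftrightarrow> r > 0 \<and> norm e = 1 \<and> C11 \<gamma> \<and>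
     \<Omega> \<inter> ball x0 r = {x \<in> ball x0 r. x \<bullet> e > \<gamma> (tangential e x)}"

definition C11_boundary_part :: "(real^'n) set \<Rightarrow> (real^'n) set \<Rightarrow> bool" where
  "C11_boundary_part \<Omega> \<Gamma> \<longleftrightarrow> openin (top_of_set (frontier \<Omega>)) \<Gamma> \<and>
     (\<forall>x\<in>\<Gamma>. \<exists>r e \<gamma>. C11_chart \<Omega> x r e \<gamma>)"

text \<open>
  The \<open>(N - 1)\<close>-dimensional Lebesgue measure of a subset of the hyperplane orthogonal to the
  unit vector \<open>e\<close> is the volume of the cylinder of height one over it.
\<close>

definition hyperplane_measure :: "real^'n \<Rightarrow> (real^'n) measure" where
  "hyperplane_measure e =
     distr (restrict_space lborel {x. 0 \<le> x \<bullet> e \<and> x \<bullet> e \<le> 1}) borel (tangential e)"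

definition graph_measure :: "real^'n \<Rightarrow> (real^'n \<Rightarrow> real) \<Rightarrow> (real^'n) measure" where
  "graph_measure e \<gamma> =
     distr (density (hyperplane_measure e)
              (\<lambda>y. ennreal (sqrt (1 + (norm (tangential e (grad \<gamma> y)))\<^sup>2))))
       borel (\<lambda>y. y + \<gamma> y *\<^sub>R e)"

text \<open>Almost everywhere with respect to the surface measure, tested in every chart.\<close>

definition AE_boundary ::
    "(real^'n) set \<Rightarrow> (real^'n) set \<Rightarrow> (real^'n \<Rightarrow> bool) \<Rightarrow> bool" where
  "AE_boundary \<Omega> \<Gamma> P \<longleftrightarrow> (\<forall>x0 r e \<gamma>. C11_chart \<Omega> x0 r e \<gamma> \<longrightarrow>
     (AE x in graph_measure e \<gamma>. x \<in> \<Gamma> \<inter> ball x0 r \<longrightarrow> P x))"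

definition tendsto_Lp_loc_boundary ::
    "real \<Rightarrow> (real^'n) set \<Rightarrow> (real^'n) set \<Rightarrow> (nat \<Rightarrow> real^'n \<Rightarrow> real) \<Rightarrow> (real^'n \<Rightarrow> real) \<Rightarrow> bool"
  where
  "tendsto_Lp_loc_boundary p \<Omega> \<Gamma> v g \<longleftrightarrow>
     (\<forall>x0 r e \<gamma> K. C11_chart \<Omega> x0 r e \<gamma> \<longrightarrow> compact K \<longrightarrow> K \<subseteq> \<Gamma> \<inter> ball x0 r \<longrightarrow>
        (\<lambda>k. \<integral>\<^sup>+x\<in>K. ennreal (\<bar>v k x - g x\<bar> powr p) \<partial>graph_measure e \<gamma>) \<longlonglongrightarrow> 0)"

definition outward_unit_normal :: "(real^'n) set \<Rightarrow> real^'n \<Rightarrow> real^'n \<Rightarrow> bool" where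
  "outward_unit_normal \<Omega> x \<nu> \<longleftrightarrow> norm \<nu> = 1 \<and>
     ((\<lambda>y. ((y - x) \<bullet> \<nu>) / norm (y - x)) \<longlongrightarrow> 0) (at x within frontier \<Omega>) \<and>
     (\<forall>\<^sub>F t in at_right 0. x - t *\<^sub>R \<nu> \<in> \<Omega> \<and> x + t *\<^sub>R \<nu> \<notin> closure \<Omega>)"


subsection \<open>Traces and differential operators on the boundary\<close>

text \<open>
  The trace is the continuous extension of the restriction map from test functions to
  \<open>W\<^sup>1\<^sup>,\<^sup>p\<close> of the whole space. It is unique up to surface null sets.
\<close>

definition is_boundary_trace ::
    "real \<Rightarrow> (real^'n) set \<Rightarrow> (real^'n) set \<Rightarrow> (real^'n \<Rightarrow> real) \<Rightarrow> (real^'n \<Rightarrow> real) \<Rightarrow> bool" where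
  "is_boundary_trace p \<Omega> \<Gamma> u g \<longleftrightarrow> sobolev 1 p u \<and> set_borel_measurable borel \<Gamma> g \<and>
     (\<exists>v. (\<forall>k. test_function (v k)) \<and> tendsto_W1 p v u \<and> tendsto_Lp_loc_boundary p \<Omega> \<Gamma> v g)"

definition boundary_trace ::
    "real \<Rightarrow> (real^'n) set \<Rightarrow> (real^'n) set \<Rightarrow> (real^'n \<Rightarrow> real) \<Rightarrow> real^'n \<Rightarrow> real" where
  "boundary_trace p \<Omega> \<Gamma> u = (SOME g. is_boundary_trace p \<Omega> \<Gamma> u g)"

definition trace_grad ::
    "real \<Rightarrow> (real^'n) set \<Rightarrow> (real^'n) set \<Rightarrow> (real^'n \<Rightarrow> real) \<Rightarrow> real^'n \<Rightarrow> real^'n" where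
  "trace_grad p \<Omega> \<Gamma> u x = (\<chi> i. boundary_trace p \<Omega> \<Gamma> (weak_pderiv i u) x)"

definition normal_deriv ::
    "real \<Rightarrow> (real^'n) set \<Rightarrow> (real^'n) set \<Rightarrow> (real^'n \<Rightarrow> real^'n) \<Rightarrow> (real^'n \<Rightarrow> real) \<Rightarrow>
      real^'n \<Rightarrow> real" where
  "normal_deriv p \<Omega> \<Gamma> n u x = n x \<bullet> trace_grad p \<Omega> \<Gamma> u x"

definition sobolev_tangential_grad ::
    "real \<Rightarrow> (real^'n) set \<Rightarrow> (real^'n) set \<Rightarrow> (real^'n \<Rightarrow> real^'n) \<Rightarrow> (real^'n \<Rightarrow> real) \<Rightarrow>
      real^'n \<Rightarrow> real^'n" where
  "sobolev_tangential_grad p \<Omega> \<Gamma> n u x =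
     trace_grad p \<Omega> \<Gamma> u x - normal_deriv p \<Omega> \<Gamma> n u x *\<^sub>R n x"

text \<open>
  For a function given only on \<open>\<Gamma>\<close>, such as a component of the normal, the tangential
  gradient at \<open>x\<close> is that of any extension differentiable at \<open>x\<close>; it does not depend on
  the extension. For Lipschitz functions it exists almost everywhere.
\<close>

definition has_tangential_grad ::
    "(real^'n) set \<Rightarrow> (real^'n \<Rightarrow> real^'n) \<Rightarrow> (real^'n \<Rightarrow> real) \<Rightarrow> real^'n \<Rightarrow> real^'n \<Rightarrow> bool" where
  "has_tangential_grad \<Gamma> n f v x \<longleftrightarrow>
     (\<exists>F. (\<forall>y\<in>\<Gamma>. F y = f y) \<and> F differentiable (at x) \<and> v = tangential (n x) (grad F x))"

definition tangential_grad ::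
    "(real^'n) set \<Rightarrow> (real^'n \<Rightarrow> real^'n) \<Rightarrow> (real^'n \<Rightarrow> real) \<Rightarrow> real^'n \<Rightarrow> real^'n" where
  "tangential_grad \<Gamma> n f x = (SOME v. has_tangential_grad \<Gamma> n f v x)"

definition weingarten :: "(real^'n) set \<Rightarrow> (real^'n \<Rightarrow> real^'n) \<Rightarrow> real^'n \<Rightarrow> real^'n^'n" where
  "weingarten \<Gamma> n x = (\<chi> \<alpha> i. tangential_grad \<Gamma> n (\<lambda>y. n y $ i) x $ \<alpha>)"

end

theory Submission
  imports Defs
begin

text \<open>
  Formally the statement is one line: differentiating \<open>n \<bullet> \<nabla>\<phi> = 0\<close> along \<open>\<Gamma>\<close> in the tangential
  direction \<open>\<nabla>\<phi>\<close> gives \<open>\<nabla>\<phi> \<bullet> (D n \<nabla>\<phi>) + n \<bullet> (D\<^sup>2\<phi> \<nabla>\<phi>) = 0\<close>, and the normal derivative of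
  \<open>|\<nabla>\<phi>|\<^sup>2\<close> is \<open>2 n \<bullet> (D\<^sup>2\<phi> \<nabla>\<phi>)\<close> because the Hessian is symmetric. For \<open>\<phi>\<close> in the third-order Sobolev
  space the gradient and the Hessian exist on \<open>\<Gamma>\<close> only as traces and \<open>n\<close> is only Lipschitz, so both
  the differentiation along \<open>\<Gamma>\<close> and the product rules have to be justified almost everywhere.

  Test functions \<open>F\<^sub>m\<close> approximate \<open>\<phi>\<close> geometrically fast (\<open>sobolev_fast_approximation\<close>). By the trace
  inequality, \<open>\<nabla>F\<^sub>m\<close> and \<open>D\<^sup>2F\<^sub>m\<close> then converge almost everywhere on every graph at once
  (\<open>fast_convergence_AE\<close>); their pointwise limits \<open>g\<close> and \<open>G\<close> represent the traces of \<open>\<nabla>\<phi>\<close> and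
  \<open>D\<^sup>2\<phi>\<close>, and \<open>2 \<Sum>\<^sub>i g\<^sub>i G\<^sub>i\<^sub>j\<close> represents that of the \<open>j\<close>-th derivative of \<open>|\<nabla>\<phi>|\<^sup>2\<close>, since
  traces are unique up to null sets (\<open>boundary_trace_eq\<close>).

  In a chart the normal is the explicit Lipschitz function \<open>graph_normal\<close> (\<open>outward_normal_eq\<close>),
  differentiable almost everywhere by Rademacher's theorem (\<open>rademacher\<close>). Integrating its product
  with \<open>\<nabla>F\<^sub>m\<close> by parts along the graph and letting \<open>m\<close> tend to infinity turns \<open>n \<bullet> g = 0\<close> into the
  differentiated identity almost everywhere (\<open>tangential_identity\<close>). Where the normal is
  differentiable the Weingarten map is its derivative (\<open>tangential_grad_normal\<close>), and what remains
  is linear algebra at one point (\<open>pointwise_identity\<close>).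

  Functions on the hyperplane orthogonal to the chart direction \<open>e\<close> are treated throughout as functions
  on the whole space that are constant along \<open>e\<close>. Surface null sets become Lebesgue null sets
  of the whole space (\<open>AE_graph_measureI\<close>, \<open>AE_graph_measureD\<close>), and the dimension never changes.
\<close>

section \<open>Partial derivatives\<close>

lemma partial_deriv_eqI:
  assumes "(f has_derivative f') (at x)"
  shows "partial_deriv i f x = f' (axis i 1)"
  using frechet_derivative_at[OF assms] by (simp add: partial_deriv_def)

lemma has_derivative_grad:
  assumes "f differentiable (at x)"
  shows "(f has_derivative (\<lambda>h. grad f x \<bullet> h)) (at x)"
proof -
  obtain f' where f': "(f has_derivative f') (at x)"
    using assms by (auto simp: differentiable_def)
  have lin: "linear f'" using f' has_derivative_linear by blast
  have "f' h = grad f x \<bullet> h" for h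
  proof -
    have "f' h = f' (\<Sum>i\<in>UNIV. (h $ i) *\<^sub>R axis i 1)"
      using basis_expansion[of h] by (simp add: scalar_mult_eq_scaleR)
    also have "\<dots> = (\<Sum>i\<in>UNIV. (h $ i) * partial_deriv i f x)"
      by (simp add: linear_sum[OF lin] linear_cmul[OF lin] partial_deriv_eqI[OF f'])
    finally show ?thesis by (simp add: grad_def inner_vec_def mult.commute)
  qed
  then have "f' = (\<lambda>h. grad f x \<bullet> h)" by blast
  with f' show ?thesis by simp
qed

lemma has_derivative_line:
  fixes f :: "'a::real_normed_vector \<Rightarrow> real"
  assumes "(f has_derivative f') (at (x + t *\<^sub>R w))"
  shows "((\<lambda>t. f (x + t *\<^sub>R w)) has_real_derivative f' w) (at t)"
proof -
  have "((\<lambda>t. x + t *\<^sub>R w) has_derivative (\<lambda>s. s *\<^sub>R w)) (at t)" by (auto intro!: derivative_eq_intros)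
  from has_derivative_compose[OF this assms]
  have "((\<lambda>t. f (x + t *\<^sub>R w)) has_derivative (\<lambda>s. f' (s *\<^sub>R w))) (at t)" .
  moreover have "f' (s *\<^sub>R w) = f' w * s" for s
    using linear_cmul[OF has_derivative_linear[OF assms], of s w] by (simp add: mult.commute)
  ultimately show ?thesis by (simp add: has_field_derivative_def mult_commute_abs)
qed

lemma has_derivative_along_line:
  assumes "f differentiable (at (z + t *\<^sub>R v))"
  shows "((\<lambda>t. f (z + t *\<^sub>R v)) has_real_derivative (grad f (z + t *\<^sub>R v) \<bullet> v)) (at t)"
  by (rule has_derivative_line[OF has_derivative_grad[OF assms]])

lemma partial_deriv_const [simp]: "partial_deriv i (\<lambda>x. c) = (\<lambda>x. 0)"
  by (rule ext, rule partial_deriv_eqI[of _ "\<lambda>h. 0"]) auto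

lemma partial_deriv_add:
  assumes "f differentiable (at x)" "g differentiable (at x)"
  shows "partial_deriv i (\<lambda>x. f x + g x) x = partial_deriv i f x + partial_deriv i g x"
  using partial_deriv_eqI[OF has_derivative_add[OF has_derivative_grad[OF assms(1)] has_derivative_grad[OF assms(2)]], of i]
  by (simp add: inner_axis grad_def)

lemma partial_deriv_diff:
  assumes "f differentiable (at x)" "g differentiable (at x)"
  shows "partial_deriv i (\<lambda>x. f x - g x) x = partial_deriv i f x - partial_deriv i g x"
  using partial_deriv_eqI[OF has_derivative_diff[OF has_derivative_grad[OF assms(1)] has_derivative_grad[OF assms(2)]], of i]
  by (simp add: inner_axis grad_def)

lemma partial_deriv_mult:
  assumes "f differentiable (at x)" "g differentiable (at x)"
  shows "partial_deriv i (\<lambda>x. f x * g x) x = partial_deriv i f x * g x + f x * partial_deriv i g x"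
  using partial_deriv_eqI[OF has_derivative_mult[OF has_derivative_grad[OF assms(1)] has_derivative_grad[OF assms(2)]], of i]
  by (simp add: inner_axis grad_def)

lemma partial_deriv_scale_shift:
  assumes "f differentiable (at (a *\<^sub>R x + b))"
  shows "partial_deriv i (\<lambda>x. f (a *\<^sub>R x + b)) x = a * partial_deriv i f (a *\<^sub>R x + b)"
proof -
  have "((\<lambda>x. f (a *\<^sub>R x + b)) has_derivative (\<lambda>h. grad f (a *\<^sub>R x + b) \<bullet> (a *\<^sub>R h))) (at x)"
    by (rule has_derivative_compose[where g=f, OF _ has_derivative_grad])
       (auto intro!: derivative_eq_intros assms)
  from partial_deriv_eqI[OF this, of i] show ?thesis by (simp add: inner_axis grad_def)
qed

section \<open>Smooth functions\<close>

definition smooth :: "(real^'n \<Rightarrow> real) \<Rightarrow> bool" where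
  "smooth f \<longleftrightarrow> (\<forall>k. C_k k f)"

lemma C_k_continuous: "C_k k f \<Longrightarrow> continuous_on UNIV f"
  by (cases k) (auto simp: continuous_on_eq_continuous_at differentiable_imp_continuous_within)

lemma C_k_Suc_imp: "C_k (Suc k) f \<Longrightarrow> C_k k f"
  by (induction k arbitrary: f) (auto simp: C_k_continuous differentiable_imp_continuous_within continuous_on_eq_continuous_at)

lemma smoothD:
  assumes "smooth f"
  shows "f differentiable (at x)" "smooth (partial_deriv i f)" "continuous_on UNIV f"
    "continuous_on S f" "f \<in> borel_measurable borel" "C_k k f"
proof -
  have *: "C_k k f" for k using assms by (auto simp: smooth_def)
  from *[of 1] show "f differentiable (at x)" by simp
  show "smooth (partial_deriv i f)" unfolding smooth_def using *[of "Suc _"] by simp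
  show c: "continuous_on UNIV f" by (rule C_k_continuous[OF *[of 0]])
  then show "continuous_on S f" by (rule continuous_on_subset) auto
  show "f \<in> borel_measurable borel" by (rule borel_measurable_continuous_onI[OF c])
qed (use assms in \<open>auto simp: smooth_def\<close>)

lemma smooth_grad_continuous: "smooth f \<Longrightarrow> continuous_on UNIV (grad f)"
  unfolding grad_def by (intro continuous_on_vec_lambda smoothD(3)[OF smoothD(2)])

lemma C_k_const [simp]: "C_k k (\<lambda>x. c)"
  by (induction k arbitrary: c) auto

lemma C_k_add: "C_k k f \<Longrightarrow> C_k k g \<Longrightarrow> C_k k (\<lambda>x. f x + g x)"
proof (induction k arbitrary: f g)
  case (Suc k)
  then have "partial_deriv i (\<lambda>x. f x + g x) = (\<lambda>x. partial_deriv i f x + partial_deriv i g x)" for i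
    by (intro ext partial_deriv_add) auto
  with Suc show ?case by (auto intro: differentiable_add)
qed (auto intro: continuous_intros)

lemma C_k_mult: "C_k k f \<Longrightarrow> C_k k g \<Longrightarrow> C_k k (\<lambda>x. f x * g x)"
proof (induction k arbitrary: f g)
  case (Suc k)
  then have "partial_deriv i (\<lambda>x. f x * g x) =
     (\<lambda>x. partial_deriv i f x * g x + f x * partial_deriv i g x)" for i
    by (intro ext partial_deriv_mult) auto
  with Suc C_k_Suc_imp[OF Suc.prems(1)] C_k_Suc_imp[OF Suc.prems(2)]
  show ?case by (auto intro!: differentiable_mult C_k_add)
qed (auto intro: continuous_intros)

lemma C_k_scale_shift: "C_k k f \<Longrightarrow> C_k k (\<lambda>x. f (a *\<^sub>R x + b))"
proof (induction k arbitrary: f)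
  case 0
  then have "continuous_on UNIV f" by simp
  then have "continuous_on UNIV (\<lambda>x. f (a *\<^sub>R x + b))"
    by (rule continuous_on_compose2) (auto intro!: continuous_intros)
  then show ?case by simp
next
  case (Suc k)
  have d: "f differentiable (at x)" for x using Suc.prems by auto
  have "(\<lambda>x. f (a *\<^sub>R x + b)) differentiable (at x)" for x
    by (rule differentiable_compose[OF d]) (auto intro!: derivative_intros)
  moreover have "partial_deriv i (\<lambda>x. f (a *\<^sub>R x + b)) = (\<lambda>x. a * partial_deriv i f (a *\<^sub>R x + b))" for i
    by (intro ext partial_deriv_scale_shift d)
  ultimately show ?case using Suc by (auto intro!: C_k_mult)
qed

lemma smooth_intros:
  "smooth (\<lambda>x. c)"
  "smooth f \<Longrightarrow> smooth g \<Longrightarrow> smooth (\<lambda>x. f x + g x)"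
  "smooth f \<Longrightarrow> smooth g \<Longrightarrow> smooth (\<lambda>x. f x * g x)"
  "smooth f \<Longrightarrow> smooth (\<lambda>x. f (a *\<^sub>R x + b))"
  by (auto simp: smooth_def C_k_add C_k_mult C_k_scale_shift)

lemma smooth_diff:
  assumes "smooth f" "smooth g" shows "smooth (\<lambda>x. f x - g x)"
proof -
  have "smooth (\<lambda>x. f x + (-1) * g x)" by (intro smooth_intros assms)
  then show ?thesis by simp
qed

lemma smooth_sum:
  "finite A \<Longrightarrow> (\<And>i. i \<in> A \<Longrightarrow> smooth (f i)) \<Longrightarrow> smooth (\<lambda>x. \<Sum>i\<in>A. f i x)"
  by (induction A rule: finite_induct) (auto intro: smooth_intros)

lemma smooth_prod:
  "finite A \<Longrightarrow> (\<And>i. i \<in> A \<Longrightarrow> smooth (f i)) \<Longrightarrow> smooth (\<lambda>x. \<Prod>i\<in>A. f i x)"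
  by (induction A rule: finite_induct) (auto intro: smooth_intros)

lemma partial_deriv_sum:
  "finite A \<Longrightarrow> (\<And>i. i \<in> A \<Longrightarrow> f i differentiable (at x)) \<Longrightarrow>
    partial_deriv j (\<lambda>x. \<Sum>i\<in>A. f i x) x = (\<Sum>i\<in>A. partial_deriv j (f i) x)"
proof (induction A rule: finite_induct)
  case (insert a A)
  then show ?case by (simp add: partial_deriv_add differentiable_sum)
qed simp

section \<open>Symmetry of second derivatives\<close>

text \<open>
  The second difference is symmetric in the two directions, which gives the symmetry of the second
  derivatives; the mean value theorem is applied once in each direction.
\<close>

lemma second_difference_MVT:
  fixes f :: "real^'n \<Rightarrow> real"
  assumes "smooth f" "h > 0"
  shows "\<exists>s\<in>{0..h}. \<exists>t\<in>{0..h}.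
    f (x + h *\<^sub>R axis i 1 + h *\<^sub>R axis j 1) - f (x + h *\<^sub>R axis i 1) - f (x + h *\<^sub>R axis j 1) + f x =
      h * h * partial_deriv j (partial_deriv i f) (x + s *\<^sub>R axis i 1 + t *\<^sub>R axis j 1)"
proof -
  note d = smoothD(1)[OF assms(1)] and d2 = smoothD(1)[OF smoothD(2)[OF assms(1)]]
  let ?A = "axis i 1 :: real^'n" and ?B = "axis j 1 :: real^'n"
  have D1: "((\<lambda>s. f (x + h *\<^sub>R ?B + s *\<^sub>R ?A) - f (x + s *\<^sub>R ?A)) has_real_derivative
     (partial_deriv i f (x + h *\<^sub>R ?B + s *\<^sub>R ?A) - partial_deriv i f (x + s *\<^sub>R ?A))) (at s)" for s
    using DERIV_diff[OF has_derivative_along_line[OF d, where z="x + h *\<^sub>R ?B" and t=s and v="?A"]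
        has_derivative_along_line[OF d, where z=x and t=s and v="?A"]] by (simp add: inner_axis grad_def)
  obtain s where s: "0 < s" "s < h" and eq1:
    "f (x + h *\<^sub>R ?B + h *\<^sub>R ?A) - f (x + h *\<^sub>R ?A) - (f (x + h *\<^sub>R ?B + 0 *\<^sub>R ?A) - f (x + 0 *\<^sub>R ?A)) =
       (h - 0) * (partial_deriv i f (x + h *\<^sub>R ?B + s *\<^sub>R ?A) - partial_deriv i f (x + s *\<^sub>R ?A))"
    using MVT2[OF assms(2) D1] by blast
  have D2: "((\<lambda>t. partial_deriv i f (x + s *\<^sub>R ?A + t *\<^sub>R ?B)) has_real_derivative
     partial_deriv j (partial_deriv i f) (x + s *\<^sub>R ?A + t *\<^sub>R ?B)) (at t)" for t
    using has_derivative_along_line[OF d2, where z="x + s *\<^sub>R ?A" and t=t and v="?B"] by (simp add: inner_axis grad_def)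
  obtain t where t: "0 < t" "t < h" and eq2:
    "partial_deriv i f (x + s *\<^sub>R ?A + h *\<^sub>R ?B) - partial_deriv i f (x + s *\<^sub>R ?A + 0 *\<^sub>R ?B) =
       (h - 0) * partial_deriv j (partial_deriv i f) (x + s *\<^sub>R ?A + t *\<^sub>R ?B)"
    using MVT2[OF assms(2) D2] by blast
  have c: "x + h *\<^sub>R ?B + r *\<^sub>R ?A = x + r *\<^sub>R ?A + h *\<^sub>R ?B" for r
    by (simp only: add.assoc add.commute[of "h *\<^sub>R ?B"])
  have "f (x + h *\<^sub>R ?A + h *\<^sub>R ?B) - f (x + h *\<^sub>R ?A) - f (x + h *\<^sub>R ?B) + f x =
      h * (h * partial_deriv j (partial_deriv i f) (x + s *\<^sub>R ?A + t *\<^sub>R ?B))"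
    using eq1 eq2 unfolding c by simp
  then show ?thesis using s t
    by (intro bexI[of _ s] bexI[of _ t]) (simp_all add: mult.assoc)
qed

lemma partial_deriv_commute:
  fixes f :: "real^'n \<Rightarrow> real"
  assumes "smooth f"
  shows "partial_deriv i (partial_deriv j f) x = partial_deriv j (partial_deriv i f) x"
proof -
  let ?F = "\<lambda>i j. partial_deriv j (partial_deriv i f)"
  define h where "h = (\<lambda>n. inverse (real (Suc n)))"
  have h: "h n > 0" "h \<longlonglongrightarrow> 0" for n
    using LIMSEQ_inverse_real_of_nat by (auto simp: h_def)
  define Q where "Q = (\<lambda>i j n. f (x + h n *\<^sub>R axis i 1 + h n *\<^sub>R axis j 1) - f (x + h n *\<^sub>R axis i 1)
     - f (x + h n *\<^sub>R axis j 1) + f x)"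
  have *: "(\<lambda>n. Q i j n / (h n * h n)) \<longlonglongrightarrow> ?F i j x" for i j
  proof -
    have "\<exists>s\<in>{0..h n}. \<exists>t\<in>{0..h n}.
      Q i j n = h n * h n * ?F i j (x + s *\<^sub>R axis i 1 + t *\<^sub>R axis j 1)" for n
      unfolding Q_def by (rule second_difference_MVT[OF assms h(1)])
    then obtain s t where st: "\<And>n. s n \<in> {0..h n}" "\<And>n. t n \<in> {0..h n}"
      and eq: "\<And>n. Q i j n = h n * h n * ?F i j (x + s n *\<^sub>R axis i 1 + t n *\<^sub>R axis j 1)" by metis
    have s0: "s \<longlonglongrightarrow> 0" by (rule tendsto_sandwich[OF _ _ tendsto_const h(2)]) (use st in auto)
    have t0: "t \<longlonglongrightarrow> 0" by (rule tendsto_sandwich[OF _ _ tendsto_const h(2)]) (use st in auto)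
    have "(\<lambda>n. x + s n *\<^sub>R axis i 1 + t n *\<^sub>R axis j 1) \<longlonglongrightarrow> x + 0 *\<^sub>R axis i 1 + 0 *\<^sub>R axis j 1"
      by (intro tendsto_intros s0 t0)
    moreover have "isCont (?F i j) x"
      using smoothD(3)[OF smoothD(2)[OF smoothD(2)[OF assms]]] by (simp add: continuous_on_eq_continuous_at)
    ultimately have "(\<lambda>n. ?F i j (x + s n *\<^sub>R axis i 1 + t n *\<^sub>R axis j 1)) \<longlonglongrightarrow> ?F i j x"
      using isCont_tendsto_compose[of x "?F i j" "\<lambda>n. x + s n *\<^sub>R axis i 1 + t n *\<^sub>R axis j 1"] by simp
    moreover have "Q i j n / (h n * h n) = ?F i j (x + s n *\<^sub>R axis i 1 + t n *\<^sub>R axis j 1)" for n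
      using h(1)[of n] unfolding eq by simp
    ultimately show ?thesis by simp
  qed
  have "Q j i = Q i j"
  proof
    fix n
    have "x + h n *\<^sub>R axis j 1 + h n *\<^sub>R axis i 1 = x + h n *\<^sub>R axis i 1 + h n *\<^sub>R axis j 1"
      by (metis add.assoc add.commute)
    then show "Q j i n = Q i j n" unfolding Q_def by (simp only: diff_right_commute)
  qed
  with *[of i j] *[of j i] show ?thesis using LIMSEQ_unique by metis
qed

section \<open>Test functions\<close>

lemma test_functionI:
  assumes "smooth f" "\<And>x. norm x > R \<Longrightarrow> f x = 0"
  shows "test_function f"
proof -
  have "closure {x. f x \<noteq> 0} \<subseteq> cball 0 R"
    by (rule closure_minimal) (use assms(2) in \<open>force simp: not_le[symmetric]\<close>, simp)
  then have "compact (closure {x. f x \<noteq> 0})"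
    by (meson bounded_cball bounded_subset closed_closure compact_eq_bounded_closed)
  with assms(1) show ?thesis by (auto simp: test_function_def smooth_def)
qed

lemma test_functionD:
  assumes "test_function f"
  shows "smooth f" "\<exists>R>0. \<forall>x. norm x > R \<longrightarrow> f x = 0"
proof -
  show "smooth f" using assms by (auto simp: smooth_def test_function_def)
  have "bounded (closure {x. f x \<noteq> 0})"
    using assms by (auto simp: test_function_def compact_imp_bounded)
  then obtain R where "R > 0" "\<And>x. x \<in> closure {x. f x \<noteq> 0} \<Longrightarrow> norm x \<le> R"
    by (auto simp: bounded_pos)
  moreover have "f x = 0" if "norm x > R" for x
    using calculation(2)[of x] that closure_subset[of "{x. f x \<noteq> 0}"] by force
  ultimately show "\<exists>R>0. \<forall>x. norm x > R \<longrightarrow> f x = 0" by blast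
qed

lemma partial_deriv_zero_outside:
  assumes "\<And>x. norm x > R \<Longrightarrow> f x = 0" "norm x > R"
  shows "partial_deriv i f x = 0"
proof -
  have "open {x::real^'n. norm x > R}" by (intro open_Collect_less continuous_intros)
  then have "(f has_derivative (\<lambda>h. 0)) (at x)"
    by (rule has_derivative_transform_within_open[of "\<lambda>x. 0", rotated]) (use assms in auto)
  from partial_deriv_eqI[OF this] show ?thesis by simp
qed

lemma test_function_partial_deriv: "test_function f \<Longrightarrow> test_function (partial_deriv i f)"
proof -
  assume f: "test_function f"
  obtain R where "\<And>x. norm x > R \<Longrightarrow> f x = 0" using test_functionD(2)[OF f] by auto
  then show ?thesis by (intro test_functionI[OF smoothD(2)[OF test_functionD(1)[OF f]]] partial_deriv_zero_outside)
qed

lemma test_function_mult_smooth: "test_function f \<Longrightarrow> smooth g \<Longrightarrow> test_function (\<lambda>x. g x * f x)"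
  using test_functionD[of f] by (auto intro!: test_functionI[OF smooth_intros(3)])

lemma test_function_scale_shift:
  assumes "test_function f" "a \<noteq> 0"
  shows "test_function (\<lambda>x. f (a *\<^sub>R x + b))"
proof -
  obtain R where R: "R > 0" "\<And>x. norm x > R \<Longrightarrow> f x = 0" using test_functionD(2)[OF assms(1)] by auto
  have "f (a *\<^sub>R x + b) = 0" if "norm x > (R + norm b) / \<bar>a\<bar>" for x
  proof -
    have "R + norm b < norm (a *\<^sub>R x)" using that assms(2) by (simp add: field_simps)
    also have "\<dots> \<le> norm (a *\<^sub>R x + b) + norm b" using norm_triangle_ineq4[of "a *\<^sub>R x + b" b] by simp
    finally show ?thesis by (intro R) simp
  qed
  then show ?thesis by (rule test_functionI[OF smooth_intros(4)[OF test_functionD(1)[OF assms(1)]]])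
qed

lemma test_function_bounded:
  assumes "test_function f"
  shows "\<exists>B>0. \<forall>x. \<bar>f x\<bar> \<le> B"
proof -
  obtain R where R: "R > 0" "\<And>x. norm x > R \<Longrightarrow> f x = 0" using test_functionD(2)[OF assms] by auto
  have "compact (f ` cball 0 R)"
    by (intro compact_continuous_image smoothD(4) test_functionD(1) assms) auto
  then obtain B where B: "B > 0" "\<And>x. x \<in> cball 0 R \<Longrightarrow> \<bar>f x\<bar> \<le> B"
    using compact_imp_bounded[of "f ` cball 0 R"] by (auto simp: bounded_pos)
  have "\<bar>f x\<bar> \<le> B" for x using B R(2)[of x] by (cases "norm x \<le> R") auto
  with B(1) show ?thesis by blast
qed

section \<open>Bump functions supported in boxes\<close>

text \<open>
  The power in the denominator makes the family closed under differentiation up to linear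
  combinations, so that smoothness can be proved for all its members by one induction.
\<close>

definition exp_inv :: "nat \<Rightarrow> real \<Rightarrow> real" where
  "exp_inv k x = (if x > 0 then exp (- 1 / x) / x ^ k else 0)"

lemma exp_inv_tendsto_0: "(exp_inv k \<longlongrightarrow> 0) (at_right 0)"
proof -
  have "((\<lambda>y::real. y ^ k / exp y) \<longlongrightarrow> 0) at_top" by (rule tendsto_power_div_exp_0)
  then have "((\<lambda>x::real. inverse x ^ k / exp (inverse x)) \<longlongrightarrow> 0) (at_right 0)"
    by (rule filterlim_compose[OF _ filterlim_inverse_at_top_right])
  then show ?thesis
    by (rule Lim_transform_eventually)
       (auto simp: eventually_at_right_field exp_inv_def exp_minus field_simps intro!: exI[of _ 1])
qed

lemma exp_inv_deriv:
  "(exp_inv k has_real_derivative (exp_inv (k + 2) x - of_nat k * exp_inv (k + 1) x)) (at x)"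
proof -
  consider "x > 0" | "x < 0" | "x = 0" by linarith
  then show ?thesis
  proof cases
    case 1
    have "((\<lambda>x. exp (- 1 / x) / x ^ k) has_real_derivative
        (exp_inv (k + 2) x - of_nat k * exp_inv (k + 1) x)) (at x)"
    proof (cases k)
      case 0
      then show ?thesis using 1
        by (auto intro!: derivative_eq_intros simp: exp_inv_def field_simps power2_eq_square)
    next
      case (Suc m)
      have "((\<lambda>x. exp (- 1 / x) / x ^ k) has_real_derivative
        (exp (- 1 / x) * (1 / x^2) * x ^ k - exp (-1 / x) * (of_nat k * x ^ (k - 1))) / (x ^ k * x ^ k)) (at x)"
        using 1 by (auto intro!: derivative_eq_intros simp: power2_eq_square)
      moreover have "(exp (- 1 / x) * (1 / x^2) * x ^ k - exp (-1 / x) * (of_nat k * x ^ (k - 1))) / (x ^ k * x ^ k)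
         = exp_inv (k + 2) x - of_nat k * exp_inv (k + 1) x"
        using 1 Suc by (simp add: exp_inv_def field_simps power2_eq_square)
      ultimately show ?thesis by simp
    qed
    then show ?thesis
      by (rule has_field_derivative_transform_within_open[of _ _ _ "{0<..}"]) (use 1 in \<open>auto simp: exp_inv_def\<close>)
  next
    case 2
    have "((\<lambda>x. 0) has_real_derivative 0) (at x)" by simp
    then have "(exp_inv k has_real_derivative 0) (at x)"
      by (rule has_field_derivative_transform_within_open[of _ _ _ "{..<0}"]) (use 2 in \<open>auto simp: exp_inv_def\<close>)
    then show ?thesis using 2 by (simp add: exp_inv_def)
  next
    case 3
    have "((\<lambda>h. (exp_inv k (0 + h) - exp_inv k 0) / h) \<longlongrightarrow> 0) (at 0)"
      unfolding filterlim_at_split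
    proof
      show "((\<lambda>h. (exp_inv k (0 + h) - exp_inv k 0) / h) \<longlongrightarrow> 0) (at_left 0)"
        by (rule Lim_transform_eventually[OF tendsto_const])
           (auto simp: eventually_at_left_field exp_inv_def intro!: exI[of _ "-1"])
      show "((\<lambda>h. (exp_inv k (0 + h) - exp_inv k 0) / h) \<longlongrightarrow> 0) (at_right 0)"
        by (rule Lim_transform_eventually[OF exp_inv_tendsto_0[of "Suc k"]])
           (auto simp: eventually_at_right_field exp_inv_def intro!: exI[of _ 1])
    qed
    then have "(exp_inv k has_real_derivative 0) (at 0)" by (simp only: DERIV_def)
    moreover have "exp_inv j 0 = 0" for j by (simp add: exp_inv_def)
    ultimately show ?thesis using 3 by simp
  qed
qed

lemma C_k_exp_inv: "C_k K (\<lambda>x::real^'n. exp_inv k (s * x $ i + c))"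
proof (induction K arbitrary: k)
  case 0
  have "continuous_on UNIV (exp_inv k)"
    by (auto simp: continuous_on_eq_continuous_at intro: DERIV_isCont[OF exp_inv_deriv])
  then have "continuous_on UNIV (\<lambda>x::real^'n. exp_inv k (s * x $ i + c))"
    by (rule continuous_on_compose2) (auto intro!: continuous_intros)
  then show ?case by simp
next
  case (Suc K)
  have D: "((\<lambda>x::real^'n. exp_inv k (s * x $ i + c)) has_derivative (\<lambda>h.
     (exp_inv (k + 2) (s * x $ i + c) - of_nat k * exp_inv (k + 1) (s * x $ i + c)) * (s * h $ i))) (at x)" for x
  proof -
    have "((\<lambda>x::real^'n. s * x $ i + c) has_derivative (\<lambda>h. s * h $ i)) (at x)"
      by (auto intro!: derivative_eq_intros bounded_linear_imp_has_derivative bounded_linear_vec_nth)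
    from has_derivative_compose[OF this exp_inv_deriv[THEN has_field_derivative_imp_has_derivative]]
    show ?thesis .
  qed
  have "partial_deriv j (\<lambda>x::real^'n. exp_inv k (s * x $ i + c)) =
    (\<lambda>x. (exp_inv (k + 2) (s * x $ i + c) + (- of_nat k) * exp_inv (k + 1) (s * x $ i + c)) * (s * axis j 1 $ i))" for j
    by (rule ext) (simp only: partial_deriv_eqI[OF D], simp)
  moreover have "(\<lambda>x::real^'n. exp_inv k (s * x $ i + c)) differentiable (at x)" for x
    using D by (rule differentiableI)
  moreover have "C_k K (\<lambda>x::real^'n. (exp_inv (k + 2) (s * x $ i + c)
      + (- of_nat k) * exp_inv (k + 1) (s * x $ i + c)) * (s * axis j 1 $ i))" for j :: 'n
    by (intro C_k_mult C_k_add C_k_const Suc)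
  ultimately show ?case by (simp only: C_k.simps(2) simp_thms)
qed

text \<open>
  Localisation to open sets, cut-offs and mollifiers are all built from this function: it is smooth and
  positive precisely on an open box.
\<close>

definition box_bump :: "real^'n \<Rightarrow> real^'n \<Rightarrow> real^'n \<Rightarrow> real" where
  "box_bump a b x = (\<Prod>i\<in>UNIV. exp_inv 0 (x $ i - a $ i) * exp_inv 0 (b $ i - x $ i))"

lemma exp_inv_0: "exp_inv 0 x \<ge> 0" "exp_inv 0 x \<le> 1" "exp_inv 0 x > 0 \<longleftrightarrow> x > 0"
  by (auto simp: exp_inv_def)

lemma box_bump_pos_iff: "box_bump a b x > 0 \<longleftrightarrow> x \<in> box a b"
proof -
  have "box_bump a b x > 0 \<longleftrightarrow> (\<forall>i. exp_inv 0 (x $ i - a $ i) * exp_inv 0 (b $ i - x $ i) > 0)"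
    unfolding box_bump_def
    by (auto intro!: prod_pos simp: less_le prod_nonneg exp_inv_0(1))
  also have "\<dots> \<longleftrightarrow> (\<forall>i. a $ i < x $ i \<and> x $ i < b $ i)"
    by (simp add: zero_less_mult_iff exp_inv_0(3) exp_inv_0(1)[THEN leD])
  finally show ?thesis by (auto simp: mem_box_cart)
qed

lemma box_bump_nonneg: "box_bump a b x \<ge> 0"
  by (auto simp: box_bump_def intro!: prod_nonneg mult_nonneg_nonneg exp_inv_0)

lemma smooth_box_bump: "smooth (box_bump a b)"
proof -
  have "smooth (\<lambda>x. \<Prod>i\<in>UNIV. exp_inv 0 (1 * x $ i + (- a $ i)) * exp_inv 0 ((-1) * x $ i + b $ i))"
    by (intro smooth_prod smooth_intros(3)) (simp_all only: smooth_def C_k_exp_inv finite simp_thms)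
  then show ?thesis by (simp add: box_bump_def[abs_def] add.commute)
qed

lemma test_function_box_bump: "test_function (box_bump a b)"
proof -
  obtain R where R: "\<forall>x\<in>box a b. norm x \<le> R"
    using bounded_box[of a b] unfolding bounded_iff by (rule exE)
  have "box_bump a b x = 0" if "norm x > R" for x
  proof -
    have "x \<notin> box a b" using R that by force
    then show ?thesis using box_bump_pos_iff[of a b x] box_bump_nonneg[of a b x] by linarith
  qed
  then show ?thesis by (rule test_functionI[OF smooth_box_bump])
qed

section \<open>Continuity of translations in the mean\<close>

lemma nn_integral_translate:
  fixes f :: "'a::euclidean_space \<Rightarrow> ennreal"
  assumes [measurable]: "f \<in> borel_measurable borel"
  shows "(\<integral>\<^sup>+x. f (x + a) \<partial>lborel) = (\<integral>\<^sup>+x. f x \<partial>lborel)"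
proof -
  have "(\<integral>\<^sup>+x. f x \<partial>lborel) = (\<integral>\<^sup>+x. f x \<partial>distr lborel borel ((+) a))"
    by (simp add: lborel_distr_plus)
  also have "\<dots> = (\<integral>\<^sup>+x. f (a + x) \<partial>lborel)"
    by (rule nn_integral_distr) auto
  finally show ?thesis by (simp add: add.commute)
qed

definition shift_small :: "(real^'n \<Rightarrow> real) \<Rightarrow> bool" where
  "shift_small f \<longleftrightarrow> (\<forall>\<epsilon>>0. \<exists>\<delta>>0. \<forall>h. norm h < \<delta> \<longrightarrow>
      (\<integral>\<^sup>+x. ennreal \<bar>f (x + h) - f x\<bar> \<partial>lborel) \<le> ennreal \<epsilon>)"

lemma shift_smallE:
  assumes "shift_small f" "\<epsilon> > 0"
  obtains \<delta> where "\<delta> > 0"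
    "\<And>h. norm h < \<delta> \<Longrightarrow> (\<integral>\<^sup>+x. ennreal \<bar>f (x + h) - f x\<bar> \<partial>lborel) \<le> ennreal \<epsilon>"
  using assms by (auto simp: shift_small_def)

text \<open>
  Outer regularity suffices: if \<open>U\<close> is open with \<open>U - A\<close> small, most points of \<open>A\<close> keep a fixed
  distance from the complement of \<open>U\<close>, so that a short translation moves them out of \<open>A\<close> only into \<open>U - A\<close>.
\<close>

lemma shift_small_indicator:
  fixes A :: "(real^'n) set"
  assumes [measurable]: "A \<in> sets borel" and fin: "emeasure lborel A < \<infinity>"
  shows "shift_small (\<lambda>x. indicator A x *\<^sub>R c)"
  unfolding shift_small_def
proof (intro allI impI)
  fix \<epsilon> :: real assume "\<epsilon> > 0"
  define e where "e = \<epsilon> / (4 * (\<bar>c\<bar> + 1))"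
  have e: "e > 0" using \<open>\<epsilon> > 0\<close> by (simp add: e_def)
  have "A \<in> sets lebesgue" using assms by simp
  from sets_lebesgue_outer_open[OF this e] obtain U where U: "open U" "A \<subseteq> U"
    "emeasure lebesgue (U - A) < ennreal e" by metis
  have [measurable]: "U \<in> sets borel" using U(1) by simp
  \<comment> \<open>points of \<open>U\<close> that translations shorter than \<open>1/(n+1)\<close> keep in \<open>U\<close>\<close>
  define C where "C n = {x. ball x (inverse (real (Suc n))) \<subseteq> U}" for n
  have closedC: "closed (C n)" for n
  proof -
    have eq: "C n = - (\<Union>y\<in>-U. ball y (inverse (real (Suc n))))"
      by (auto simp: C_def subset_iff dist_commute)
    have "open (\<Union>y\<in>-U. ball y (inverse (real (Suc n))))" by (intro open_UN ballI open_ball)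
    then show ?thesis unfolding eq by (rule closed_Compl)
  qed
  then have [measurable]: "C n \<in> sets borel" for n by simp
  have "(\<lambda>n. emeasure lborel (A - C n)) \<longlonglongrightarrow> emeasure lborel (\<Inter>n. A - C n)"
  proof (rule Lim_emeasure_decseq)
    show "decseq (\<lambda>n. A - C n)"
    proof (rule decseq_SucI)
      fix n
      have "inverse (real (Suc (Suc n))) \<le> inverse (real (Suc n))" by (simp add: field_simps)
      then have "ball x (inverse (real (Suc (Suc n)))) \<subseteq> ball x (inverse (real (Suc n)))" for x :: "real^'n"
        by (rule subset_ball)
      then have "C n \<subseteq> C (Suc n)" unfolding C_def by (auto intro: order_trans)
      then show "A - C (Suc n) \<subseteq> A - C n" by auto
    qed
    show "emeasure lborel (A - C n) \<noteq> \<infinity>" for n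
    proof -
      have "emeasure lborel (A - C n) \<le> emeasure lborel A" by (intro emeasure_mono) auto
      then show ?thesis using fin by (auto simp: top_unique)
    qed
  qed auto
  moreover have "(\<Inter>n. A - C n) = {}"
  proof -
    have "\<exists>n. x \<in> C n" if xA: "x \<in> A" for x
    proof -
      obtain r where r: "r > 0" "ball x r \<subseteq> U" using openE[OF U(1) subsetD[OF U(2) xA]] by blast
      obtain n where "inverse (real (Suc n)) < r" using reals_Archimedean[OF r(1)] by auto
      then have "ball x (inverse (real (Suc n))) \<subseteq> U" using r(2) subset_ball[of "inverse (real (Suc n))" r x] by auto
      then show ?thesis by (auto simp: C_def)
    qed
    then show ?thesis by auto
  qed
  ultimately have "(\<lambda>n. emeasure lborel (A - C n)) \<longlonglongrightarrow> 0"
    by (simp only: emeasure_empty)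
  then have "\<forall>\<^sub>F n in sequentially. emeasure lborel (A - C n) < ennreal e"
    by (rule order_tendstoD) (use e in auto)
  then obtain n where n: "emeasure lborel (A - C n) < ennreal e"
    by (auto simp: eventually_sequentially)
  have UA: "emeasure lborel (U - A) \<le> ennreal e"
    using U(3) by (simp add: emeasure_completion less_imp_le)
  show "\<exists>\<delta>>0. \<forall>h. norm h < \<delta> \<longrightarrow>
      (\<integral>\<^sup>+x. ennreal \<bar>indicator A (x + h) *\<^sub>R c - indicator A x *\<^sub>R c\<bar> \<partial>lborel) \<le> ennreal \<epsilon>"
  proof (intro exI[of _ "inverse (real (Suc n))"] conjI allI impI)
    fix h :: "real^'n" assume h: "norm h < inverse (real (Suc n))"
    have CU: "y + k \<in> U" if "y \<in> C n" "norm k = norm h" for y k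
      using that h by (auto simp: C_def subset_iff dist_norm)
    have CU': "x \<in> U" if "x + h \<in> C n" for x
      using CU[OF that, of "- h"] by simp
    have pw: "ennreal \<bar>indicator A (x + h) *\<^sub>R c - indicator A x *\<^sub>R c\<bar> \<le>
      ennreal \<bar>c\<bar> * ((indicator (U - A) (x + h) + indicator (A - C n) (x + h)) + (indicator (U - A) x + indicator (A - C n) x))" for x
    proof (cases "(x + h \<in> A) = (x \<in> A)")
      case True
      then show ?thesis by (auto simp: indicator_def)
    next
      case False
      then have "x + h \<in> U - A \<or> x + h \<in> A - C n \<or> x \<in> U - A \<or> x \<in> A - C n"
        using CU[of x h] CU'[of x] by auto
      then have "(1::ennreal) \<le> (indicator (U - A) (x + h) + indicator (A - C n) (x + h)) + (indicator (U - A) x + indicator (A - C n) x)"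
        by (auto simp: indicator_def)
      then have "ennreal \<bar>c\<bar> * 1 \<le> ennreal \<bar>c\<bar> * ((indicator (U - A) (x + h) + indicator (A - C n) (x + h)) + (indicator (U - A) x + indicator (A - C n) x))"
        by (rule mult_left_mono) simp
      moreover have "\<bar>indicator A (x + h) *\<^sub>R c - indicator A x *\<^sub>R c\<bar> = \<bar>c\<bar>" 
        using False by (auto simp: indicator_def)
      ultimately show ?thesis by simp
    qed
    have "(\<integral>\<^sup>+x. ennreal \<bar>indicator A (x + h) *\<^sub>R c - indicator A x *\<^sub>R c\<bar> \<partial>lborel) \<le>
       (\<integral>\<^sup>+x. ennreal \<bar>c\<bar> * ((indicator (U - A) (x + h) + indicator (A - C n) (x + h)) + (indicator (U - A) x + indicator (A - C n) x)) \<partial>lborel)"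
      by (intro nn_integral_mono pw)
    also have "\<dots> = ennreal \<bar>c\<bar> * ((\<integral>\<^sup>+x. (indicator (U - A) (x + h) + indicator (A - C n) (x + h)) \<partial>lborel)
        + (\<integral>\<^sup>+x. (indicator (U - A) x + indicator (A - C n) x) \<partial>lborel))"
      by (simp add: nn_integral_cmult nn_integral_add)
    also have "(\<integral>\<^sup>+x. (indicator (U - A) (x + h) + indicator (A - C n) (x + h)) \<partial>lborel) =
       (\<integral>\<^sup>+x. (indicator (U - A) x + indicator (A - C n) x) \<partial>lborel)"
      by (rule nn_integral_translate[of "\<lambda>x. indicator (U - A) x + indicator (A - C n) x"]) simp
    also have "(\<integral>\<^sup>+x. (indicator (U - A) x + indicator (A - C n) x) \<partial>lborel) =
        emeasure lborel (U - A) + emeasure lborel (A - C n)"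
      by (simp add: nn_integral_add)
    also have "ennreal \<bar>c\<bar> * (emeasure lborel (U - A) + emeasure lborel (A - C n) + (emeasure lborel (U - A) + emeasure lborel (A - C n)))
        \<le> ennreal \<bar>c\<bar> * (ennreal e + ennreal e + (ennreal e + ennreal e))"
      using UA n by (intro mult_left_mono add_mono) (auto simp: less_imp_le)
    also have "ennreal e + ennreal e + (ennreal e + ennreal e) = ennreal (4 * e)"
      using e by (simp flip: ennreal_plus)
    also have "ennreal \<bar>c\<bar> * ennreal (4 * e) = ennreal (\<bar>c\<bar> * (4 * e))"
      using e by (intro ennreal_mult[symmetric]) auto
    also have "\<dots> \<le> ennreal \<epsilon>"
      using \<open>\<epsilon> > 0\<close> by (intro ennreal_leI) (simp add: e_def field_simps)
    finally show "(\<integral>\<^sup>+x. ennreal \<bar>indicator A (x + h) *\<^sub>R c - indicator A x *\<^sub>R c\<bar> \<partial>lborel) \<le> ennreal \<epsilon>" .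
  qed simp
qed

lemma nn_integral_abs_triangle:
  fixes f g :: "'a \<Rightarrow> real"
  assumes [measurable]: "f \<in> borel_measurable M" "g \<in> borel_measurable M"
  shows "(\<integral>\<^sup>+x. ennreal \<bar>f x + g x\<bar> \<partial>M) \<le> (\<integral>\<^sup>+x. ennreal \<bar>f x\<bar> \<partial>M) + (\<integral>\<^sup>+x. ennreal \<bar>g x\<bar> \<partial>M)"
proof -
  have "(\<integral>\<^sup>+x. ennreal \<bar>f x + g x\<bar> \<partial>M) \<le> (\<integral>\<^sup>+x. ennreal \<bar>f x\<bar> + ennreal \<bar>g x\<bar> \<partial>M)"
    by (intro nn_integral_mono) (simp flip: ennreal_plus)
  then show ?thesis by (simp add: nn_integral_add)
qed

lemma integrable_shift_small:
  fixes f :: "real^'n \<Rightarrow> real"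
  assumes "integrable lborel f"
  shows "shift_small f"
  using assms
proof (induction rule: integrable_induct)
  case (base A c)
  then show ?case by (intro shift_small_indicator) auto
next
  case (add f g)
  have [measurable]: "f \<in> borel_measurable borel" "g \<in> borel_measurable borel"
    using add by auto
  show ?case unfolding shift_small_def
  proof (intro allI impI)
    fix \<epsilon> :: real assume "\<epsilon> > 0"
    then have e2: "\<epsilon> / 2 > 0" by simp
    obtain d1 where d1: "d1 > 0"
      "\<And>h. norm h < d1 \<Longrightarrow> (\<integral>\<^sup>+x. ennreal \<bar>f (x + h) - f x\<bar> \<partial>lborel) \<le> ennreal (\<epsilon>/2)"
      by (rule shift_smallE[OF add.IH(1) e2]) simp
    obtain d2 where d2: "d2 > 0"
      "\<And>h. norm h < d2 \<Longrightarrow> (\<integral>\<^sup>+x. ennreal \<bar>g (x + h) - g x\<bar> \<partial>lborel) \<le> ennreal (\<epsilon>/2)"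
      by (rule shift_smallE[OF add.IH(2) e2]) simp
    note d = d1(1) d2(1) d1(2) d2(2)
    have "(\<integral>\<^sup>+x. ennreal \<bar>f (x + h) + g (x + h) - (f x + g x)\<bar> \<partial>lborel) \<le> ennreal \<epsilon>"
      if "norm h < min d1 d2" for h
    proof -
      have "(\<integral>\<^sup>+x. ennreal \<bar>f (x + h) + g (x + h) - (f x + g x)\<bar> \<partial>lborel) =
         (\<integral>\<^sup>+x. ennreal \<bar>(f (x + h) - f x) + (g (x + h) - g x)\<bar> \<partial>lborel)"
        by (simp add: algebra_simps)
      also have "\<dots> \<le> (\<integral>\<^sup>+x. ennreal \<bar>f (x + h) - f x\<bar> \<partial>lborel) + (\<integral>\<^sup>+x. ennreal \<bar>g (x + h) - g x\<bar> \<partial>lborel)"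
        by (rule nn_integral_abs_triangle) auto
      also have "\<dots> \<le> ennreal (\<epsilon>/2) + ennreal (\<epsilon>/2)" using that d by (intro add_mono) auto
      also have "\<dots> = ennreal \<epsilon>" using \<open>\<epsilon> > 0\<close> by (simp flip: ennreal_plus)
      finally show ?thesis .
    qed
    then show "\<exists>\<delta>>0. \<forall>h. norm h < \<delta> \<longrightarrow>
       (\<integral>\<^sup>+x. ennreal \<bar>f (x + h) + g (x + h) - (f x + g x)\<bar> \<partial>lborel) \<le> ennreal \<epsilon>"
      using d(1,2) by (intro exI[of _ "min d1 d2"]) auto
  qed
next
  case (lim f s)
  have [measurable]: "f \<in> borel_measurable borel" "s i \<in> borel_measurable borel" for i
    using lim.hyps by auto
  show ?case unfolding shift_small_def
  proof (intro allI impI)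
    fix \<epsilon> :: real assume "\<epsilon> > 0"
    then have e3: "\<epsilon> / 3 > 0" by simp
    have "(\<lambda>i. (\<integral>\<^sup>+x. norm (f x - s i x) \<partial>lborel)) \<longlonglongrightarrow> 0"
    proof (rule nn_integral_dominated_convergence_norm[where w="\<lambda>x. 2 * norm (f x)"])
      have "integrable lborel (\<lambda>x. 2 * norm (f x))" using lim.hyps by auto
      then show "(\<integral>\<^sup>+x. ennreal (2 * norm (f x)) \<partial>lborel) < \<infinity>"
        unfolding integrable_iff_bounded by auto
    qed (use lim.hyps in auto)
    then have "\<forall>\<^sub>F i in sequentially. (\<integral>\<^sup>+x. norm (f x - s i x) \<partial>lborel) < ennreal (\<epsilon>/3)"
      by (rule order_tendstoD) (use e3 in \<open>simp add: ennreal_zero_less_divide\<close>)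
    then obtain i where i: "(\<integral>\<^sup>+x. ennreal \<bar>f x - s i x\<bar> \<partial>lborel) < ennreal (\<epsilon>/3)"
      by (auto simp: eventually_sequentially)
    obtain d where d: "d > 0"
      "\<And>h. norm h < d \<Longrightarrow> (\<integral>\<^sup>+x. ennreal \<bar>s i (x + h) - s i x\<bar> \<partial>lborel) \<le> ennreal (\<epsilon>/3)"
      by (rule shift_smallE[OF lim.IH[of i] e3]) simp
    have "(\<integral>\<^sup>+x. ennreal \<bar>f (x + h) - f x\<bar> \<partial>lborel) \<le> ennreal \<epsilon>" if "norm h < d" for h
    proof -
      have "(\<integral>\<^sup>+x. ennreal \<bar>f (x + h) - f x\<bar> \<partial>lborel) =
         (\<integral>\<^sup>+x. ennreal \<bar>(f (x + h) - s i (x + h)) + ((s i (x + h) - s i x) + (s i x - f x))\<bar> \<partial>lborel)"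
        by simp
      also have "\<dots> \<le> (\<integral>\<^sup>+x. ennreal \<bar>f (x + h) - s i (x + h)\<bar> \<partial>lborel) +
          (\<integral>\<^sup>+x. ennreal \<bar>(s i (x + h) - s i x) + (s i x - f x)\<bar> \<partial>lborel)"
        by (rule nn_integral_abs_triangle) auto
      also have "(\<integral>\<^sup>+x. ennreal \<bar>(s i (x + h) - s i x) + (s i x - f x)\<bar> \<partial>lborel) \<le>
         (\<integral>\<^sup>+x. ennreal \<bar>s i (x + h) - s i x\<bar> \<partial>lborel) + (\<integral>\<^sup>+x. ennreal \<bar>s i x - f x\<bar> \<partial>lborel)"
        by (rule nn_integral_abs_triangle) auto
      also have "(\<integral>\<^sup>+x. ennreal \<bar>f (x + h) - s i (x + h)\<bar> \<partial>lborel) = (\<integral>\<^sup>+x. ennreal \<bar>f x - s i x\<bar> \<partial>lborel)"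
        by (rule nn_integral_translate[of "\<lambda>x. ennreal \<bar>f x - s i x\<bar>"]) auto
      also have "(\<integral>\<^sup>+x. ennreal \<bar>s i x - f x\<bar> \<partial>lborel) = (\<integral>\<^sup>+x. ennreal \<bar>f x - s i x\<bar> \<partial>lborel)"
        by (simp add: abs_minus_commute)
      also have "(\<integral>\<^sup>+x. ennreal \<bar>f x - s i x\<bar> \<partial>lborel) + ((\<integral>\<^sup>+x. ennreal \<bar>s i (x + h) - s i x\<bar> \<partial>lborel) + (\<integral>\<^sup>+x. ennreal \<bar>f x - s i x\<bar> \<partial>lborel))
          \<le> ennreal (\<epsilon>/3) + (ennreal (\<epsilon>/3) + ennreal (\<epsilon>/3))"
        using i d(2)[OF that] by (intro add_mono) (auto intro: less_imp_le)
      also have "\<dots> = ennreal \<epsilon>" using \<open>\<epsilon> > 0\<close> by (simp flip: ennreal_plus)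
      finally show ?thesis by (simp add: add_left_mono)
    qed
    then show "\<exists>\<delta>>0. \<forall>h. norm h < \<delta> \<longrightarrow> (\<integral>\<^sup>+x. ennreal \<bar>f (x + h) - f x\<bar> \<partial>lborel) \<le> ennreal \<epsilon>"
      using d(1) by blast
  qed
qed

text \<open>
  Reduces the continuity of translations in the mean square for \<open>u\<close> to that in the mean for \<open>u \<bar>u\<bar>\<close>.
\<close>

lemma square_diff_le: "\<bar>a - b\<bar>^2 \<le> 2 * \<bar>a * \<bar>a\<bar> - b * \<bar>b\<bar>\<bar>" for a b :: real
proof -
  have gen: "(c - d)^2 \<le> 2 * \<bar>c * c - d * d\<bar>" if "c \<ge> 0" "d \<ge> 0" for c d :: real
  proof -
    have "(c - d)^2 = \<bar>c - d\<bar> * \<bar>c - d\<bar>" by (simp add: power2_eq_square)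
    also have "\<dots> \<le> \<bar>c - d\<bar> * \<bar>c + d\<bar>" using that by (intro mult_left_mono) auto
    also have "\<dots> = \<bar>c * c - d * d\<bar>" by (simp add: abs_mult[symmetric] algebra_simps)
    finally have "(c - d)^2 \<le> \<bar>c * c - d * d\<bar>" .
    then show ?thesis using abs_ge_zero[of "c * c - d * d"] by (simp only: mult_2)
  qed
  have mixed: "(c + d)^2 \<le> 2 * (c * c + d * d)" for c d :: real
    using sum_squares_bound[of c d] by (simp add: power2_eq_square algebra_simps)
  consider "a \<ge> 0" "b \<ge> 0" | "a \<ge> 0" "b < 0" | "a < 0" "b \<ge> 0" | "a < 0" "b < 0" by linarith
  then show ?thesis
  proof cases
    case 1 then show ?thesis using gen[of a b] by simp
  next
    case 2 then show ?thesis using mixed[of a "-b"] by (simp add: abs_of_nonneg mult_nonpos_nonpos)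
  next
    case 3 then show ?thesis using mixed[of "-a" b] by (simp add: power2_commute abs_if algebra_simps power2_eq_square split: if_splits)
  next
    case 4 then show ?thesis using gen[of "-a" "-b"] by (simp add: power2_commute[of a b] abs_minus_commute)
  qed
qed

definition integrable_pow :: "nat \<Rightarrow> (real^'n \<Rightarrow> real) \<Rightarrow> bool" where
  "integrable_pow p u \<longleftrightarrow> u \<in> borel_measurable borel \<and> integrable lborel (\<lambda>x. \<bar>u x\<bar> ^ p)"

lemma integrable_pow_shift_small:
  fixes u :: "real^'n \<Rightarrow> real"
  assumes "integrable_pow p u" "p = 1 \<or> p = 2" "\<epsilon> > 0"
  shows "\<exists>\<delta>>0. \<forall>h. norm h < \<delta> \<longrightarrow> (\<integral>\<^sup>+x. ennreal (\<bar>u (x + h) - u x\<bar> ^ p) \<partial>lborel) \<le> ennreal \<epsilon>"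
  using assms(2)
proof
  assume p: "p = 1"
  have [measurable]: "u \<in> borel_measurable borel" using assms(1) by (simp add: integrable_pow_def)
  have "integrable lborel (\<lambda>x. \<bar>u x\<bar>)" using assms(1) p by (simp add: integrable_pow_def)
  then have "integrable lborel u" by (subst (asm) integrable_abs_iff) auto
  from integrable_shift_small[OF this] show ?thesis using assms(3) p by (simp add: shift_small_def)
next
  assume p: "p = 2"
  have [measurable]: "u \<in> borel_measurable borel" using assms(1) by (simp add: integrable_pow_def)
  have "integrable lborel (\<lambda>x. u x ^ 2)" using assms(1) p by (simp add: integrable_pow_def)
  then have "integrable lborel (\<lambda>x. u x * \<bar>u x\<bar>)"
    by (rule Bochner_Integration.integrable_bound) (auto simp: power2_eq_square abs_mult)
  then have sm: "shift_small (\<lambda>x. u x * \<bar>u x\<bar>)" by (rule integrable_shift_small)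
  obtain d where d: "d > 0"
    "\<And>h. norm h < d \<Longrightarrow> (\<integral>\<^sup>+x. ennreal \<bar>u (x + h) * \<bar>u (x + h)\<bar> - u x * \<bar>u x\<bar>\<bar> \<partial>lborel) \<le> ennreal (\<epsilon>/2)"
    by (rule shift_smallE[OF sm, of "\<epsilon>/2"]) (use assms(3) in auto)
  have "(\<integral>\<^sup>+x. ennreal (\<bar>u (x + h) - u x\<bar> ^ p) \<partial>lborel) \<le> ennreal \<epsilon>" if "norm h < d" for h
  proof -
    have "(\<integral>\<^sup>+x. ennreal (\<bar>u (x + h) - u x\<bar> ^ p) \<partial>lborel) \<le>
       (\<integral>\<^sup>+x. ennreal 2 * ennreal \<bar>u (x + h) * \<bar>u (x + h)\<bar> - u x * \<bar>u x\<bar>\<bar> \<partial>lborel)"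
      unfolding p by (intro nn_integral_mono) (subst ennreal_mult[symmetric], simp, simp, intro ennreal_leI square_diff_le)
    also have "\<dots> = ennreal 2 * (\<integral>\<^sup>+x. ennreal \<bar>u (x + h) * \<bar>u (x + h)\<bar> - u x * \<bar>u x\<bar>\<bar> \<partial>lborel)"
      by (rule nn_integral_cmult) auto
    also have "\<dots> \<le> ennreal 2 * ennreal (\<epsilon>/2)" using d(2)[OF that] by (rule mult_left_mono) simp
    also have "\<dots> = ennreal (2 * (\<epsilon>/2))" using assms(3) by (intro ennreal_mult[symmetric]) auto
    finally show ?thesis by simp
  qed
  with d(1) show ?thesis by blast
qed

section \<open>Integrals against test functions\<close>

lemma locally_integrable_mult:
  fixes u :: "real^'n \<Rightarrow> real"
  assumes "locally_integrable u" and [measurable]: "\<zeta> \<in> borel_measurable borel"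
    and B: "\<And>x. \<bar>\<zeta> x\<bar> \<le> B" and R: "\<And>x. norm x > R \<Longrightarrow> \<zeta> x = 0"
  shows "integrable lebesgue (\<lambda>y. u y * \<zeta> y)"
proof -
  have 1: "integrable lebesgue (\<lambda>x. indicator (cball 0 R) x *\<^sub>R u x)"
    using assms(1) by (auto simp: locally_integrable_def set_integrable_def)
  then have m: "(\<lambda>x. indicator (cball 0 R) x *\<^sub>R u x) \<in> borel_measurable lebesgue" by auto
  have z: "\<zeta> \<in> borel_measurable lebesgue" by (rule measurable_completion) simp
  have "integrable lebesgue (\<lambda>y. (indicator (cball 0 R) y *\<^sub>R u y) * \<zeta> y)"
  proof (rule Bochner_Integration.integrable_bound)
    show "integrable lebesgue (\<lambda>y. B * (indicator (cball 0 R) y *\<^sub>R u y))" using 1 by auto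
    show "(\<lambda>y. (indicator (cball 0 R) y *\<^sub>R u y) * \<zeta> y) \<in> borel_measurable lebesgue"
      using m z by (rule borel_measurable_times)
    have "\<bar>a\<bar> * \<bar>\<zeta> y\<bar> \<le> \<bar>B\<bar> * \<bar>a\<bar>" for a y
      using mult_right_mono[of "\<bar>\<zeta> y\<bar>" "\<bar>B\<bar>" "\<bar>a\<bar>"] B[of y] by (simp add: mult.commute)
    then show "AE y in lebesgue. norm ((indicator (cball 0 R) y *\<^sub>R u y) * \<zeta> y) \<le> norm (B * (indicator (cball 0 R) y *\<^sub>R u y))"
      by (auto intro!: AE_I2 simp: abs_mult indicator_def)
  qed
  moreover have "(\<lambda>y. (indicator (cball 0 R) y *\<^sub>R u y) * \<zeta> y) = (\<lambda>y. u y * \<zeta> y)"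
    using R by (auto simp: fun_eq_iff indicator_def)
  ultimately show ?thesis by simp
qed

lemma locally_integrable_mult_test:
  assumes "locally_integrable u" "test_function \<zeta>"
  shows "integrable lebesgue (\<lambda>y. u y * \<zeta> y)"
proof -
  obtain B where "\<And>x. \<bar>\<zeta> x\<bar> \<le> B" using test_function_bounded[OF assms(2)] by auto
  moreover obtain R where "\<And>x. norm x > R \<Longrightarrow> \<zeta> x = 0" using test_functionD(2)[OF assms(2)] by auto
  ultimately show ?thesis
    by (intro locally_integrable_mult[OF assms(1) smoothD(5)[OF test_functionD(1)[OF assms(2)]]])
qed

lemma test_function_lipschitz:
  assumes "test_function f"
  shows "\<exists>B>0. \<forall>x h. \<bar>f (x + h) - f x\<bar> \<le> B * norm h"
proof -
  have "\<exists>B>0. \<forall>x. \<bar>partial_deriv i f x\<bar> \<le> B" for i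
    by (rule test_function_bounded[OF test_function_partial_deriv[OF assms]])
  then obtain B where B: "\<And>i. B i > 0" "\<And>i x. \<bar>partial_deriv i f x\<bar> \<le> B i" by metis
  note d = smoothD(1)[OF test_functionD(1)[OF assms]]
  have gb: "norm (grad f x) \<le> sum B UNIV" for x
  proof -
    have "norm (grad f x) \<le> (\<Sum>i\<in>UNIV. \<bar>grad f x $ i\<bar>)" by (rule norm_le_l1_cart)
    also have "\<dots> \<le> sum B UNIV" by (intro sum_mono) (simp add: grad_def B)
    finally show ?thesis .
  qed
  have "\<bar>f (x + h) - f x\<bar> \<le> sum B UNIV * norm h" for x h
  proof -
    obtain t where "f (x + 1 *\<^sub>R h) - f (x + 0 *\<^sub>R h) = (1 - 0) * (grad f (x + t *\<^sub>R h) \<bullet> h)"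
      using MVT2[of 0 1 "\<lambda>t. f (x + t *\<^sub>R h)", OF _ has_derivative_along_line[OF d]] by auto
    then have "\<bar>f (x + h) - f x\<bar> = \<bar>grad f (x + t *\<^sub>R h) \<bullet> h\<bar>" by simp
    also have "\<dots> \<le> norm (grad f (x + t *\<^sub>R h)) * norm h" by (rule Cauchy_Schwarz_ineq2)
    also have "\<dots> \<le> sum B UNIV * norm h" by (intro mult_right_mono gb) simp
    finally show ?thesis .
  qed
  moreover have "sum B UNIV > 0" using B(1) by (intro sum_pos) auto
  ultimately show ?thesis by blast
qed

text \<open>
  The remainder is quadratic uniformly in \<open>x\<close>; this is what allows differentiation under the integral
  sign in a mollification of a function that is only locally integrable.
\<close>

lemma test_function_taylor:
  fixes f :: "real^'n \<Rightarrow> real"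
  assumes "test_function f"
  shows "\<exists>C>0. \<forall>x h. \<bar>f (x + h) - f x - grad f x \<bullet> h\<bar> \<le> C * (norm h)^2"
proof -
  have "\<exists>B>0. \<forall>x h. \<bar>partial_deriv i f (x + h) - partial_deriv i f x\<bar> \<le> B * norm h" for i
    by (rule test_function_lipschitz[OF test_function_partial_deriv[OF assms]])
  then obtain B where B: "\<And>i. B i > 0" 
    "\<And>i x h. \<bar>partial_deriv i f (x + h) - partial_deriv i f x\<bar> \<le> B i * norm h" by metis
  note d = smoothD(1)[OF test_functionD(1)[OF assms]]
  have gb: "norm (grad f (x + h) - grad f x) \<le> sum B UNIV * norm h" for x h
  proof -
    have "norm (grad f (x + h) - grad f x) \<le> (\<Sum>i\<in>UNIV. \<bar>(grad f (x + h) - grad f x) $ i\<bar>)" by (rule norm_le_l1_cart)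
    also have "\<dots> \<le> (\<Sum>i\<in>UNIV. B i * norm h)" by (intro sum_mono) (simp add: grad_def B)
    finally show ?thesis by (simp add: sum_distrib_right)
  qed
  have S: "sum B UNIV > 0" using B(1) by (intro sum_pos) auto
  have "\<bar>f (x + h) - f x - grad f x \<bullet> h\<bar> \<le> sum B UNIV * (norm h)^2" for x h
  proof -
    obtain t where t: "0 < t" "t < 1" "f (x + 1 *\<^sub>R h) - f (x + 0 *\<^sub>R h) = (1 - 0) * (grad f (x + t *\<^sub>R h) \<bullet> h)"
      using MVT2[of 0 1 "\<lambda>t. f (x + t *\<^sub>R h)", OF _ has_derivative_along_line[OF d]] by auto
    then have "\<bar>f (x + h) - f x - grad f x \<bullet> h\<bar> = \<bar>(grad f (x + t *\<^sub>R h) - grad f x) \<bullet> h\<bar>" by (simp add: inner_diff_left)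
    also have "\<dots> \<le> norm (grad f (x + t *\<^sub>R h) - grad f x) * norm h" by (rule Cauchy_Schwarz_ineq2)
    also have "\<dots> \<le> (sum B UNIV * norm (t *\<^sub>R h)) * norm h" by (intro mult_right_mono gb) simp
    also have "\<dots> \<le> (sum B UNIV * norm h) * norm h"
      using t S by (intro mult_right_mono mult_left_mono) (auto simp: mult_left_le_one_le)
    finally show ?thesis by (simp add: power2_eq_square mult.assoc)
  qed
  with S show ?thesis by blast
qed

section \<open>Mollification\<close>

text \<open>
  The kernel is evaluated at \<open>y - x\<close> instead of \<open>x - y\<close>. All changes of variables are then translations,
  and the sign produced by differentiating in \<open>x\<close> cancels the sign in the definition of the weak derivative.
\<close>

definition mollify :: "(real^'n \<Rightarrow> real) \<Rightarrow> (real^'n \<Rightarrow> real) \<Rightarrow> real^'n \<Rightarrow> real" where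
  "mollify \<rho> u x = (LINT y|lebesgue. u y * \<rho> (y - x))"

lemma test_function_shift: "test_function \<rho> \<Longrightarrow> test_function (\<lambda>y. \<rho> (y - x))"
  using test_function_scale_shift[of \<rho> 1 "- x"] by simp

lemma partial_deriv_shift: "\<rho> differentiable (at (y - x)) \<Longrightarrow> partial_deriv i (\<lambda>y. \<rho> (y - x)) y = partial_deriv i \<rho> (y - x)"
  using partial_deriv_scale_shift[of \<rho> 1 y "- x" i] by simp

lemma mollify_has_derivative:
  fixes u :: "real^'n \<Rightarrow> real"
  assumes u: "locally_integrable u" and \<rho>: "test_function \<rho>"
  shows "(mollify \<rho> u has_derivative (\<lambda>h. (\<chi> i. - mollify (partial_deriv i \<rho>) u x) \<bullet> h)) (at x)"
proof -
  let ?g = "(\<chi> i. - mollify (partial_deriv i \<rho>) u x)"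
  obtain C where C: "C > 0" "\<And>x h. \<bar>\<rho> (x + h) - \<rho> x - grad \<rho> x \<bullet> h\<bar> \<le> C * (norm h)^2"
    using test_function_taylor[OF \<rho>] by blast
  obtain R where R: "R > 0" "\<And>x. norm x > R \<Longrightarrow> \<rho> x = 0" using test_functionD(2)[OF \<rho>] by blast
  define S where "S = R + norm x + 1"
  define D where "D = (LINT y|lebesgue. \<bar>indicator (cball 0 S) y *\<^sub>R u y\<bar>)"
  have iu: "integrable lebesgue (\<lambda>y. indicator (cball 0 S) y *\<^sub>R u y)"
    using u by (auto simp: locally_integrable_def set_integrable_def)
  have gi: "integrable lebesgue (\<lambda>y. u y * partial_deriv i \<rho> (y - z))" for i z
    by (intro locally_integrable_mult_test u test_function_shift test_function_partial_deriv \<rho>)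
  have ri: "integrable lebesgue (\<lambda>y. u y * \<rho> (y - z))" for z
    by (intro locally_integrable_mult_test u test_function_shift \<rho>)
  have g_eq: "?g \<bullet> h = (LINT y|lebesgue. - (u y * (grad \<rho> (y - x) \<bullet> h)))"
    and g_int: "integrable lebesgue (\<lambda>y. u y * (grad \<rho> (y - x) \<bullet> h))" for h
  proof -
    have e: "u y * (grad \<rho> (y - x) \<bullet> h) = (\<Sum>i\<in>UNIV. (u y * partial_deriv i \<rho> (y - x)) * h $ i)" for y
      by (simp add: inner_vec_def grad_def sum_distrib_left mult.assoc)
    show "integrable lebesgue (\<lambda>y. u y * (grad \<rho> (y - x) \<bullet> h))"
      unfolding e using gi by auto
    show "?g \<bullet> h = (LINT y|lebesgue. - (u y * (grad \<rho> (y - x) \<bullet> h)))"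
      unfolding e using gi by (simp add: inner_vec_def mollify_def Bochner_Integration.integral_sum sum_negf)
  qed
  have main: "\<bar>mollify \<rho> u (x + h) - mollify \<rho> u x - ?g \<bullet> h\<bar> \<le> (C * D) * (norm h)^2" if "norm h \<le> 1" for h
  proof -
    let ?b = "\<lambda>y. \<rho> ((y - x) + (- h)) - \<rho> (y - x) - grad \<rho> (y - x) \<bullet> (- h)"
    have "mollify \<rho> u (x + h) - mollify \<rho> u x - ?g \<bullet> h = (LINT y|lebesgue. u y * ?b y)"
    proof -
      have "y - (x + h) = (y - x) + (-h)" for y by simp
      then have "mollify \<rho> u (x + h) = (LINT y|lebesgue. u y * \<rho> ((y - x) + (-h)))"
        by (simp only: mollify_def)
      moreover have "integrable lebesgue (\<lambda>y. u y * \<rho> ((y - x) + (-h)))" using ri[of "x + h"] by (simp add: algebra_simps)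
      ultimately show ?thesis
        using ri[of x] g_int[of h] unfolding g_eq by (simp add: mollify_def right_diff_distrib distrib_left)
    qed
    also have "\<bar>\<dots>\<bar> \<le> (LINT y|lebesgue. (C * (norm h)^2) * \<bar>indicator (cball 0 S) y *\<^sub>R u y\<bar>)"
    proof (cases "integrable lebesgue (\<lambda>y. u y * ?b y)")
      case True
      have "norm (u y * ?b y) \<le> (C * (norm h)^2) * \<bar>indicator (cball 0 S) y *\<^sub>R u y\<bar>" for y
      proof (cases "norm y \<le> S")
        case True
        then show ?thesis using mult_left_mono[OF C(2)[of "y - x" "-h"], of "\<bar>u y\<bar>"]
          by (simp add: abs_mult mult.commute mult.left_commute)
      next
        case False
        have "norm (y - x) \<ge> norm y - norm x" by (rule norm_triangle_ineq2)
        then have 1: "norm (y - x) > R + 1" using False by (simp add: S_def)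
        moreover have "norm ((y - x) + (-h)) > R" using norm_triangle_ineq2[of "y - x" h] that 1 by simp
        moreover have "grad \<rho> (y - x) = 0"
          using 1 partial_deriv_zero_outside[where x="y - x" and R=R and f=\<rho>] R(2) by (simp add: grad_def vec_eq_iff)
        ultimately have "?b y = 0" using R(2)[of "y - x"] R(2)[of "(y - x) + (-h)"] by simp
        then show ?thesis using C(1) by simp
      qed
      then have "norm (LINT y|lebesgue. u y * ?b y) \<le> (LINT y|lebesgue. (C * (norm h)^2) * \<bar>indicator (cball 0 S) y *\<^sub>R u y\<bar>)"
        using iu by (intro integral_norm_bound[THEN order_trans] integral_mono integrable_norm True) auto
      then show ?thesis by simp
    next
      case False
      then show ?thesis using C(1) by (simp add: not_integrable_integral_eq)
    qed
    also have "\<dots> = (C * D) * (norm h)^2" by (simp add: D_def)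
    finally show ?thesis .
  qed
  have D: "D \<ge> 0" by (simp add: D_def)
  show ?thesis unfolding has_derivative_at_alt
  proof (intro conjI allI impI)
    show "bounded_linear (\<lambda>h. ?g \<bullet> h)" by (rule bounded_linear_inner_right)
    fix e :: real assume e: "e > 0"
    show "\<exists>d>0. \<forall>y. norm (y - x) < d \<longrightarrow> norm (mollify \<rho> u y - mollify \<rho> u x - ?g \<bullet> (y - x)) \<le> e * norm (y - x)"
    proof (intro exI[of _ "min 1 (e / (C * D + 1))"] conjI allI impI)
      show "min 1 (e / (C * D + 1)) > 0" using e C(1) D by (simp add: add_nonneg_pos)
      fix y assume y: "norm (y - x) < min 1 (e / (C * D + 1))"
      have CD: "C * D \<ge> 0" using C(1) D by simp
      have "norm (mollify \<rho> u y - mollify \<rho> u x - ?g \<bullet> (y - x)) \<le> (C * D) * (norm (y - x))^2"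
        using main[of "y - x"] y by simp
      also have "\<dots> = ((C * D) * norm (y - x)) * norm (y - x)" by (simp add: power2_eq_square)
      also have "\<dots> \<le> e * norm (y - x)"
      proof (rule mult_right_mono)
        have "(C * D) * norm (y - x) \<le> (C * D + 1) * norm (y - x)" by (simp add: mult_right_mono)
        also have "\<dots> \<le> e" using y CD by (simp add: field_simps)
        finally show "(C * D) * norm (y - x) \<le> e" .
      qed simp
      finally show "norm (mollify \<rho> u y - mollify \<rho> u x - ?g \<bullet> (y - x)) \<le> e * norm (y - x)" .
    qed
  qed
qed

lemma partial_deriv_mollify:
  assumes "locally_integrable u" "test_function \<rho>"
  shows "partial_deriv i (mollify \<rho> u) x = - mollify (partial_deriv i \<rho>) u x"
  using partial_deriv_eqI[OF mollify_has_derivative[OF assms], of i] by (simp add: inner_axis)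

lemma smooth_mollify:
  assumes "locally_integrable u" "test_function \<rho>"
  shows "smooth (mollify \<rho> u)"
proof -
  have "C_k k (mollify \<rho> u)" for k
    using assms(2)
  proof (induction k arbitrary: \<rho>)
    case 0
    have "continuous_on UNIV (mollify \<rho> u)"
      using has_derivative_continuous[OF mollify_has_derivative[OF assms(1) 0]]
      by (simp add: continuous_on_eq_continuous_at)
    then show ?case by simp
  next
    case (Suc k)
    have "partial_deriv i (mollify \<rho> u) = (\<lambda>x. (-1) * mollify (partial_deriv i \<rho>) u x)" for i
      by (rule ext) (simp add: partial_deriv_mollify[OF assms(1) Suc.prems])
    moreover have "C_k k (\<lambda>x. (-1) * mollify (partial_deriv i \<rho>) u x)" for i
      by (intro C_k_mult C_k_const Suc.IH test_function_partial_deriv Suc.prems)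
    moreover have "mollify \<rho> u differentiable (at x)" for x
      using mollify_has_derivative[OF assms(1) Suc.prems] by (rule differentiableI)
    ultimately show ?case by (simp only: C_k.simps(2) simp_thms)
  qed
  then show ?thesis by (simp add: smooth_def)
qed

lemma partial_deriv_mollify_weak:
  assumes "has_weak_pderiv i u w" "test_function \<rho>"
  shows "partial_deriv i (mollify \<rho> u) = mollify \<rho> w"
proof
  fix x
  have u: "locally_integrable u" using assms(1) by (simp add: has_weak_pderiv_def)
  have "partial_deriv i (\<lambda>y. \<rho> (y - x)) y = partial_deriv i \<rho> (y - x)" for y
    by (rule partial_deriv_shift[OF smoothD(1)[OF test_functionD(1)[OF assms(2)]]])
  moreover have "(LINT y|lebesgue. u y * partial_deriv i (\<lambda>y. \<rho> (y - x)) y) = - (LINT y|lebesgue. w y * \<rho> (y - x))"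
    using assms(1) test_function_shift[OF assms(2)] unfolding has_weak_pderiv_def by blast
  ultimately show "partial_deriv i (mollify \<rho> u) x = mollify \<rho> w x"
    by (simp add: partial_deriv_mollify[OF u assms(2)] mollify_def)
qed

definition mollifier :: "real \<Rightarrow> (real^'n \<Rightarrow> real) \<Rightarrow> bool" where
  "mollifier \<delta> \<rho> \<longleftrightarrow> test_function \<rho> \<and> (\<forall>x. \<rho> x \<ge> 0) \<and> (\<forall>x. norm x \<ge> \<delta> \<longrightarrow> \<rho> x = 0) \<and>
     integrable lborel \<rho> \<and> (LINT x|lborel. \<rho> x) = 1"

lemma mollifier_exists:
  assumes "\<delta> > 0"
  shows "\<exists>\<rho>::real^'n \<Rightarrow> real. mollifier \<delta> \<rho>"
proof -
  obtain a b :: "real^'n" where ab: "0 \<in> box a b" "box a b \<subseteq> ball 0 \<delta>"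
    using rational_boxes[OF assms, of 0] by metis
  let ?f = "box_bump a b" and ?I = "LINT x|lborel. box_bump a b x"
  have [measurable]: "?f \<in> borel_measurable borel" by (rule smoothD(5)[OF smooth_box_bump])
  obtain B where B: "\<And>x. \<bar>?f x\<bar> \<le> B" using test_function_bounded[OF test_function_box_bump[of a b]] by auto
  have fz: "?f x = 0" if "x \<notin> box a b" for x
    using box_bump_pos_iff[of a b x] box_bump_nonneg[of a b x] that by linarith
  have int: "integrable lborel ?f"
  proof (rule Bochner_Integration.integrable_bound)
    show "integrable lborel (\<lambda>x. B * indicator (box a b) x)"
      using emeasure_bounded_finite[OF bounded_box, of a b]
      by (intro integrable_mult_right integrable_real_indicator) auto
    show "AE x in lborel. norm (?f x) \<le> norm (B * indicator (box a b) x)"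
      using B fz by (auto simp: indicator_def intro: order_trans[OF B abs_ge_self])
  qed simp
  have "?I \<noteq> 0"
  proof
    assume "?I = 0"
    then have "AE x in lborel. ?f x = 0"
      using integral_nonneg_eq_0_iff_AE[OF int] box_bump_nonneg by auto
    then have "AE x in lborel. x \<notin> box a b"
    proof eventually_elim
      case (elim x)
      then show ?case using box_bump_pos_iff[of a b x] by simp
    qed
    then have "box a b \<in> null_sets lborel" by (subst (asm) AE_iff_null_sets[symmetric]) auto
    then have "negligible (box a b)" by (simp add: negligible_iff_null_sets null_sets_completionI)
    then show False using open_not_negligible[OF open_box, of a b] ab(1) by auto
  qed
  moreover have "?I \<ge> 0" by (intro integral_nonneg_AE) (simp add: box_bump_nonneg)
  ultimately have I: "?I > 0" by simp
  have "mollifier \<delta> (\<lambda>x. (1 / ?I) * ?f x)"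
    unfolding mollifier_def
  proof (intro conjI allI impI)
    show "test_function (\<lambda>x. (1 / ?I) * ?f x)"
      by (rule test_function_mult_smooth[OF test_function_box_bump smooth_intros(1)])
    show "(1 / ?I) * ?f x \<ge> 0" for x using I box_bump_nonneg[of a b x] by simp
    show "(1 / ?I) * ?f x = 0" if "norm x \<ge> \<delta>" for x
    proof -
      have "x \<notin> box a b" using ab(2) that by auto
      then show ?thesis by (simp add: fz)
    qed
  qed (use int I in auto)
  then show ?thesis by blast
qed

lemma integrable_pow_locally_integrable:
  fixes u :: "real^'n \<Rightarrow> real"
  assumes "u \<in> borel_measurable lebesgue" "integrable lebesgue (\<lambda>x. \<bar>u x\<bar> ^ p)" "p \<ge> 1"
  shows "locally_integrable u"
  unfolding locally_integrable_def
proof (intro allI impI)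
  fix K :: "(real^'n) set" assume K: "compact K"
  then have Km: "K \<in> sets lebesgue" by (simp add: lmeasurable_compact fmeasurableD)
  have le: "\<bar>a\<bar> \<le> 1 + \<bar>a\<bar> ^ p" for a :: real
  proof (cases "\<bar>a\<bar> \<le> 1")
    case False
    then have "\<bar>a\<bar> ^ 1 \<le> \<bar>a\<bar> ^ p" using assms(3) by (intro power_increasing) auto
    then show ?thesis by simp
  qed (simp add: add_increasing2)
  show "u absolutely_integrable_on K"
    unfolding set_integrable_def
  proof (rule Bochner_Integration.integrable_bound)
    have "integrable lebesgue (indicator K :: _ \<Rightarrow> real)"
      using lmeasurable_compact[OF K] by (intro integrable_real_indicator) (auto simp: fmeasurable_def)
    then show "integrable lebesgue (\<lambda>x. indicator K x + \<bar>u x\<bar> ^ p)" using assms(2) by auto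
    show "(\<lambda>x. indicator K x *\<^sub>R u x) \<in> borel_measurable lebesgue"
      using assms(1) Km by (intro borel_measurable_scaleR borel_measurable_indicator)
    show "AE x in lebesgue. norm (indicator K x *\<^sub>R u x) \<le> norm (indicator K x + \<bar>u x\<bar> ^ p)"
      using le by (auto simp: indicator_def)
  qed
qed

text \<open>
  For \<open>p = 2\<close> the Cauchy-Schwarz inequality with respect to the probability density \<open>\<rho>\<close> bounds the square
  of the average by the average of the square. Tonelli's theorem then leaves an average of translation
  differences over short translations.
\<close>

lemma mollify_conv:
  fixes u :: "real^'n \<Rightarrow> real"
  assumes u: "integrable_pow p u" and p: "p = 1 \<or> p = 2" and e: "\<epsilon> > 0"
  shows "\<exists>\<delta>>0. \<forall>\<rho>. mollifier \<delta> \<rho> \<longrightarrow> (\<integral>\<^sup>+x. ennreal (\<bar>mollify \<rho> u x - u x\<bar> ^ p) \<partial>lborel) \<le> ennreal \<epsilon>"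
proof -
  have [measurable]: "u \<in> borel_measurable borel" using u by (simp add: integrable_pow_def)
  have ul: "u \<in> borel_measurable lebesgue" by (rule measurable_completion) simp
  have li: "locally_integrable u"
  proof (rule integrable_pow_locally_integrable[OF ul])
    have "integrable lborel (\<lambda>x. \<bar>u x\<bar> ^ p)" using u by (simp add: integrable_pow_def)
    then show "integrable lebesgue (\<lambda>x. \<bar>u x\<bar> ^ p)" by (subst integrable_completion) auto
  qed (use p in auto)
  obtain \<delta> where \<delta>: "\<delta> > 0" "\<And>h. norm h < \<delta> \<Longrightarrow> (\<integral>\<^sup>+x. ennreal (\<bar>u (x + h) - u x\<bar> ^ p) \<partial>lborel) \<le> ennreal \<epsilon>"
    using integrable_pow_shift_small[OF u p e] by auto
  have "(\<integral>\<^sup>+x. ennreal (\<bar>mollify \<rho> u x - u x\<bar> ^ p) \<partial>lborel) \<le> ennreal \<epsilon>" if \<rho>: "mollifier \<delta> \<rho>" for \<rho>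
  proof -
    have t: "test_function \<rho>" and r0: "\<And>x. \<rho> x \<ge> 0" and rs: "\<And>x. norm x \<ge> \<delta> \<Longrightarrow> \<rho> x = 0"
      and ri: "integrable lborel \<rho>" and r1: "(LINT x|lborel. \<rho> x) = 1"
      using \<rho> by (auto simp: mollifier_def)
    have [measurable]: "\<rho> \<in> borel_measurable borel" by (rule smoothD(5)[OF test_functionD(1)[OF t]])
    have [measurable]: "mollify \<rho> u \<in> borel_measurable borel" by (rule smoothD(5)[OF smooth_mollify[OF li t]])
    have rn: "(\<integral>\<^sup>+h. ennreal (\<rho> h) \<partial>lborel) = 1"
      using nn_integral_eq_integral[OF ri] r0 r1 by simp
    have pw1: "ennreal \<bar>mollify \<rho> u x - u x\<bar> \<le> (\<integral>\<^sup>+h. ennreal \<bar>u (x + h) - u x\<bar> * ennreal (\<rho> h) \<partial>lborel)" for x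
    proof -
      have i1: "integrable lborel (\<lambda>y. u y * \<rho> (y - x))"
        using locally_integrable_mult_test[OF li test_function_shift[OF t, of x]] by (subst (asm) integrable_completion) auto
      have rn': "(\<integral>\<^sup>+y. ennreal (\<rho> (y - x)) \<partial>lborel) = 1"
        using nn_integral_translate[of "\<lambda>y. ennreal (\<rho> y)" "- x"] rn by simp
      then have i2: "integrable lborel (\<lambda>y. \<rho> (y - x))"
        by (intro integrableI_nonneg) (auto simp: r0)
      have i2': "(LINT y|lborel. \<rho> (y - x)) = 1"
        by (subst integral_eq_nn_integral) (auto simp: r0 rn')
      have "mollify \<rho> u x - u x = (LINT y|lborel. u y * \<rho> (y - x)) - (LINT y|lborel. u x * \<rho> (y - x))"
        by (simp add: mollify_def i2') (subst integral_completion, auto)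
      also have "\<dots> = (LINT y|lborel. (u y - u x) * \<rho> (y - x))"
        using i1 i2 by (subst Bochner_Integration.integral_diff[symmetric]) (auto simp: left_diff_distrib)
      finally have "ennreal \<bar>mollify \<rho> u x - u x\<bar> = ennreal (norm (LINT y|lborel. (u y - u x) * \<rho> (y - x)))" by simp
      also have "\<dots> \<le> (\<integral>\<^sup>+y. norm ((u y - u x) * \<rho> (y - x)) \<partial>lborel)"
        using i1 i2 by (intro integral_norm_bound_ennreal) (auto simp: left_diff_distrib)
      also have "\<dots> = (\<integral>\<^sup>+y. ennreal \<bar>u y - u x\<bar> * ennreal (\<rho> (y - x)) \<partial>lborel)"
        by (simp add: abs_mult r0 ennreal_mult)
      also have "\<dots> = (\<integral>\<^sup>+h. ennreal \<bar>u (x + h) - u x\<bar> * ennreal (\<rho> h) \<partial>lborel)"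
        using nn_integral_translate[of "\<lambda>y. ennreal \<bar>u y - u x\<bar> * ennreal (\<rho> (y - x))" x] by (simp add: add.commute)
      finally show ?thesis .
    qed
    have pw: "ennreal (\<bar>mollify \<rho> u x - u x\<bar> ^ p) \<le> (\<integral>\<^sup>+h. ennreal (\<bar>u (x + h) - u x\<bar> ^ p) * ennreal (\<rho> h) \<partial>lborel)" for x
      using p
    proof
      assume "p = 1" then show ?thesis using pw1[of x] by simp
    next
      assume p2: "p = 2"
      have sq: "ennreal (sqrt (\<rho> h)) * ennreal (sqrt (\<rho> h)) = ennreal (\<rho> h)" for h
        using r0[of h] by (simp flip: ennreal_mult)
      have "ennreal (\<bar>mollify \<rho> u x - u x\<bar> ^ 2) = (ennreal \<bar>mollify \<rho> u x - u x\<bar>)^2"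
        by (simp add: ennreal_power del: power2_abs)
      also have "\<dots> \<le> (\<integral>\<^sup>+h. ennreal \<bar>u (x + h) - u x\<bar> * ennreal (\<rho> h) \<partial>lborel)^2"
        by (intro power_mono pw1) simp
      also have "\<dots> = (\<integral>\<^sup>+h. (ennreal \<bar>u (x + h) - u x\<bar> * ennreal (sqrt (\<rho> h))) * ennreal (sqrt (\<rho> h)) \<partial>lborel)^2"
        by (simp add: mult.assoc sq)
      also have "\<dots> \<le> (\<integral>\<^sup>+h. (ennreal \<bar>u (x + h) - u x\<bar> * ennreal (sqrt (\<rho> h)))^2 \<partial>lborel) * (\<integral>\<^sup>+h. (ennreal (sqrt (\<rho> h)))^2 \<partial>lborel)"
        by (rule Cauchy_Schwarz_nn_integral) auto
      also have "(\<integral>\<^sup>+h. (ennreal (sqrt (\<rho> h)))^2 \<partial>lborel) = 1" by (simp add: power2_eq_square sq rn)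
      also have "(\<integral>\<^sup>+h. (ennreal \<bar>u (x + h) - u x\<bar> * ennreal (sqrt (\<rho> h)))^2 \<partial>lborel) =
          (\<integral>\<^sup>+h. ennreal (\<bar>u (x + h) - u x\<bar> ^ 2) * ennreal (\<rho> h) \<partial>lborel)"
      proof (rule nn_integral_cong)
        fix h
        have "(ennreal \<bar>u (x + h) - u x\<bar> * ennreal (sqrt (\<rho> h)))^2 = (ennreal \<bar>u (x + h) - u x\<bar>)^2 * (ennreal (sqrt (\<rho> h)) * ennreal (sqrt (\<rho> h)))"
          by (simp add: power2_eq_square mult_ac)
        then show "(ennreal \<bar>u (x + h) - u x\<bar> * ennreal (sqrt (\<rho> h)))^2 = ennreal (\<bar>u (x + h) - u x\<bar> ^ 2) * ennreal (\<rho> h)"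
          by (simp add: sq ennreal_power del: power2_abs)
      qed
      finally show ?thesis using p2 by simp
    qed
    have "(\<integral>\<^sup>+x. ennreal (\<bar>mollify \<rho> u x - u x\<bar> ^ p) \<partial>lborel) \<le>
      (\<integral>\<^sup>+x. \<integral>\<^sup>+h. ennreal (\<bar>u (x + h) - u x\<bar> ^ p) * ennreal (\<rho> h) \<partial>lborel \<partial>lborel)"
      by (intro nn_integral_mono pw)
    also have "\<dots> = (\<integral>\<^sup>+h. \<integral>\<^sup>+x. ennreal (\<bar>u (x + h) - u x\<bar> ^ p) * ennreal (\<rho> h) \<partial>lborel \<partial>lborel)"
      by (rule lborel_pair.Fubini'[symmetric]) measurable
    also have "\<dots> = (\<integral>\<^sup>+h. (\<integral>\<^sup>+x. ennreal (\<bar>u (x + h) - u x\<bar> ^ p) \<partial>lborel) * ennreal (\<rho> h) \<partial>lborel)"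
      by (intro nn_integral_cong nn_integral_multc) auto
    also have "\<dots> \<le> (\<integral>\<^sup>+h. ennreal \<epsilon> * ennreal (\<rho> h) \<partial>lborel)"
    proof (rule nn_integral_mono)
      fix h :: "real^'n"
      show "(\<integral>\<^sup>+x. ennreal (\<bar>u (x + h) - u x\<bar> ^ p) \<partial>lborel) * ennreal (\<rho> h) \<le> ennreal \<epsilon> * ennreal (\<rho> h)"
        by (cases "norm h < \<delta>") (auto simp: rs intro: mult_right_mono \<delta>(2))
    qed
    also have "\<dots> = ennreal \<epsilon>" by (simp add: nn_integral_cmult rn)
    finally show ?thesis .
  qed
  with \<delta>(1) show ?thesis by blast
qed

section \<open>The fundamental lemma of the calculus of variations\<close>

text \<open>
  Multiplying \<open>w\<close> by a bump makes it integrable and keeps the hypothesis. All mollifications of the product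
  vanish identically, yet they converge to it in the mean.
\<close>

lemma fundamental_lemma:
  fixes w :: "real^'n \<Rightarrow> real"
  assumes w: "locally_integrable w"
    and z: "\<And>\<eta>. test_function \<eta> \<Longrightarrow> (LINT x|lebesgue. w x * \<eta> x) = 0"
  shows "AE x in lebesgue. w x = 0"
proof -
  have loc: "AE x in lebesgue. x \<in> box (vec (- real n)) (vec (real n)) \<longrightarrow> w x = 0" for n
  proof -
    let ?\<zeta> = "box_bump (vec (- real n)) (vec (real n)) :: real^'n \<Rightarrow> real"
    let ?v = "\<lambda>x. w x * ?\<zeta> x"
    have iv: "integrable lebesgue ?v" by (rule locally_integrable_mult_test[OF w test_function_box_bump])
    then have "?v \<in> borel_measurable lebesgue" by auto
    from completion_ex_borel_measurable_real[OF this] obtain v where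
      v[measurable]: "v \<in> borel_measurable borel" and ae: "AE x in lborel. ?v x = v x" by auto
    have ae': "AE x in lebesgue. ?v x = v x" using ae by (rule AE_completion)
    have vl: "v \<in> borel_measurable lebesgue" by (rule measurable_completion) simp
    have "integrable lebesgue v" 
      using integrable_cong_AE[THEN iffD1, OF _ vl ae' iv] iv by auto
    then have "integrable lborel v" by (subst (asm) integrable_completion) auto
    then have vp: "integrable_pow 1 v" by (simp add: integrable_pow_def)
    have m0: "mollify \<rho> v x = 0" if "test_function \<rho>" for \<rho> x
    proof -
      have "mollify \<rho> v x = (LINT y|lebesgue. ?v y * \<rho> (y - x))"
        unfolding mollify_def
      proof (rule integral_cong_AE)
        have r: "(\<lambda>y. \<rho> (y - x)) \<in> borel_measurable lebesgue"
          using smoothD(5)[OF test_functionD(1)[OF test_function_shift[OF that, of x]]]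
          by (intro measurable_completion) simp
        show "(\<lambda>y. v y * \<rho> (y - x)) \<in> borel_measurable lebesgue" using vl r by (rule borel_measurable_times)
        show "(\<lambda>y. ?v y * \<rho> (y - x)) \<in> borel_measurable lebesgue" 
          using borel_measurable_integrable[OF iv] r by (rule borel_measurable_times)
      qed (use ae' in auto)
      also have "\<dots> = (LINT y|lebesgue. w y * (?\<zeta> y * \<rho> (y - x)))" by (simp add: mult.assoc)
      also have "\<dots> = 0"
        by (intro z test_function_mult_smooth test_function_shift that smooth_box_bump)
      finally show ?thesis .
    qed
    have "(\<integral>\<^sup>+x. ennreal \<bar>v x\<bar> \<partial>lborel) \<le> ennreal \<epsilon>" if e: "\<epsilon> > 0" for \<epsilon>
    proof -
      obtain \<delta> where "\<delta> > 0" "\<And>\<rho>. mollifier \<delta> \<rho> \<Longrightarrow> (\<integral>\<^sup>+x. ennreal (\<bar>mollify \<rho> v x - v x\<bar> ^ 1) \<partial>lborel) \<le> ennreal \<epsilon>"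
        using mollify_conv[OF vp _ e] by auto
      moreover obtain \<rho> :: "real^'n \<Rightarrow> real" where "mollifier \<delta> \<rho>" using mollifier_exists[OF \<open>\<delta> > 0\<close>] by blast
      ultimately have "(\<integral>\<^sup>+x. ennreal (\<bar>mollify \<rho> v x - v x\<bar> ^ 1) \<partial>lborel) \<le> ennreal \<epsilon>" by simp
      moreover have "mollify \<rho> v = (\<lambda>x. 0)" using m0[of \<rho>] \<open>mollifier \<delta> \<rho>\<close> by (auto simp: mollifier_def)
      ultimately show ?thesis by simp
    qed
    then have "(\<integral>\<^sup>+x. ennreal \<bar>v x\<bar> \<partial>lborel) = 0"
      by (metis ennreal_le_epsilon add.left_neutral le_zero_eq)
    then have "AE x in lborel. v x = 0" by (subst (asm) nn_integral_0_iff_AE) auto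
    then have "AE x in lebesgue. v x = 0" by (rule AE_completion)
    with ae' show ?thesis
    proof eventually_elim
      case (elim x)
      then show ?case using box_bump_pos_iff[of "vec (- real n)" "vec (real n)" x] by auto
    qed
  qed
  then have "AE x in lebesgue. \<forall>n. x \<in> box (vec (- real n)) (vec (real n)) \<longrightarrow> w x = 0"
    unfolding AE_all_countable by blast
  then show ?thesis
  proof eventually_elim
    case (elim x)
    obtain n :: nat where n: "norm x < real n" using reals_Archimedean2 by blast
    have "\<bar>x $ i\<bar> < real n" for i using component_le_norm_cart[of x i] n by linarith
    then have "x \<in> box (vec (- real n)) (vec (real n))" by (auto simp: mem_box_cart abs_less_iff minus_less_iff)
    with elim show ?case by blast
  qed
qed

section \<open>Weak derivatives and their representatives\<close>

lemma borel_measurable_lebesgueI: "f \<in> borel_measurable borel \<Longrightarrow> f \<in> borel_measurable lebesgue"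
  by (rule measurable_completion) simp

lemma locally_integrable_measurable:
  fixes u :: "real^'n \<Rightarrow> real"
  assumes "locally_integrable u"
  shows "u \<in> borel_measurable lebesgue"
proof (rule borel_measurable_LIMSEQ_real)
  show "(\<lambda>n. indicator (cball 0 (real n)) x *\<^sub>R u x) \<longlonglongrightarrow> u x" for x :: "real^'n"
  proof (rule tendsto_eventually)
    obtain N :: nat where "norm x \<le> real N" using real_arch_simple by blast
    then show "\<forall>\<^sub>F n in sequentially. indicator (cball 0 (real n)) x *\<^sub>R u x = u x"
      by (auto simp: eventually_sequentially intro!: exI[of _ N])
  qed
  show "(\<lambda>x. indicator (cball 0 (real n)) x *\<^sub>R u x) \<in> borel_measurable lebesgue" for n
    using assms unfolding locally_integrable_def set_integrable_def
    by (intro borel_measurable_integrable) auto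
qed

lemma locally_integrable_cong_AE:
  fixes u u' :: "real^'n \<Rightarrow> real"
  assumes "locally_integrable u" "u' \<in> borel_measurable lebesgue" "AE x in lebesgue. u x = u' x"
  shows "locally_integrable u'"
  unfolding locally_integrable_def set_integrable_def
proof (intro allI impI)
  fix K :: "(real^'n) set" assume K: "compact K"
  then have i: "integrable lebesgue (\<lambda>x. indicator K x *\<^sub>R u x)"
    using assms(1) by (auto simp: locally_integrable_def set_integrable_def)
  have "K \<in> sets lebesgue" using K by (simp add: lmeasurable_compact fmeasurableD)
  then have m: "(\<lambda>x. indicator K x *\<^sub>R u' x) \<in> borel_measurable lebesgue"
    using assms(2) by (intro borel_measurable_scaleR borel_measurable_indicator)
  have "AE x in lebesgue. indicator K x *\<^sub>R u x = indicator K x *\<^sub>R u' x"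
    using assms(3) by eventually_elim simp
  then show "integrable lebesgue (\<lambda>x. indicator K x *\<^sub>R u' x)"
    by (rule integrable_cong_AE_imp[OF i m])
qed

lemma integral_mult_cong_AE:
  fixes u u' :: "real^'n \<Rightarrow> real"
  assumes "u \<in> borel_measurable lebesgue" "u' \<in> borel_measurable lebesgue" "AE x in lebesgue. u x = u' x"
    "test_function \<eta>"
  shows "(LINT x|lebesgue. u x * \<eta> x) = (LINT x|lebesgue. u' x * \<eta> x)"
proof -
  have "\<eta> \<in> borel_measurable lebesgue"
    by (rule borel_measurable_lebesgueI[OF smoothD(5)[OF test_functionD(1)[OF assms(4)]]])
  then show ?thesis using assms by (intro integral_cong_AE borel_measurable_times) auto
qed

lemma has_weak_pderiv_cong_AE:
  fixes u :: "real^'n \<Rightarrow> real"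
  assumes h: "has_weak_pderiv i u w" and u': "u' \<in> borel_measurable lebesgue" "AE x in lebesgue. u x = u' x"
    and w': "w' \<in> borel_measurable lebesgue" "AE x in lebesgue. w x = w' x"
  shows "has_weak_pderiv i u' w'"
proof -
  have lu: "locally_integrable u" and lw: "locally_integrable w"
    and e: "\<And>\<eta>. test_function \<eta> \<Longrightarrow> (LINT x|lebesgue. u x * partial_deriv i \<eta> x) = - (LINT x|lebesgue. w x * \<eta> x)"
    using h by (auto simp: has_weak_pderiv_def)
  have "(LINT x|lebesgue. u' x * partial_deriv i \<eta> x) = - (LINT x|lebesgue. w' x * \<eta> x)"
    if t: "test_function \<eta>" for \<eta>
    using e[OF t] integral_mult_cong_AE[OF locally_integrable_measurable[OF lu] u' test_function_partial_deriv[OF t]]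
      integral_mult_cong_AE[OF locally_integrable_measurable[OF lw] w' t] by metis
  then show ?thesis
    using locally_integrable_cong_AE[OF lu u'] locally_integrable_cong_AE[OF lw w'] by (simp add: has_weak_pderiv_def)
qed

lemma weak_pderiv_unique:
  fixes u :: "real^'n \<Rightarrow> real"
  assumes "has_weak_pderiv i u w" "has_weak_pderiv i u w'"
  shows "AE x in lebesgue. w x = w' x"
proof -
  have l: "locally_integrable w" "locally_integrable w'" using assms by (auto simp: has_weak_pderiv_def)
  have ld: "locally_integrable (\<lambda>x. w x - w' x)"
    using l by (auto simp: locally_integrable_def intro: set_integral_diff)
  have "AE x in lebesgue. w x - w' x = 0"
  proof (rule fundamental_lemma[OF ld])
    fix \<eta> :: "real^'n \<Rightarrow> real" assume t: "test_function \<eta>"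
    have "(LINT x|lebesgue. w x * \<eta> x) = (LINT x|lebesgue. w' x * \<eta> x)"
      using assms t unfolding has_weak_pderiv_def by (metis neg_equal_iff_equal)
    then show "(LINT x|lebesgue. (w x - w' x) * \<eta> x) = 0"
      using locally_integrable_mult_test[OF l(1) t] locally_integrable_mult_test[OF l(2) t]
      by (simp add: left_diff_distrib)
  qed
  then show ?thesis by simp
qed

lemma weak_pderiv_eq:
  assumes "has_weak_pderiv i u w"
  shows "has_weak_pderiv i u (weak_pderiv i u)" "AE x in lebesgue. weak_pderiv i u x = w x"
proof -
  show *: "has_weak_pderiv i u (weak_pderiv i u)"
    unfolding weak_pderiv_def by (rule someI[of "has_weak_pderiv i u"]) (rule assms)
  show "AE x in lebesgue. weak_pderiv i u x = w x" by (rule weak_pderiv_unique[OF * assms])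
qed

text \<open>
  Being a weak derivative of \<open>u\<close> only depends on integrals of \<open>u\<close>, so the chosen representatives agree
  everywhere and not merely almost everywhere.
\<close>

lemma weak_pderiv_cong_AE:
  fixes u u' :: "real^'n \<Rightarrow> real"
  assumes "u \<in> borel_measurable lebesgue" "u' \<in> borel_measurable lebesgue" "AE x in lebesgue. u x = u' x"
  shows "weak_pderiv i u = weak_pderiv i u'"
proof -
  have s: "AE x in lebesgue. u' x = u x" using assms(3) by eventually_elim simp
  have "has_weak_pderiv i u w = has_weak_pderiv i u' w" for w
  proof
    assume h: "has_weak_pderiv i u w"
    then have "w \<in> borel_measurable lebesgue" by (auto simp: has_weak_pderiv_def locally_integrable_measurable)
    then show "has_weak_pderiv i u' w" by (intro has_weak_pderiv_cong_AE[OF h assms(2,3)]) auto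
  next
    assume h: "has_weak_pderiv i u' w"
    then have "w \<in> borel_measurable lebesgue" by (auto simp: has_weak_pderiv_def locally_integrable_measurable)
    then show "has_weak_pderiv i u w" by (intro has_weak_pderiv_cong_AE[OF h assms(1) s]) auto
  qed
  then show ?thesis by (simp add: weak_pderiv_def)
qed

lemma sobolev_Lp: "sobolev k p u \<Longrightarrow> Lp p u"
  by (cases k) auto

lemma Lp_cong_AE:
  assumes "Lp p u" "u' \<in> borel_measurable lebesgue" "AE x in lebesgue. u x = u' x"
  shows "Lp p u'"
  unfolding Lp_def
proof
  have i: "integrable lebesgue (\<lambda>x. \<bar>u x\<bar> powr p)" using assms(1) by (simp add: Lp_def)
  have m: "(\<lambda>x. \<bar>u' x\<bar> powr p) \<in> borel_measurable lebesgue" using assms(2) by measurable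
  show "integrable lebesgue (\<lambda>x. \<bar>u' x\<bar> powr p)"
  proof (rule integrable_cong_AE_imp[OF i m])
    show "AE x in lebesgue. \<bar>u x\<bar> powr p = \<bar>u' x\<bar> powr p" using assms(3) by eventually_elim simp
  qed
qed (rule assms(2))

lemma sobolev_cong_AE:
  fixes u u' :: "real^'n \<Rightarrow> real"
  assumes "sobolev k p u" "u' \<in> borel_measurable lebesgue" "AE x in lebesgue. u x = u' x"
  shows "sobolev k p u'"
proof (cases k)
  case 0
  then show ?thesis using assms Lp_cong_AE by auto
next
  case (Suc j)
  have "\<exists>w. has_weak_pderiv i u' w \<and> sobolev j p w" for i
  proof -
    obtain w where w: "has_weak_pderiv i u w" "sobolev j p w" using assms(1) Suc by auto
    then have "w \<in> borel_measurable lebesgue" by (auto simp: has_weak_pderiv_def locally_integrable_measurable)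
    then have "has_weak_pderiv i u' w" by (intro has_weak_pderiv_cong_AE[OF w(1) assms(2,3)]) auto
    with w(2) show ?thesis by blast
  qed
  then show ?thesis using Suc assms Lp_cong_AE[OF sobolev_Lp[OF assms(1)]] by simp
qed

text \<open>
  The derivative whose existence the definition asserts may be replaced by the chosen representative:
  the two agree almost everywhere by uniqueness, and Sobolev regularity ignores null sets.
\<close>

lemma sobolev_SucD:
  fixes u :: "real^'n \<Rightarrow> real"
  assumes "sobolev (Suc k) p u"
  shows "Lp p u" "has_weak_pderiv i u (weak_pderiv i u)" "sobolev k p (weak_pderiv i u)"
proof -
  show "Lp p u" using assms by simp
  obtain w where w: "has_weak_pderiv i u w" "sobolev k p w" using assms by auto
  show h: "has_weak_pderiv i u (weak_pderiv i u)" by (rule weak_pderiv_eq[OF w(1)])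
  have "AE x in lebesgue. w x = weak_pderiv i u x" using weak_pderiv_eq(2)[OF w(1)] by eventually_elim simp
  moreover have "weak_pderiv i u \<in> borel_measurable lebesgue"
    using h by (auto simp: has_weak_pderiv_def locally_integrable_measurable)
  ultimately show "sobolev k p (weak_pderiv i u)" by (intro sobolev_cong_AE[OF w(2)])
qed

lemma sobolev_SucI:
  assumes "Lp p u" "\<And>i. has_weak_pderiv i u (w i)" "\<And>i. sobolev k p (w i)"
  shows "sobolev (Suc k) p u"
  using assms by auto

section \<open>Convergence in the mean square\<close>

lemma tendsto_0_ennrealI:
  fixes X :: "_ \<Rightarrow> ennreal"
  assumes "\<And>\<epsilon>. \<epsilon> > 0 \<Longrightarrow> \<forall>\<^sub>F m in F. X m \<le> ennreal \<epsilon>"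
  shows "(X \<longlongrightarrow> 0) F"
proof (rule order_tendstoI)
  fix a :: ennreal assume "0 < a"
  then obtain y where y: "0 < y" "y < a" using dense by blast
  then obtain r where r: "y = ennreal r" "r > 0" by (cases y) auto
  show "\<forall>\<^sub>F m in F. X m < a" using assms[OF r(2)] by eventually_elim (use y r in auto)
qed auto

lemma tendsto_0_ennrealD:
  fixes X :: "_ \<Rightarrow> ennreal"
  assumes "(X \<longlongrightarrow> 0) F" "\<epsilon> > 0"
  shows "\<forall>\<^sub>F m in F. X m \<le> ennreal \<epsilon>"
proof -
  have "\<forall>\<^sub>F m in F. X m < ennreal \<epsilon>" using order_tendstoD(2)[OF assms(1), of "ennreal \<epsilon>"] assms(2) by simp
  then show ?thesis by eventually_elim simp
qed

lemma tendsto_0_le: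
  fixes X Y :: "_ \<Rightarrow> ennreal"
  assumes "(Y \<longlongrightarrow> 0) F" "\<And>m. X m \<le> Y m"
  shows "(X \<longlongrightarrow> 0) F"
  by (rule tendsto_sandwich[OF _ _ tendsto_const assms(1)]) (auto simp: assms(2))

definition sq_integral :: "(real^'n \<Rightarrow> real) \<Rightarrow> ennreal" where
  "sq_integral f = (\<integral>\<^sup>+x. ennreal ((f x)^2) \<partial>lebesgue)"

lemma sq_sum_le: "(a + b)^2 \<le> 2 * a^2 + 2 * b^2" for a b :: real
  using sum_squares_bound[of a b] by (simp add: power2_sum)

lemma sq_integral_add:
  assumes "f \<in> borel_measurable lebesgue" "g \<in> borel_measurable lebesgue"
  shows "sq_integral (\<lambda>x. f x + g x) \<le> 2 * sq_integral f + 2 * sq_integral g"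
proof -
  note [measurable] = assms
  have "sq_integral (\<lambda>x. f x + g x) \<le> (\<integral>\<^sup>+x. 2 * ennreal ((f x)^2) + 2 * ennreal ((g x)^2) \<partial>lebesgue)"
    unfolding sq_integral_def
  proof (rule nn_integral_mono)
    fix x
    have "ennreal ((f x + g x)^2) \<le> ennreal (2 * (f x)^2 + 2 * (g x)^2)" by (intro ennreal_leI sq_sum_le)
    also have "\<dots> = 2 * ennreal ((f x)^2) + 2 * ennreal ((g x)^2)"
      by (simp add: ennreal_plus ennreal_mult)
    finally show "ennreal ((f x + g x)^2) \<le> 2 * ennreal ((f x)^2) + 2 * ennreal ((g x)^2)" .
  qed
  also have "\<dots> = 2 * sq_integral f + 2 * sq_integral g"
    unfolding sq_integral_def by (subst nn_integral_add) (auto simp: nn_integral_cmult)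
  finally show ?thesis .
qed

lemma tendsto_0_2add:
  fixes X Y :: "_ \<Rightarrow> ennreal"
  assumes "(X \<longlongrightarrow> 0) F" "(Y \<longlongrightarrow> 0) F"
  shows "((\<lambda>m. 2 * X m + 2 * Y m) \<longlongrightarrow> 0) F"
proof -
  have "((\<lambda>m. 2 * X m) \<longlongrightarrow> 2 * 0) F" "((\<lambda>m. 2 * Y m) \<longlongrightarrow> 2 * 0) F"
    by (intro ennreal_tendsto_cmult assms; simp)+
  from tendsto_add[OF this] show ?thesis by simp
qed

lemma tendsto_0_le2:
  fixes X Y Z :: "_ \<Rightarrow> ennreal"
  assumes "(X \<longlongrightarrow> 0) F" "(Y \<longlongrightarrow> 0) F" "\<And>m. Z m \<le> 2 * X m + 2 * Y m"
  shows "(Z \<longlongrightarrow> 0) F"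
  by (rule tendsto_0_le[OF tendsto_0_2add[OF assms(1,2)] assms(3)])

text \<open>
  Convergence in the Sobolev space of order \<open>k\<close> of classical functions to a weakly differentiable
  one. The recursion follows that of \<^const>\<open>sobolev\<close>, with the chosen representatives as limits.
\<close>

primrec H_conv :: "nat \<Rightarrow> (nat \<Rightarrow> real^'n \<Rightarrow> real) \<Rightarrow> (real^'n \<Rightarrow> real) \<Rightarrow> bool" where
  "H_conv 0 f u \<longleftrightarrow> (\<lambda>m. sq_integral (\<lambda>x. f m x - u x)) \<longlonglongrightarrow> 0"
| "H_conv (Suc k) f u \<longleftrightarrow> (\<lambda>m. sq_integral (\<lambda>x. f m x - u x)) \<longlonglongrightarrow> 0 \<and>
     (\<forall>i. H_conv k (\<lambda>m. partial_deriv i (f m)) (weak_pderiv i u))"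

primrec H_null :: "nat \<Rightarrow> (nat \<Rightarrow> real^'n \<Rightarrow> real) \<Rightarrow> bool" where
  "H_null 0 f \<longleftrightarrow> (\<lambda>m. sq_integral (f m)) \<longlonglongrightarrow> 0"
| "H_null (Suc k) f \<longleftrightarrow> (\<lambda>m. sq_integral (f m)) \<longlonglongrightarrow> 0 \<and> (\<forall>i. H_null k (\<lambda>m. partial_deriv i (f m)))"

primrec H_bounded :: "nat \<Rightarrow> (nat \<Rightarrow> real^'n \<Rightarrow> real) \<Rightarrow> bool" where
  "H_bounded 0 f \<longleftrightarrow> (\<exists>B\<ge>0. \<forall>\<^sub>F m in sequentially. sq_integral (f m) \<le> ennreal B)"
| "H_bounded (Suc k) f \<longleftrightarrow> (\<exists>B\<ge>0. \<forall>\<^sub>F m in sequentially. sq_integral (f m) \<le> ennreal B) \<and>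
     (\<forall>i. H_bounded k (\<lambda>m. partial_deriv i (f m)))"

text \<open>
  Convergence to zero in the uniform norm of the derivatives up to order \<open>k\<close>.
\<close>

primrec C_null :: "nat \<Rightarrow> (nat \<Rightarrow> real^'n \<Rightarrow> real) \<Rightarrow> bool" where
  "C_null 0 \<psi> \<longleftrightarrow> (\<forall>\<epsilon>>0. \<forall>\<^sub>F m in sequentially. \<forall>x. \<bar>\<psi> m x\<bar> \<le> \<epsilon>)"
| "C_null (Suc k) \<psi> \<longleftrightarrow> (\<forall>\<epsilon>>0. \<forall>\<^sub>F m in sequentially. \<forall>x. \<bar>\<psi> m x\<bar> \<le> \<epsilon>) \<and>
     (\<forall>i. C_null k (\<lambda>m. partial_deriv i (\<psi> m)))"

lemma smooth_lebesgue_measurable: "smooth f \<Longrightarrow> f \<in> borel_measurable lebesgue"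
  by (intro borel_measurable_lebesgueI smoothD(5))

lemma partial_deriv_add_smooth:
  "smooth f \<Longrightarrow> smooth g \<Longrightarrow> partial_deriv i (\<lambda>x. f x + g x) = (\<lambda>x. partial_deriv i f x + partial_deriv i g x)"
  by (intro ext partial_deriv_add smoothD)

lemma partial_deriv_mult_smooth:
  "smooth f \<Longrightarrow> smooth g \<Longrightarrow> partial_deriv i (\<lambda>x. f x * g x) = (\<lambda>x. f x * partial_deriv i g x + partial_deriv i f x * g x)"
  by (intro ext, subst partial_deriv_mult) (auto intro: smoothD)

lemma H_null_sq: "H_null k f \<Longrightarrow> (\<lambda>m. sq_integral (f m)) \<longlonglongrightarrow> 0"
  by (cases k) auto

lemma H_bounded_sq: "H_bounded k f \<Longrightarrow> (\<exists>B\<ge>0. \<forall>\<^sub>F m in sequentially. sq_integral (f m) \<le> ennreal B)"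
  by (cases k) auto

lemma H_conv_sq: "H_conv k f u \<Longrightarrow> (\<lambda>m. sq_integral (\<lambda>x. f m x - u x)) \<longlonglongrightarrow> 0"
  by (cases k) auto

lemma C_null_sup: "C_null k \<psi> \<Longrightarrow> \<epsilon> > 0 \<Longrightarrow> \<forall>\<^sub>F m in sequentially. \<forall>x. \<bar>\<psi> m x\<bar> \<le> \<epsilon>"
  by (cases k) auto

lemma H_bounded_Suc_imp: "H_bounded (Suc k) f \<Longrightarrow> H_bounded k f"
  by (induction k arbitrary: f) auto

lemma C_null_Suc_imp: "C_null (Suc k) f \<Longrightarrow> C_null k f"
  by (induction k arbitrary: f) auto

lemma H_null_add:
  assumes "H_null k f" "H_null k g" "\<And>m. smooth (f m)" "\<And>m. smooth (g m)"
  shows "H_null k (\<lambda>m x. f m x + g m x)"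
  using assms
proof (induction k arbitrary: f g)
  case 0
  have "sq_integral (\<lambda>x. f m x + g m x) \<le> 2 * sq_integral (f m) + 2 * sq_integral (g m)" for m
    by (rule sq_integral_add[OF smooth_lebesgue_measurable[OF 0(3)] smooth_lebesgue_measurable[OF 0(4)]])
  from tendsto_0_le2[OF H_null_sq[OF 0(1)] H_null_sq[OF 0(2)] this] show ?case by simp
next
  case (Suc k)
  have "sq_integral (\<lambda>x. f m x + g m x) \<le> 2 * sq_integral (f m) + 2 * sq_integral (g m)" for m
    by (rule sq_integral_add[OF smooth_lebesgue_measurable[OF Suc.prems(3)] smooth_lebesgue_measurable[OF Suc.prems(4)]])
  then have "(\<lambda>m. sq_integral (\<lambda>x. f m x + g m x)) \<longlonglongrightarrow> 0"
    by (rule tendsto_0_le2[OF H_null_sq[OF Suc.prems(1)] H_null_sq[OF Suc.prems(2)]])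
  moreover have "H_null k (\<lambda>m. partial_deriv i (\<lambda>x. f m x + g m x))" for i
    unfolding partial_deriv_add_smooth[OF Suc.prems(3,4)]
    using Suc.prems by (intro Suc.IH smoothD(2)) auto
  ultimately show ?case by simp
qed

lemma H_conv_add_null:
  assumes "H_conv k f u" "H_null k g" "\<And>m. smooth (f m)" "\<And>m. smooth (g m)" "sobolev k p u"
  shows "H_conv k (\<lambda>m x. f m x + g m x) u"
  using assms
proof (induction k arbitrary: f g u)
  case 0
  then have "u \<in> borel_measurable lebesgue" by (simp add: Lp_def)
  then have "sq_integral (\<lambda>x. f m x + g m x - u x) \<le> 2 * sq_integral (\<lambda>x. f m x - u x) + 2 * sq_integral (g m)" for m
    using sq_integral_add[of "\<lambda>x. f m x - u x" "g m"] smooth_lebesgue_measurable[OF 0(3)] smooth_lebesgue_measurable[OF 0(4)]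
    by (simp add: algebra_simps)
  from tendsto_0_le2[OF H_conv_sq[OF 0(1)] H_null_sq[OF 0(2)] this] show ?case by simp
next
  case (Suc k)
  have "u \<in> borel_measurable lebesgue" using Suc.prems(5) by (simp add: Lp_def)
  then have "sq_integral (\<lambda>x. f m x + g m x - u x) \<le> 2 * sq_integral (\<lambda>x. f m x - u x) + 2 * sq_integral (g m)" for m
    using sq_integral_add[of "\<lambda>x. f m x - u x" "g m"] smooth_lebesgue_measurable[OF Suc.prems(3)] smooth_lebesgue_measurable[OF Suc.prems(4)]
    by (simp add: algebra_simps)
  then have "(\<lambda>m. sq_integral (\<lambda>x. f m x + g m x - u x)) \<longlonglongrightarrow> 0"
    by (rule tendsto_0_le2[OF H_conv_sq[OF Suc.prems(1)] H_null_sq[OF Suc.prems(2)]])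
  moreover have "H_conv k (\<lambda>m. partial_deriv i (\<lambda>x. f m x + g m x)) (weak_pderiv i u)" for i
    unfolding partial_deriv_add_smooth[OF Suc.prems(3,4)]
    using Suc.prems sobolev_SucD(3)[OF Suc.prems(5)] by (intro Suc.IH smoothD(2)) auto
  ultimately show ?case by simp
qed

lemma sq_integral_mult_le:
  assumes "f \<in> borel_measurable lebesgue" "\<And>x. \<bar>\<psi> x\<bar> \<le> c" "c \<ge> 0"
  shows "sq_integral (\<lambda>x. \<psi> x * f x) \<le> ennreal (c^2) * sq_integral f"
proof -
  note [measurable] = assms(1)
  have "sq_integral (\<lambda>x. \<psi> x * f x) \<le> (\<integral>\<^sup>+x. ennreal (c^2) * ennreal ((f x)^2) \<partial>lebesgue)"
    unfolding sq_integral_def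
  proof (rule nn_integral_mono)
    fix x
    have "(\<psi> x)^2 \<le> c^2" using assms(2)[of x] assms(3) by (simp add: power2_le_iff_abs_le)
    then have "(\<psi> x * f x)^2 \<le> c^2 * (f x)^2" by (simp add: power_mult_distrib mult_right_mono)
    then show "ennreal ((\<psi> x * f x)^2) \<le> ennreal (c^2) * ennreal ((f x)^2)"
      by (simp flip: ennreal_mult add: ennreal_leI)
  qed
  also have "\<dots> = ennreal (c^2) * sq_integral f" unfolding sq_integral_def by (rule nn_integral_cmult) measurable
  finally show ?thesis .
qed

lemma sq_integral_C_null:
  assumes "C_null k \<psi>" "H_bounded l f" "\<And>m. smooth (f m)"
  shows "(\<lambda>m. sq_integral (\<lambda>x. \<psi> m x * f m x)) \<longlonglongrightarrow> 0"
proof (rule tendsto_0_ennrealI)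
  fix \<epsilon> :: real assume e: "\<epsilon> > 0"
  obtain B where B: "B \<ge> 0" "\<forall>\<^sub>F m in sequentially. sq_integral (f m) \<le> ennreal B" using H_bounded_sq[OF assms(2)] by auto
  define c where "c = sqrt (\<epsilon> / (B + 1))"
  have c: "c > 0" "c^2 = \<epsilon> / (B + 1)" using e B(1) by (auto simp: c_def)
  from C_null_sup[OF assms(1) c(1)] B(2)
  show "\<forall>\<^sub>F m in sequentially. sq_integral (\<lambda>x. \<psi> m x * f m x) \<le> ennreal \<epsilon>"
  proof eventually_elim
    case (elim m)
    have "sq_integral (\<lambda>x. \<psi> m x * f m x) \<le> ennreal (c^2) * sq_integral (f m)"
      using elim(1) c(1) by (intro sq_integral_mult_le smooth_lebesgue_measurable assms) auto
    also have "\<dots> \<le> ennreal (c^2) * ennreal B" by (intro mult_left_mono elim) simp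
    also have "\<dots> = ennreal (c^2 * B)" using B by (simp add: ennreal_mult)
    also have "\<dots> \<le> ennreal \<epsilon>"
      using e B(1) by (intro ennreal_leI) (simp add: c(2) field_simps)
    finally show ?case .
  qed
qed

text \<open>
  Controls the terms of the Leibniz rule in which a derivative falls on a slowly varying cut-off.
\<close>

lemma H_null_mult:
  assumes "C_null k \<psi>" "H_bounded k f" "\<And>m. smooth (f m)" "\<And>m. smooth (\<psi> m)"
  shows "H_null k (\<lambda>m x. \<psi> m x * f m x)"
  using assms
proof (induction k arbitrary: f \<psi>)
  case 0
  then show ?case using sq_integral_C_null[OF 0(1,2,3)] by simp
next
  case (Suc k)
  have "H_null k (\<lambda>m. partial_deriv i (\<lambda>x. \<psi> m x * f m x))" for i
    unfolding partial_deriv_mult_smooth[OF Suc.prems(4,3)]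
  proof (rule H_null_add)
    show "H_null k (\<lambda>m x. \<psi> m x * partial_deriv i (f m) x)"
      using Suc.prems C_null_Suc_imp[OF Suc.prems(1)] by (intro Suc.IH smoothD(2)) auto
    show "H_null k (\<lambda>m x. partial_deriv i (\<psi> m) x * f m x)"
      using Suc.prems H_bounded_Suc_imp[OF Suc.prems(2)] by (intro Suc.IH smoothD(2)) auto
  qed (use Suc.prems in \<open>auto intro!: smooth_intros smoothD(2)\<close>)
  then show ?case using sq_integral_C_null[OF Suc.prems(1,2,3)] by simp
qed

section \<open>Density of test functions\<close>

definition std_mollifier :: "nat \<Rightarrow> real^'n \<Rightarrow> real" where
  "std_mollifier m = (SOME \<rho>. mollifier (inverse (real (Suc m))) \<rho>)"

lemma std_mollifier: "mollifier (inverse (real (Suc m))) (std_mollifier m)"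
  unfolding std_mollifier_def by (rule someI_ex[OF mollifier_exists]) simp

lemma std_mollifier_test: "test_function (std_mollifier m)"
  using std_mollifier by (auto simp: mollifier_def)

lemma abs_powr_2: "\<bar>x::real\<bar> powr 2 = x^2"
  by (cases "x = 0") (auto simp: powr_numeral)

lemma Lp2D:
  assumes "Lp 2 u"
  shows "u \<in> borel_measurable lebesgue" "integrable lebesgue (\<lambda>x. (u x)^2)" "sq_integral u < \<infinity>" "locally_integrable u"
proof -
  show m: "u \<in> borel_measurable lebesgue" using assms by (simp add: Lp_def)
  show i: "integrable lebesgue (\<lambda>x. (u x)^2)" using assms by (simp add: Lp_def abs_powr_2)
  show "sq_integral u < \<infinity>" using i by (simp add: sq_integral_def integrable_iff_bounded)
  show "locally_integrable u" using integrable_pow_locally_integrable[OF m, of 2] i by simp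
qed

lemma mollify_cong_AE:
  assumes "u \<in> borel_measurable lebesgue" "v \<in> borel_measurable lebesgue" "AE x in lebesgue. u x = v x" "test_function \<rho>"
  shows "mollify \<rho> u = mollify \<rho> v"
  unfolding mollify_def by (rule ext) (rule integral_mult_cong_AE[OF assms(1-3) test_function_shift[OF assms(4)]])

lemma mollify_std_mollifier_conv:
  fixes u :: "real^'n \<Rightarrow> real"
  assumes "Lp 2 u"
  shows "(\<lambda>m. sq_integral (\<lambda>x. mollify (std_mollifier m) u x - u x)) \<longlonglongrightarrow> 0"
proof (rule tendsto_0_ennrealI)
  fix \<epsilon> :: real assume e: "\<epsilon> > 0"
  obtain v where v[measurable]: "v \<in> borel_measurable borel" and ae: "AE x in lborel. u x = v x"
    using completion_ex_borel_measurable_real[OF Lp2D(1)[OF assms]] by auto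
  have ae': "AE x in lebesgue. u x = v x" using ae by (rule AE_completion)
  have vl: "v \<in> borel_measurable lebesgue" by (rule borel_measurable_lebesgueI) simp
  have "Lp 2 v" by (rule Lp_cong_AE[OF assms vl ae'])
  from Lp2D(2)[OF this] have "integrable lborel (\<lambda>x. (v x)^2)" by (subst (asm) integrable_completion) auto
  then have vp: "integrable_pow 2 v" by (simp add: integrable_pow_def)
  obtain \<delta> where d: "\<delta> > 0" "\<And>\<rho>. mollifier \<delta> \<rho> \<Longrightarrow> (\<integral>\<^sup>+x. ennreal (\<bar>mollify \<rho> v x - v x\<bar> ^ 2) \<partial>lborel) \<le> ennreal \<epsilon>"
    using mollify_conv[OF vp _ e] by auto
  obtain N where N: "inverse (real (Suc N)) < \<delta>" using reals_Archimedean[OF d(1)] by auto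
  show "\<forall>\<^sub>F m in sequentially. sq_integral (\<lambda>x. mollify (std_mollifier m) u x - u x) \<le> ennreal \<epsilon>"
    unfolding eventually_sequentially
  proof (intro exI[of _ N] allI impI)
    fix m assume "N \<le> m"
    then have "inverse (real (Suc m)) \<le> inverse (real (Suc N))" by (simp add: field_simps)
    then have "inverse (real (Suc m)) \<le> \<delta>" using N by linarith
    then have "mollifier \<delta> (std_mollifier m :: real^'n \<Rightarrow> real)" using std_mollifier[of m] by (auto simp: mollifier_def)
    note d(2)[OF this]
    moreover have "sq_integral (\<lambda>x. mollify (std_mollifier m) u x - u x) = (\<integral>\<^sup>+x. ennreal (\<bar>mollify (std_mollifier m) v x - v x\<bar> ^ 2) \<partial>lebesgue)"
      unfolding sq_integral_def mollify_cong_AE[OF Lp2D(1)[OF assms] vl ae' std_mollifier_test]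
      by (intro nn_integral_cong_AE) (use ae' in auto)
    ultimately show "sq_integral (\<lambda>x. mollify (std_mollifier m) u x - u x) \<le> ennreal \<epsilon>" by (simp add: nn_integral_completion)
  qed
qed

lemma mollify_sq_integral_bounded:
  fixes u :: "real^'n \<Rightarrow> real"
  assumes L: "Lp 2 u"
  shows "\<exists>B\<ge>0. \<forall>\<^sub>F m in sequentially. sq_integral (mollify (std_mollifier m) u) \<le> ennreal B"
proof -
  have li: "locally_integrable u" by (rule Lp2D[OF L])
  obtain r where r: "sq_integral u = ennreal r" "r \<ge> 0" using Lp2D(3)[OF L] by (cases "sq_integral u") auto
  have "\<forall>\<^sub>F m in sequentially. sq_integral (mollify (std_mollifier m) u) \<le> ennreal (2 + 2 * r)"
    using tendsto_0_ennrealD[OF mollify_std_mollifier_conv[OF L] zero_less_one]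
  proof eventually_elim
    case (elim m)
    have "sq_integral (mollify (std_mollifier m) u) = sq_integral (\<lambda>x. (mollify (std_mollifier m) u x - u x) + u x)" by simp
    also have "\<dots> \<le> 2 * sq_integral (\<lambda>x. mollify (std_mollifier m) u x - u x) + 2 * sq_integral u"
      using Lp2D(1)[OF L] smooth_lebesgue_measurable[OF smooth_mollify[OF li std_mollifier_test]]
      by (intro sq_integral_add borel_measurable_diff)
    also have "\<dots> \<le> 2 * ennreal 1 + 2 * ennreal r" unfolding r by (intro add_mono mult_left_mono elim) auto
    also have "\<dots> = ennreal (2 + 2 * r)" using r(2) by (simp add: ennreal_plus ennreal_mult)
    finally show ?case .
  qed
  then show ?thesis using r(2) by (auto intro!: exI[of _ "2 + 2 * r"])
qed

lemma mollify_H_bounded: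
  fixes u :: "real^'n \<Rightarrow> real"
  assumes "sobolev k 2 u"
  shows "H_bounded k (\<lambda>m. mollify (std_mollifier m) u)"
  using assms
proof (induction k arbitrary: u)
  case 0
  then show ?case by (simp add: mollify_sq_integral_bounded)
next
  case (Suc k)
  have "H_bounded k (\<lambda>m. partial_deriv i (mollify (std_mollifier m) u))" for i
    unfolding partial_deriv_mollify_weak[OF sobolev_SucD(2)[OF Suc.prems] std_mollifier_test]
    by (rule Suc.IH[OF sobolev_SucD(3)[OF Suc.prems]])
  then show ?case using mollify_sq_integral_bounded[OF sobolev_Lp[OF Suc.prems]] by simp
qed

lemma cutoff_exists: "\<exists>\<kappa>::real^'n \<Rightarrow> real. test_function \<kappa> \<and> \<kappa> 0 = 1"
proof -
  have "(0::real^'n) \<in> box (vec (-1)) (vec 1)" by (simp add: mem_box_cart)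
  then have p: "box_bump (vec (-1)) (vec 1) (0::real^'n) > 0" using box_bump_pos_iff by blast
  have "test_function (\<lambda>x. (1 / box_bump (vec (-1)) (vec 1) (0::real^'n)) * box_bump (vec (-1)) (vec 1) x)"
    by (rule test_function_mult_smooth[OF test_function_box_bump smooth_intros(1)])
  moreover have "(1 / box_bump (vec (-1)) (vec 1) (0::real^'n)) * box_bump (vec (-1)) (vec 1) (0::real^'n) = 1"
    using p by simp
  ultimately show ?thesis by blast
qed

definition dilate :: "(real^'n \<Rightarrow> real) \<Rightarrow> nat \<Rightarrow> real^'n \<Rightarrow> real" where
  "dilate \<theta> m x = \<theta> (inverse (real (Suc m)) *\<^sub>R x)"

lemma smooth_dilate: "smooth \<theta> \<Longrightarrow> smooth (dilate \<theta> m)"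
  unfolding dilate_def[abs_def] using smooth_intros(4)[of \<theta> "inverse (real (Suc m))" 0] by simp

lemma partial_deriv_dilate:
  assumes "smooth \<theta>"
  shows "partial_deriv i (dilate \<theta> m) = (\<lambda>x. inverse (real (Suc m)) * dilate (partial_deriv i \<theta>) m x)"
proof
  fix x
  show "partial_deriv i (dilate \<theta> m) x = inverse (real (Suc m)) * dilate (partial_deriv i \<theta>) m x"
    unfolding dilate_def[abs_def]
    using partial_deriv_scale_shift[of \<theta> "inverse (real (Suc m))" x 0 i] smoothD(1)[OF assms] by simp
qed

lemma dilate_sup_null:
  assumes "test_function \<theta>" "c \<longlonglongrightarrow> 0" "\<epsilon> > 0"
  shows "\<forall>\<^sub>F m in sequentially. \<forall>x. \<bar>c m * dilate \<theta> m x\<bar> \<le> \<epsilon>"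
proof -
  obtain B where B: "B > 0" "\<And>x. \<bar>\<theta> x\<bar> \<le> B" using test_function_bounded[OF assms(1)] by auto
  have "\<forall>\<^sub>F m in sequentially. \<bar>c m\<bar> < \<epsilon> / B"
    using tendstoD[OF assms(2), of "\<epsilon> / B"] B(1) assms(3) by (simp add: dist_real_def)
  then show ?thesis
  proof eventually_elim
    case (elim m)
    have "\<bar>c m * dilate \<theta> m x\<bar> \<le> (\<epsilon> / B) * B" for x
      unfolding abs_mult using elim B assms(3) by (intro mult_mono) (auto simp: dilate_def)
    then show ?case using B(1) by simp
  qed
qed

lemma C_null_dilate:
  assumes "test_function \<theta>" "c \<longlonglongrightarrow> 0"
  shows "C_null k (\<lambda>m x. c m * dilate \<theta> m x)"
  using assms
proof (induction k arbitrary: \<theta> c)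
  case 0
  then show ?case by (simp add: dilate_sup_null)
next
  case (Suc k)
  have s: "smooth \<theta>" by (rule test_functionD[OF Suc.prems(1)])
  have "C_null k (\<lambda>m. partial_deriv i (\<lambda>x. c m * dilate \<theta> m x))" for i
  proof -
    have "partial_deriv i (\<lambda>x. c m * dilate \<theta> m x) =
        (\<lambda>x. (c m * inverse (real (Suc m))) * dilate (partial_deriv i \<theta>) m x)" for m
      unfolding partial_deriv_mult_smooth[OF smooth_intros(1) smooth_dilate[OF s]] partial_deriv_dilate[OF s]
      by (simp add: mult.assoc)
    moreover have "(\<lambda>m. c m * inverse (real (Suc m))) \<longlonglongrightarrow> 0"
      using tendsto_mult[OF Suc.prems(2) LIMSEQ_inverse_real_of_nat] by simp
    ultimately show ?thesis using Suc.IH[OF test_function_partial_deriv[OF Suc.prems(1), of i]] by simp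
  qed
  then show ?case using dilate_sup_null[OF Suc.prems] by simp
qed

lemma cutoff_mollify_sq:
  fixes u :: "real^'n \<Rightarrow> real"
  assumes L: "Lp 2 u" and \<kappa>: "test_function \<kappa>" "\<kappa> 0 = 1"
  shows "(\<lambda>m. sq_integral (\<lambda>x. dilate \<kappa> m x * mollify (std_mollifier m) u x - u x)) \<longlonglongrightarrow> 0"
proof -
  obtain B where B: "B > 0" "\<And>x. \<bar>\<kappa> x\<bar> \<le> B" using test_function_bounded[OF \<kappa>(1)] by auto
  have um: "u \<in> borel_measurable lebesgue" by (rule Lp2D[OF L])
  note li = Lp2D(4)[OF L]
  have s: "smooth \<kappa>" by (rule test_functionD[OF \<kappa>(1)])
  have dm: "dilate \<kappa> m \<in> borel_measurable lebesgue" for m by (intro smooth_lebesgue_measurable smooth_dilate s)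
  have mm: "mollify (std_mollifier m) u \<in> borel_measurable lebesgue" for m
    by (intro smooth_lebesgue_measurable smooth_mollify li std_mollifier_test)
  have 1: "(\<lambda>m. sq_integral (\<lambda>x. dilate \<kappa> m x * (mollify (std_mollifier m) u x - u x))) \<longlonglongrightarrow> 0"
  proof (rule tendsto_0_le)
    show "(\<lambda>m. ennreal (B^2) * sq_integral (\<lambda>x. mollify (std_mollifier m) u x - u x)) \<longlonglongrightarrow> 0"
      using ennreal_tendsto_cmult[OF _ mollify_std_mollifier_conv[OF L], of "ennreal (B^2)"] by simp
    show "sq_integral (\<lambda>x. dilate \<kappa> m x * (mollify (std_mollifier m) u x - u x)) \<le> ennreal (B^2) * sq_integral (\<lambda>x. mollify (std_mollifier m) u x - u x)" for m
      using B by (intro sq_integral_mult_le borel_measurable_diff mm um) (auto simp: dilate_def)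
  qed
  have 2: "(\<lambda>m. sq_integral (\<lambda>x. (dilate \<kappa> m x - 1) * u x)) \<longlonglongrightarrow> 0"
  proof -
    let ?s = "\<lambda>m x. ((dilate \<kappa> m x - 1) * u x)^2"
    have "(\<lambda>m. \<integral>\<^sup>+x. norm (0 - ?s m x) \<partial>lebesgue) \<longlonglongrightarrow> 0"
    proof (rule nn_integral_dominated_convergence_norm[where w="\<lambda>x. (B + 1)^2 * (u x)^2"])
      show "?s m \<in> borel_measurable lebesgue" for m using dm um by measurable
      show "(\<lambda>x. (B + 1)^2 * (u x)^2) \<in> borel_measurable lebesgue" using um by measurable
      show "AE x in lebesgue. norm (?s m x) \<le> (B + 1)^2 * (u x)^2" for m
      proof (rule AE_I2)
        fix x
        have "\<bar>dilate \<kappa> m x - 1\<bar> \<le> B + 1" using B(2)[of "inverse (real (Suc m)) *\<^sub>R x"] by (simp add: dilate_def)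
        then have "(dilate \<kappa> m x - 1)^2 \<le> (B + 1)^2" using B(1) by (simp add: power2_le_iff_abs_le)
        then show "norm (?s m x) \<le> (B + 1)^2 * (u x)^2" by (simp add: power_mult_distrib mult_right_mono)
      qed
      have "integrable lebesgue (\<lambda>x. (B + 1)^2 * (u x)^2)" using Lp2D(2)[OF L] by simp
      then have "(\<integral>\<^sup>+x. ennreal (norm ((B + 1)^2 * (u x)^2)) \<partial>lebesgue) < \<infinity>" unfolding integrable_iff_bounded by blast
      then show "(\<integral>\<^sup>+x. ennreal ((B + 1)^2 * (u x)^2) \<partial>lebesgue) < \<infinity>" by simp
      show "AE x in lebesgue. (\<lambda>m. ?s m x) \<longlonglongrightarrow> 0"
      proof (rule AE_I2)
        fix x :: "real^'n"
        have "(\<lambda>m. inverse (real (Suc m)) *\<^sub>R x) \<longlonglongrightarrow> 0 *\<^sub>R x"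
          by (rule tendsto_scaleR[OF LIMSEQ_inverse_real_of_nat tendsto_const])
        moreover have "isCont \<kappa> 0" using smoothD(3)[OF s] by (simp add: continuous_on_eq_continuous_at)
        ultimately have "(\<lambda>m. dilate \<kappa> m x) \<longlonglongrightarrow> \<kappa> 0"
          unfolding dilate_def using isCont_tendsto_compose[of 0 \<kappa> "\<lambda>m. inverse (real (Suc m)) *\<^sub>R x"] by simp
        then have "(\<lambda>m. ?s m x) \<longlonglongrightarrow> ((1 - 1) * u x)^2" unfolding \<kappa>(2) by (intro tendsto_intros)
        then show "(\<lambda>m. ?s m x) \<longlonglongrightarrow> 0" by simp
      qed
    qed auto
    then show ?thesis by (simp add: sq_integral_def)
  qed
  show ?thesis
  proof (rule tendsto_0_le[OF tendsto_0_2add[OF 1 2]])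
    fix m
    have "sq_integral (\<lambda>x. dilate \<kappa> m x * mollify (std_mollifier m) u x - u x) =
        sq_integral (\<lambda>x. dilate \<kappa> m x * (mollify (std_mollifier m) u x - u x) + (dilate \<kappa> m x - 1) * u x)"
      by (simp add: algebra_simps)
    also have "\<dots> \<le> 2 * sq_integral (\<lambda>x. dilate \<kappa> m x * (mollify (std_mollifier m) u x - u x)) + 2 * sq_integral (\<lambda>x. (dilate \<kappa> m x - 1) * u x)"
      by (intro sq_integral_add borel_measurable_times borel_measurable_diff dm mm um borel_measurable_const)
    finally show "sq_integral (\<lambda>x. dilate \<kappa> m x * mollify (std_mollifier m) u x - u x) \<le>
        2 * sq_integral (\<lambda>x. dilate \<kappa> m x * (mollify (std_mollifier m) u x - u x)) + 2 * sq_integral (\<lambda>x. (dilate \<kappa> m x - 1) * u x)" .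
  qed
qed

text \<open>
  The derivative of cut-off times mollification is the cut-off times the mollified weak derivative, to which
  the induction hypothesis applies, plus a term with a differentiated cut-off, which tends to zero.
\<close>

lemma cutoff_mollify_H_conv:
  fixes u :: "real^'n \<Rightarrow> real"
  assumes "sobolev k 2 u" "test_function \<kappa>" "\<kappa> 0 = 1"
  shows "H_conv k (\<lambda>m x. dilate \<kappa> m x * mollify (std_mollifier m) u x) u"
  using assms
proof (induction k arbitrary: u)
  case 0
  then show ?case using cutoff_mollify_sq[of u \<kappa>] by simp
next
  case (Suc k)
  have L: "Lp 2 u" using Suc.prems by simp
  note li = Lp2D(4)[OF L]
  have s: "smooth \<kappa>" by (rule test_functionD[OF Suc.prems(2)])
  have sm: "smooth (mollify (std_mollifier m) u)" for m by (intro smooth_mollify li std_mollifier_test)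
  have "H_conv k (\<lambda>m. partial_deriv i (\<lambda>x. dilate \<kappa> m x * mollify (std_mollifier m) u x)) (weak_pderiv i u)" for i
    unfolding partial_deriv_mult_smooth[OF smooth_dilate[OF s] sm]
  proof (rule H_conv_add_null)
    have wp: "has_weak_pderiv i u (weak_pderiv i u)" and ws: "sobolev k 2 (weak_pderiv i u)"
      by (rule sobolev_SucD[OF Suc.prems(1)])+
    show "H_conv k (\<lambda>m x. dilate \<kappa> m x * partial_deriv i (mollify (std_mollifier m) u) x) (weak_pderiv i u)"
      unfolding partial_deriv_mollify_weak[OF wp std_mollifier_test] by (rule Suc.IH[OF ws Suc.prems(2,3)])
    show "sobolev k 2 (weak_pderiv i u)" by (rule ws)
    have hb: "H_bounded k (\<lambda>m. mollify (std_mollifier m) u)"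
      by (rule H_bounded_Suc_imp[OF mollify_H_bounded[OF Suc.prems(1)]])
    have un: "C_null k (\<lambda>m. partial_deriv i (dilate \<kappa> m))"
      unfolding partial_deriv_dilate[OF s]
      by (rule C_null_dilate[OF test_function_partial_deriv[OF Suc.prems(2)] LIMSEQ_inverse_real_of_nat])
    show "H_null k (\<lambda>m x. partial_deriv i (dilate \<kappa> m) x * mollify (std_mollifier m) u x)"
      by (rule H_null_mult[OF un hb sm smoothD(2)[OF smooth_dilate[OF s]]])
  qed (intro smooth_intros smoothD(2) smooth_dilate s sm)+
  then show ?case using cutoff_mollify_sq[OF L Suc.prems(2,3)] by simp
qed

theorem sobolev_density:
  fixes u :: "real^'n \<Rightarrow> real"
  assumes "sobolev k 2 u"
  shows "\<exists>f. (\<forall>m. test_function (f m)) \<and> H_conv k f u"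
proof -
  obtain \<kappa> :: "real^'n \<Rightarrow> real" where \<kappa>: "test_function \<kappa>" "\<kappa> 0 = 1" using cutoff_exists by blast
  have "Lp 2 u" by (rule sobolev_Lp[OF assms])
  then have li: "locally_integrable u" by (rule Lp2D)
  have "test_function (\<lambda>x. mollify (std_mollifier m) u x * dilate \<kappa> m x)" for m
  proof (rule test_function_mult_smooth[OF _ smooth_mollify[OF li std_mollifier_test]])
    show "test_function (dilate \<kappa> m)"
      unfolding dilate_def[abs_def] using test_function_scale_shift[OF \<kappa>(1), of "inverse (real (Suc m))" 0] by simp
  qed
  then have "\<forall>m. test_function (\<lambda>x. dilate \<kappa> m x * mollify (std_mollifier m) u x)" by (simp add: mult.commute)
  with cutoff_mollify_H_conv[OF assms \<kappa>] show ?thesis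
    by (intro exI[of _ "\<lambda>m x. dilate \<kappa> m x * mollify (std_mollifier m) u x"] conjI)
qed

section \<open>Integration by parts against Lipschitz functions\<close>

definition step_size :: "nat \<Rightarrow> real" where "step_size n = inverse (real (Suc n))"

lemma step_size: "step_size n > 0" "step_size n \<le> 1" "step_size \<longlonglongrightarrow> 0"
  using LIMSEQ_inverse_real_of_nat by (auto simp: step_size_def[abs_def] field_simps)

lemma step_size_neq_0: "step_size n \<noteq> 0"
  by (simp add: step_size_def)

text \<open>
  Only the steps \<open>1/(n+1)\<close> are used. For a Lipschitz function convergence along this sequence already
  determines one-sided differentiability, and a countable family of steps avoids all questions of measurability.
\<close>

definition diff_quotient :: "('a::real_vector \<Rightarrow> real) \<Rightarrow> 'a \<Rightarrow> nat \<Rightarrow> 'a \<Rightarrow> real" where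
  "diff_quotient f v n x = (f (x + step_size n *\<^sub>R v) - f x) / step_size n"

lemma integral_shift:
  fixes f :: "real^'n \<Rightarrow> real"
  assumes [measurable]: "f \<in> borel_measurable borel"
  shows "(LINT x|lborel. f (x + a)) = (LINT x|lborel. f x)"
proof -
  have "(LINT x|lborel. f x) = (LINT x|distr lborel borel ((+) a). f x)"
    by (simp add: lborel_distr_plus)
  also have "\<dots> = (LINT x|lborel. f (a + x))"
    by (rule integral_distr) auto
  finally show ?thesis by (simp add: add.commute)
qed

lemma lipschitz_continuous:
  fixes f :: "'a::real_normed_vector \<Rightarrow> real"
  assumes "\<And>x y. \<bar>f x - f y\<bar> \<le> L * norm (x - y)"
  shows "continuous_on UNIV f"
proof -
  have "\<bar>L\<bar>-lipschitz_on UNIV f"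
  proof (rule lipschitz_onI)
    fix x y :: 'a
    have "\<bar>f x - f y\<bar> \<le> L * norm (x - y)" by (rule assms)
    also have "\<dots> \<le> \<bar>L\<bar> * norm (x - y)" by (intro mult_right_mono) auto
    finally show "dist (f x) (f y) \<le> \<bar>L\<bar> * dist x y" by (simp add: dist_norm)
  qed simp
  then show ?thesis by (rule lipschitz_on_continuous_on)
qed

lemma integrable_cont_compact_support:
  fixes \<zeta> :: "real^'n \<Rightarrow> real"
  assumes "continuous_on UNIV \<zeta>" "\<And>x. norm x > R \<Longrightarrow> \<zeta> x = 0"
  shows "integrable lborel \<zeta>"
proof -
  have "integrable lborel (\<lambda>x. indicator (cball 0 R) x *\<^sub>R \<zeta> x)"
    by (rule borel_integrable_compact) (auto intro: continuous_on_subset[OF assms(1)])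
  moreover have "(\<lambda>x. indicator (cball 0 R) x *\<^sub>R \<zeta> x) = \<zeta>"
    using assms(2) by (auto simp: fun_eq_iff indicator_def)
  ultimately show ?thesis by simp
qed

text \<open>
  For difference quotients the formula is the translation invariance of Lebesgue measure; both sides pass to the
  limit by dominated convergence, because \<open>f\<close> and \<open>\<zeta>\<close> are Lipschitz along \<open>v\<close>.
\<close>

lemma lipschitz_integration_by_parts:
  fixes f :: "real^'n \<Rightarrow> real"
  assumes L: "\<And>x y. \<bar>f x - f y\<bar> \<le> L * norm (x - y)"
    and f'[measurable]: "f' \<in> borel_measurable borel"
    and ae: "AE x in lborel. (\<lambda>n. diff_quotient f v n x) \<longlonglongrightarrow> f' x"
    and zc: "continuous_on UNIV \<zeta>" and z'c: "continuous_on UNIV \<zeta>'"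
    and z': "\<And>x t. ((\<lambda>t. \<zeta> (x + t *\<^sub>R v)) has_real_derivative \<zeta>' (x + t *\<^sub>R v)) (at t)"
    and R: "\<And>x. norm x > R \<Longrightarrow> \<zeta> x = 0"
  shows "integrable lborel (\<lambda>x. f' x * \<zeta> x)" "integrable lborel (\<lambda>x. f x * \<zeta>' x)"
    "(LINT x|lborel. f' x * \<zeta> x) = - (LINT x|lborel. f x * \<zeta>' x)"
proof -
  have fc: "continuous_on UNIV f" by (rule lipschitz_continuous[OF L])
  have [measurable]: "f \<in> borel_measurable borel" "\<zeta> \<in> borel_measurable borel" "\<zeta>' \<in> borel_measurable borel"
    using fc zc z'c by (auto intro: borel_measurable_continuous_onI)
  define S where "S = R + norm v"
  have "compact (\<zeta>' ` cball 0 (S + norm v))"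
    by (intro compact_continuous_image continuous_on_subset[OF z'c]) auto
  then obtain C where C: "C > 0" "\<And>x. x \<in> cball 0 (S + norm v) \<Longrightarrow> \<bar>\<zeta>' x\<bar> \<le> C"
    using compact_imp_bounded[of "\<zeta>' ` cball 0 (S + norm v)"] by (auto simp: bounded_pos)
  have L0: "L * norm v \<ge> 0" using order_trans[OF abs_ge_zero L[of v 0]] by simp
  define A where "A = (\<lambda>n x. diff_quotient f v n x * \<zeta> x)"
  define B where "B = (\<lambda>n x. f x * ((\<zeta> (x + step_size n *\<^sub>R (- v)) - \<zeta> x) / step_size n))"
  have cshift: "continuous_on UNIV (\<lambda>x. g (x + c))" if "continuous_on UNIV g" for g :: "real^'n \<Rightarrow> real" and c
    by (rule continuous_on_compose2[OF that]) (auto intro!: continuous_intros)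
  have AB: "(LINT x|lborel. A n x) = (LINT x|lborel. B n x)" for n
  proof -
    let ?h = "step_size n"
    have i1: "integrable lborel (\<lambda>x. f x * \<zeta> x)"
      by (rule integrable_cont_compact_support[of _ R]) (auto intro!: continuous_intros fc zc simp: R)
    have i2: "integrable lborel (\<lambda>x. f (x + ?h *\<^sub>R v) * \<zeta> x)"
      by (rule integrable_cont_compact_support[of _ R]) (auto intro!: continuous_intros cshift fc zc simp: R)
    have i3: "integrable lborel (\<lambda>x. f x * \<zeta> (x + ?h *\<^sub>R (- v)))"
    proof (rule integrable_cont_compact_support[of _ S])
      show "continuous_on UNIV (\<lambda>x. f x * \<zeta> (x + ?h *\<^sub>R (- v)))" by (intro continuous_intros cshift fc zc)
      fix x :: "real^'n" assume x: "norm x > S"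
      have "norm (?h *\<^sub>R v) \<le> norm v" using step_size(1,2)[of n] by (simp add: mult_left_le_one_le)
      then have "norm (x + ?h *\<^sub>R (- v)) > R" using norm_triangle_ineq2[of x "?h *\<^sub>R v"] x by (simp add: S_def)
      then show "f x * \<zeta> (x + ?h *\<^sub>R (- v)) = 0" by (simp add: R)
    qed
    have "(LINT x|lborel. A n x) = (LINT x|lborel. (f (x + ?h *\<^sub>R v) * \<zeta> x - f x * \<zeta> x) / ?h)"
      by (simp add: A_def diff_quotient_def left_diff_distrib)
    also have "\<dots> = ((LINT x|lborel. f (x + ?h *\<^sub>R v) * \<zeta> x) - (LINT x|lborel. f x * \<zeta> x)) / ?h"
      using i1 i2 by simp
    also have "(LINT x|lborel. f (x + ?h *\<^sub>R v) * \<zeta> x) = (LINT x|lborel. f x * \<zeta> (x + ?h *\<^sub>R (- v)))"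
      using integral_shift[of "\<lambda>x. f x * \<zeta> (x + ?h *\<^sub>R (- v))" "?h *\<^sub>R v"] by simp
    also have "((LINT x|lborel. f x * \<zeta> (x + ?h *\<^sub>R (- v))) - (LINT x|lborel. f x * \<zeta> x)) / ?h =
        (LINT x|lborel. (f x * \<zeta> (x + ?h *\<^sub>R (- v)) - f x * \<zeta> x) / ?h)"
      using i1 i3 by simp
    finally show ?thesis by (simp add: B_def right_diff_distrib)
  qed
  have [measurable]: "A n \<in> borel_measurable borel" "B n \<in> borel_measurable borel" for n
    unfolding A_def B_def diff_quotient_def by measurable
  have dqb: "\<bar>diff_quotient f v n x\<bar> \<le> L * norm v" for n x
    using L[of "x + step_size n *\<^sub>R v" x] step_size(1)[of n] by (simp add: diff_quotient_def field_simps)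
  have wA: "integrable lborel (\<lambda>x. (L * norm v) * \<bar>\<zeta> x\<bar>)"
    by (rule integrable_cont_compact_support[of _ R]) (auto intro!: continuous_intros zc simp: R)
  have limA: "AE x in lborel. (\<lambda>n. A n x) \<longlonglongrightarrow> f' x * \<zeta> x"
    using ae unfolding A_def by eventually_elim (intro tendsto_intros)
  have bA: "AE x in lborel. norm (A n x) \<le> (L * norm v) * \<bar>\<zeta> x\<bar>" for n
    using dqb by (auto simp: A_def abs_mult intro!: AE_I2 mult_right_mono)
  show "integrable lborel (\<lambda>x. f' x * \<zeta> x)"
    by (rule integrable_dominated_convergence[OF _ _ wA limA bA]) auto
  have cA: "(\<lambda>n. LINT x|lborel. A n x) \<longlonglongrightarrow> (LINT x|lborel. f' x * \<zeta> x)"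
    by (rule integral_dominated_convergence[OF _ _ wA limA bA]) auto
  have wB: "integrable lborel (\<lambda>x. indicator (cball 0 S) x *\<^sub>R (\<bar>f x\<bar> * C))"
    by (rule borel_integrable_compact) (auto intro!: continuous_intros continuous_on_subset[OF fc])
  have limB: "AE x in lborel. (\<lambda>n. B n x) \<longlonglongrightarrow> - (f x * \<zeta>' x)"
  proof (rule AE_I2)
    fix x :: "real^'n"
    have "((\<lambda>h. (\<zeta> (x + (0 + h) *\<^sub>R v) - \<zeta> (x + 0 *\<^sub>R v)) / h) \<longlongrightarrow> \<zeta>' (x + 0 *\<^sub>R v)) (at 0)"
      using z'[of x 0] by (simp add: DERIV_def)
    then have "((\<lambda>h. (\<zeta> (x + h *\<^sub>R v) - \<zeta> x) / h) \<longlongrightarrow> \<zeta>' x) (at 0)" by simp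
    moreover have "filterlim (\<lambda>n. - step_size n) (at 0) sequentially"
      unfolding filterlim_at using step_size(1) tendsto_minus[OF step_size(3)] by (auto simp: step_size_neq_0)
    ultimately have "(\<lambda>n. (\<zeta> (x + (- step_size n) *\<^sub>R v) - \<zeta> x) / (- step_size n)) \<longlonglongrightarrow> \<zeta>' x"
      by (rule filterlim_compose)
    then have "(\<lambda>n. - f x * ((\<zeta> (x + (- step_size n) *\<^sub>R v) - \<zeta> x) / (- step_size n))) \<longlonglongrightarrow> - f x * \<zeta>' x"
      by (intro tendsto_intros)
    then show "(\<lambda>n. B n x) \<longlonglongrightarrow> - (f x * \<zeta>' x)" by (simp add: B_def)
  qed
  have bB: "AE x in lborel. norm (B n x) \<le> indicator (cball 0 S) x *\<^sub>R (\<bar>f x\<bar> * C)" for n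
  proof (rule AE_I2)
    fix x :: "real^'n"
    have hv: "norm (step_size n *\<^sub>R v) \<le> norm v" using step_size(1,2)[of n] by (simp add: mult_left_le_one_le)
    show "norm (B n x) \<le> indicator (cball 0 S) x *\<^sub>R (\<bar>f x\<bar> * C)"
    proof (cases "norm x \<le> S")
      case False
      then have "norm (x + step_size n *\<^sub>R (- v)) > R" "norm x > R"
        using norm_triangle_ineq2[of x "step_size n *\<^sub>R v"] hv norm_ge_zero[of v] unfolding S_def by (simp_all del: norm_ge_zero)
      then have "B n x = 0" by (simp add: B_def R)
      then show ?thesis using C(1) by simp
    next
      case True
      obtain t where t: "- step_size n < t" "t < 0" and
        eq: "\<zeta> (x + 0 *\<^sub>R v) - \<zeta> (x + (- step_size n) *\<^sub>R v) = (0 - (- step_size n)) * \<zeta>' (x + t *\<^sub>R v)"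
        using MVT2[of "- step_size n" 0 "\<lambda>t. \<zeta> (x + t *\<^sub>R v)", OF _ z'] step_size(1)[of n] by auto
      have "\<bar>t\<bar> \<le> 1" using t step_size(2)[of n] by linarith
      then have "norm (t *\<^sub>R v) \<le> norm v" by (simp add: mult_left_le_one_le)
      then have "x + t *\<^sub>R v \<in> cball 0 (S + norm v)" using True norm_triangle_ineq[of x "t *\<^sub>R v"] by simp
      then have "\<bar>\<zeta>' (x + t *\<^sub>R v)\<bar> \<le> C" by (rule C(2))
      moreover have "\<bar>(\<zeta> (x + step_size n *\<^sub>R (- v)) - \<zeta> x) / step_size n\<bar> = \<bar>\<zeta>' (x + t *\<^sub>R v)\<bar>"
      proof -
        have "\<zeta> (x + step_size n *\<^sub>R (- v)) - \<zeta> x = - step_size n * \<zeta>' (x + t *\<^sub>R v)" using eq by simp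
        then show ?thesis using step_size(1)[of n] by (simp add: abs_mult)
      qed
      ultimately have "norm (B n x) \<le> \<bar>f x\<bar> * C" unfolding B_def real_norm_def abs_mult by (intro mult_left_mono) auto
      then show ?thesis using True by simp
    qed
  qed
  have "integrable lborel (\<lambda>x. - (f x * \<zeta>' x))"
    by (rule integrable_dominated_convergence[OF _ _ wB limB bB]) auto
  then show "integrable lborel (\<lambda>x. f x * \<zeta>' x)" by simp
  have cB: "(\<lambda>n. LINT x|lborel. B n x) \<longlonglongrightarrow> (LINT x|lborel. - (f x * \<zeta>' x))"
    by (rule integral_dominated_convergence[OF _ _ wB limB bB]) auto
  show "(LINT x|lborel. f' x * \<zeta> x) = - (LINT x|lborel. f x * \<zeta>' x)"
    using LIMSEQ_unique[OF cA cB[folded AB]] by simp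
qed

lemma integral_derivative_zero:
  fixes \<zeta> :: "real^'n \<Rightarrow> real"
  assumes "continuous_on UNIV \<zeta>" "continuous_on UNIV \<zeta>'"
    "\<And>x t. ((\<lambda>t. \<zeta> (x + t *\<^sub>R v)) has_real_derivative \<zeta>' (x + t *\<^sub>R v)) (at t)"
    "\<And>x. norm x > R \<Longrightarrow> \<zeta> x = 0"
  shows "(LINT x|lborel. \<zeta>' x) = 0"
proof -
  have "(\<lambda>n. diff_quotient (\<lambda>x. 1) v n x) \<longlonglongrightarrow> 0" for x by (simp add: diff_quotient_def)
  then show ?thesis
    using lipschitz_integration_by_parts(3)[of "\<lambda>x. 1" 0 "\<lambda>x. 0" v \<zeta> \<zeta>' R] assms by simp
qed

section \<open>Lipschitz functions of one variable\<close>

text \<open>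
  Adding a large linear term makes \<open>f\<close> a homeomorphism that is Lipschitz together with its inverse.
  It maps null sets to null sets, so the measure it induces has a density by the Radon-Nikodym theorem.
  This exhibits \<open>f\<close> as an indefinite integral, to which Lebesgue's differentiation theorem applies.
\<close>

lemma lipschitz_1d_right_derivative:
  fixes f :: "real \<Rightarrow> real"
  assumes L: "\<And>x y. \<bar>f x - f y\<bar> \<le> L * \<bar>x - y\<bar>"
  shows "\<exists>N. negligible N \<and> (\<forall>x. x \<notin> N \<longrightarrow> convergent (\<lambda>n. diff_quotient f 1 n x))"
proof -
  \<comment> \<open>slope at least one, hence the inverse is Lipschitz with constant one\<close>
  define F where "F = (\<lambda>x. f x + (L + 1) * x)"
  have F1: "y - x \<le> F y - F x" "F y - F x \<le> (2 * L + 1) * (y - x)" if "x \<le> y" for x y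
    using L[of y x] that by (auto simp: F_def algebra_simps abs_le_iff)
  have mono: "F x \<le> F y \<longleftrightarrow> x \<le> y" for x y
    using F1(1)[of x y] F1(1)[of y x] by (cases "x \<le> y") auto
  have injF: "inj F" by (rule injI) (metis mono order_antisym order_refl)
  have L0: "L \<ge> 0" using order_trans[OF abs_ge_zero L[of 1 0]] by simp
  have Flip: "\<bar>F x - F y\<bar> \<le> (2 * L + 1) * \<bar>x - y\<bar>" for x y
    using F1[of x y] F1[of y x] by (cases "x \<le> y") auto
  have Fc: "continuous_on UNIV F"
    by (rule lipschitz_continuous[of F "2 * L + 1"]) (use Flip in simp)
  have surjF: "surj F"
  proof -
    have "\<exists>x. F x = y" for y
    proof -
      let ?a = "\<bar>y - F 0\<bar>"
      have "F (- ?a) \<le> y" using F1(1)[of "- ?a" 0] by auto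
      moreover have "y \<le> F ?a" using F1(1)[of 0 ?a] by auto
      ultimately show ?thesis using IVT'[of F "- ?a" y ?a] continuous_on_subset[OF Fc] by auto
    qed
    then show ?thesis by (metis surjI)
  qed
  define G where "G = inv F"
  have FG: "F (G y) = y" for y by (simp add: G_def surj_f_inv_f[OF surjF])
  have GF: "G (F x) = x" for x by (simp add: G_def inv_f_f[OF injF])
  have Glip: "\<bar>G x - G y\<bar> \<le> 1 * norm (x - y)" for x y
    using F1(1)[of "G x" "G y"] F1(1)[of "G y" "G x"] by (cases "G x \<le> G y") (auto simp: FG)
  have [measurable]: "G \<in> borel_measurable borel"
    by (rule borel_measurable_continuous_onI[OF lipschitz_continuous[of G 1]]) (use Glip in simp)
  define \<nu> where "\<nu> = distr lborel borel G"
  have ac: "absolutely_continuous lborel \<nu>"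
    unfolding absolutely_continuous_def
  proof
    fix N :: "real set" assume N: "N \<in> null_sets lborel"
    then have "negligible N" by (simp add: negligible_iff_null_sets null_sets_completionI)
    then have "negligible (F ` N)"
    proof (rule negligible_locally_Lipschitz_image[rotated])
      fix x assume "x \<in> N"
      show "\<exists>T B. open T \<and> x \<in> T \<and> (\<forall>y\<in>N \<inter> T. norm (F y - F x) \<le> B * norm (y - x))"
        by (rule exI[of _ UNIV], rule exI[of _ "2 * L + 1"]) (use Flip in auto)
    qed simp
    moreover have FN: "G -` N = F ` N"
      by (auto simp: GF) (metis FG image_eqI)
    moreover have Nb: "N \<in> sets borel" using N by (simp add: null_sets_def)
    moreover have "G -` N \<in> sets borel" using measurable_sets[of G borel borel N] Nb by simp
    ultimately have "emeasure lborel (G -` N) = 0"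
      by (simp add: negligible_iff_null_sets null_sets_def)
    then show "N \<in> null_sets \<nu>" using Nb by (simp add: null_sets_def \<nu>_def emeasure_distr)
  qed
  obtain g where g[measurable]: "g \<in> borel_measurable lborel" and gd: "density lborel g = \<nu>"
    using sigma_finite_measure.Radon_Nikodym[OF sigma_finite_lborel ac] by (auto simp: \<nu>_def)
  have gint: "(\<integral>\<^sup>+x. g x * indicator {a..b} x \<partial>lborel) = ennreal (F b - F a)" if "a \<le> b" for a b
  proof -
    have "(\<integral>\<^sup>+x. g x * indicator {a..b} x \<partial>lborel) = emeasure \<nu> {a..b}"
      unfolding gd[symmetric] by (subst emeasure_density) auto
    also have "\<dots> = emeasure lborel (G -` {a..b})" by (simp add: \<nu>_def emeasure_distr)
    also have "G -` {a..b} = {F a..F b}"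
      using mono by (auto simp: FG) (metis FG mono)+
    also have "emeasure lborel {F a..F b} = ennreal (F b - F a)" using that mono by simp
    finally show ?thesis .
  qed
  have gfin: "AE x in lborel. g x \<noteq> \<infinity>"
  proof -
    have "AE x in lborel. x \<in> {- real n..real n} \<longrightarrow> g x \<noteq> \<infinity>" for n
    proof -
      have "AE x in lborel. g x * indicator {- real n..real n} x \<noteq> \<infinity>"
        by (rule nn_integral_PInf_AE) (auto simp: gint)
      then show ?thesis by eventually_elim (auto simp: indicator_def)
    qed
    then have "AE x in lborel. \<forall>n. x \<in> {- real n..real n} \<longrightarrow> g x \<noteq> \<infinity>" unfolding AE_all_countable by blast
    then show ?thesis
    proof eventually_elim
      case (elim x)
      obtain n where "\<bar>x\<bar> \<le> real n" using real_arch_simple by blast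
      then show ?case using elim by (auto simp: abs_le_iff)
    qed
  qed
  define g' where "g' = (\<lambda>x. enn2real (g x))"
  have [measurable]: "g' \<in> borel_measurable borel" unfolding g'_def using g by measurable
  have hi: "(g' has_integral (F b - F a)) (cbox a b)" if "a \<le> b" for a b
  proof -
    have "((\<lambda>x. indicator {a..b} x * g' x) has_integral (F b - F a)) UNIV"
    proof -
      have "(\<integral>\<^sup>+x. ennreal (indicator {a..b} x * g' x) \<partial>lborel) = (\<integral>\<^sup>+x. g x * indicator {a..b} x \<partial>lborel)"
        by (rule nn_integral_cong_AE) (use gfin in eventually_elim, auto simp: g'_def indicator_def less_top)
      then have nn: "(\<integral>\<^sup>+x. ennreal (indicator {a..b} x * g' x) \<partial>lborel) = ennreal (F b - F a)" using gint[OF that] by simp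
      have "has_bochner_integral lborel (\<lambda>x. indicator {a..b} x * g' x) (F b - F a)"
        by (rule has_bochner_integral_nn_integral[OF _ _ _ nn]) (use that mono in \<open>auto simp: g'_def\<close>)
      then show ?thesis
        using has_integral_integral_lborel[of "\<lambda>x. indicator {a..b} x * g' x"]
        by (simp add: has_bochner_integral_iff)
    qed
    moreover have "(\<lambda>x. indicator {a..b} x * g' x) = (\<lambda>x. if x \<in> cbox a b then g' x else 0)"
      by (auto simp: fun_eq_iff indicator_def)
    ultimately show ?thesis by (simp only: has_integral_restrict_UNIV)
  qed
  have io: "g' integrable_on cbox a b" for a b
    using hi[of a b] by (cases "a \<le> b") (auto simp: integrable_on_def)
  obtain N where N: "negligible N" and Nd: "\<And>x e. x \<notin> N \<Longrightarrow> 0 < e \<Longrightarrow>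
      \<exists>d>0. \<forall>h. 0 < h \<and> h < d \<longrightarrow> norm (integral (cbox x (x + h *\<^sub>R One)) g' /\<^sub>R h ^ DIM(real) - g' x) < e"
    by (rule integrable_ccontinuous_explicit[OF io]) blast
  have "convergent (\<lambda>n. diff_quotient f 1 n x)" if x: "x \<notin> N" for x
  proof -
    have "(\<lambda>n. diff_quotient F 1 n x) \<longlonglongrightarrow> g' x"
    proof (rule LIMSEQ_I)
      fix e :: real assume "e > 0"
      from Nd[OF x this] obtain d where d: "d > 0"
        "\<And>h. 0 < h \<Longrightarrow> h < d \<Longrightarrow> norm (integral (cbox x (x + h *\<^sub>R One)) g' /\<^sub>R h ^ DIM(real) - g' x) < e" by blast
      obtain n0 where n0: "\<And>n. n \<ge> n0 \<Longrightarrow> step_size n < d"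
        using order_tendstoD(2)[OF step_size(3) d(1)] by (auto simp: eventually_sequentially)
      have "norm (diff_quotient F 1 n x - g' x) < e" if "n \<ge> n0" for n
      proof -
        have "integral (cbox x (x + step_size n)) g' = F (x + step_size n) - F x"
          using hi[of x "x + step_size n"] step_size(1)[of n] by (intro integral_unique) auto
        then show ?thesis using d(2)[OF step_size(1) n0[OF that]] by (simp add: diff_quotient_def divide_inverse mult.commute)
      qed
      then show "\<exists>no. \<forall>n\<ge>no. norm (diff_quotient F 1 n x - g' x) < e" by blast
    qed
    moreover have "diff_quotient F 1 n x = diff_quotient f 1 n x + (L + 1)" for n
      using step_size(1)[of n] by (simp add: diff_quotient_def F_def field_simps)
    ultimately have "(\<lambda>n. diff_quotient f 1 n x + (L + 1)) \<longlonglongrightarrow> g' x" by simp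
    from tendsto_diff[OF this tendsto_const[of "L + 1"]] show ?thesis by (auto simp: convergent_def)
  qed
  with N show ?thesis by blast
qed

section \<open>Rademacher's theorem\<close>

text \<open>
  The value 0 at points without a limit keeps this function Borel measurable and bounded for Lipschitz \<open>f\<close>.
\<close>

definition directional_limit :: "(real^'n \<Rightarrow> real) \<Rightarrow> real^'n \<Rightarrow> real^'n \<Rightarrow> real" where
  "directional_limit f v x = (if Cauchy (\<lambda>n. diff_quotient f v n x) then lim (\<lambda>n. diff_quotient f v n x) else 0)"

lemma directional_limit_LIMSEQ: "Cauchy (\<lambda>n. diff_quotient f v n x) \<Longrightarrow> (\<lambda>n. diff_quotient f v n x) \<longlonglongrightarrow> directional_limit f v x"
  by (simp add: directional_limit_def Cauchy_convergent_iff convergent_LIMSEQ_iff)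

context
  fixes f :: "real^'n \<Rightarrow> real" and L :: real
  assumes L: "\<And>x y. \<bar>f x - f y\<bar> \<le> L * norm (x - y)"
begin

lemma diff_quotient_measurable [measurable]: "diff_quotient f v n \<in> borel_measurable borel"
proof -
  have [measurable]: "f \<in> borel_measurable borel"
    by (rule borel_measurable_continuous_onI[OF lipschitz_continuous[OF L]])
  show ?thesis unfolding diff_quotient_def by measurable
qed

lemma diff_quotient_bound: "\<bar>diff_quotient f v n x\<bar> \<le> L * norm v"
  using L[of "x + step_size n *\<^sub>R v" x] step_size(1)[of n] by (simp add: diff_quotient_def field_simps)

lemma Cauchy_set_measurable [measurable]: "{x. Cauchy (\<lambda>n. diff_quotient f v n x)} \<in> sets borel"
  using sets_Collect_Cauchy[of "\<lambda>n. diff_quotient f v n" borel] by simp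

lemma directional_limit_measurable [measurable]: "directional_limit f v \<in> borel_measurable borel"
proof -
  have "(\<lambda>x. if Cauchy (\<lambda>n. diff_quotient f v n x) then lim (\<lambda>n. diff_quotient f v n x) else 0) \<in> borel_measurable borel"
    by (intro measurable_If borel_measurable_lim_metric) (auto simp: Cauchy_set_measurable)
  then show ?thesis by (simp add: directional_limit_def[abs_def])
qed

lemma directional_limit_bound: "\<bar>directional_limit f v x\<bar> \<le> L * norm v"
proof (cases "Cauchy (\<lambda>n. diff_quotient f v n x)")
  case True
  have "(\<lambda>n. \<bar>diff_quotient f v n x\<bar>) \<longlonglongrightarrow> \<bar>directional_limit f v x\<bar>" by (intro tendsto_rabs directional_limit_LIMSEQ True)
  then show ?thesis by (rule LIMSEQ_le_const2) (use diff_quotient_bound in blast)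
next
  case False
  then show ?thesis using order_trans[OF abs_ge_zero diff_quotient_bound[of v 0 x]] by (simp add: directional_limit_def)
qed

text \<open>
  The one-dimensional theorem makes the exceptional set null on every line parallel to \<open>v\<close>. Averaging the
  translates of the set along \<open>v\<close> and exchanging the integrals shows that it is null in space.
\<close>

lemma diff_quotient_Cauchy_AE: "AE x in lborel. Cauchy (\<lambda>n. diff_quotient f v n x)"
proof -
  define B where "B = {x. \<not> Cauchy (\<lambda>n. diff_quotient f v n x)}"
  have [measurable]: "B \<in> sets borel"
  proof -
    have "B = - {x. Cauchy (\<lambda>n. diff_quotient f v n x)}" by (auto simp: B_def)
    then show ?thesis using Cauchy_set_measurable[of v] by auto
  qed
  have null: "(\<integral>\<^sup>+t. indicator {0..1::real} t * indicator B (x + t *\<^sub>R v) \<partial>lborel) = 0" for x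
  proof -
    let ?f = "\<lambda>t. f (x + t *\<^sub>R v)"
    have "\<bar>?f s - ?f t\<bar> \<le> (L * norm v) * \<bar>s - t\<bar>" for s t
      using L[of "x + s *\<^sub>R v" "x + t *\<^sub>R v"] by (simp add: scaleR_diff_left[symmetric] mult_ac)
    from lipschitz_1d_right_derivative[of ?f, OF this] obtain N where
      N: "negligible N" "\<And>t. t \<notin> N \<Longrightarrow> convergent (\<lambda>n. diff_quotient ?f 1 n t)" by blast
    have "diff_quotient ?f 1 n t = diff_quotient f v n (x + t *\<^sub>R v)" for n t
      by (simp add: diff_quotient_def scaleR_add_left add.assoc)
    then have *: "t \<in> N" if "x + t *\<^sub>R v \<in> B" for t
      using N(2)[of t] that by (auto simp: B_def Cauchy_convergent_iff)
    have "AE t in lebesgue. t \<notin> N" using N(1) by (simp add: negligible_iff_null_sets AE_not_in)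
    then have "AE t in lebesgue. indicator {0..1::real} t * indicator B (x + t *\<^sub>R v) = (0::ennreal)"
      by eventually_elim (use * in \<open>auto simp: indicator_def\<close>)
    then have "AE t in lborel. indicator {0..1::real} t * indicator B (x + t *\<^sub>R v) = (0::ennreal)"
      by (simp add: AE_completion_iff)
    then show ?thesis by (subst nn_integral_0_iff_AE) auto
  qed
  have "emeasure lborel B = (\<integral>\<^sup>+t. indicator {0..1::real} t * emeasure lborel B \<partial>lborel)"
    by (simp add: nn_integral_multc)
  also have "\<dots> = (\<integral>\<^sup>+t. \<integral>\<^sup>+x. indicator {0..1::real} t * indicator B (x + t *\<^sub>R v) \<partial>lborel \<partial>lborel)"
  proof (rule nn_integral_cong)
    fix t :: real
    have "(\<integral>\<^sup>+x. indicator {0..1::real} t * indicator B (x + t *\<^sub>R v) \<partial>lborel) =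
        indicator {0..1} t * (\<integral>\<^sup>+x. indicator B (x + t *\<^sub>R v) \<partial>lborel)"
      by (rule nn_integral_cmult) measurable
    also have "(\<integral>\<^sup>+x. indicator B (x + t *\<^sub>R v) \<partial>lborel) = emeasure lborel B"
      using nn_integral_translate[of "indicator B" "t *\<^sub>R v"] by simp
    finally show "indicator {0..1} t * emeasure lborel B =
        (\<integral>\<^sup>+x. indicator {0..1::real} t * indicator B (x + t *\<^sub>R v) \<partial>lborel)" by simp
  qed
  also have "\<dots> = (\<integral>\<^sup>+x. \<integral>\<^sup>+t. indicator {0..1::real} t * indicator B (x + t *\<^sub>R v) \<partial>lborel \<partial>lborel)"
    by (rule lborel_pair.Fubini') measurable
  also have "\<dots> = 0" by (simp add: null)
  finally have "B \<in> null_sets lborel" by (simp add: null_sets_def)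
  then have "AE x in lborel. x \<notin> B" by (rule AE_not_in)
  then show ?thesis by (simp add: B_def)
qed

lemma directional_limit_weak:
  assumes "test_function \<eta>"
  shows "integrable lborel (\<lambda>x. directional_limit f v x * \<eta> x)"
    "integrable lborel (\<lambda>x. f x * (grad \<eta> x \<bullet> v))"
    "(LINT x|lborel. directional_limit f v x * \<eta> x) = - (LINT x|lborel. f x * (grad \<eta> x \<bullet> v))"
proof -
  have s: "smooth \<eta>" by (rule test_functionD[OF assms])
  obtain R where R: "\<And>x. norm x > R \<Longrightarrow> \<eta> x = 0" using test_functionD(2)[OF assms] by auto
  have ae: "AE x in lborel. (\<lambda>n. diff_quotient f v n x) \<longlonglongrightarrow> directional_limit f v x"
    using diff_quotient_Cauchy_AE[of v] by eventually_elim (rule directional_limit_LIMSEQ)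
  have c: "continuous_on UNIV (\<lambda>x. grad \<eta> x \<bullet> v)" by (intro continuous_intros smooth_grad_continuous s)
  note ibp = lipschitz_integration_by_parts[OF L directional_limit_measurable ae smoothD(3)[OF s] c has_derivative_along_line[OF smoothD(1)[OF s]] R]
  show "integrable lborel (\<lambda>x. directional_limit f v x * \<eta> x)" "integrable lborel (\<lambda>x. f x * (grad \<eta> x \<bullet> v))"
    "(LINT x|lborel. directional_limit f v x * \<eta> x) = - (LINT x|lborel. f x * (grad \<eta> x \<bullet> v))"
    by (rule ibp; assumption)+
qed

text \<open>
  Both sides define the same distribution, because differentiation of test functions is linear in the direction.
\<close>

lemma directional_limit_linear_AE: "AE x in lborel. directional_limit f v x = (\<chi> i. directional_limit f (axis i 1) x) \<bullet> v"
proof -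
  let ?w = "\<lambda>x. directional_limit f v x - (\<Sum>i\<in>UNIV. directional_limit f (axis i 1) x * v $ i)"
  define C where "C = L * norm v + (\<Sum>i\<in>UNIV. L * norm (axis i 1 :: real^'n) * \<bar>v $ i\<bar>)"
  have wb: "\<bar>?w x\<bar> \<le> C" for x
  proof -
    have "\<bar>?w x\<bar> \<le> \<bar>directional_limit f v x\<bar> + \<bar>\<Sum>i\<in>UNIV. directional_limit f (axis i 1) x * v $ i\<bar>" by (rule abs_triangle_ineq4)
    also have "\<bar>\<Sum>i\<in>UNIV. directional_limit f (axis i 1) x * v $ i\<bar> \<le> (\<Sum>i\<in>UNIV. \<bar>directional_limit f (axis i 1) x * v $ i\<bar>)" by (rule sum_abs)
    also have "\<dots> \<le> (\<Sum>i\<in>UNIV. L * norm (axis i 1 :: real^'n) * \<bar>v $ i\<bar>)"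
      unfolding abs_mult by (intro sum_mono mult_right_mono directional_limit_bound) simp
    finally show ?thesis using directional_limit_bound[of v x] by (simp add: C_def)
  qed
  have wm[measurable]: "?w \<in> borel_measurable borel" by measurable
  have li: "locally_integrable ?w"
    unfolding locally_integrable_def set_integrable_def
  proof (intro allI impI)
    fix K :: "(real^'n) set" assume K: "compact K"
    have Kb[measurable]: "K \<in> sets borel" using K by (simp add: compact_imp_closed borel_closed)
    have "integrable lborel (\<lambda>x. indicator K x *\<^sub>R ?w x)"
    proof (rule Bochner_Integration.integrable_bound)
      show "integrable lborel (\<lambda>x. C * indicator K x)"
        using emeasure_compact_finite[OF K] by (intro integrable_mult_right integrable_real_indicator) auto
      show "AE x in lborel. norm (indicator K x *\<^sub>R ?w x) \<le> norm (C * indicator K x)"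
        using wb by (intro AE_I2) (auto simp: indicator_def intro: order_trans[OF wb abs_ge_self])
    qed measurable
    then show "integrable lebesgue (\<lambda>x. indicator K x *\<^sub>R ?w x)" by (subst integrable_completion) measurable
  qed
  have "AE x in lebesgue. ?w x = 0"
  proof (rule fundamental_lemma[OF li])
    fix \<eta> :: "real^'n \<Rightarrow> real" assume t: "test_function \<eta>"
    have [measurable]: "\<eta> \<in> borel_measurable borel" by (rule smoothD(5)[OF test_functionD(1)[OF t]])
    note D = directional_limit_weak[OF t]
    have e1: "?w x * \<eta> x = directional_limit f v x * \<eta> x - (\<Sum>i\<in>UNIV. v $ i * (directional_limit f (axis i 1) x * \<eta> x))" for x
      by (subst left_diff_distrib) (simp add: sum_distrib_left mult_ac)
    have e2: "f x * (grad \<eta> x \<bullet> v) = (\<Sum>i\<in>UNIV. v $ i * (f x * (grad \<eta> x \<bullet> axis i 1)))" for x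
      by (simp add: inner_vec_def[of "grad \<eta> x" v] inner_axis sum_distrib_left mult_ac)
    have "(LINT x|lebesgue. ?w x * \<eta> x) = (LINT x|lborel. ?w x * \<eta> x)" by (rule integral_completion) measurable
    also have "\<dots> = (LINT x|lborel. directional_limit f v x * \<eta> x) - (\<Sum>i\<in>UNIV. v $ i * (LINT x|lborel. directional_limit f (axis i 1) x * \<eta> x))"
      unfolding e1 using D(1)
      by (subst Bochner_Integration.integral_diff) (auto intro!: Bochner_Integration.integrable_sum simp: Bochner_Integration.integral_sum)
    also have "\<dots> = - (LINT x|lborel. f x * (grad \<eta> x \<bullet> v)) + (\<Sum>i\<in>UNIV. v $ i * (LINT x|lborel. f x * (grad \<eta> x \<bullet> axis i 1)))"
      unfolding D(3) by (simp add: sum_negf)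
    also have "(LINT x|lborel. f x * (grad \<eta> x \<bullet> v)) = (\<Sum>i\<in>UNIV. v $ i * (LINT x|lborel. f x * (grad \<eta> x \<bullet> axis i 1)))"
      unfolding e2 using D(2) by (subst Bochner_Integration.integral_sum) auto
    finally show "(LINT x|lebesgue. ?w x * \<eta> x) = 0" by simp
  qed
  then have "AE x in lborel. ?w x = 0" by (simp add: AE_completion_iff)
  then show ?thesis by eventually_elim (simp add: inner_vec_def)
qed

text \<open>
  By compactness of the sphere finitely many of the dense directions approximate all directions to within
  \<open>\<epsilon>\<close>, and the Lipschitz bound absorbs both this error and the rounding of the distance to a step size.
\<close>

lemma differentiable_from_dense_directions:
  assumes D: "\<And>S. open S \<Longrightarrow> S \<noteq> {} \<Longrightarrow> \<exists>d\<in>D. d \<in> S"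
    and lim: "\<And>v. v \<in> D \<Longrightarrow> (\<lambda>n. diff_quotient f v n x) \<longlonglongrightarrow> g \<bullet> v"
  shows "(f has_derivative (\<lambda>h. g \<bullet> h)) (at x)"
  unfolding has_derivative_at_alt
proof (intro conjI allI impI)
  show "bounded_linear (\<lambda>h. g \<bullet> h)" by (rule bounded_linear_inner_right)
  fix e :: real assume e: "e > 0"
  have L0: "L \<ge> 0"
  proof -
    have "0 \<le> L * norm (axis undefined 1 - 0 :: real^'n)" by (rule order_trans[OF abs_ge_zero L])
    then show ?thesis by simp
  qed
  define \<epsilon> where "\<epsilon> = min 1 (e / (4 * (L + norm g) + 2))"
  have pos: "4 * (L + norm g) + 2 > 0" using L0 by (simp add: add_nonneg_pos)
  have \<epsilon>: "\<epsilon> > 0" using e pos by (simp add: \<epsilon>_def)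
  have \<epsilon>e: "\<epsilon> * (4 * (L + norm g) + 2) \<le> e"
  proof -
    have "\<epsilon> \<le> e / (4 * (L + norm g) + 2)" by (simp add: \<epsilon>_def)
    then show ?thesis using pos by (simp add: pos_le_divide_eq)
  qed
  have cov: "sphere (0::real^'n) 1 \<subseteq> (\<Union>v\<in>D. ball v \<epsilon>)"
  proof
    fix u :: "real^'n"
    obtain d where "d \<in> D" "d \<in> ball u \<epsilon>" using D[OF open_ball, of u \<epsilon>] \<epsilon> by auto
    then show "u \<in> (\<Union>v\<in>D. ball v \<epsilon>)" by (auto simp: dist_commute)
  qed
  obtain D' where D': "D' \<subseteq> D" "finite D'" "sphere (0::real^'n) 1 \<subseteq> (\<Union>v\<in>D'. ball v \<epsilon>)"
    using compactE_image[OF compact_sphere _ cov] by auto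
  have "\<forall>\<^sub>F n in sequentially. \<forall>v\<in>D'. \<bar>diff_quotient f v n x - g \<bullet> v\<bar> < \<epsilon>"
  proof (rule eventually_ball_finite[OF D'(2)], rule ballI)
    fix v assume "v \<in> D'"
    then have "(\<lambda>n. diff_quotient f v n x) \<longlonglongrightarrow> g \<bullet> v" using D'(1) lim by auto
    from tendstoD[OF this \<epsilon>] show "\<forall>\<^sub>F n in sequentially. \<bar>diff_quotient f v n x - g \<bullet> v\<bar> < \<epsilon>" by (simp add: dist_real_def)
  qed
  then obtain N where N: "\<And>n v. n \<ge> N \<Longrightarrow> v \<in> D' \<Longrightarrow> \<bar>diff_quotient f v n x - g \<bullet> v\<bar> < \<epsilon>"
    by (auto simp: eventually_sequentially)
  show "\<exists>d>0. \<forall>y. norm (y - x) < d \<longrightarrow> norm (f y - f x - g \<bullet> (y - x)) \<le> e * norm (y - x)"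
  proof (intro exI[of _ "min \<epsilon> (step_size N)"] conjI allI impI)
    show "min \<epsilon> (step_size N) > 0" using \<epsilon> step_size(1) by simp
    fix y assume y: "norm (y - x) < min \<epsilon> (step_size N)"
    show "norm (f y - f x - g \<bullet> (y - x)) \<le> e * norm (y - x)"
    proof (cases "y = x")
      case False
      define t where "t = norm (y - x)"
      define u where "u = (1 / t) *\<^sub>R (y - x)"
      have t: "t > 0" "t < \<epsilon>" "t < step_size N" using False y by (auto simp: t_def)
      have yu: "y = x + t *\<^sub>R u" using t by (simp add: u_def)
      have "u \<in> sphere 0 1" using t by (simp add: u_def t_def)
      then obtain v where v: "v \<in> D'" "norm (u - v) < \<epsilon>" using D'(3) by (auto simp: dist_norm norm_minus_commute)
      \<comment> \<open>round \<open>t\<close> up to the step size \<open>1/k\<close>; the error is of order \<open>t\<^sup>2\<close>\<close>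
      define k where "k = nat \<lfloor>1 / t\<rfloor>"
      have "1 / t > real (Suc N)" using t by (simp add: step_size_def field_simps)
      then have k1: "k \<ge> Suc N" "real k \<le> 1 / t" "1 / t < real k + 1"
        unfolding k_def by (linarith)+
      define n where "n = k - 1"
      have nN: "n \<ge> N" and hn: "step_size n = 1 / real k" using k1(1) by (auto simp: n_def step_size_def inverse_eq_divide)
      have kp: "real k \<ge> 1" using k1(1) by linarith
      have a1: "t \<le> step_size n" using k1(2) t kp by (simp add: hn field_simps)
      have tk: "t * (real k + 1) > 1" using k1(3) t by (simp add: field_simps)
      have a2: "step_size n - t \<le> step_size n * t"
      proof -
        have hk: "real k * step_size n = 1" using kp by (simp add: hn)
        have "real k * (step_size n - t) = real k * step_size n - real k * t" by (rule right_diff_distrib)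
        also have "\<dots> \<le> (real k * step_size n) * t" unfolding hk using tk by (simp add: algebra_simps)
        also have "\<dots> = real k * (step_size n * t)" by simp
        finally show ?thesis using kp by (simp add: mult_le_cancel_left)
      qed
      have a3: "step_size n \<le> 2 * t"
      proof -
        have "1 \<le> t * (2 * real k)" using tk kp t mult_left_mono[of "real k + 1" "2 * real k" t] by linarith
        then show ?thesis using kp by (simp add: hn field_simps)
      qed
      have h0: "step_size n > 0" by (rule step_size)
      let ?h = "step_size n"
      have near: "norm (t *\<^sub>R u - ?h *\<^sub>R v) \<le> 4 * \<epsilon> * t"
      proof -
        have "t *\<^sub>R u - ?h *\<^sub>R v = (t - ?h) *\<^sub>R u + ?h *\<^sub>R (u - v)" by (simp add: algebra_simps)
        then have "norm (t *\<^sub>R u - ?h *\<^sub>R v) \<le> norm ((t - ?h) *\<^sub>R u) + norm (?h *\<^sub>R (u - v))"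
          by (metis norm_triangle_ineq)
        also have "norm ((t - ?h) *\<^sub>R u) = ?h - t" using \<open>u \<in> sphere 0 1\<close> a1 by simp
        also have "norm (?h *\<^sub>R (u - v)) \<le> ?h * \<epsilon>" using v(2) h0 by simp
        also have "?h - t + ?h * \<epsilon> \<le> ?h * \<epsilon> + ?h * \<epsilon>"
          using a2 mult_left_mono[of t \<epsilon> ?h] t h0 by linarith
        also have "\<dots> \<le> 4 * \<epsilon> * t" using mult_right_mono[OF a3, of \<epsilon>] \<epsilon> by (simp add: mult_ac)
        finally show ?thesis by simp
      qed
      have p1: "\<bar>f y - f (x + ?h *\<^sub>R v)\<bar> \<le> L * (4 * \<epsilon> * t)"
      proof -
        have "\<bar>f y - f (x + ?h *\<^sub>R v)\<bar> \<le> L * norm (t *\<^sub>R u - ?h *\<^sub>R v)" using L[of y "x + ?h *\<^sub>R v"] by (simp add: yu)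
        also have "\<dots> \<le> L * (4 * \<epsilon> * t)" by (rule mult_left_mono[OF near L0])
        finally show ?thesis .
      qed
      have p2: "\<bar>f (x + ?h *\<^sub>R v) - f x - ?h * (g \<bullet> v)\<bar> \<le> 2 * \<epsilon> * t"
      proof -
        have "f (x + ?h *\<^sub>R v) - f x - ?h * (g \<bullet> v) = ?h * (diff_quotient f v n x - g \<bullet> v)"
          using h0 by (simp add: diff_quotient_def field_simps)
        then have "\<bar>f (x + ?h *\<^sub>R v) - f x - ?h * (g \<bullet> v)\<bar> = ?h * \<bar>diff_quotient f v n x - g \<bullet> v\<bar>" using h0 by (simp add: abs_mult)
        also have "\<dots> \<le> ?h * \<epsilon>" using N[OF nN v(1)] h0 by simp
        also have "\<dots> \<le> 2 * t * \<epsilon>" using a3 \<epsilon> by (intro mult_right_mono) auto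
        finally show ?thesis by (simp add: mult_ac)
      qed
      have p3: "\<bar>g \<bullet> (?h *\<^sub>R v - t *\<^sub>R u)\<bar> \<le> norm g * (4 * \<epsilon> * t)"
      proof -
        have "\<bar>g \<bullet> (?h *\<^sub>R v - t *\<^sub>R u)\<bar> \<le> norm g * norm (?h *\<^sub>R v - t *\<^sub>R u)" by (rule Cauchy_Schwarz_ineq2)
        also have "\<dots> = norm g * norm (t *\<^sub>R u - ?h *\<^sub>R v)" by (simp add: norm_minus_commute)
        also have "\<dots> \<le> norm g * (4 * \<epsilon> * t)" by (rule mult_left_mono[OF near norm_ge_zero])
        finally show ?thesis .
      qed
      have "f y - f x - g \<bullet> (y - x) = (f y - f (x + ?h *\<^sub>R v)) + (f (x + ?h *\<^sub>R v) - f x - ?h * (g \<bullet> v)) + g \<bullet> (?h *\<^sub>R v - t *\<^sub>R u)"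
        by (simp add: yu inner_diff_right)
      then have "\<bar>f y - f x - g \<bullet> (y - x)\<bar> \<le> L * (4 * \<epsilon> * t) + 2 * \<epsilon> * t + norm g * (4 * \<epsilon> * t)"
        using p1 p2 p3 by linarith
      also have "\<dots> = \<epsilon> * (4 * (L + norm g) + 2) * t" by (simp add: algebra_simps)
      also have "\<dots> \<le> e * t" using \<epsilon>e t by (intro mult_right_mono) auto
      finally show ?thesis by (simp add: t_def)
    qed simp
  qed
qed

theorem rademacher: "AE x in lborel. f differentiable (at x)"
proof -
  obtain D :: "(real^'n) set" where D: "countable D" "\<And>S. open S \<Longrightarrow> S \<noteq> {} \<Longrightarrow> \<exists>d\<in>D. d \<in> S"
    by (rule countable_dense_setE) blast
  have "AE x in lborel. Cauchy (\<lambda>n. diff_quotient f v n x) \<and> directional_limit f v x = (\<chi> i. directional_limit f (axis i 1) x) \<bullet> v" for v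
    using diff_quotient_Cauchy_AE[of v] directional_limit_linear_AE[of v] by eventually_elim simp
  then have "AE x in lborel. \<forall>v\<in>D. Cauchy (\<lambda>n. diff_quotient f v n x) \<and> directional_limit f v x = (\<chi> i. directional_limit f (axis i 1) x) \<bullet> v"
    by (subst AE_ball_countable[OF D(1)]) blast
  then show ?thesis
  proof eventually_elim
    case (elim x)
    have "(\<lambda>n. diff_quotient f v n x) \<longlonglongrightarrow> (\<chi> i. directional_limit f (axis i 1) x) \<bullet> v" if "v \<in> D" for v
      using directional_limit_LIMSEQ[of f v x] elim that by metis
    from differentiable_from_dense_directions[OF D(2) this] show ?case by (auto intro: differentiableI)
  qed
qed

lemma directional_limit_grad:
  assumes "f differentiable (at x)"
  shows "directional_limit f v x = grad f x \<bullet> v"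
proof -
  have "((\<lambda>t. f (x + t *\<^sub>R v)) has_real_derivative (grad f (x + 0 *\<^sub>R v) \<bullet> v)) (at 0)"
    by (rule has_derivative_along_line) (use assms in simp)
  then have "((\<lambda>h. (f (x + h *\<^sub>R v) - f x) / h) \<longlongrightarrow> grad f x \<bullet> v) (at 0)" by (simp add: DERIV_def)
  moreover have "filterlim step_size (at 0) sequentially"
    unfolding filterlim_at using step_size(3) by (auto simp: step_size_neq_0)
  ultimately have *: "(\<lambda>n. diff_quotient f v n x) \<longlonglongrightarrow> grad f x \<bullet> v"
    unfolding diff_quotient_def by (rule filterlim_compose)
  then have "Cauchy (\<lambda>n. diff_quotient f v n x)" by (rule LIMSEQ_imp_Cauchy)
  from LIMSEQ_unique[OF directional_limit_LIMSEQ[OF this] *] show ?thesis .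
qed

end

section \<open>The graph measure as an integral over a slab\<close>

lemma AE_lborel_translate:
  fixes a :: "'a::euclidean_space"
  assumes "AE x in lborel. P x"
  shows "AE x in lborel. P (x + a)"
proof -
  have "AE x in distr lborel borel ((+) a). P x" using assms unfolding lborel_distr_plus .
  then have "AE x in lborel. P (a + x)" by (rule AE_distrD[rotated]) simp
  then show ?thesis by (simp add: add.commute)
qed

lemma tangential_linear: "linear (tangential e)"
  by (rule linearI) (auto simp: tangential_def inner_add_right algebra_simps)

lemma tangential_continuous: "continuous_on S (tangential e)"
  unfolding tangential_def[abs_def] by (intro continuous_intros)

lemma tangential_measurable [measurable]: "tangential e \<in> borel_measurable borel"
  by (intro borel_measurable_continuous_onI tangential_continuous)

lemma tangential_decomp: "tangential e z + (z \<bullet> e) *\<^sub>R e = z"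
  by (simp add: tangential_def inner_commute)

context
  fixes e :: "real^'n"
  assumes e: "norm e = 1"
begin

lemma e_inner: "e \<bullet> e = 1" using e by (simp add: norm_eq_1)

lemma tangential_inner [simp]: "tangential e z \<bullet> e = 0" "e \<bullet> tangential e z = 0"
  by (simp_all add: tangential_def inner_diff_left inner_diff_right e_inner inner_commute)

lemma tangential_add_scale [simp]: "tangential e (z + t *\<^sub>R e) = tangential e z"
  by (simp add: tangential_def inner_add_right e_inner algebra_simps)

lemma tangential_idem [simp]: "tangential e (tangential e z) = tangential e z"
  by (simp add: tangential_def[of e "tangential e z"])

text \<open>
  Replacing \<open>tangential e z\<close> by \<open>z\<close> translates the inner variable; after exchanging the integrals
  a translation in \<open>z\<close> turns the left-hand side into a product.
\<close>

lemma slab_fubini: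
  fixes h :: "real^'n \<Rightarrow> ennreal"
  assumes [measurable]: "A \<in> sets borel" "h \<in> borel_measurable borel"
  shows "(\<integral>\<^sup>+z. indicator A (z \<bullet> e) * (\<integral>\<^sup>+t. h (tangential e z + t *\<^sub>R e) \<partial>lborel) \<partial>lborel) =
     emeasure lborel A * (\<integral>\<^sup>+w. h w \<partial>lborel)"
proof -
  have inner: "(\<integral>\<^sup>+t. h (tangential e z + t *\<^sub>R e) \<partial>lborel) = (\<integral>\<^sup>+t. h (z + t *\<^sub>R e) \<partial>lborel)" for z
  proof -
    have "z + t *\<^sub>R e = tangential e z + (t + z \<bullet> e) *\<^sub>R e" for t
      by (simp add: tangential_def scaleR_add_left inner_commute[of e z])
    then show ?thesis
      using nn_integral_translate[of "\<lambda>t. h (tangential e z + t *\<^sub>R e)" "z \<bullet> e"] by simp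
  qed
  have "(\<integral>\<^sup>+z. indicator A (z \<bullet> e) * (\<integral>\<^sup>+t. h (tangential e z + t *\<^sub>R e) \<partial>lborel) \<partial>lborel) =
     (\<integral>\<^sup>+z. \<integral>\<^sup>+t. indicator A (z \<bullet> e) * h (z + t *\<^sub>R e) \<partial>lborel \<partial>lborel)"
    unfolding inner by (intro nn_integral_cong nn_integral_cmult[symmetric]) measurable
  also have "\<dots> = (\<integral>\<^sup>+t. \<integral>\<^sup>+z. indicator A (z \<bullet> e) * h (z + t *\<^sub>R e) \<partial>lborel \<partial>lborel)"
    by (rule lborel_pair.Fubini'[symmetric]) measurable
  also have "\<dots> = (\<integral>\<^sup>+t. \<integral>\<^sup>+w. indicator A (w \<bullet> e - t) * h w \<partial>lborel \<partial>lborel)"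
  proof (rule nn_integral_cong)
    fix t :: real
    show "(\<integral>\<^sup>+z. indicator A (z \<bullet> e) * h (z + t *\<^sub>R e) \<partial>lborel) = (\<integral>\<^sup>+w. indicator A (w \<bullet> e - t) * h w \<partial>lborel)"
      using nn_integral_translate[of "\<lambda>w. indicator A (w \<bullet> e - t) * h w" "t *\<^sub>R e"]
      by (simp add: inner_add_left e_inner)
  qed
  also have "\<dots> = (\<integral>\<^sup>+w. \<integral>\<^sup>+t. indicator A (w \<bullet> e - t) * h w \<partial>lborel \<partial>lborel)"
    by (rule lborel_pair.Fubini') measurable
  also have "\<dots> = (\<integral>\<^sup>+w. emeasure lborel A * h w \<partial>lborel)"
  proof (rule nn_integral_cong)
    fix w :: "real^'n"
    have "(\<integral>\<^sup>+t. indicator A (w \<bullet> e - t) * h w \<partial>lborel) = (\<integral>\<^sup>+t. indicator A (w \<bullet> e - t) \<partial>lborel) * h w"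
      by (rule nn_integral_multc) measurable
    also have "(\<integral>\<^sup>+t. indicator A (w \<bullet> e - t) \<partial>lborel) = (\<integral>\<^sup>+t. indicator A t \<partial>lborel)"
      using nn_integral_real_affine[of "indicator A" "-1" "w \<bullet> e"] by simp
    finally show "(\<integral>\<^sup>+t. indicator A (w \<bullet> e - t) * h w \<partial>lborel) = emeasure lborel A * h w" by simp
  qed
  also have "\<dots> = emeasure lborel A * (\<integral>\<^sup>+w. h w \<partial>lborel)" by (rule nn_integral_cmult) measurable
  finally show ?thesis .
qed

end

lemma C11_continuous: "C11 \<gamma> \<Longrightarrow> continuous_on S \<gamma>"
  unfolding C11_def by (meson continuous_at_imp_continuous_on differentiable_imp_continuous_within)

lemma C11_grad_continuous: "C11 \<gamma> \<Longrightarrow> continuous_on S (grad \<gamma>)"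
  unfolding C11_def using lipschitz_on_continuous_on continuous_on_subset by blast

text \<open>
  The vertical projection of \<open>z\<close> to the graph, constant along \<open>e\<close>.
\<close>

definition graph_map :: "real^'n \<Rightarrow> (real^'n \<Rightarrow> real) \<Rightarrow> real^'n \<Rightarrow> real^'n" where
  "graph_map e \<gamma> z = tangential e z + \<gamma> (tangential e z) *\<^sub>R e"

context
  fixes e :: "real^'n" and \<gamma> :: "real^'n \<Rightarrow> real"
  assumes e: "norm e = 1" and \<gamma>: "C11 \<gamma>"
begin

lemma gamma_measurable [measurable]: "\<gamma> \<in> borel_measurable borel"
  by (intro borel_measurable_continuous_onI C11_continuous \<gamma>)

lemma graph_map_continuous: "continuous_on S (graph_map e \<gamma>)"
  unfolding graph_map_def[abs_def]
  by (intro continuous_intros tangential_continuous continuous_on_compose2[OF C11_continuous[OF \<gamma>, of UNIV]]) auto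

lemma graph_map_measurable [measurable]: "graph_map e \<gamma> \<in> borel_measurable borel"
  by (intro borel_measurable_continuous_onI graph_map_continuous)

lemma tangential_graph_map [simp]: "tangential e (graph_map e \<gamma> z) = tangential e z"
  by (simp add: graph_map_def e)

lemma graph_map_tangential [simp]: "graph_map e \<gamma> (tangential e z) = graph_map e \<gamma> z"
  by (simp add: graph_map_def e)

lemma graph_map_shift [simp]: "graph_map e \<gamma> (z + t *\<^sub>R e) = graph_map e \<gamma> z"
  by (simp add: graph_map_def e)

lemma graph_map_inner: "graph_map e \<gamma> z \<bullet> e = \<gamma> (tangential e z)"
  by (simp add: graph_map_def inner_add_left e e_inner)

lemma graph_map_fixed: "x \<bullet> e = \<gamma> (tangential e x) \<Longrightarrow> graph_map e \<gamma> x = x"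
  using tangential_decomp[of e x] by (simp add: graph_map_def)

definition graph_density :: "real^'n \<Rightarrow> real" where
  "graph_density y = sqrt (1 + (norm (tangential e (grad \<gamma> y)))\<^sup>2)"

lemma graph_density_continuous: "continuous_on S graph_density"
  unfolding graph_density_def[abs_def]
  by (intro continuous_intros continuous_on_compose2[OF tangential_continuous[of UNIV]] C11_grad_continuous \<gamma>) auto

lemma graph_density_measurable [measurable]: "graph_density \<in> borel_measurable borel"
  by (intro borel_measurable_continuous_onI graph_density_continuous)

lemma graph_density_ge: "graph_density y \<ge> 1"
  by (simp add: graph_density_def)

lemma sets_hyperplane_measure [simp, measurable_cong]: "sets (hyperplane_measure e) = sets borel"
  by (simp add: hyperplane_measure_def)

lemma graph_measure_alt:
  "graph_measure e \<gamma> = distr (density (hyperplane_measure e) (\<lambda>y. ennreal (graph_density y))) borel (\<lambda>y. y + \<gamma> y *\<^sub>R e)"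
  by (simp add: graph_measure_def graph_density_def)

lemma slab_set [measurable]: "{x. 0 \<le> x \<bullet> e \<and> x \<bullet> e \<le> 1} \<in> sets borel"
proof -
  have "{x. 0 \<le> x \<bullet> e \<and> x \<bullet> e \<le> 1} = {x \<in> space borel. 0 \<le> x \<bullet> e \<and> x \<bullet> e \<le> 1}" by simp
  also have "\<dots> \<in> sets borel" by measurable
  finally show ?thesis .
qed

lemma tangential_restrict_measurable:
  "tangential e \<in> restrict_space lborel {x. 0 \<le> x \<bullet> e \<and> x \<bullet> e \<le> 1} \<rightarrow>\<^sub>M borel"
  by (rule measurable_restrict_space1) simp

lemma nn_integral_graph_measure:
  assumes [measurable]: "F \<in> borel_measurable borel"
  shows "(\<integral>\<^sup>+x. F x \<partial>graph_measure e \<gamma>) =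
    (\<integral>\<^sup>+z. indicator {0..1} (z \<bullet> e) * (ennreal (graph_density (tangential e z)) * F (graph_map e \<gamma> z)) \<partial>lborel)"
proof -
  have "(\<integral>\<^sup>+x. F x \<partial>graph_measure e \<gamma>) =
      (\<integral>\<^sup>+y. F (y + \<gamma> y *\<^sub>R e) \<partial>density (hyperplane_measure e) (\<lambda>y. ennreal (graph_density y)))"
    unfolding graph_measure_alt by (rule nn_integral_distr) auto
  also have "\<dots> = (\<integral>\<^sup>+y. ennreal (graph_density y) * F (y + \<gamma> y *\<^sub>R e) \<partial>hyperplane_measure e)"
    by (rule nn_integral_density) auto
  also have "\<dots> = (\<integral>\<^sup>+z. ennreal (graph_density (tangential e z)) * F (graph_map e \<gamma> z)
      \<partial>restrict_space lborel {x. 0 \<le> x \<bullet> e \<and> x \<bullet> e \<le> 1})"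
    unfolding hyperplane_measure_def graph_map_def
    by (rule nn_integral_distr[OF tangential_restrict_measurable]) auto
  also have "\<dots> = (\<integral>\<^sup>+z. (ennreal (graph_density (tangential e z)) * F (graph_map e \<gamma> z)) * indicator {x. 0 \<le> x \<bullet> e \<and> x \<bullet> e \<le> 1} z \<partial>lborel)"
    by (rule nn_integral_restrict_space) (simp add: slab_set)
  also have "\<dots> = (\<integral>\<^sup>+z. indicator {0..1} (z \<bullet> e) * (ennreal (graph_density (tangential e z)) * F (graph_map e \<gamma> z)) \<partial>lborel)"
    by (rule nn_integral_cong) (auto simp: indicator_def)
  finally show ?thesis .
qed

text \<open>
  The measure only sees a slab of height one; integer translations along \<open>e\<close>, under which the graph map is
  invariant, extend the statement to the whole space.
\<close>

lemma AE_graph_measureD: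
  assumes "AE x in graph_measure e \<gamma>. R x"
  shows "AE z in lborel. R (graph_map e \<gamma> z)"
proof -
  have "AE y in density (hyperplane_measure e) (\<lambda>y. ennreal (graph_density y)). R (y + \<gamma> y *\<^sub>R e)"
    by (rule AE_distrD[OF _ assms[unfolded graph_measure_alt]]) auto
  then have "AE y in hyperplane_measure e. 0 < ennreal (graph_density y) \<longrightarrow> R (y + \<gamma> y *\<^sub>R e)"
    by (subst (asm) AE_density) auto
  then have "AE y in hyperplane_measure e. R (y + \<gamma> y *\<^sub>R e)"
    by eventually_elim (use graph_density_ge in \<open>auto intro: less_le_trans[OF zero_less_one]\<close>)
  then have "AE z in restrict_space lborel {x. 0 \<le> x \<bullet> e \<and> x \<bullet> e \<le> 1}. R (tangential e z + \<gamma> (tangential e z) *\<^sub>R e)"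
    unfolding hyperplane_measure_def by (rule AE_distrD[OF tangential_restrict_measurable])
  then have *: "AE z in lborel. 0 \<le> z \<bullet> e \<and> z \<bullet> e \<le> 1 \<longrightarrow> R (graph_map e \<gamma> z)"
    unfolding graph_map_def by (subst (asm) AE_restrict_space_iff) (auto simp: slab_set)
  have "AE z in lborel. 0 \<le> (z + real_of_int k *\<^sub>R e) \<bullet> e \<and> (z + real_of_int k *\<^sub>R e) \<bullet> e \<le> 1 \<longrightarrow> R (graph_map e \<gamma> z)" for k
    using AE_lborel_translate[OF *, of "real_of_int k *\<^sub>R e"] by simp
  then have "AE z in lborel. \<forall>k::int. 0 \<le> (z + real_of_int k *\<^sub>R e) \<bullet> e \<and> (z + real_of_int k *\<^sub>R e) \<bullet> e \<le> 1 \<longrightarrow> R (graph_map e \<gamma> z)"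
    unfolding AE_all_countable by blast
  then show ?thesis
  proof eventually_elim
    case (elim z)
    have "(z + real_of_int (- \<lfloor>z \<bullet> e\<rfloor>) *\<^sub>R e) \<bullet> e = z \<bullet> e - real_of_int \<lfloor>z \<bullet> e\<rfloor>"
      by (simp add: inner_add_left inner_diff_left e_inner[OF e])
    moreover have "0 \<le> z \<bullet> e - real_of_int \<lfloor>z \<bullet> e\<rfloor>" "z \<bullet> e - real_of_int \<lfloor>z \<bullet> e\<rfloor> \<le> 1" by linarith+
    ultimately show ?case using elim[rule_format, of "- \<lfloor>z \<bullet> e\<rfloor>"] by (simp only:)
  qed
qed

text \<open>
  The predicate \<open>R\<close> may fail to be measurable. A Borel null set containing its exceptional set
  has, by Tonelli's theorem, a null slice orthogonal to \<open>e\<close>; the exceptional set is constant along \<open>e\<close> and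
  hence contained in the Borel cylinder over that slice.
\<close>

lemma AE_graph_measureI:
  assumes "AE z in lborel. R (graph_map e \<gamma> z)"
  shows "AE x in graph_measure e \<gamma>. R x"
proof -
  obtain N where N: "{z \<in> space lborel. \<not> R (graph_map e \<gamma> z)} \<subseteq> N" "emeasure lborel N = 0" "N \<in> sets lborel"
    using AE_E[OF assms] by blast
  have [measurable]: "N \<in> sets borel" using N(3) by simp
  have "(\<integral>\<^sup>+t. \<integral>\<^sup>+z. indicator {0..1} (z \<bullet> e) * indicator N (tangential e z + t *\<^sub>R e) \<partial>lborel \<partial>lborel) =
    (\<integral>\<^sup>+z. \<integral>\<^sup>+t. indicator {0..1} (z \<bullet> e) * indicator N (tangential e z + t *\<^sub>R e) \<partial>lborel \<partial>lborel)"
    by (rule lborel_pair.Fubini') measurable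
  also have "\<dots> = (\<integral>\<^sup>+z. indicator {0..1} (z \<bullet> e) * (\<integral>\<^sup>+t. indicator N (tangential e z + t *\<^sub>R e) \<partial>lborel) \<partial>lborel)"
    by (intro nn_integral_cong nn_integral_cmult) measurable
  also have "\<dots> = emeasure lborel {0..1::real} * (\<integral>\<^sup>+w. indicator N w \<partial>lborel)"
    by (rule slab_fubini[OF e]) auto
  also have "\<dots> = 0" using N(2) by simp
  finally have z: "(\<integral>\<^sup>+t. \<integral>\<^sup>+z. indicator {0..1} (z \<bullet> e) * indicator N (tangential e z + t *\<^sub>R e) \<partial>lborel \<partial>lborel) = 0" .
  have "AE t in lborel. (\<integral>\<^sup>+z. indicator {0..1} (z \<bullet> e) * indicator N (tangential e z + t *\<^sub>R e) \<partial>lborel) = 0"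
    using z by (subst (asm) nn_integral_0_iff_AE) measurable
  then have "\<exists>t. (\<integral>\<^sup>+z. indicator {0..1} (z \<bullet> e) * indicator N (tangential e z + t *\<^sub>R e) \<partial>lborel) = 0"
    by (rule eventually_happens'[rotated]) (simp add: ae_filter_eq_bot_iff)
  then obtain t where "(\<integral>\<^sup>+z. indicator {0..1} (z \<bullet> e) * indicator N (tangential e z + t *\<^sub>R e) \<partial>lborel) = 0" by blast
  then have "AE z in lborel. indicator {0..1} (z \<bullet> e) * indicator N (tangential e z + t *\<^sub>R e) = (0::ennreal)"
    by (subst (asm) nn_integral_0_iff_AE) auto
  then have "AE z in lborel. z \<in> {x. 0 \<le> x \<bullet> e \<and> x \<bullet> e \<le> 1} \<longrightarrow> tangential e z + t *\<^sub>R e \<notin> N"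
    by eventually_elim (auto simp: indicator_def split: if_splits)
  then have a1: "AE z in restrict_space lborel {x. 0 \<le> x \<bullet> e \<and> x \<bullet> e \<le> 1}. tangential e z + t *\<^sub>R e \<notin> N"
    by (subst AE_restrict_space_iff) (auto simp: slab_set)
  let ?P = "\<lambda>y. tangential e y + t *\<^sub>R e \<notin> N \<and> y = tangential e y"
  have Pm: "{y \<in> space borel. ?P y} \<in> sets borel" by measurable
  have a2: "AE y in hyperplane_measure e. ?P y"
    unfolding hyperplane_measure_def
    by (subst AE_distr_iff[OF tangential_restrict_measurable Pm]) (use a1 in \<open>simp add: e\<close>)
  then have a3: "AE y in density (hyperplane_measure e) (\<lambda>y. ennreal (graph_density y)). ?P y"
    by (subst AE_density) auto
  let ?Q = "\<lambda>x. tangential e x + t *\<^sub>R e \<notin> N \<and> x = graph_map e \<gamma> x"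
  have Qm: "{x \<in> space borel. ?Q x} \<in> sets borel" by measurable
  have "AE x in graph_measure e \<gamma>. ?Q x"
    unfolding graph_measure_alt
  proof (subst AE_distr_iff[OF _ Qm])
    show "AE y in density (hyperplane_measure e) (\<lambda>y. ennreal (graph_density y)). ?Q (y + \<gamma> y *\<^sub>R e)"
      using a3
    proof eventually_elim
      case (elim y)
      then have y: "tangential e y = y" by simp
      have *: "graph_map e \<gamma> y = y + \<gamma> y *\<^sub>R e" by (simp add: graph_map_def e y)
      have "y + t *\<^sub>R e \<notin> N" using elim[THEN conjunct1] unfolding y .
      then show ?case by (simp add: e y *)
    qed
  qed auto
  then show ?thesis
  proof eventually_elim
    case (elim x)
    from elim have "tangential e x + t *\<^sub>R e \<notin> N" by (rule conjunct1)
    moreover have "\<forall>z. z \<notin> N \<longrightarrow> R (graph_map e \<gamma> z)" using N(1) by auto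
    ultimately have "R (graph_map e \<gamma> (tangential e x + t *\<^sub>R e))" by blast
    then have "R (graph_map e \<gamma> x)" by simp
    moreover have "graph_map e \<gamma> x = x" using elim[THEN conjunct2] by (rule sym)
    ultimately show ?case by (simp only:)
  qed
qed

section \<open>The trace inequality\<close>

lemma line_bound:
  fixes v :: "real^'n \<Rightarrow> real"
  assumes "test_function v"
  shows "ennreal \<bar>v (y + s *\<^sub>R e)\<bar> \<le> (\<integral>\<^sup>+t. ennreal \<bar>grad v (y + t *\<^sub>R e) \<bullet> e\<bar> \<partial>lborel)"
proof -
  have sm: "smooth v" by (rule test_functionD[OF assms])
  obtain R where R: "R > 0" "\<And>x. norm x > R \<Longrightarrow> v x = 0" using test_functionD(2)[OF assms] by auto
  define b where "b = R + norm y + \<bar>s\<bar> + 1"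
  have "s \<le> b" using R(1) norm_ge_zero[of y] abs_ge_self[of s] unfolding b_def by linarith
  have "norm (y + b *\<^sub>R e) \<ge> norm (b *\<^sub>R e) - norm y" using norm_triangle_ineq2[of "b *\<^sub>R e" "- y"] by (simp add: add.commute)
  then have vb: "v (y + b *\<^sub>R e) = 0" using R by (intro R(2)) (simp add: e b_def)
  let ?g = "\<lambda>t. grad v (y + t *\<^sub>R e) \<bullet> e"
  have gc: "continuous_on UNIV ?g"
    by (intro continuous_intros continuous_on_compose2[OF smooth_grad_continuous[OF sm]]) auto
  have [measurable]: "?g \<in> borel_measurable borel" by (rule borel_measurable_continuous_onI[OF gc])
  have "(LINT t|lborel. ?g t * indicator {s..b} t) = v (y + b *\<^sub>R e) - v (y + s *\<^sub>R e)"
    by (rule integral_FTC_Icc_real[OF \<open>s \<le> b\<close>])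
       (use gc has_derivative_along_line[OF smoothD(1)[OF sm]] in \<open>auto simp: continuous_on_eq_continuous_at\<close>)
  then have "\<bar>v (y + s *\<^sub>R e)\<bar> = norm (LINT t|lborel. ?g t * indicator {s..b} t)" by (simp add: vb)
  moreover have "ennreal (norm (LINT t|lborel. ?g t * indicator {s..b} t)) \<le> (\<integral>\<^sup>+t. norm (?g t * indicator {s..b} t) \<partial>lborel)"
  proof (cases "integrable lborel (\<lambda>t. ?g t * indicator {s..b} t)")
    case True
    then show ?thesis by (rule integral_norm_bound_ennreal)
  next
    case False
    then show ?thesis by (simp add: not_integrable_integral_eq)
  qed
  moreover have "(\<integral>\<^sup>+t. norm (?g t * indicator {s..b} t) \<partial>lborel) \<le> (\<integral>\<^sup>+t. ennreal \<bar>?g t\<bar> \<partial>lborel)"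
    by (intro nn_integral_mono ennreal_leI) (auto simp: indicator_def)
  ultimately show ?thesis by simp
qed

text \<open>
  The value on the graph is bounded by the integral of the derivative along the line through the point in
  direction \<open>e\<close>, and \<open>slab_fubini\<close> collects these lines.
\<close>

lemma trace_inequality_aux:
  fixes v :: "real^'n \<Rightarrow> real"
  assumes t: "test_function v" and [measurable]: "A \<in> sets borel"
  shows "(\<integral>\<^sup>+z. indicator A (z \<bullet> e) * ennreal \<bar>v (graph_map e \<gamma> z)\<bar> \<partial>lborel) \<le>
     emeasure lborel A * (\<Sum>i\<in>UNIV. \<integral>\<^sup>+x. ennreal \<bar>partial_deriv i v x\<bar> \<partial>lborel)"
proof -
  have sm: "smooth v" by (rule test_functionD[OF t])
  have [measurable]: "partial_deriv i v \<in> borel_measurable borel" for i by (intro smoothD(5) smoothD(2) sm)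
  have [measurable]: "(\<lambda>w. grad v w \<bullet> e) \<in> borel_measurable borel"
    by (intro borel_measurable_continuous_onI continuous_intros smooth_grad_continuous sm)
  have "(\<integral>\<^sup>+z. indicator A (z \<bullet> e) * ennreal \<bar>v (graph_map e \<gamma> z)\<bar> \<partial>lborel) \<le>
     (\<integral>\<^sup>+z. indicator A (z \<bullet> e) * (\<integral>\<^sup>+t. ennreal \<bar>grad v (tangential e z + t *\<^sub>R e) \<bullet> e\<bar> \<partial>lborel) \<partial>lborel)"
    unfolding graph_map_def by (intro nn_integral_mono mult_left_mono line_bound t) simp
  also have "\<dots> = emeasure lborel A * (\<integral>\<^sup>+w. ennreal \<bar>grad v w \<bullet> e\<bar> \<partial>lborel)"
    by (rule slab_fubini[OF e]) auto
  also have "\<dots> \<le> emeasure lborel A * (\<integral>\<^sup>+w. (\<Sum>i\<in>UNIV. ennreal \<bar>partial_deriv i v w\<bar>) \<partial>lborel)"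
  proof (intro mult_left_mono nn_integral_mono)
    fix w
    have "\<bar>grad v w \<bullet> e\<bar> \<le> (\<Sum>i\<in>UNIV. \<bar>partial_deriv i v w * e $ i\<bar>)"
      unfolding inner_vec_def by (rule order_trans[OF sum_abs]) (simp add: grad_def)
    also have "\<dots> \<le> (\<Sum>i\<in>UNIV. \<bar>partial_deriv i v w\<bar>)"
    proof (rule sum_mono)
      fix i
      have "\<bar>e $ i\<bar> \<le> 1" using component_le_norm_cart[of e i] e by simp
      then show "\<bar>partial_deriv i v w * e $ i\<bar> \<le> \<bar>partial_deriv i v w\<bar>" by (simp add: abs_mult mult_left_le)
    qed
    finally have "ennreal \<bar>grad v w \<bullet> e\<bar> \<le> ennreal (\<Sum>i\<in>UNIV. \<bar>partial_deriv i v w\<bar>)" by (rule ennreal_leI)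
    then show "ennreal \<bar>grad v w \<bullet> e\<bar> \<le> (\<Sum>i\<in>UNIV. ennreal \<bar>partial_deriv i v w\<bar>)" by simp
  qed simp
  also have "(\<integral>\<^sup>+w. (\<Sum>i\<in>UNIV. ennreal \<bar>partial_deriv i v w\<bar>) \<partial>lborel) = (\<Sum>i\<in>UNIV. \<integral>\<^sup>+x. ennreal \<bar>partial_deriv i v x\<bar> \<partial>lborel)"
    by (rule nn_integral_sum) auto
  finally show ?thesis .
qed

end

text \<open>
  The \<open>p\<close>-th power of the first-order Sobolev norm of a classical function.
\<close>

definition W1_energy :: "real \<Rightarrow> (real^'n \<Rightarrow> real) \<Rightarrow> ennreal" where
  "W1_energy p v = (\<integral>\<^sup>+x. ennreal (\<bar>v x\<bar> powr p) \<partial>lebesgue) + (\<Sum>i\<in>UNIV. \<integral>\<^sup>+x. ennreal (\<bar>partial_deriv i v x\<bar> powr p) \<partial>lebesgue)"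

text \<open>
  The case \<open>p = 2\<close> is the case \<open>p = 1\<close> for the square of \<open>v\<close>.
\<close>

lemma trace_inequality:
  fixes v :: "real^'n \<Rightarrow> real"
  assumes e: "norm e = 1" and \<gamma>: "C11 \<gamma>" and t: "test_function v" and [measurable]: "A \<in> sets borel" and p: "p = 1 \<or> p = 2"
  shows "(\<integral>\<^sup>+z. indicator A (z \<bullet> e) * ennreal (\<bar>v (graph_map e \<gamma> z)\<bar> powr p) \<partial>lborel) \<le>
     emeasure lborel A * (of_nat CARD('n) * W1_energy p v)"
proof -
  have sm: "smooth v" by (rule test_functionD[OF t])
  have [measurable]: "partial_deriv i v \<in> borel_measurable borel" "v \<in> borel_measurable borel" for i
    by (intro smoothD(5) smoothD(2) sm)+
  have N1: "(1::ennreal) \<le> of_nat CARD('n)"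
  proof -
    have "1 \<le> CARD('n)" using zero_less_card_finite[where 'a='n] by linarith
    from of_nat_mono[OF this, where 'a=ennreal] show ?thesis by (simp only: of_nat_1)
  qed
  let ?S = "\<Sum>i\<in>UNIV. \<integral>\<^sup>+x. ennreal (\<bar>partial_deriv i v x\<bar> powr p) \<partial>lborel"
  have W: "W1_energy p v = (\<integral>\<^sup>+x. ennreal (\<bar>v x\<bar> powr p) \<partial>lborel) + ?S"
    by (simp add: W1_energy_def nn_integral_completion)
  show ?thesis using p
  proof
    assume p1: "p = 1"
    have "?S \<le> W1_energy p v" unfolding W by (rule le_iff_add[THEN iffD2]) (auto simp: add.commute)
    then have "1 * ?S \<le> of_nat CARD('n) * W1_energy p v" by (rule mult_mono[OF N1]) auto
    then have "?S \<le> of_nat CARD('n) * W1_energy p v" by (simp only: mult_1)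
    then have "emeasure lborel A * ?S \<le> emeasure lborel A * (of_nat CARD('n) * W1_energy p v)" by (rule mult_left_mono) simp
    then have le: "emeasure lborel A * ?S \<le> emeasure lborel A * (of_nat CARD('n) * W1_energy p v)" .
    have S: "?S = (\<Sum>i\<in>UNIV. \<integral>\<^sup>+x. ennreal \<bar>partial_deriv i v x\<bar> \<partial>lborel)" by (simp add: p1)
    have "(\<integral>\<^sup>+z. indicator A (z \<bullet> e) * ennreal \<bar>v (graph_map e \<gamma> z)\<bar> \<partial>lborel) \<le> emeasure lborel A * (of_nat CARD('n) * W1_energy p v)"
      by (rule order_trans[OF trace_inequality_aux[OF e \<gamma> t] le[unfolded S]]) simp
    then show ?thesis by (simp add: p1)
  next
    assume p2: "p = 2"
    have t2: "test_function (\<lambda>x. v x * v x)" by (rule test_function_mult_smooth[OF t sm])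
    have pd: "partial_deriv i (\<lambda>x. v x * v x) x = 2 * (v x * partial_deriv i v x)" for i x
      by (subst partial_deriv_mult) (auto intro: smoothD(1)[OF sm])
    have "(\<integral>\<^sup>+x. ennreal \<bar>partial_deriv i (\<lambda>x. v x * v x) x\<bar> \<partial>lborel) \<le>
        (\<integral>\<^sup>+x. ennreal (\<bar>v x\<bar> powr p) \<partial>lborel) + (\<integral>\<^sup>+x. ennreal (\<bar>partial_deriv i v x\<bar> powr p) \<partial>lborel)" for i
    proof -
      have "\<bar>partial_deriv i (\<lambda>x. v x * v x) x\<bar> \<le> (v x)^2 + (partial_deriv i v x)^2" for x
        using sum_squares_bound[of "\<bar>v x\<bar>" "\<bar>partial_deriv i v x\<bar>"] unfolding pd by (simp add: abs_mult)
      then have "(\<integral>\<^sup>+x. ennreal \<bar>partial_deriv i (\<lambda>x. v x * v x) x\<bar> \<partial>lborel) \<le>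
         (\<integral>\<^sup>+x. ennreal ((v x)^2) + ennreal ((partial_deriv i v x)^2) \<partial>lborel)"
        by (intro nn_integral_mono) (simp flip: ennreal_plus add: ennreal_leI)
      also have "\<dots> = (\<integral>\<^sup>+x. ennreal ((v x)^2) \<partial>lborel) + (\<integral>\<^sup>+x. ennreal ((partial_deriv i v x)^2) \<partial>lborel)"
        by (rule nn_integral_add) auto
      finally show ?thesis by (simp add: p2 abs_powr_2)
    qed
    then have "(\<Sum>i\<in>UNIV. \<integral>\<^sup>+x. ennreal \<bar>partial_deriv i (\<lambda>x. v x * v x) x\<bar> \<partial>lborel) \<le>
        (\<Sum>i\<in>(UNIV::'n set). (\<integral>\<^sup>+x. ennreal (\<bar>v x\<bar> powr p) \<partial>lborel) + (\<integral>\<^sup>+x. ennreal (\<bar>partial_deriv i v x\<bar> powr p) \<partial>lborel))"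
      by (rule sum_mono)
    also have "\<dots> = of_nat CARD('n) * (\<integral>\<^sup>+x. ennreal (\<bar>v x\<bar> powr p) \<partial>lborel) + ?S" by (simp add: sum.distrib)
    also have "\<dots> \<le> of_nat CARD('n) * (\<integral>\<^sup>+x. ennreal (\<bar>v x\<bar> powr p) \<partial>lborel) + of_nat CARD('n) * ?S"
      using mult_right_mono[OF N1, of ?S] by (intro add_left_mono) simp
    also have "\<dots> = of_nat CARD('n) * W1_energy p v" by (simp add: W distrib_left)
    finally have "emeasure lborel A * (\<Sum>i\<in>UNIV. \<integral>\<^sup>+x. ennreal \<bar>partial_deriv i (\<lambda>x. v x * v x) x\<bar> \<partial>lborel) \<le>
       emeasure lborel A * (of_nat CARD('n) * W1_energy p v)" by (rule mult_left_mono) simp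
    from order_trans[OF trace_inequality_aux[OF e \<gamma> t2, of A] this]
    show ?thesis by (simp add: p2 abs_powr_2 power2_eq_square)
  qed
qed

section \<open>Traces as almost everywhere limits\<close>

lemma powr_sum_le:
  assumes p: "p = 1 \<or> p = (2::real)"
  shows "\<bar>a + b\<bar> powr p \<le> 2 * \<bar>a\<bar> powr p + 2 * \<bar>b\<bar> powr p"
  using p
proof
  assume "p = 1" then show ?thesis using abs_triangle_ineq[of a b] abs_ge_zero[of a] abs_ge_zero[of b] by simp
next
  assume "p = 2" then show ?thesis using sq_sum_le[of a b] by (simp add: abs_powr_2)
qed

lemma nn_powr_sum_le:
  fixes f g :: "'a \<Rightarrow> real"
  assumes [measurable]: "f \<in> borel_measurable M" "g \<in> borel_measurable M" and p: "p = 1 \<or> p = 2"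
  shows "(\<integral>\<^sup>+x. ennreal (\<bar>f x + g x\<bar> powr p) \<partial>M) \<le>
    2 * (\<integral>\<^sup>+x. ennreal (\<bar>f x\<bar> powr p) \<partial>M) + 2 * (\<integral>\<^sup>+x. ennreal (\<bar>g x\<bar> powr p) \<partial>M)"
proof -
  have "(\<integral>\<^sup>+x. ennreal (\<bar>f x + g x\<bar> powr p) \<partial>M) \<le>
      (\<integral>\<^sup>+x. 2 * ennreal (\<bar>f x\<bar> powr p) + 2 * ennreal (\<bar>g x\<bar> powr p) \<partial>M)"
  proof (rule nn_integral_mono)
    fix x
    have "ennreal (\<bar>f x + g x\<bar> powr p) \<le> ennreal (2 * \<bar>f x\<bar> powr p + 2 * \<bar>g x\<bar> powr p)"
      by (intro ennreal_leI powr_sum_le p)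
    also have "\<dots> = 2 * ennreal (\<bar>f x\<bar> powr p) + 2 * ennreal (\<bar>g x\<bar> powr p)"
      by (simp add: ennreal_plus ennreal_mult)
    finally show "ennreal (\<bar>f x + g x\<bar> powr p) \<le> 2 * ennreal (\<bar>f x\<bar> powr p) + 2 * ennreal (\<bar>g x\<bar> powr p)" .
  qed
  also have "\<dots> = 2 * (\<integral>\<^sup>+x. ennreal (\<bar>f x\<bar> powr p) \<partial>M) + 2 * (\<integral>\<^sup>+x. ennreal (\<bar>g x\<bar> powr p) \<partial>M)"
    by (subst nn_integral_add) (auto simp: nn_integral_cmult)
  finally show ?thesis .
qed

definition W1_distance :: "real \<Rightarrow> (real^'n \<Rightarrow> real) \<Rightarrow> (real^'n \<Rightarrow> real) \<Rightarrow> ennreal" where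
  "W1_distance p v u = (\<integral>\<^sup>+x. ennreal (\<bar>v x - u x\<bar> powr p) \<partial>lebesgue) +
     (\<Sum>i\<in>UNIV. \<integral>\<^sup>+x. ennreal (\<bar>partial_deriv i v x - weak_pderiv i u x\<bar> powr p) \<partial>lebesgue)"

lemma tendsto_W1_W1_distance:
  assumes "tendsto_W1 p v u"
  shows "(\<lambda>k. W1_distance p (v k) u) \<longlonglongrightarrow> 0"
proof -
  have "(\<lambda>k. W1_distance p (v k) u) \<longlonglongrightarrow> 0 + (\<Sum>i\<in>(UNIV::'a set). 0)"
    unfolding W1_distance_def by (intro tendsto_add tendsto_sum) (use assms in \<open>auto simp: tendsto_W1_def\<close>)
  then show ?thesis by simp
qed

lemma sobolev_1_measurable:
  fixes u :: "real^'n \<Rightarrow> real"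
  assumes "sobolev 1 p u"
  shows "u \<in> borel_measurable lebesgue" "weak_pderiv i u \<in> borel_measurable lebesgue"
proof -
  have s: "sobolev (Suc 0) p u" using assms by simp
  show "u \<in> borel_measurable lebesgue" using sobolev_SucD(1)[OF s] by (simp add: Lp_def)
  show "weak_pderiv i u \<in> borel_measurable lebesgue"
    using sobolev_SucD(2)[OF s] by (auto simp: has_weak_pderiv_def locally_integrable_measurable)
qed

lemma W1_energy_diff_le:
  fixes u :: "real^'n \<Rightarrow> real"
  assumes v: "smooth v" "smooth v'" and u: "sobolev 1 p u" and p: "p = 1 \<or> p = 2"
  shows "W1_energy p (\<lambda>x. v x - v' x) \<le> 2 * W1_distance p v u + 2 * W1_distance p v' u"
proof -
  have *: "(\<integral>\<^sup>+x. ennreal (\<bar>a x - b x\<bar> powr p) \<partial>lebesgue) \<le>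
     2 * (\<integral>\<^sup>+x. ennreal (\<bar>a x - c x\<bar> powr p) \<partial>lebesgue) + 2 * (\<integral>\<^sup>+x. ennreal (\<bar>b x - c x\<bar> powr p) \<partial>lebesgue)"
    if "smooth a" "smooth b" "c \<in> borel_measurable lebesgue" for a b c :: "real^'n \<Rightarrow> real"
    using nn_powr_sum_le[of "\<lambda>x. a x - c x" lebesgue "\<lambda>x. c x - b x" p,
        OF borel_measurable_diff[OF smooth_lebesgue_measurable[OF that(1)] that(3)]
          borel_measurable_diff[OF that(3) smooth_lebesgue_measurable[OF that(2)]] p]
    by (simp add: abs_minus_commute[of "c _"])
  have pd: "partial_deriv i (\<lambda>x. v x - v' x) x = partial_deriv i v x - partial_deriv i v' x" for i x
    by (intro partial_deriv_diff smoothD v)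
  have "W1_energy p (\<lambda>x. v x - v' x) \<le> (2 * (\<integral>\<^sup>+x. ennreal (\<bar>v x - u x\<bar> powr p) \<partial>lebesgue) + 2 * (\<integral>\<^sup>+x. ennreal (\<bar>v' x - u x\<bar> powr p) \<partial>lebesgue))
    + (\<Sum>i\<in>UNIV. 2 * (\<integral>\<^sup>+x. ennreal (\<bar>partial_deriv i v x - weak_pderiv i u x\<bar> powr p) \<partial>lebesgue)
        + 2 * (\<integral>\<^sup>+x. ennreal (\<bar>partial_deriv i v' x - weak_pderiv i u x\<bar> powr p) \<partial>lebesgue))"
    unfolding W1_energy_def pd
    by (intro add_mono sum_mono * smoothD(2) v sobolev_1_measurable[OF u])
  also have "\<dots> = 2 * W1_distance p v u + 2 * W1_distance p v' u"
    unfolding W1_distance_def by (simp add: sum.distrib sum_distrib_left[symmetric] distrib_left add_ac)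
  finally show ?thesis .
qed

lemma test_function_diff:
  assumes "test_function f" "test_function g"
  shows "test_function (\<lambda>x. f x - g x)"
proof -
  obtain R where R: "\<And>x. norm x > R \<Longrightarrow> f x = 0" using test_functionD(2)[OF assms(1)] by auto
  obtain S where S: "\<And>x. norm x > S \<Longrightarrow> g x = 0" using test_functionD(2)[OF assms(2)] by auto
  show ?thesis
    by (rule test_functionI[where R="max R S", OF smooth_diff[OF test_functionD(1)[OF assms(1)] test_functionD(1)[OF assms(2)]]])
       (simp add: R S)
qed

lemma nn_integral_AE_limit_le:
  fixes F :: "nat \<Rightarrow> 'a \<Rightarrow> ennreal"
  assumes "\<And>l. F l \<in> borel_measurable M" "AE x in M. (\<lambda>l. F l x) \<longlonglongrightarrow> G x"
    and "\<And>l. l \<ge> N \<Longrightarrow> (\<integral>\<^sup>+x. F l x \<partial>M) \<le> c"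
  shows "(\<integral>\<^sup>+x. G x \<partial>M) \<le> c"
proof -
  have "(\<integral>\<^sup>+x. G x \<partial>M) = (\<integral>\<^sup>+x. liminf (\<lambda>l. F l x) \<partial>M)"
  proof (rule nn_integral_cong_AE)
    show "AE x in M. G x = liminf (\<lambda>l. F l x)"
      using assms(2) by eventually_elim (simp add: lim_imp_Liminf)
  qed
  also have "\<dots> \<le> liminf (\<lambda>l. \<integral>\<^sup>+x. F l x \<partial>M)" by (rule nn_integral_liminf[OF assms(1)])
  also have "\<dots> \<le> liminf (\<lambda>l::nat. c)"
    by (rule Liminf_mono) (use assms(3) in \<open>auto simp: eventually_sequentially\<close>)
  also have "\<dots> = c" by (simp add: Liminf_const)
  finally show ?thesis .
qed

text \<open>
  The trace inequality makes \<open>v\<close> a Cauchy sequence on the graph, and Fatou's lemma replaces the second index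
  by the almost everywhere limit.
\<close>

lemma trace_conv_slab:
  fixes u g :: "real^'n \<Rightarrow> real"
  assumes e: "norm e = 1" and \<gamma>: "C11 \<gamma>" and p: "p = 1 \<or> p = 2"
    and v: "\<And>k. test_function (v k)" and u: "sobolev 1 p u" and W: "tendsto_W1 p v u"
    and lim: "AE z in lborel. (\<lambda>k. v k (graph_map e \<gamma> z)) \<longlonglongrightarrow> g (graph_map e \<gamma> z)"
    and A[measurable]: "A \<in> sets borel" and fin: "emeasure lborel A < \<infinity>"
  shows "(\<lambda>k. \<integral>\<^sup>+z. indicator A (z \<bullet> e) * ennreal (\<bar>v k (graph_map e \<gamma> z) - g (graph_map e \<gamma> z)\<bar> powr p) \<partial>lborel) \<longlonglongrightarrow> 0"
proof (rule tendsto_0_ennrealI)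
  fix \<epsilon> :: real assume \<epsilon>: "\<epsilon> > 0"
  have sm: "smooth (v k)" for k by (rule test_functionD[OF v])
  have [measurable]: "v k \<in> borel_measurable borel" for k by (rule smoothD(5)[OF sm])
  have [measurable]: "graph_map e \<gamma> \<in> borel_measurable borel" by (rule graph_map_measurable[OF e \<gamma>])
  obtain a where a: "emeasure lborel A = ennreal a" "a \<ge> 0" using fin by (cases "emeasure lborel A") auto
  define c where "c = a * real CARD('n)"
  have c0: "c \<ge> 0" using a(2) by (simp add: c_def)
  define \<delta> where "\<delta> = \<epsilon> / (4 * (c + 1))"
  have \<delta>: "\<delta> > 0" using \<epsilon> c0 by (simp add: \<delta>_def)
  obtain M where M: "\<And>k. k \<ge> M \<Longrightarrow> W1_distance p (v k) u \<le> ennreal \<delta>"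
    using tendsto_0_ennrealD[OF tendsto_W1_W1_distance[OF W] \<delta>] by (auto simp: eventually_sequentially)
  have kl: "(\<integral>\<^sup>+z. indicator A (z \<bullet> e) * ennreal (\<bar>v k (graph_map e \<gamma> z) - v l (graph_map e \<gamma> z)\<bar> powr p) \<partial>lborel) \<le> ennreal \<epsilon>"
    if "k \<ge> M" "l \<ge> M" for k l
  proof -
    have "(\<integral>\<^sup>+z. indicator A (z \<bullet> e) * ennreal (\<bar>v k (graph_map e \<gamma> z) - v l (graph_map e \<gamma> z)\<bar> powr p) \<partial>lborel)
       \<le> emeasure lborel A * (of_nat CARD('n) * W1_energy p (\<lambda>x. v k x - v l x))"
      by (rule trace_inequality[OF e \<gamma> test_function_diff[OF v v] A p])
    also have "\<dots> \<le> emeasure lborel A * (of_nat CARD('n) * (2 * ennreal \<delta> + 2 * ennreal \<delta>))"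
      by (intro mult_left_mono order_trans[OF W1_energy_diff_le[OF sm sm u p]] add_mono M that) auto
    also have "\<dots> = ennreal (c * (4 * \<delta>))"
    proof -
      have "2 * ennreal \<delta> + 2 * ennreal \<delta> = ennreal (4 * \<delta>)"
      proof -
        have "2 * ennreal \<delta> = ennreal (2 * \<delta>)" using \<delta> by (simp add: ennreal_mult)
        then show ?thesis using \<delta> by (simp flip: ennreal_plus)
      qed
      moreover have "(of_nat CARD('n) :: ennreal) = ennreal (real CARD('n))" by (simp add: ennreal_of_nat_eq_real_of_nat)
      ultimately show ?thesis using a \<delta> by (simp add: c_def ennreal_mult mult_ac)
    qed
    also have "\<dots> \<le> ennreal \<epsilon>" using \<epsilon> c0 by (intro ennreal_leI) (simp add: \<delta>_def field_simps)
    finally show ?thesis .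
  qed
  have "(\<integral>\<^sup>+z. indicator A (z \<bullet> e) * ennreal (\<bar>v k (graph_map e \<gamma> z) - g (graph_map e \<gamma> z)\<bar> powr p) \<partial>lborel) \<le> ennreal \<epsilon>"
    if k: "k \<ge> M" for k
  proof (rule nn_integral_AE_limit_le[where N=M])
    show "(\<lambda>z. indicator A (z \<bullet> e) * ennreal (\<bar>v k (graph_map e \<gamma> z) - v l (graph_map e \<gamma> z)\<bar> powr p)) \<in> borel_measurable lborel" for l
      by measurable
    show "AE z in lborel. (\<lambda>l. indicator A (z \<bullet> e) * ennreal (\<bar>v k (graph_map e \<gamma> z) - v l (graph_map e \<gamma> z)\<bar> powr p))
       \<longlonglongrightarrow> indicator A (z \<bullet> e) * ennreal (\<bar>v k (graph_map e \<gamma> z) - g (graph_map e \<gamma> z)\<bar> powr p)"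
      using lim
    proof eventually_elim
      case (elim z)
      have "(\<lambda>l. \<bar>v k (graph_map e \<gamma> z) - v l (graph_map e \<gamma> z)\<bar> powr p) \<longlonglongrightarrow> \<bar>v k (graph_map e \<gamma> z) - g (graph_map e \<gamma> z)\<bar> powr p"
        using p
      proof
        assume "p = 1" then show ?thesis using elim by (simp add: tendsto_intros)
      next
        assume "p = 2" then show ?thesis using elim unfolding \<open>p = 2\<close> abs_powr_2 by (intro tendsto_intros)
      qed
      then show ?case by (intro ennreal_tendsto_cmult tendsto_ennrealI) (auto simp: indicator_def)
    qed
    show "(\<integral>\<^sup>+z. indicator A (z \<bullet> e) * ennreal (\<bar>v k (graph_map e \<gamma> z) - v l (graph_map e \<gamma> z)\<bar> powr p) \<partial>lborel) \<le> ennreal \<epsilon>"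
      if "l \<ge> M" for l by (rule kl[OF k that])
  qed
  then show "\<forall>\<^sub>F k in sequentially. (\<integral>\<^sup>+z. indicator A (z \<bullet> e) * ennreal (\<bar>v k (graph_map e \<gamma> z) - g (graph_map e \<gamma> z)\<bar> powr p) \<partial>lborel) \<le> ennreal \<epsilon>"
    unfolding eventually_sequentially by blast
qed

lemma graph_measure_compact_bound:
  fixes e :: "real^'n"
  assumes e: "norm e = 1" and \<gamma>: "C11 \<gamma>" and K: "compact K"
  shows "\<exists>C\<ge>0. \<forall>F\<in>borel_measurable borel. (\<integral>\<^sup>+x\<in>K. F x \<partial>graph_measure e \<gamma>) \<le>
      ennreal C * (\<integral>\<^sup>+z. indicator {0..1} (z \<bullet> e) * F (graph_map e \<gamma> z) \<partial>lborel)"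
proof -
  have Kb[measurable]: "K \<in> sets borel" using K by (simp add: compact_imp_closed borel_closed)
  have gd[measurable]: "graph_density e \<gamma> \<in> borel_measurable borel" by (rule graph_density_measurable[OF e \<gamma>])
  have [measurable]: "graph_map e \<gamma> \<in> borel_measurable borel" by (rule graph_map_measurable[OF e \<gamma>])
  have "compact (graph_density e \<gamma> ` (tangential e ` K))"
    by (intro compact_continuous_image graph_density_continuous[OF e \<gamma>] tangential_continuous K)
  then obtain C where C: "C > 0" "\<And>x. x \<in> K \<Longrightarrow> \<bar>graph_density e \<gamma> (tangential e x)\<bar> \<le> C"
    using compact_imp_bounded[of "graph_density e \<gamma> ` (tangential e ` K)"] by (auto simp: bounded_pos)
  have "(\<integral>\<^sup>+x\<in>K. F x \<partial>graph_measure e \<gamma>) \<le> ennreal C * (\<integral>\<^sup>+z. indicator {0..1} (z \<bullet> e) * F (graph_map e \<gamma> z) \<partial>lborel)"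
    if [measurable]: "F \<in> borel_measurable borel" for F
  proof -
    have "(\<integral>\<^sup>+x\<in>K. F x \<partial>graph_measure e \<gamma>) = (\<integral>\<^sup>+z. indicator {0..1} (z \<bullet> e) * (ennreal (graph_density e \<gamma> (tangential e z)) *
        (F (graph_map e \<gamma> z) * indicator K (graph_map e \<gamma> z))) \<partial>lborel)"
      by (rule nn_integral_graph_measure[OF e \<gamma>]) measurable
    also have "\<dots> \<le> (\<integral>\<^sup>+z. ennreal C * (indicator {0..1} (z \<bullet> e) * F (graph_map e \<gamma> z)) \<partial>lborel)"
    proof (rule nn_integral_mono)
      fix z
      show "indicator {0..1} (z \<bullet> e) * (ennreal (graph_density e \<gamma> (tangential e z)) * (F (graph_map e \<gamma> z) * indicator K (graph_map e \<gamma> z)))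
         \<le> ennreal C * (indicator {0..1} (z \<bullet> e) * F (graph_map e \<gamma> z))"
      proof (cases "graph_map e \<gamma> z \<in> K")
        case True
        from C(2)[OF True] have "graph_density e \<gamma> (tangential e z) \<le> C"
          by (simp add: tangential_graph_map[OF e \<gamma>])
        then have "ennreal (graph_density e \<gamma> (tangential e z)) * (indicator {0..1} (z \<bullet> e) * F (graph_map e \<gamma> z)) \<le>
            ennreal C * (indicator {0..1} (z \<bullet> e) * F (graph_map e \<gamma> z))"
          by (intro mult_right_mono ennreal_leI) auto
        then show ?thesis using True by (simp add: mult_ac)
      qed simp
    qed
    also have "\<dots> = ennreal C * (\<integral>\<^sup>+z. indicator {0..1} (z \<bullet> e) * F (graph_map e \<gamma> z) \<partial>lborel)"
      by (rule nn_integral_cmult) measurable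
    finally show ?thesis .
  qed
  with C(1) show ?thesis by (intro exI[of _ C]) auto
qed

lemma is_boundary_traceI:
  fixes u g :: "real^'n \<Rightarrow> real"
  assumes p: "p = 1 \<or> p = 2"
    and v: "\<And>k. test_function (v k)" and u: "sobolev 1 p u" and W: "tendsto_W1 p v u"
    and g[measurable]: "g \<in> borel_measurable borel" and \<Gamma>: "\<Gamma> \<in> sets borel"
    and lim: "\<And>e \<gamma>. norm e = 1 \<Longrightarrow> C11 \<gamma> \<Longrightarrow>
      AE z in lborel. (\<lambda>k. v k (graph_map e \<gamma> z)) \<longlonglongrightarrow> g (graph_map e \<gamma> z)"
  shows "is_boundary_trace p \<Omega> \<Gamma> u g"
proof -
  have [measurable]: "v k \<in> borel_measurable borel" for k by (rule smoothD(5)[OF test_functionD(1)[OF v]])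
  have "tendsto_Lp_loc_boundary p \<Omega> \<Gamma> v g"
    unfolding tendsto_Lp_loc_boundary_def
  proof (intro allI impI)
    fix x0 r e \<gamma> K assume c: "C11_chart \<Omega> x0 r e \<gamma>" and K: "compact K" "K \<subseteq> \<Gamma> \<inter> ball x0 r"
    have e: "norm e = 1" and \<gamma>: "C11 \<gamma>" using c by (auto simp: C11_chart_def)
    obtain C where C: "C \<ge> 0" "\<And>F. F \<in> borel_measurable borel \<Longrightarrow> (\<integral>\<^sup>+x\<in>K. F x \<partial>graph_measure e \<gamma>) \<le>
      ennreal C * (\<integral>\<^sup>+z. indicator {0..1} (z \<bullet> e) * F (graph_map e \<gamma> z) \<partial>lborel)"
      using graph_measure_compact_bound[OF e \<gamma> K(1)] by blast
    show "(\<lambda>k. \<integral>\<^sup>+x\<in>K. ennreal (\<bar>v k x - g x\<bar> powr p) \<partial>graph_measure e \<gamma>) \<longlonglongrightarrow> 0"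
    proof (rule tendsto_0_le)
      have "(\<lambda>k. \<integral>\<^sup>+z. indicator {0..1} (z \<bullet> e) * ennreal (\<bar>v k (graph_map e \<gamma> z) - g (graph_map e \<gamma> z)\<bar> powr p) \<partial>lborel) \<longlonglongrightarrow> 0"
        by (rule trace_conv_slab[OF e \<gamma> p v u W lim[OF e \<gamma>]]) auto
      from ennreal_tendsto_cmult[OF _ this, of "ennreal C"]
      show "(\<lambda>k. ennreal C * (\<integral>\<^sup>+z. indicator {0..1} (z \<bullet> e) * ennreal (\<bar>v k (graph_map e \<gamma> z) - g (graph_map e \<gamma> z)\<bar> powr p) \<partial>lborel)) \<longlonglongrightarrow> 0"
        by simp
      show "(\<integral>\<^sup>+x\<in>K. ennreal (\<bar>v k x - g x\<bar> powr p) \<partial>graph_measure e \<gamma>) \<le>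
         ennreal C * (\<integral>\<^sup>+z. indicator {0..1} (z \<bullet> e) * ennreal (\<bar>v k (graph_map e \<gamma> z) - g (graph_map e \<gamma> z)\<bar> powr p) \<partial>lborel)" for k
        by (rule C(2)) measurable
    qed
  qed
  moreover have "set_borel_measurable borel \<Gamma> g"
    unfolding set_borel_measurable_def using \<Gamma> by measurable
  ultimately show ?thesis using v u W unfolding is_boundary_trace_def by blast
qed

text \<open>
  Two approximating sequences have the same Sobolev limit, so by the trace inequality they have the same limit
  on every compact part of the graph. A relatively open part of the boundary is a countable union of such compact sets.
\<close>

lemma is_boundary_trace_unique:
  fixes u g g' :: "real^'n \<Rightarrow> real"
  assumes p: "p = 1 \<or> p = 2" and op: "openin (top_of_set (frontier \<Omega>)) \<Gamma>"
    and tr: "is_boundary_trace p \<Omega> \<Gamma> u g" "is_boundary_trace p \<Omega> \<Gamma> u g'"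
  shows "AE_boundary \<Omega> \<Gamma> (\<lambda>x. g x = g' x)"
  unfolding AE_boundary_def
proof (intro allI impI)
  fix x0 r e \<gamma> assume c: "C11_chart \<Omega> x0 r e \<gamma>"
  then have e: "norm e = 1" and \<gamma>: "C11 \<gamma>" by (auto simp: C11_chart_def)
  have u: "sobolev 1 p u" using tr(1) by (simp add: is_boundary_trace_def)
  obtain v where v: "\<And>k. test_function (v k)" "tendsto_W1 p v u" "tendsto_Lp_loc_boundary p \<Omega> \<Gamma> v g"
    using tr(1) by (auto simp: is_boundary_trace_def)
  obtain v' where v': "\<And>k. test_function (v' k)" "tendsto_W1 p v' u" "tendsto_Lp_loc_boundary p \<Omega> \<Gamma> v' g'"
    using tr(2) by (auto simp: is_boundary_trace_def)
  have sm: "smooth (v k)" "smooth (v' k)" for k using v(1) v'(1) test_functionD(1) by auto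
  have vm[measurable]: "v k \<in> borel_measurable borel" "v' k \<in> borel_measurable borel" for k
    by (rule smoothD(5)[OF sm(1)], rule smoothD(5)[OF sm(2)])
  obtain T where T: "open T" "\<Gamma> = frontier \<Omega> \<inter> T" using op by (auto simp: openin_open)
  have compact_case: "AE x in graph_measure e \<gamma>. x \<in> K \<longrightarrow> g x = g' x" if K: "compact K" "K \<subseteq> \<Gamma> \<inter> ball x0 r" for K
  proof -
    have Kb[measurable]: "K \<in> sets borel" using K by (simp add: compact_imp_closed borel_closed)
    have sg: "sets (graph_measure e \<gamma>) = sets borel" by (simp add: graph_measure_def)
    have gm: "(\<lambda>x. indicator K x * f x) \<in> borel_measurable borel" if "set_borel_measurable borel \<Gamma> f" for f :: "real^'n \<Rightarrow> real"
    proof -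
      have "(\<lambda>x. indicator K x * (indicator \<Gamma> x *\<^sub>R f x)) \<in> borel_measurable borel"
        using that unfolding set_borel_measurable_def by measurable
      moreover have "(\<lambda>x. indicator K x * (indicator \<Gamma> x *\<^sub>R f x)) = (\<lambda>x. indicator K x * f x)"
        using K(2) by (auto simp: indicator_def fun_eq_iff)
      ultimately show ?thesis by simp
    qed
    let ?g = "\<lambda>x. indicator K x * g x" and ?g' = "\<lambda>x. indicator K x * g' x"
    have [measurable]: "?g \<in> borel_measurable borel" "?g' \<in> borel_measurable borel"
      using tr by (auto intro!: gm simp: is_boundary_trace_def)
    have meas: "f \<in> borel_measurable (graph_measure e \<gamma>)" if "f \<in> borel_measurable borel" for f :: "real^'n \<Rightarrow> real"
      using that measurable_cong_sets[OF sg refl] by blast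
    define I where "I f = (\<integral>\<^sup>+x. ennreal (\<bar>f x\<bar> powr p) \<partial>graph_measure e \<gamma>)" for f :: "real^'n \<Rightarrow> real"
    have Iadd: "I (\<lambda>x. f x + h x) \<le> 2 * I f + 2 * I h" if "f \<in> borel_measurable borel" "h \<in> borel_measurable borel" for f h
      unfolding I_def by (rule nn_powr_sum_le[OF meas[OF that(1)] meas[OF that(2)] p])
    have pne: "0 powr p = 0" by simp
    have IK: "I (\<lambda>x. indicator K x * f x) = (\<integral>\<^sup>+x\<in>K. ennreal (\<bar>f x\<bar> powr p) \<partial>graph_measure e \<gamma>)" for f
      unfolding I_def by (rule nn_integral_cong) (auto simp: indicator_def)
    have c1: "(\<lambda>k. I (\<lambda>x. indicator K x * (v k x - g x))) \<longlonglongrightarrow> 0"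
      unfolding IK using v(3) c K unfolding tendsto_Lp_loc_boundary_def by blast
    have c2: "(\<lambda>k. I (\<lambda>x. indicator K x * (v' k x - g' x))) \<longlonglongrightarrow> 0"
      unfolding IK using v'(3) c K unfolding tendsto_Lp_loc_boundary_def by blast
    obtain C where C: "C \<ge> 0" "\<And>F. F \<in> borel_measurable borel \<Longrightarrow> (\<integral>\<^sup>+x\<in>K. F x \<partial>graph_measure e \<gamma>) \<le>
      ennreal C * (\<integral>\<^sup>+z. indicator {0..1} (z \<bullet> e) * F (graph_map e \<gamma> z) \<partial>lborel)"
      using graph_measure_compact_bound[OF e \<gamma> K(1)] by blast
    have c3: "(\<lambda>k. I (\<lambda>x. indicator K x * (v k x - v' k x))) \<longlonglongrightarrow> 0"
    proof (rule tendsto_0_le)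
      have t: "(\<lambda>k. 2 * W1_distance p (v k) u + 2 * W1_distance p (v' k) u) \<longlonglongrightarrow> 0"
        by (intro tendsto_0_2add tendsto_W1_W1_distance v v')
      have "(\<lambda>k. (ennreal C * of_nat CARD('n)) * (2 * W1_distance p (v k) u + 2 * W1_distance p (v' k) u)) \<longlonglongrightarrow> (ennreal C * of_nat CARD('n)) * 0"
        by (rule ennreal_tendsto_cmult[OF _ t]) (auto simp: ennreal_mult_less_top of_nat_less_top)
      then show "(\<lambda>k. (ennreal C * of_nat CARD('n)) * (2 * W1_distance p (v k) u + 2 * W1_distance p (v' k) u)) \<longlonglongrightarrow> 0" by simp
      fix k
      have "I (\<lambda>x. indicator K x * (v k x - v' k x)) \<le>
         ennreal C * (\<integral>\<^sup>+z. indicator {0..1} (z \<bullet> e) * ennreal (\<bar>v k (graph_map e \<gamma> z) - v' k (graph_map e \<gamma> z)\<bar> powr p) \<partial>lborel)"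
        unfolding IK by (rule C(2)) measurable
      also have "\<dots> \<le> ennreal C * (emeasure lborel {0..1::real} * (of_nat CARD('n) * W1_energy p (\<lambda>x. v k x - v' k x)))"
        by (intro mult_left_mono trace_inequality[OF e \<gamma> test_function_diff[OF v(1) v'(1)] _ p]) auto
      also have "\<dots> \<le> ennreal C * (emeasure lborel {0..1::real} * (of_nat CARD('n) * (2 * W1_distance p (v k) u + 2 * W1_distance p (v' k) u)))"
        by (intro mult_left_mono W1_energy_diff_le[OF sm(1) sm(2) u p]) auto
      finally show "I (\<lambda>x. indicator K x * (v k x - v' k x)) \<le> (ennreal C * of_nat CARD('n)) * (2 * W1_distance p (v k) u + 2 * W1_distance p (v' k) u)"
        by (simp add: mult.assoc)
    qed
    have minus: "I (\<lambda>x. indicator K x * (a x - b x)) = I (\<lambda>x. indicator K x * (b x - a x))" for a b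
      unfolding IK by (simp add: abs_minus_commute)
    have m: "(\<lambda>x. indicator K x * (v k x - g x)) \<in> borel_measurable borel"
      "(\<lambda>x. indicator K x * (v' k x - g' x)) \<in> borel_measurable borel"
      "(\<lambda>x. indicator K x * (v k x - v' k x)) \<in> borel_measurable borel"
      "(\<lambda>x. indicator K x * (g x - v k x)) \<in> borel_measurable borel" for k
      by (simp_all only: right_diff_distrib) measurable
    have bound: "I (\<lambda>x. indicator K x * (g x - g' x)) \<le> 2 * I (\<lambda>x. indicator K x * (v k x - g x)) +
        2 * (2 * I (\<lambda>x. indicator K x * (v k x - v' k x)) + 2 * I (\<lambda>x. indicator K x * (v' k x - g' x)))" for k
    proof -
      have e1: "indicator K x * (g x - g' x) = indicator K x * (g x - v k x) +
         (indicator K x * (v k x - v' k x) + indicator K x * (v' k x - g' x))" for x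
        by (simp add: algebra_simps)
      have "I (\<lambda>x. indicator K x * (g x - g' x)) \<le> 2 * I (\<lambda>x. indicator K x * (g x - v k x)) +
         2 * I (\<lambda>x. indicator K x * (v k x - v' k x) + indicator K x * (v' k x - g' x))"
        unfolding e1 by (intro Iadd m borel_measurable_add)
      also have "I (\<lambda>x. indicator K x * (v k x - v' k x) + indicator K x * (v' k x - g' x)) \<le>
          2 * I (\<lambda>x. indicator K x * (v k x - v' k x)) + 2 * I (\<lambda>x. indicator K x * (v' k x - g' x))"
        by (intro Iadd m)
      finally show ?thesis by (simp add: minus[of g] add_left_mono mult_left_mono)
    qed
    have "(\<lambda>k::nat. I (\<lambda>x. indicator K x * (g x - g' x))) \<longlonglongrightarrow> 0"
      by (rule tendsto_0_le[OF tendsto_0_2add[OF c1 tendsto_0_2add[OF c3 c2]] bound])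
    then have "I (\<lambda>x. indicator K x * (g x - g' x)) = 0" by (simp add: LIMSEQ_const_iff)
    then have "AE x in graph_measure e \<gamma>. ennreal (\<bar>indicator K x * (g x - g' x)\<bar> powr p) = 0"
      unfolding I_def
    proof (subst (asm) nn_integral_0_iff_AE)
      have "(\<lambda>x. indicator K x * (g x - g' x)) \<in> borel_measurable borel" by (simp only: right_diff_distrib) measurable
      from meas[OF this] show "(\<lambda>x. ennreal (\<bar>indicator K x * (g x - g' x)\<bar> powr p)) \<in> borel_measurable (graph_measure e \<gamma>)"
        by measurable
    qed
    then show ?thesis by eventually_elim (auto simp: indicator_def)
  qed
  have "open (T \<inter> ball x0 r)" using T(1) by (intro open_Int open_ball)
  from open_countable_Union_open_cbox[OF this] obtain D where
    D: "countable D" "\<And>X. X \<in> D \<Longrightarrow> \<exists>a b. X = cbox a b" "\<Union>D = T \<inter> ball x0 r" by metis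
  have "AE x in graph_measure e \<gamma>. x \<in> frontier \<Omega> \<inter> X \<longrightarrow> g x = g' x" if "X \<in> D" for X
  proof (rule compact_case)
    show "compact (frontier \<Omega> \<inter> X)" using D(2)[OF that] by (auto intro: closed_Int_compact)
    show "frontier \<Omega> \<inter> X \<subseteq> \<Gamma> \<inter> ball x0 r" using D(3) that T(2) by auto
  qed
  then have "AE x in graph_measure e \<gamma>. \<forall>X\<in>D. x \<in> frontier \<Omega> \<inter> X \<longrightarrow> g x = g' x"
    by (subst AE_ball_countable[OF D(1)]) blast
  then show "AE x in graph_measure e \<gamma>. x \<in> \<Gamma> \<inter> ball x0 r \<longrightarrow> g x = g' x"
  proof eventually_elim
    case (elim x)
    show ?case
    proof
      assume "x \<in> \<Gamma> \<inter> ball x0 r"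
      then have "x \<in> frontier \<Omega>" "x \<in> \<Union>D" using T(2) D(3) by auto
      then show "g x = g' x" using elim by blast
    qed
  qed
qed

text \<open>
  Identifies the chosen trace, up to null sets, from any approximating sequence that converges almost everywhere.
\<close>

lemma boundary_trace_eq:
  fixes u g :: "real^'n \<Rightarrow> real"
  assumes p: "p = 1 \<or> p = 2" and op: "openin (top_of_set (frontier \<Omega>)) \<Gamma>"
    and v: "\<And>k. test_function (v k)" and u: "sobolev 1 p u" and W: "tendsto_W1 p v u"
    and g: "g \<in> borel_measurable borel"
    and lim: "\<And>e \<gamma>. norm e = 1 \<Longrightarrow> C11 \<gamma> \<Longrightarrow>
      AE z in lborel. (\<lambda>k. v k (graph_map e \<gamma> z)) \<longlonglongrightarrow> g (graph_map e \<gamma> z)"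
  shows "AE_boundary \<Omega> \<Gamma> (\<lambda>x. boundary_trace p \<Omega> \<Gamma> u x = g x)"
proof -
  obtain T where T: "open T" "\<Gamma> = frontier \<Omega> \<inter> T" using op by (auto simp: openin_open)
  have "\<Gamma> \<in> sets borel" unfolding T(2) using T(1) by (intro sets.Int borel_closed borel_open frontier_closed)
  then have tr: "is_boundary_trace p \<Omega> \<Gamma> u g" by (intro is_boundary_traceI[OF p v u W g _ lim])
  then have "is_boundary_trace p \<Omega> \<Gamma> u (boundary_trace p \<Omega> \<Gamma> u)"
    unfolding boundary_trace_def by (rule someI[of "is_boundary_trace p \<Omega> \<Gamma> u"])
  from is_boundary_trace_unique[OF p op this tr] show ?thesis .
qed

text \<open>
  Geometric decay of the energies makes the increments summable almost everywhere. The hypothesis does not mention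
  the graph, so one and the same sequence converges on all graphs; this provides a single trace for all charts.
\<close>

lemma fast_convergence_AE:
  fixes v :: "nat \<Rightarrow> real^'n \<Rightarrow> real"
  assumes e: "norm e = 1" and \<gamma>: "C11 \<gamma>" and v: "\<And>k. test_function (v k)"
    and fast: "\<And>k. W1_energy 2 (\<lambda>x. v (Suc k) x - v k x) \<le> ennreal (c / 16 ^ k)" and c: "c \<ge> 0"
  shows "AE z in lborel. convergent (\<lambda>k. v k (graph_map e \<gamma> z))"
proof -
  have [measurable]: "v k \<in> borel_measurable borel" for k by (rule smoothD(5)[OF test_functionD(1)[OF v]])
  have [measurable]: "graph_map e \<gamma> \<in> borel_measurable borel" by (rule graph_map_measurable[OF e \<gamma>])
  define d where "d k z = v (Suc k) (graph_map e \<gamma> z) - v k (graph_map e \<gamma> z)" for k z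
  have [measurable]: "d k \<in> borel_measurable borel" for k unfolding d_def by measurable
  have "AE z in lborel. z \<bullet> e \<in> {- real R..real R} \<longrightarrow> convergent (\<lambda>k. v k (graph_map e \<gamma> z))" for R :: nat
  proof -
    let ?A = "{- real R..real R}"
    \<comment> \<open>the weights \<open>4\<^sup>k\<close> are beaten by the decay \<open>16\<^sup>-\<^sup>k\<close> and give \<open>\<bar>d k z\<bar> \<le> C 2\<^sup>-\<^sup>k\<close>\<close>
    let ?t = "\<lambda>k z. ennreal (4 ^ k) * (indicator ?A (z \<bullet> e) * ennreal ((d k z)^2))"
    define B where "B = 2 * real R * real CARD('n) * c"
    have B0: "B \<ge> 0" using c by (simp add: B_def)
    have tk: "(\<integral>\<^sup>+z. ?t k z \<partial>lborel) \<le> ennreal (B * (1/4) ^ k)" for k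
    proof -
      have "(\<integral>\<^sup>+z. ?t k z \<partial>lborel) = ennreal (4 ^ k) * (\<integral>\<^sup>+z. indicator ?A (z \<bullet> e) * ennreal ((d k z)^2) \<partial>lborel)"
        by (rule nn_integral_cmult) measurable
      also have "(\<integral>\<^sup>+z. indicator ?A (z \<bullet> e) * ennreal ((d k z)^2) \<partial>lborel) \<le>
         emeasure lborel ?A * (of_nat CARD('n) * W1_energy 2 (\<lambda>x. v (Suc k) x - v k x))"
        using trace_inequality[OF e \<gamma> test_function_diff[OF v v], of ?A 2 "Suc k" k]
        by (simp add: d_def abs_powr_2)
      also have "\<dots> \<le> emeasure lborel ?A * (of_nat CARD('n) * ennreal (c / 16 ^ k))"
        by (intro mult_left_mono fast) auto
      also have "\<dots> = ennreal (2 * real R * (real CARD('n) * (c / 16 ^ k)))"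
      proof -
        have em: "emeasure lborel ?A = ennreal (2 * real R)" by (subst emeasure_lborel_Icc) auto
        have i: "ennreal (real CARD('n)) * ennreal (c / 16 ^ k) = ennreal (real CARD('n) * (c / 16 ^ k))"
          by (rule ennreal_mult[symmetric]) (use c in auto)
        show ?thesis
          unfolding em ennreal_of_nat_eq_real_of_nat i by (rule ennreal_mult[symmetric]) (use c in auto)
      qed
      also have "ennreal (4 ^ k) * ennreal (2 * real R * (real CARD('n) * (c / 16 ^ k))) = ennreal (4 ^ k * (2 * real R * (real CARD('n) * (c / 16 ^ k))))"
        using c by (intro ennreal_mult[symmetric]) auto
      also have "4 ^ k * (2 * real R * (real CARD('n) * (c / 16 ^ k))) = B * (1/4) ^ k"
      proof -
        have "(16::real) ^ k = 4 ^ k * 4 ^ k" by (simp add: power_mult_distrib[symmetric])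
        then show ?thesis by (simp add: B_def power_divide)
      qed
      finally show ?thesis by (simp add: mult_left_mono)
    qed
    have "(\<integral>\<^sup>+z. (\<Sum>k. ?t k z) \<partial>lborel) = (\<Sum>k. \<integral>\<^sup>+z. ?t k z \<partial>lborel)"
      by (rule nn_integral_suminf) measurable
    also have "\<dots> \<le> (\<Sum>k. ennreal (B * (1/4) ^ k))" by (intro suminf_le tk) auto
    also have "\<dots> = ennreal (\<Sum>k. B * (1/4) ^ k)"
      by (rule suminf_ennreal2) (auto intro!: summable_mult summable_geometric simp: B0)
    finally have "(\<integral>\<^sup>+z. (\<Sum>k. ?t k z) \<partial>lborel) \<noteq> \<infinity>" by (auto simp: top_unique)
    then have "AE z in lborel. (\<Sum>k. ?t k z) \<noteq> \<infinity>" by (intro nn_integral_PInf_AE) measurable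
    then show ?thesis
    proof eventually_elim
      case (elim z)
      show ?case
      proof
        assume z: "z \<bullet> e \<in> ?A"
        obtain S where S: "(\<Sum>k. ?t k z) = ennreal S" "S \<ge> 0" using elim by (cases "\<Sum>k. ?t k z") auto
        have dk: "\<bar>d k z\<bar> \<le> sqrt S * (1/2) ^ k" for k
        proof -
          have "?t k z \<le> (\<Sum>k. ?t k z)" using sum_le_suminf[of "\<lambda>k. ?t k z" "{k}"] by auto
          then have "ennreal (4 ^ k * (d k z)^2) \<le> ennreal S" using z S by (simp add: ennreal_mult)
          then have "4 ^ k * (d k z)^2 \<le> S" using S(2) by simp
          moreover have "(4::real) ^ k = (2 ^ k)^2" by (simp add: power_mult[symmetric] mult.commute power2_eq_square power_mult_distrib[symmetric])
          ultimately have "(2 ^ k * \<bar>d k z\<bar>)^2 \<le> S" by (simp add: power_mult_distrib)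
          then have "2 ^ k * \<bar>d k z\<bar> \<le> sqrt S" by (rule real_le_rsqrt)
          then show ?thesis by (simp add: power_divide field_simps)
        qed
        have "summable (\<lambda>k. d k z)"
          by (rule summable_comparison_test'[of "\<lambda>k. sqrt S * (1/2) ^ k" 0]) (auto intro!: summable_mult summable_geometric dk)
        then have "convergent (\<lambda>n. \<Sum>k<n. d k z)" by (simp add: summable_iff_convergent)
        moreover have "(\<Sum>k<n. d k z) = v n (graph_map e \<gamma> z) - v 0 (graph_map e \<gamma> z)" for n
          unfolding d_def by (rule sum_lessThan_telescope)
        ultimately have "convergent (\<lambda>n. v n (graph_map e \<gamma> z) - v 0 (graph_map e \<gamma> z))" by simp
        then have "convergent (\<lambda>n. (v n (graph_map e \<gamma> z) - v 0 (graph_map e \<gamma> z)) + v 0 (graph_map e \<gamma> z))"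
          by (intro convergent_add convergent_const)
        then show "convergent (\<lambda>k. v k (graph_map e \<gamma> z))" by simp
      qed
    qed
  qed
  then have "AE z in lborel. \<forall>R::nat. z \<bullet> e \<in> {- real R..real R} \<longrightarrow> convergent (\<lambda>k. v k (graph_map e \<gamma> z))"
    unfolding AE_all_countable by blast
  then show ?thesis
  proof eventually_elim
    case (elim z)
    obtain R :: nat where "\<bar>z \<bullet> e\<bar> \<le> real R" using real_arch_simple by blast
    then have "z \<bullet> e \<in> {- real R..real R}" by (auto simp: abs_le_iff)
    with elim show ?case by blast
  qed
qed

section \<open>The normal of a graph\<close>

lemma difference_quotient_LIMSEQ:
  fixes f :: "'a::real_normed_vector \<Rightarrow> 'b::real_normed_vector"
  assumes "(f has_derivative f') (at x)"
  shows "(\<lambda>n. (f (x + step_size n *\<^sub>R w) - f x) /\<^sub>R step_size n) \<longlonglongrightarrow> f' w"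
proof (cases "w = 0")
  case True
  have "f' 0 = 0" by (rule linear_0[OF has_derivative_linear[OF assms]])
  then show ?thesis using True by simp
next
  case False
  have lin: "linear f'" by (rule has_derivative_linear[OF assms])
  have "(\<lambda>h. norm (f (x + h) - f x - f' h) / norm h) \<midarrow>0\<rightarrow> 0" using assms by (simp add: has_derivative_at)
  moreover have "filterlim (\<lambda>n. step_size n *\<^sub>R w) (at 0) sequentially"
    unfolding filterlim_at
  proof
    show "\<forall>\<^sub>F n in sequentially. step_size n *\<^sub>R w \<in> UNIV \<and> step_size n *\<^sub>R w \<noteq> 0" using False by (simp add: step_size_neq_0)
    show "(\<lambda>n. step_size n *\<^sub>R w) \<longlonglongrightarrow> 0" using tendsto_scaleR[OF step_size(3) tendsto_const[of w]] by simp
  qed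
  ultimately have "(\<lambda>n. norm (f (x + step_size n *\<^sub>R w) - f x - f' (step_size n *\<^sub>R w)) / norm (step_size n *\<^sub>R w)) \<longlonglongrightarrow> 0"
    by (rule filterlim_compose)
  from tendsto_mult_right[OF this, of "norm w"]
  have "(\<lambda>n. norm (f (x + step_size n *\<^sub>R w) - f x - f' (step_size n *\<^sub>R w)) / norm (step_size n *\<^sub>R w) * norm w) \<longlonglongrightarrow> 0" by simp
  moreover have "norm (f (x + step_size n *\<^sub>R w) - f x - f' (step_size n *\<^sub>R w)) / norm (step_size n *\<^sub>R w) * norm w =
      norm ((f (x + step_size n *\<^sub>R w) - f x) /\<^sub>R step_size n - f' w)" for n
  proof -
    have "(f (x + step_size n *\<^sub>R w) - f x) /\<^sub>R step_size n - f' w = (f (x + step_size n *\<^sub>R w) - f x - f' (step_size n *\<^sub>R w)) /\<^sub>R step_size n"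
      using step_size_neq_0[of n] by (simp add: linear_cmul[OF lin] scaleR_diff_right)
    then show ?thesis using False step_size(1)[of n] by (simp add: divide_inverse mult.commute)
  qed
  ultimately have "(\<lambda>n. norm ((f (x + step_size n *\<^sub>R w) - f x) /\<^sub>R step_size n - f' w)) \<longlonglongrightarrow> 0" by simp
  then show ?thesis by (simp add: tendsto_norm_zero_iff LIM_zero_iff)
qed

lemma norm_tangential_le: "norm e = 1 \<Longrightarrow> norm (tangential e v) \<le> norm v"
proof -
  assume e: "norm e = 1"
  have "(norm v)^2 = (norm (tangential e v))^2 + (v \<bullet> e)^2"
  proof -
    have "(norm v)^2 = (tangential e v + (v \<bullet> e) *\<^sub>R e) \<bullet> (tangential e v + (v \<bullet> e) *\<^sub>R e)"
      by (simp only: tangential_decomp power2_norm_eq_inner)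
    also have "\<dots> = (norm (tangential e v))^2 + (v \<bullet> e)^2"
      by (simp add: inner_add_left inner_add_right tangential_inner[OF e] e_inner[OF e] power2_norm_eq_inner power2_eq_square[of "v \<bullet> e"])
    finally show ?thesis .
  qed
  then have "(norm (tangential e v))^2 \<le> (norm v)^2" by simp
  then show ?thesis by (rule power2_le_imp_le) simp
qed

lemma tangential_adjoint: "a \<bullet> tangential e w = tangential e a \<bullet> w"
  by (simp add: tangential_def inner_diff_left inner_diff_right inner_commute)

definition graph_slope :: "real^'n \<Rightarrow> (real^'n \<Rightarrow> real) \<Rightarrow> real^'n \<Rightarrow> real^'n" where
  "graph_slope e \<gamma> z = tangential e (grad \<gamma> (tangential e z))"

text \<open>
  The derivative of the graph map at \<open>z\<close> in direction \<open>w\<close>.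
\<close>

definition graph_tangent :: "real^'n \<Rightarrow> (real^'n \<Rightarrow> real) \<Rightarrow> real^'n \<Rightarrow> real^'n \<Rightarrow> real^'n" where
  "graph_tangent e \<gamma> z w = tangential e w + (graph_slope e \<gamma> z \<bullet> w) *\<^sub>R e"

text \<open>
  The downward normal of the graph, extended to the whole space as a function constant along \<open>e\<close>.
\<close>

definition graph_normal :: "real^'n \<Rightarrow> (real^'n \<Rightarrow> real) \<Rightarrow> real^'n \<Rightarrow> real^'n" where
  "graph_normal e \<gamma> z = sgn (graph_slope e \<gamma> z - e)"

lemma sgn_lipschitz:
  fixes a b :: "'a::real_normed_vector"
  assumes "norm a \<ge> 1" "norm b \<ge> 1"
  shows "norm (sgn a - sgn b) \<le> 2 * norm (a - b)"
proof -
  have a: "norm a > 0" and b: "norm b > 0" using assms by auto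
  have "norm a *\<^sub>R (sgn a - sgn b) = (a - b) + (norm b - norm a) *\<^sub>R sgn b"
  proof -
    have "norm a *\<^sub>R sgn a = a" "norm b *\<^sub>R sgn b = b" using a b by (auto simp: sgn_div_norm)
    then show ?thesis by (simp add: algebra_simps)
  qed
  then have "norm a * norm (sgn a - sgn b) = norm ((a - b) + (norm b - norm a) *\<^sub>R sgn b)"
    by (metis abs_norm_cancel norm_scaleR)
  also have "\<dots> \<le> norm (a - b) + norm ((norm b - norm a) *\<^sub>R sgn b)" by (rule norm_triangle_ineq)
  also have "norm ((norm b - norm a) *\<^sub>R sgn b) = \<bar>norm b - norm a\<bar>" using b by (simp add: norm_sgn)
  also have "\<dots> \<le> norm (a - b)" using norm_triangle_ineq3[of b a] by (simp add: norm_minus_commute)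
  finally have "norm a * norm (sgn a - sgn b) \<le> 2 * norm (a - b)" by simp
  moreover have "norm (sgn a - sgn b) \<le> norm a * norm (sgn a - sgn b)"
    using mult_right_mono[OF assms(1), of "norm (sgn a - sgn b)"] by simp
  ultimately show ?thesis by linarith
qed

context
  fixes e :: "real^'n" and \<gamma> :: "real^'n \<Rightarrow> real"
  assumes e: "norm e = 1" and \<gamma>: "C11 \<gamma>"
begin

lemma slope_inner_e [simp]: "graph_slope e \<gamma> z \<bullet> e = 0" "e \<bullet> graph_slope e \<gamma> z = 0"
  by (simp_all add: graph_slope_def tangential_inner[OF e])

lemma slope_shift: "graph_slope e \<gamma> (z + t *\<^sub>R e) = graph_slope e \<gamma> z"
  by (simp add: graph_slope_def e)

lemma normal_shift: "graph_normal e \<gamma> (z + t *\<^sub>R e) = graph_normal e \<gamma> z"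
  by (simp add: graph_normal_def slope_shift)

lemma normal_graph_map: "graph_normal e \<gamma> (graph_map e \<gamma> z) = graph_normal e \<gamma> z"
  by (simp add: graph_normal_def graph_slope_def tangential_graph_map[OF e \<gamma>])

lemma height_has_derivative:
  "((\<lambda>z. \<gamma> (tangential e z)) has_derivative (\<lambda>w. graph_slope e \<gamma> z \<bullet> w)) (at z)"
proof -
  have "\<gamma> differentiable (at (tangential e z))" using \<gamma> by (simp add: C11_def)
  from has_derivative_grad[OF this]
  have d: "(\<gamma> has_derivative (\<lambda>h. grad \<gamma> (tangential e z) \<bullet> h)) (at (tangential e z))" .
  have t: "(tangential e has_derivative tangential e) (at z)"
    using tangential_linear[of e] by (intro linear_imp_has_derivative)
  from has_derivative_compose[OF t d] show ?thesis by (simp add: graph_slope_def tangential_adjoint)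
qed

lemma graph_map_has_derivative:
  "(graph_map e \<gamma> has_derivative graph_tangent e \<gamma> z) (at z)"
proof -
  have t: "(tangential e has_derivative tangential e) (at z)"
    using tangential_linear[of e] by (intro linear_imp_has_derivative)
  show ?thesis unfolding graph_map_def[abs_def] graph_tangent_def[abs_def]
    by (intro has_derivative_add t has_derivative_scaleR_left height_has_derivative)
qed

lemma slope_lipschitz: "\<exists>L\<ge>0. \<forall>x y. norm (graph_slope e \<gamma> x - graph_slope e \<gamma> y) \<le> L * norm (x - y)"
proof -
  obtain L where L: "L-lipschitz_on UNIV (grad \<gamma>)" using \<gamma> by (auto simp: C11_def)
  have "norm (graph_slope e \<gamma> x - graph_slope e \<gamma> y) \<le> L * norm (x - y)" for x y
  proof -
    have "norm (graph_slope e \<gamma> x - graph_slope e \<gamma> y) \<le> norm (grad \<gamma> (tangential e x) - grad \<gamma> (tangential e y))"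
      unfolding graph_slope_def linear_diff[OF tangential_linear, symmetric] by (rule norm_tangential_le[OF e])
    also have "\<dots> \<le> L * norm (tangential e x - tangential e y)"
      using lipschitz_onD[OF L] by (simp add: dist_norm)
    also have "\<dots> \<le> L * norm (x - y)"
      unfolding linear_diff[OF tangential_linear, symmetric]
      by (intro mult_left_mono norm_tangential_le[OF e] lipschitz_on_nonneg[OF L])
    finally show ?thesis .
  qed
  then show ?thesis using lipschitz_on_nonneg[OF L] by blast
qed

lemma norm_slope_e: "(norm (graph_slope e \<gamma> z - e))^2 = (norm (graph_slope e \<gamma> z))^2 + 1"
  by (simp add: power2_norm_eq_inner inner_diff_left inner_diff_right e_inner[OF e])

lemma norm_slope_e_ge: "norm (graph_slope e \<gamma> z - e) \<ge> 1"
proof -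
  have "1^2 \<le> (norm (graph_slope e \<gamma> z - e))^2" unfolding norm_slope_e by simp
  then show ?thesis by (rule power2_le_imp_le) simp
qed

lemma normal_lipschitz: "\<exists>L\<ge>0. \<forall>x y i. \<bar>graph_normal e \<gamma> x $ i - graph_normal e \<gamma> y $ i\<bar> \<le> L * norm (x - y)"
proof -
  obtain L where L: "L \<ge> 0" "\<And>x y. norm (graph_slope e \<gamma> x - graph_slope e \<gamma> y) \<le> L * norm (x - y)"
    using slope_lipschitz by blast
  have "\<bar>graph_normal e \<gamma> x $ i - graph_normal e \<gamma> y $ i\<bar> \<le> (2 * L) * norm (x - y)" for x y i
  proof -
    have "\<bar>graph_normal e \<gamma> x $ i - graph_normal e \<gamma> y $ i\<bar> \<le> norm (graph_normal e \<gamma> x - graph_normal e \<gamma> y)"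
      using component_le_norm_cart[of "graph_normal e \<gamma> x - graph_normal e \<gamma> y" i] by simp
    also have "\<dots> \<le> 2 * norm ((graph_slope e \<gamma> x - e) - (graph_slope e \<gamma> y - e))"
      unfolding graph_normal_def by (intro sgn_lipschitz norm_slope_e_ge)
    also have "\<dots> \<le> (2 * L) * norm (x - y)" using L(2)[of x y] by simp
    finally show ?thesis .
  qed
  then show ?thesis using L(1) by (intro exI[of _ "2 * L"]) auto
qed

text \<open>
  Tangent vectors of the graph are fixed by the derivative of the projection to it.
\<close>

lemma graph_tangent_orthogonal:
  assumes "w \<bullet> graph_normal e \<gamma> z = 0"
  shows "graph_tangent e \<gamma> z w = w"
proof -
  have "norm (graph_slope e \<gamma> z - e) \<noteq> 0" using norm_slope_e_ge[of z] by auto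
  then have "w \<bullet> (graph_slope e \<gamma> z - e) = 0" using assms by (simp add: graph_normal_def sgn_div_norm)
  then have "graph_slope e \<gamma> z \<bullet> w = w \<bullet> e" by (simp add: inner_diff_right inner_commute)
  then show ?thesis by (simp add: graph_tangent_def tangential_decomp)
qed

end

lemma chart_frontierD:
  assumes c: "C11_chart \<Omega> x0 r e \<gamma>" and op: "open \<Omega>" and x: "x \<in> frontier \<Omega>" "x \<in> ball x0 r"
  shows "x \<bullet> e = \<gamma> (tangential e x)"
proof -
  have e: "norm e = 1" and \<gamma>: "C11 \<gamma>" and eq: "\<Omega> \<inter> ball x0 r = {x \<in> ball x0 r. x \<bullet> e > \<gamma> (tangential e x)}"
    using c by (auto simp: C11_chart_def)
  have "x \<notin> \<Omega>" "x \<in> closure \<Omega>" using x op by (auto simp: frontier_def interior_open)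
  then have le: "x \<bullet> e \<le> \<gamma> (tangential e x)" using eq x(2) by force
  moreover have "\<not> x \<bullet> e < \<gamma> (tangential e x)"
  proof
    assume lt: "x \<bullet> e < \<gamma> (tangential e x)"
    have "continuous_on UNIV (\<lambda>y. \<gamma> (tangential e y))"
      by (intro continuous_on_compose2[OF C11_continuous[OF \<gamma>, of UNIV] tangential_continuous]) auto
    then have "open {y. y \<bullet> e < \<gamma> (tangential e y)}" by (intro open_Collect_less continuous_intros)
    then have "open ({y. y \<bullet> e < \<gamma> (tangential e y)} \<inter> ball x0 r)" by (intro open_Int open_ball)
    moreover have "x \<in> {y. y \<bullet> e < \<gamma> (tangential e y)} \<inter> ball x0 r" using lt x(2) by simp
    ultimately have "\<Omega> \<inter> ({y. y \<bullet> e < \<gamma> (tangential e y)} \<inter> ball x0 r) \<noteq> {}"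
      using \<open>x \<in> closure \<Omega>\<close> open_Int_closure_eq_empty by blast
    then obtain y where "y \<in> \<Omega>" "y \<bullet> e < \<gamma> (tangential e y)" "y \<in> ball x0 r" by blast
    then show False using eq by force
  qed
  ultimately show ?thesis by linarith
qed

lemma chart_frontierI:
  assumes c: "C11_chart \<Omega> x0 r e \<gamma>" and op: "open \<Omega>" and x: "x \<bullet> e = \<gamma> (tangential e x)" "x \<in> ball x0 r"
  shows "x \<in> frontier \<Omega>"
proof -
  have e: "norm e = 1" and eq: "\<Omega> \<inter> ball x0 r = {x \<in> ball x0 r. x \<bullet> e > \<gamma> (tangential e x)}"
    using c by (auto simp: C11_chart_def)
  have "x \<notin> \<Omega>" using eq x by force
  moreover have "x \<in> closure \<Omega>"
    unfolding closure_approachable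
  proof (intro allI impI)
    fix \<epsilon> :: real assume "\<epsilon> > 0"
    obtain d where d: "d > 0" "ball x d \<subseteq> ball x0 r" using x(2) openE[OF open_ball] by blast
    define t where "t = min d \<epsilon> / 2"
    have t: "t > 0" "t < d" "t < \<epsilon>" using d \<open>\<epsilon> > 0\<close> by (auto simp: t_def)
    have "dist x (x + t *\<^sub>R e) = t" using e t by (simp add: dist_norm)
    then have "x + t *\<^sub>R e \<in> ball x0 r" using d(2) t(2) by (auto simp: subset_iff)
    moreover have "(x + t *\<^sub>R e) \<bullet> e > \<gamma> (tangential e (x + t *\<^sub>R e))"
      using x(1) t(1) by (simp add: e inner_add_left e_inner[OF e])
    ultimately have "x + t *\<^sub>R e \<in> \<Omega>" using eq by blast
    moreover have "dist (x + t *\<^sub>R e) x < \<epsilon>" using e t by (simp add: dist_norm)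
    ultimately show "\<exists>y\<in>\<Omega>. dist y x < \<epsilon>" by blast
  qed
  ultimately show ?thesis using op by (simp add: frontier_def interior_open)
qed

text \<open>
  The first condition on \<open>\<nu>\<close>, tested along curves in the graph, makes it orthogonal to all tangent vectors,
  which determines it up to sign; the sign follows because the inner points \<open>x - t \<nu>\<close> lie above the graph.
\<close>

lemma outward_normal_eq:
  assumes c: "C11_chart \<Omega> x0 r e \<gamma>" and op: "open \<Omega>" and x: "x \<in> frontier \<Omega>" "x \<in> ball x0 r"
    and \<nu>: "outward_unit_normal \<Omega> x \<nu>"
  shows "\<nu> = graph_normal e \<gamma> x"
proof -
  have e: "norm e = 1" and \<gamma>: "C11 \<gamma>" and eq: "\<Omega> \<inter> ball x0 r = {x \<in> ball x0 r. x \<bullet> e > \<gamma> (tangential e x)}"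
    using c by (auto simp: C11_chart_def)
  have xe: "x \<bullet> e = \<gamma> (tangential e x)" by (rule chart_frontierD[OF c op x])
  have gx: "graph_map e \<gamma> x = x" by (rule graph_map_fixed[OF e \<gamma> xe])
  have n1: "norm \<nu> = 1" and lim: "((\<lambda>y. ((y - x) \<bullet> \<nu>) / norm (y - x)) \<longlongrightarrow> 0) (at x within frontier \<Omega>)"
    and inside: "\<forall>\<^sub>F t in at_right 0. x - t *\<^sub>R \<nu> \<in> \<Omega>"
    using \<nu> by (auto simp: outward_unit_normal_def elim: eventually_mono)
  let ?p = "graph_slope e \<gamma> x"
  have pe: "?p \<bullet> e = 0" "e \<bullet> ?p = 0" by (simp_all add: slope_inner_e[OF e \<gamma>])
  have hright: "filterlim step_size (at_right 0) sequentially"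
    unfolding filterlim_at using step_size(1,3) by (auto simp: step_size_neq_0)
  \<comment> \<open>curves in the graph with velocity \<open>graph_tangent e \<gamma> x w\<close> at \<open>x\<close>\<close>
  have orth: "graph_tangent e \<gamma> x w \<bullet> \<nu> = 0" for w
  proof (cases "graph_tangent e \<gamma> x w = 0")
    case False
    define y where "y n = graph_map e \<gamma> (x + step_size n *\<^sub>R w)" for n
    have q: "(\<lambda>n. (y n - x) /\<^sub>R step_size n) \<longlonglongrightarrow> graph_tangent e \<gamma> x w"
      using difference_quotient_LIMSEQ[OF graph_map_has_derivative[OF e \<gamma>, of x], of w] by (simp add: y_def gx)
    have yx: "y \<longlonglongrightarrow> x"
    proof -
      have "(\<lambda>n. step_size n *\<^sub>R ((y n - x) /\<^sub>R step_size n)) \<longlonglongrightarrow> 0 *\<^sub>R graph_tangent e \<gamma> x w"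
        by (intro tendsto_scaleR step_size q)
      then have "(\<lambda>n. y n - x) \<longlonglongrightarrow> 0" by (simp add: step_size_neq_0)
      then show ?thesis by (simp add: LIM_zero_iff)
    qed
    have ev1: "\<forall>\<^sub>F n in sequentially. y n \<in> ball x0 r" by (rule topological_tendstoD[OF yx open_ball x(2)])
    have ev2: "\<forall>\<^sub>F n in sequentially. (y n - x) /\<^sub>R step_size n \<noteq> 0" by (rule tendsto_imp_eventually_ne[OF q False])
    have "filterlim y (at x within frontier \<Omega>) sequentially"
      unfolding filterlim_at
    proof
      show "\<forall>\<^sub>F n in sequentially. y n \<in> frontier \<Omega> \<and> y n \<noteq> x" using ev1 ev2
      proof eventually_elim
        case (elim n)
        have "y n \<bullet> e = \<gamma> (tangential e (y n))"
          unfolding y_def by (simp add: graph_map_inner[OF e \<gamma>] tangential_graph_map[OF e \<gamma>])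
        then show ?case using chart_frontierI[OF c op _ elim(1)] elim(2) by auto
      qed
    qed (rule yx)
    from filterlim_compose[OF lim this] have l0: "(\<lambda>n. ((y n - x) \<bullet> \<nu>) / norm (y n - x)) \<longlonglongrightarrow> 0" .
    have "(\<lambda>n. (((y n - x) /\<^sub>R step_size n) \<bullet> \<nu>) / norm ((y n - x) /\<^sub>R step_size n)) \<longlonglongrightarrow> (graph_tangent e \<gamma> x w \<bullet> \<nu>) / norm (graph_tangent e \<gamma> x w)"
      by (intro tendsto_divide tendsto_inner q tendsto_const tendsto_norm) (use False in simp)
    moreover have "(((y n - x) /\<^sub>R step_size n) \<bullet> \<nu>) / norm ((y n - x) /\<^sub>R step_size n) = ((y n - x) \<bullet> \<nu>) / norm (y n - x)" for n
      using step_size(1)[of n] by simp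
    ultimately have "(\<lambda>n. ((y n - x) \<bullet> \<nu>) / norm (y n - x)) \<longlonglongrightarrow> (graph_tangent e \<gamma> x w \<bullet> \<nu>) / norm (graph_tangent e \<gamma> x w)"
      by (simp only:)
    from LIMSEQ_unique[OF this l0] have "(graph_tangent e \<gamma> x w \<bullet> \<nu>) / norm (graph_tangent e \<gamma> x w) = 0" .
    then show ?thesis using False by simp
  qed simp
  define a where "a = \<nu> \<bullet> e"
  have tan: "tangential e \<nu> + a *\<^sub>R ?p = 0"
  proof -
    have "w \<bullet> (tangential e \<nu> + a *\<^sub>R ?p) = 0" for w
    proof -
      have "w \<bullet> (tangential e \<nu> + a *\<^sub>R ?p) = graph_tangent e \<gamma> x w \<bullet> \<nu>"
      proof -
        have "w \<bullet> tangential e \<nu> = tangential e w \<bullet> \<nu>" by (simp only: tangential_adjoint)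
        then show ?thesis
          by (simp add: graph_tangent_def inner_add_left inner_add_right a_def inner_commute[of e \<nu>] inner_commute[of ?p w])
      qed
      then show ?thesis using orth by simp
    qed
    then show ?thesis by (metis inner_eq_zero_iff)
  qed
  have nu: "\<nu> = a *\<^sub>R (e - ?p)"
  proof -
    have "\<nu> = tangential e \<nu> + a *\<^sub>R e" by (simp add: tangential_decomp a_def)
    moreover have "tangential e \<nu> = - (a *\<^sub>R ?p)" using tan by (simp add: eq_neg_iff_add_eq_0)
    ultimately show ?thesis by (simp add: scaleR_diff_right)
  qed
  have "a \<noteq> 0" using nu n1 by auto
  \<comment> \<open>otherwise the inner points \<open>x - t \<nu>\<close> would lie below the graph\<close>
  moreover have "\<not> a > 0"
  proof
    assume a: "a > 0"
    let ?f = "\<lambda>z. \<gamma> (tangential e z)"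
    have q: "(\<lambda>n. (?f (x + step_size n *\<^sub>R (- \<nu>)) - ?f x) /\<^sub>R step_size n) \<longlonglongrightarrow> ?p \<bullet> (- \<nu>)"
      by (rule difference_quotient_LIMSEQ[OF height_has_derivative[OF e \<gamma>]])
    have val: "?p \<bullet> (- \<nu>) = a * (norm ?p)^2"
      by (subst nu) (simp add: inner_diff_right pe power2_norm_eq_inner)
    have "(\<lambda>n. x + step_size n *\<^sub>R (- \<nu>)) \<longlonglongrightarrow> x + 0 *\<^sub>R (- \<nu>)" by (intro tendsto_intros step_size)
    then have ev1: "\<forall>\<^sub>F n in sequentially. x + step_size n *\<^sub>R (- \<nu>) \<in> ball x0 r"
      by (intro topological_tendstoD[OF _ open_ball x(2)]) simp
    have ev2: "\<forall>\<^sub>F n in sequentially. x - step_size n *\<^sub>R \<nu> \<in> \<Omega>"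
      using filterlim_iff[THEN iffD1, OF hright] inside by blast
    have "\<forall>\<^sub>F n in sequentially. (?f (x + step_size n *\<^sub>R (- \<nu>)) - ?f x) /\<^sub>R step_size n \<le> - a"
      using ev1 ev2
    proof eventually_elim
      case (elim n)
      then have "x + step_size n *\<^sub>R (- \<nu>) \<in> \<Omega> \<inter> ball x0 r" by simp
      then have "(x + step_size n *\<^sub>R (- \<nu>)) \<bullet> e > ?f (x + step_size n *\<^sub>R (- \<nu>))" using eq by blast
      then have "?f (x + step_size n *\<^sub>R (- \<nu>)) - ?f x \<le> step_size n * (- a)"
        using xe by (simp add: inner_diff_left a_def)
      then show ?case using step_size(1)[of n] by (simp add: field_simps)
    qed
    then have "?p \<bullet> (- \<nu>) \<le> - a" by (rule tendsto_upperbound[OF q]) simp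
    then have "a * (1 + (norm ?p)^2) \<le> 0" unfolding val by (simp add: algebra_simps)
    moreover have "a * (1 + (norm ?p)^2) > 0" using a by (intro mult_pos_pos add_pos_nonneg) auto
    ultimately show False by simp
  qed
  ultimately have a: "a < 0" by simp
  have "norm \<nu> = \<bar>a\<bar> * norm (?p - e)" by (subst nu) (simp add: norm_minus_commute)
  then have "- a * norm (?p - e) = 1" using n1 a by simp
  moreover have "norm (?p - e) \<noteq> 0" using norm_slope_e_ge[OF e \<gamma>, of x] by auto
  ultimately have "- a = inverse (norm (?p - e))" by (simp add: field_simps)
  then have "(- a) *\<^sub>R (?p - e) = graph_normal e \<gamma> x" by (simp add: graph_normal_def sgn_div_norm)
  then show ?thesis using nu by (simp add: algebra_simps)
qed

section \<open>The Weingarten map of a graph\<close>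

lemma differentiable_cong_open:
  assumes "open S" "x \<in> S" "\<And>y. y \<in> S \<Longrightarrow> f y = g y" "f differentiable (at x)"
  shows "g differentiable (at x)"
proof -
  obtain D where "(f has_derivative D) (at x)" using assms(4) by (auto simp: differentiable_def)
  then have "(g has_derivative D) (at x)"
    by (rule has_derivative_transform_within_open[OF _ assms(1,2)]) (rule assms(3))
  then show ?thesis by (rule differentiableI)
qed

text \<open>
  An extension exists because near \<open>x\<close> the normal is the restriction of \<open>graph_normal\<close>. All extensions
  agree with it along the curves that the graph map produces from straight lines, so whichever extension is
  chosen has the same derivative in tangential directions.
\<close>

lemma tangential_grad_normal:
  fixes n :: "real^'n \<Rightarrow> real^'n"
  assumes c: "C11_chart \<Omega> x0 r e \<gamma>" and op: "open \<Omega>" and \<Gamma>: "openin (top_of_set (frontier \<Omega>)) \<Gamma>"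
    and n: "\<forall>x\<in>\<Gamma>. outward_unit_normal \<Omega> x (n x)"
    and x: "x \<in> \<Gamma> \<inter> ball x0 r"
    and d: "(\<lambda>y. graph_normal e \<gamma> y $ i) differentiable (at x)"
    and w: "w \<bullet> n x = 0"
  shows "tangential_grad \<Gamma> n (\<lambda>y. n y $ i) x \<bullet> w = grad (\<lambda>y. graph_normal e \<gamma> y $ i) x \<bullet> w"
proof -
  have e: "norm e = 1" and \<gamma>: "C11 \<gamma>" using c by (auto simp: C11_chart_def)
  let ?f = "\<lambda>y. graph_normal e \<gamma> y $ i"
  obtain T where T: "open T" "\<Gamma> = frontier \<Omega> \<inter> T" using \<Gamma> by (auto simp: openin_open)
  have n_eq: "n y = graph_normal e \<gamma> y" if "y \<in> \<Gamma>" "y \<in> ball x0 r" for y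
    using that n T(2) by (intro outward_normal_eq[OF c op]) auto
  \<comment> \<open>differentiable at \<open>x\<close> because it coincides with \<open>graph_normal\<close> on a ball around \<open>x\<close>\<close>
  define F where "F y = (if y \<in> \<Gamma> then n y $ i else ?f y)" for y
  have "F differentiable (at x)"
    by (rule differentiable_cong_open[OF open_ball _ _ d]) (use x n_eq in \<open>auto simp: F_def\<close>)
  moreover have "\<forall>y\<in>\<Gamma>. F y = n y $ i" by (simp add: F_def)
  ultimately have "has_tangential_grad \<Gamma> n (\<lambda>y. n y $ i) (tangential (n x) (grad F x)) x"
    unfolding has_tangential_grad_def by blast
  then have "has_tangential_grad \<Gamma> n (\<lambda>y. n y $ i) (tangential_grad \<Gamma> n (\<lambda>y. n y $ i) x) x"
    unfolding tangential_grad_def by (rule someI)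
  then obtain F' where F': "\<And>y. y \<in> \<Gamma> \<Longrightarrow> F' y = n y $ i" "F' differentiable (at x)"
    "tangential_grad \<Gamma> n (\<lambda>y. n y $ i) x = tangential (n x) (grad F' x)"
    unfolding has_tangential_grad_def by blast
  have v1: "tangential_grad \<Gamma> n (\<lambda>y. n y $ i) x \<bullet> w = grad F' x \<bullet> w"
  proof -
    have "n x \<bullet> w = 0" using w by (simp add: inner_commute)
    then show ?thesis by (simp add: F'(3) tangential_def inner_diff_left)
  qed
  have xf: "x \<in> frontier \<Omega>" "x \<in> ball x0 r" using x T(2) by auto
  have gx: "graph_map e \<gamma> x = x" by (rule graph_map_fixed[OF e \<gamma> chart_frontierD[OF c op xf]])
  have Tw: "graph_tangent e \<gamma> x w = w"
    using w x by (intro graph_tangent_orthogonal[OF e \<gamma>]) (simp add: n_eq)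
  have "(F' has_derivative (\<lambda>h. grad F' x \<bullet> h)) (at (graph_map e \<gamma> x))"
    unfolding gx by (rule has_derivative_grad[OF F'(2)])
  from has_derivative_compose[OF graph_map_has_derivative[OF e \<gamma>] this]
  have "((\<lambda>z. F' (graph_map e \<gamma> z)) has_derivative (\<lambda>h. grad F' x \<bullet> graph_tangent e \<gamma> x h)) (at x)" .
  from difference_quotient_LIMSEQ[OF this, of w]
  have l1: "(\<lambda>k. (F' (graph_map e \<gamma> (x + step_size k *\<^sub>R w)) - F' (graph_map e \<gamma> x)) /\<^sub>R step_size k) \<longlonglongrightarrow> grad F' x \<bullet> w"
    by (simp add: Tw)
  have l2: "(\<lambda>k. (?f (x + step_size k *\<^sub>R w) - ?f x) /\<^sub>R step_size k) \<longlonglongrightarrow> grad ?f x \<bullet> w"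
    by (rule difference_quotient_LIMSEQ[OF has_derivative_grad[OF d]])
  have on: "F' y = ?f y" if "y \<in> \<Gamma>" "y \<in> ball x0 r" for y using that by (simp add: F'(1) n_eq)
  have "(\<lambda>k. x + step_size k *\<^sub>R w) \<longlonglongrightarrow> x + 0 *\<^sub>R w" by (intro tendsto_intros step_size)
  then have "(\<lambda>k. x + step_size k *\<^sub>R w) \<longlonglongrightarrow> x" by simp
  moreover have "isCont (graph_map e \<gamma>) x" using graph_map_continuous[OF e \<gamma>, of UNIV] by (simp add: continuous_on_eq_continuous_at)
  ultimately have "(\<lambda>k. graph_map e \<gamma> (x + step_size k *\<^sub>R w)) \<longlonglongrightarrow> graph_map e \<gamma> x"
    using isCont_tendsto_compose[of x "graph_map e \<gamma>" "\<lambda>k. x + step_size k *\<^sub>R w"] by blast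
  then have "(\<lambda>k. graph_map e \<gamma> (x + step_size k *\<^sub>R w)) \<longlonglongrightarrow> x" by (simp add: gx)
  then have "\<forall>\<^sub>F k in sequentially. graph_map e \<gamma> (x + step_size k *\<^sub>R w) \<in> T \<inter> ball x0 r"
    by (rule topological_tendstoD) (use T x in auto)
  then have "\<forall>\<^sub>F k in sequentially. (F' (graph_map e \<gamma> (x + step_size k *\<^sub>R w)) - F' (graph_map e \<gamma> x)) /\<^sub>R step_size k =
     (?f (x + step_size k *\<^sub>R w) - ?f x) /\<^sub>R step_size k"
  proof eventually_elim
    case (elim k)
    let ?y = "graph_map e \<gamma> (x + step_size k *\<^sub>R w)"
    have "?y \<bullet> e = \<gamma> (tangential e ?y)" by (simp add: graph_map_inner[OF e \<gamma>] tangential_graph_map[OF e \<gamma>])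
    then have "?y \<in> frontier \<Omega>" using elim by (intro chart_frontierI[OF c op]) auto
    then have "F' ?y = ?f ?y" using elim T(2) by (intro on) auto
    moreover have "F' x = ?f x" using x by (intro on) auto
    ultimately show ?case by (simp add: normal_graph_map[OF e \<gamma>] gx)
  qed
  from Lim_transform_eventually[OF l1 this] have "(\<lambda>k. (?f (x + step_size k *\<^sub>R w) - ?f x) /\<^sub>R step_size k) \<longlonglongrightarrow> grad F' x \<bullet> w" .
  from LIMSEQ_unique[OF this l2] v1 show ?thesis by simp
qed

section \<open>Approximation in the third-order Sobolev space\<close>

lemma H_conv_W1_distance:
  assumes "H_conv (Suc k) f u"
  shows "(\<lambda>m. W1_distance 2 (f m) u) \<longlonglongrightarrow> 0"
proof -
  have W: "W1_distance 2 (f m) u = sq_integral (\<lambda>x. f m x - u x) + (\<Sum>i\<in>UNIV. sq_integral (\<lambda>x. partial_deriv i (f m) x - weak_pderiv i u x))" for m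
    by (simp add: W1_distance_def sq_integral_def abs_powr_2)
  have "(\<lambda>m. W1_distance 2 (f m) u) \<longlonglongrightarrow> 0 + (\<Sum>i\<in>(UNIV::'a set). 0)"
    unfolding W
  proof (intro tendsto_add tendsto_sum)
    show "(\<lambda>m. sq_integral (\<lambda>x. f m x - u x)) \<longlonglongrightarrow> 0" by (rule H_conv_sq[OF assms])
    show "(\<lambda>m. sq_integral (\<lambda>x. partial_deriv i (f m) x - weak_pderiv i u x)) \<longlonglongrightarrow> 0" for i
      by (rule H_conv_sq[of k "\<lambda>m. partial_deriv i (f m)"]) (use assms in simp)
  qed
  then show ?thesis by simp
qed

lemma sobolev_fast_approximation:
  fixes \<phi> :: "real^'n \<Rightarrow> real"
  assumes "sobolev 3 2 \<phi>"
  shows "\<exists>f. (\<forall>m. test_function (f m)) \<and>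
    (\<forall>m i. W1_distance 2 (partial_deriv i (f m)) (weak_pderiv i \<phi>) \<le> ennreal (1 / 16 ^ m)) \<and>
    (\<forall>m i j. W1_distance 2 (partial_deriv j (partial_deriv i (f m))) (weak_pderiv j (weak_pderiv i \<phi>)) \<le> ennreal (1 / 16 ^ m))"
proof -
  obtain f where t: "\<And>m. test_function (f m)" and h: "H_conv 3 f \<phi>"
    using sobolev_density[OF assms] by blast
  have h2: "H_conv (Suc (Suc 0)) (\<lambda>m. partial_deriv i (f m)) (weak_pderiv i \<phi>)" for i
    using h by (simp add: numeral_3_eq_3)
  have h1: "H_conv (Suc 0) (\<lambda>m. partial_deriv j (partial_deriv i (f m))) (weak_pderiv j (weak_pderiv i \<phi>))" for i j
    using h2[of i] by simp
  have ev: "\<forall>\<^sub>F m in sequentially. (\<forall>i. W1_distance 2 (partial_deriv i (f m)) (weak_pderiv i \<phi>) \<le> ennreal \<epsilon>) \<and>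
     (\<forall>i j. W1_distance 2 (partial_deriv j (partial_deriv i (f m))) (weak_pderiv j (weak_pderiv i \<phi>)) \<le> ennreal \<epsilon>)"
    if "\<epsilon> > 0" for \<epsilon>
    by (intro eventually_conj eventually_all_finite tendsto_0_ennrealD[OF _ that] H_conv_W1_distance[OF h2] H_conv_W1_distance[OF h1])
  have "\<exists>k. (\<forall>i. W1_distance 2 (partial_deriv i (f k)) (weak_pderiv i \<phi>) \<le> ennreal (1 / 16 ^ m)) \<and>
     (\<forall>i j. W1_distance 2 (partial_deriv j (partial_deriv i (f k))) (weak_pderiv j (weak_pderiv i \<phi>)) \<le> ennreal (1 / 16 ^ m))" for m
    by (rule eventually_happens'[OF _ ev]) auto
  then obtain r where "\<And>m. (\<forall>i. W1_distance 2 (partial_deriv i (f (r m))) (weak_pderiv i \<phi>) \<le> ennreal (1 / 16 ^ m)) \<and>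
     (\<forall>i j. W1_distance 2 (partial_deriv j (partial_deriv i (f (r m)))) (weak_pderiv j (weak_pderiv i \<phi>)) \<le> ennreal (1 / 16 ^ m))"
    by metis
  then show ?thesis using t by (intro exI[of _ "\<lambda>m. f (r m)"]) auto
qed

lemma W1_distance_tendsto_W1:
  fixes u :: "real^'n \<Rightarrow> real"
  assumes "(\<lambda>k. W1_distance p (v k) u) \<longlonglongrightarrow> 0"
  shows "tendsto_W1 p v u"
  unfolding tendsto_W1_def
proof (intro conjI allI)
  show "(\<lambda>k. \<integral>\<^sup>+x. ennreal (\<bar>v k x - u x\<bar> powr p) \<partial>lebesgue) \<longlonglongrightarrow> 0"
    by (rule tendsto_0_le[OF assms]) (simp add: W1_distance_def)
  fix i
  show "(\<lambda>k. \<integral>\<^sup>+x. ennreal (\<bar>partial_deriv i (v k) x - weak_pderiv i u x\<bar> powr p) \<partial>lebesgue) \<longlonglongrightarrow> 0"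
  proof (rule tendsto_0_le[OF assms])
    fix k
    let ?I = "\<lambda>i. \<integral>\<^sup>+x. ennreal (\<bar>partial_deriv i (v k) x - weak_pderiv i u x\<bar> powr p) \<partial>lebesgue"
    have "?I i \<le> sum ?I UNIV" by (rule member_le_sum) auto
    also have "\<dots> \<le> W1_distance p (v k) u" by (simp add: W1_distance_def)
    finally show "?I i \<le> W1_distance p (v k) u" .
  qed
qed

lemma inverse_power_16_tendsto_0:
  fixes X :: "nat \<Rightarrow> ennreal"
  assumes "\<And>m. X m \<le> ennreal (1 / 16 ^ m)"
  shows "X \<longlonglongrightarrow> 0"
proof (rule tendsto_0_le[OF _ assms])
  have "(\<lambda>m. (1/16::real) ^ m) \<longlonglongrightarrow> 0" by (rule LIMSEQ_realpow_zero) auto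
  then have "(\<lambda>m. 1 / 16 ^ m :: real) \<longlonglongrightarrow> 0" by (simp add: power_divide)
  from tendsto_ennrealI[OF this] show "(\<lambda>m. ennreal (1 / 16 ^ m)) \<longlonglongrightarrow> 0" by simp
qed

lemma fast_trace_limit:
  fixes v :: "nat \<Rightarrow> real^'n \<Rightarrow> real"
  assumes v: "\<And>m. test_function (v m)" and u: "sobolev 1 2 u"
    and fast: "\<And>m. W1_distance 2 (v m) u \<le> ennreal (1 / 16 ^ m)"
    and e: "norm e = 1" and \<gamma>: "C11 \<gamma>"
  shows "AE z in lborel. (\<lambda>m. v m (graph_map e \<gamma> z)) \<longlonglongrightarrow> lim (\<lambda>m. v m (graph_map e \<gamma> z))"
proof -
  have sm: "smooth (v m)" for m by (rule test_functionD[OF v])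
  have "W1_energy 2 (\<lambda>x. v (Suc k) x - v k x) \<le> ennreal (4 / 16 ^ k)" for k
  proof -
    have "W1_energy 2 (\<lambda>x. v (Suc k) x - v k x) \<le> 2 * W1_distance 2 (v (Suc k)) u + 2 * W1_distance 2 (v k) u"
      by (rule W1_energy_diff_le[OF sm sm u]) simp
    also have "\<dots> \<le> 2 * ennreal (1 / 16 ^ Suc k) + 2 * ennreal (1 / 16 ^ k)"
      by (intro add_mono mult_left_mono fast) auto
    also have "\<dots> \<le> 2 * ennreal (1 / 16 ^ k) + 2 * ennreal (1 / 16 ^ k)"
      by (intro add_mono mult_left_mono ennreal_leI divide_left_mono power_increasing) auto
    also have "\<dots> = ennreal (4 / 16 ^ k)"
    proof -
      have "2 * ennreal (1 / 16 ^ k) = ennreal (2 * (1 / 16 ^ k))"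
        using ennreal_mult[of 2 "1 / 16 ^ k"] by simp
      then show ?thesis by (simp flip: ennreal_plus)
    qed
    finally show ?thesis .
  qed
  from fast_convergence_AE[OF e \<gamma> v this]
  have "AE z in lborel. convergent (\<lambda>k. v k (graph_map e \<gamma> z))" by simp
  then show ?thesis by eventually_elim (simp add: convergent_LIMSEQ_iff)
qed

section \<open>Weak derivatives of products\<close>

text \<open>
  The arithmetic-geometric mean inequality with a weight \<open>s\<close> replaces the Cauchy-Schwarz inequality.
\<close>

lemma nn_product_tendsto_0:
  fixes a b :: "nat \<Rightarrow> 'a \<Rightarrow> real"
  assumes m[measurable]: "\<And>m. a m \<in> borel_measurable M" "\<And>m. b m \<in> borel_measurable M"
    and a: "(\<lambda>m. \<integral>\<^sup>+x. ennreal ((a m x)^2) \<partial>M) \<longlonglongrightarrow> 0"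
    and b: "\<forall>\<^sub>F m in sequentially. (\<integral>\<^sup>+x. ennreal ((b m x)^2) \<partial>M) \<le> ennreal B" "B \<ge> 0"
  shows "(\<lambda>m. \<integral>\<^sup>+x. ennreal (\<bar>a m x\<bar> * \<bar>b m x\<bar>) \<partial>M) \<longlonglongrightarrow> 0"
proof (rule tendsto_0_ennrealI)
  fix \<epsilon> :: real assume \<epsilon>: "\<epsilon> > 0"
  \<comment> \<open>the weight makes the contribution of the bounded factor at most \<open>\<epsilon>/2\<close>\<close>
  define s where "s = (B + 1) / (2 * \<epsilon>)"
  have s: "s > 0" using \<epsilon> b(2) by (simp add: s_def)
  have amgm: "\<bar>x\<bar> * \<bar>y\<bar> \<le> s * x^2 + (1 / (4 * s)) * y^2" for x y :: real
  proof -
    have "(2 * s * \<bar>x\<bar> - \<bar>y\<bar>)^2 = (4 * s) * (s * x^2) - (4 * s) * (\<bar>x\<bar> * \<bar>y\<bar>) + y^2"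
      by (simp add: power2_diff power_mult_distrib power2_eq_square[of s])
    moreover have "(4 * s) * (s * x^2 + (1 / (4 * s)) * y^2) = (4 * s) * (s * x^2) + y^2"
      using s by (simp add: distrib_left)
    ultimately have "(4 * s) * (\<bar>x\<bar> * \<bar>y\<bar>) \<le> (4 * s) * (s * x^2 + (1 / (4 * s)) * y^2)"
      using zero_le_power2[of "2 * s * \<bar>x\<bar> - \<bar>y\<bar>"] by linarith
    then show ?thesis by (rule mult_left_le_imp_le) (use s in simp)
  qed
  have "\<epsilon> / (2 * s) > 0" using \<epsilon> s by simp
  from tendsto_0_ennrealD[OF a this] b(1)
  show "\<forall>\<^sub>F m in sequentially. (\<integral>\<^sup>+x. ennreal (\<bar>a m x\<bar> * \<bar>b m x\<bar>) \<partial>M) \<le> ennreal \<epsilon>"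
  proof eventually_elim
    case (elim m)
    have "(\<integral>\<^sup>+x. ennreal (\<bar>a m x\<bar> * \<bar>b m x\<bar>) \<partial>M) \<le> (\<integral>\<^sup>+x. ennreal s * ennreal ((a m x)^2) + ennreal (1 / (4 * s)) * ennreal ((b m x)^2) \<partial>M)"
    proof (rule nn_integral_mono)
      fix x
      have "ennreal (\<bar>a m x\<bar> * \<bar>b m x\<bar>) \<le> ennreal (s * (a m x)^2 + (1 / (4 * s)) * (b m x)^2)" by (intro ennreal_leI amgm)
      also have "\<dots> = ennreal (s * (a m x)^2) + ennreal ((1 / (4 * s)) * (b m x)^2)"
        using s by (intro ennreal_plus) auto
      also have "ennreal (s * (a m x)^2) = ennreal s * ennreal ((a m x)^2)" using s by (intro ennreal_mult) auto
      also have "ennreal ((1 / (4 * s)) * (b m x)^2) = ennreal (1 / (4 * s)) * ennreal ((b m x)^2)" using s by (intro ennreal_mult) auto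
      finally show "ennreal (\<bar>a m x\<bar> * \<bar>b m x\<bar>) \<le> ennreal s * ennreal ((a m x)^2) + ennreal (1 / (4 * s)) * ennreal ((b m x)^2)" .
    qed
    also have "\<dots> = ennreal s * (\<integral>\<^sup>+x. ennreal ((a m x)^2) \<partial>M) + ennreal (1 / (4 * s)) * (\<integral>\<^sup>+x. ennreal ((b m x)^2) \<partial>M)"
      by (subst nn_integral_add) (auto simp: nn_integral_cmult)
    also have "\<dots> \<le> ennreal s * ennreal (\<epsilon> / (2 * s)) + ennreal (1 / (4 * s)) * ennreal B"
      by (intro add_mono mult_left_mono elim) auto
    also have "ennreal s * ennreal (\<epsilon> / (2 * s)) = ennreal (s * (\<epsilon> / (2 * s)))" using s \<epsilon> by (intro ennreal_mult[symmetric]) auto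
    also have "ennreal (1 / (4 * s)) * ennreal B = ennreal ((1 / (4 * s)) * B)" using s b(2) by (intro ennreal_mult[symmetric]) auto
    also have "ennreal (s * (\<epsilon> / (2 * s))) + ennreal ((1 / (4 * s)) * B) = ennreal (s * (\<epsilon> / (2 * s)) + (1 / (4 * s)) * B)"
      using s \<epsilon> b(2) by (intro ennreal_plus[symmetric]) auto
    also have "\<dots> \<le> ennreal \<epsilon>"
    proof (rule ennreal_leI)
      have "(1 / (4 * s)) * B = \<epsilon> * B / (2 * (B + 1))" using \<epsilon> b(2) by (simp add: s_def field_simps)
      also have "\<dots> \<le> \<epsilon> / 2" using \<epsilon> b(2) by (simp add: field_simps)
      finally show "s * (\<epsilon> / (2 * s)) + (1 / (4 * s)) * B \<le> \<epsilon>" using s by simp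
    qed
    finally show ?case .
  qed
qed

definition L1_conv :: "(nat \<Rightarrow> real^'n \<Rightarrow> real) \<Rightarrow> (real^'n \<Rightarrow> real) \<Rightarrow> bool" where
  "L1_conv F F0 \<longleftrightarrow> (\<forall>m. F m \<in> borel_measurable lebesgue) \<and> integrable lebesgue F0 \<and>
     (\<lambda>m. \<integral>\<^sup>+x. ennreal \<bar>F m x - F0 x\<bar> \<partial>lebesgue) \<longlonglongrightarrow> 0"

lemma L1_conv_add:
  assumes "L1_conv F F0" "L1_conv H H0"
  shows "L1_conv (\<lambda>m x. F m x + H m x) (\<lambda>x. F0 x + H0 x)"
proof -
  have [measurable]: "F m \<in> borel_measurable lebesgue" "H m \<in> borel_measurable lebesgue"
    "F0 \<in> borel_measurable lebesgue" "H0 \<in> borel_measurable lebesgue" for m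
    using assms by (auto simp: L1_conv_def)
  have "(\<lambda>m. \<integral>\<^sup>+x. ennreal \<bar>F m x + H m x - (F0 x + H0 x)\<bar> \<partial>lebesgue) \<longlonglongrightarrow> 0"
  proof (rule tendsto_0_le)
    have "(\<lambda>m. (\<integral>\<^sup>+x. ennreal \<bar>F m x - F0 x\<bar> \<partial>lebesgue) + (\<integral>\<^sup>+x. ennreal \<bar>H m x - H0 x\<bar> \<partial>lebesgue)) \<longlonglongrightarrow> 0 + 0"
      using assms by (intro tendsto_add) (auto simp: L1_conv_def)
    then show "(\<lambda>m. (\<integral>\<^sup>+x. ennreal \<bar>F m x - F0 x\<bar> \<partial>lebesgue) + (\<integral>\<^sup>+x. ennreal \<bar>H m x - H0 x\<bar> \<partial>lebesgue)) \<longlonglongrightarrow> 0" by simp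
    show "(\<integral>\<^sup>+x. ennreal \<bar>F m x + H m x - (F0 x + H0 x)\<bar> \<partial>lebesgue) \<le>
       (\<integral>\<^sup>+x. ennreal \<bar>F m x - F0 x\<bar> \<partial>lebesgue) + (\<integral>\<^sup>+x. ennreal \<bar>H m x - H0 x\<bar> \<partial>lebesgue)" for m
      using nn_integral_abs_triangle[of "\<lambda>x. F m x - F0 x" lebesgue "\<lambda>x. H m x - H0 x"] by (simp add: add_diff_add)
  qed
  then show ?thesis using assms by (auto simp: L1_conv_def)
qed

lemma L1_conv_sum:
  assumes "finite A" "\<And>i. i \<in> A \<Longrightarrow> L1_conv (F i) (F0 i)"
  shows "L1_conv (\<lambda>m x. \<Sum>i\<in>A. F i m x) (\<lambda>x. \<Sum>i\<in>A. F0 i x)"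
  using assms
proof (induction A rule: finite_induct)
  case empty
  then show ?case by (simp add: L1_conv_def)
next
  case (insert i A)
  then show ?case by (simp add: L1_conv_add)
qed

lemma L1_conv_double: "L1_conv F F0 \<Longrightarrow> L1_conv (\<lambda>m x. 2 * F m x) (\<lambda>x. 2 * F0 x)"
  unfolding mult_2 by (rule L1_conv_add)

lemma L1_conv_mult:
  assumes f: "\<And>m. f m \<in> borel_measurable lebesgue" "Lp 2 f0" "(\<lambda>m. sq_integral (\<lambda>x. f m x - f0 x)) \<longlonglongrightarrow> 0"
    and g: "\<And>m. g m \<in> borel_measurable lebesgue" "Lp 2 g0" "(\<lambda>m. sq_integral (\<lambda>x. g m x - g0 x)) \<longlonglongrightarrow> 0"
  shows "L1_conv (\<lambda>m x. f m x * g m x) (\<lambda>x. f0 x * g0 x)"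
proof -
  note [measurable] = f(1) g(1) Lp2D(1)[OF f(2)] Lp2D(1)[OF g(2)]
  have bd: "\<exists>B\<ge>0. sq_integral h \<le> ennreal B" if "Lp 2 h" for h :: "real^'a \<Rightarrow> real"
    using Lp2D(3)[OF that] by (cases "sq_integral h") auto
  obtain B1 where B1: "B1 \<ge> 0" "sq_integral f0 \<le> ennreal B1" using bd[OF f(2)] by blast
  obtain B2 where B2: "B2 \<ge> 0" "sq_integral g0 \<le> ennreal B2" using bd[OF g(2)] by blast
  have 1: "(\<lambda>m. \<integral>\<^sup>+x. ennreal (\<bar>f m x - f0 x\<bar> * \<bar>g m x - g0 x\<bar>) \<partial>lebesgue) \<longlonglongrightarrow> 0"
    by (rule nn_product_tendsto_0[where B=1])
       (use f(3) tendsto_0_ennrealD[OF g(3) zero_less_one] in \<open>auto simp: sq_integral_def\<close>)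
  have 2: "(\<lambda>m. \<integral>\<^sup>+x. ennreal (\<bar>f m x - f0 x\<bar> * \<bar>g0 x\<bar>) \<partial>lebesgue) \<longlonglongrightarrow> 0"
    by (rule nn_product_tendsto_0[where B=B2]) (use f(3) B2 in \<open>auto simp: sq_integral_def\<close>)
  have 3: "(\<lambda>m. \<integral>\<^sup>+x. ennreal (\<bar>g m x - g0 x\<bar> * \<bar>f0 x\<bar>) \<partial>lebesgue) \<longlonglongrightarrow> 0"
    by (rule nn_product_tendsto_0[where B=B1]) (use g(3) B1 in \<open>auto simp: sq_integral_def\<close>)
  have "(\<lambda>m. \<integral>\<^sup>+x. ennreal \<bar>f m x * g m x - f0 x * g0 x\<bar> \<partial>lebesgue) \<longlonglongrightarrow> 0"
  proof (rule tendsto_0_le)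
    show "(\<lambda>m. (\<integral>\<^sup>+x. ennreal (\<bar>f m x - f0 x\<bar> * \<bar>g m x - g0 x\<bar>) \<partial>lebesgue) +
      ((\<integral>\<^sup>+x. ennreal (\<bar>f m x - f0 x\<bar> * \<bar>g0 x\<bar>) \<partial>lebesgue) + (\<integral>\<^sup>+x. ennreal (\<bar>g m x - g0 x\<bar> * \<bar>f0 x\<bar>) \<partial>lebesgue))) \<longlonglongrightarrow> 0"
      using tendsto_add[OF 1 tendsto_add[OF 2 3]] by simp
    fix m
    have "(\<integral>\<^sup>+x. ennreal \<bar>f m x * g m x - f0 x * g0 x\<bar> \<partial>lebesgue) =
      (\<integral>\<^sup>+x. ennreal \<bar>(f m x - f0 x) * (g m x - g0 x) + ((f m x - f0 x) * g0 x + (g m x - g0 x) * f0 x)\<bar> \<partial>lebesgue)"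
      by (simp add: algebra_simps)
    also have "\<dots> \<le> (\<integral>\<^sup>+x. ennreal \<bar>(f m x - f0 x) * (g m x - g0 x)\<bar> \<partial>lebesgue) +
        (\<integral>\<^sup>+x. ennreal \<bar>(f m x - f0 x) * g0 x + (g m x - g0 x) * f0 x\<bar> \<partial>lebesgue)"
      by (rule nn_integral_abs_triangle) measurable
    also have "(\<integral>\<^sup>+x. ennreal \<bar>(f m x - f0 x) * g0 x + (g m x - g0 x) * f0 x\<bar> \<partial>lebesgue) \<le>
        (\<integral>\<^sup>+x. ennreal \<bar>(f m x - f0 x) * g0 x\<bar> \<partial>lebesgue) + (\<integral>\<^sup>+x. ennreal \<bar>(g m x - g0 x) * f0 x\<bar> \<partial>lebesgue)"
      by (rule nn_integral_abs_triangle) measurable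
    finally show "(\<integral>\<^sup>+x. ennreal \<bar>f m x * g m x - f0 x * g0 x\<bar> \<partial>lebesgue) \<le>
      (\<integral>\<^sup>+x. ennreal (\<bar>f m x - f0 x\<bar> * \<bar>g m x - g0 x\<bar>) \<partial>lebesgue) +
      ((\<integral>\<^sup>+x. ennreal (\<bar>f m x - f0 x\<bar> * \<bar>g0 x\<bar>) \<partial>lebesgue) + (\<integral>\<^sup>+x. ennreal (\<bar>g m x - g0 x\<bar> * \<bar>f0 x\<bar>) \<partial>lebesgue))"
      by (simp add: abs_mult add_left_mono)
  qed
  moreover have "integrable lebesgue (\<lambda>x. f0 x * g0 x)"
  proof (rule Bochner_Integration.integrable_bound)
    show "integrable lebesgue (\<lambda>x. (f0 x)^2 + (g0 x)^2)"
      using Lp2D(2)[OF f(2)] Lp2D(2)[OF g(2)] by simp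
    have "\<bar>f0 x * g0 x\<bar> \<le> (f0 x)^2 + (g0 x)^2" for x
    proof -
      have "2 * (\<bar>f0 x\<bar> * \<bar>g0 x\<bar>) \<le> (f0 x)^2 + (g0 x)^2" using sum_squares_bound[of "\<bar>f0 x\<bar>" "\<bar>g0 x\<bar>"] by simp
      moreover have "0 \<le> \<bar>f0 x\<bar> * \<bar>g0 x\<bar>" by simp
      ultimately show ?thesis unfolding abs_mult by linarith
    qed
    then show "AE x in lebesgue. norm (f0 x * g0 x) \<le> norm ((f0 x)^2 + (g0 x)^2)" by (intro AE_I2) simp
  qed measurable
  ultimately show ?thesis unfolding L1_conv_def by (intro conjI allI) measurable
qed

lemma integral_partial_deriv_test:
  assumes "test_function \<theta>"
  shows "(LINT x|lborel. partial_deriv j \<theta> x) = 0"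
proof -
  have sm: "smooth \<theta>" by (rule test_functionD[OF assms])
  obtain R where R: "\<And>x. norm x > R \<Longrightarrow> \<theta> x = 0" using test_functionD(2)[OF assms] by auto
  have D: "((\<lambda>t. \<theta> (x + t *\<^sub>R axis j 1)) has_real_derivative partial_deriv j \<theta> (x + t *\<^sub>R axis j 1)) (at t)" for x t
    using has_derivative_along_line[OF smoothD(1)[OF sm], where z=x and t=t and v="axis j 1"] by (simp add: inner_axis grad_def)
  show ?thesis by (rule integral_derivative_zero[OF smoothD(3)[OF sm] smoothD(3)[OF smoothD(2)[OF sm]] D R])
qed

lemma L1_conv_test_integral:
  assumes F: "L1_conv F F0" "\<And>m. test_function (F m)" and \<eta>: "test_function \<eta>"
  shows "(\<lambda>m. LINT x|lebesgue. F m x * \<eta> x) \<longlonglongrightarrow> (LINT x|lebesgue. F0 x * \<eta> x)"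
proof (rule tendsto_L1_int)
  have li: "locally_integrable F0"
    by (rule integrable_pow_locally_integrable[where p=1]) (use F(1) in \<open>auto simp: L1_conv_def\<close>)
  have lF: "locally_integrable (F m)" for m
  proof (rule integrable_pow_locally_integrable[where p=1])
    show "F m \<in> borel_measurable lebesgue" using F(1) by (simp add: L1_conv_def)
    obtain R where R: "\<And>x. norm x > R \<Longrightarrow> F m x = 0" using test_functionD(2)[OF F(2)] by auto
    have sm: "smooth (F m)" by (rule test_functionD[OF F(2)])
    have "integrable lborel (F m)" by (rule integrable_cont_compact_support[OF smoothD(3)[OF sm] R])
    then have "integrable lebesgue (F m)" by (subst integrable_completion) (auto intro: smoothD(5)[OF sm])
    then show "integrable lebesgue (\<lambda>x. \<bar>F m x\<bar> ^ 1)" by simp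
  qed simp
  show "integrable lebesgue (\<lambda>x. F0 x * \<eta> x)" by (rule locally_integrable_mult_test[OF li \<eta>])
  show "integrable lebesgue (\<lambda>x. F m x * \<eta> x)" for m by (rule locally_integrable_mult_test[OF lF \<eta>])
  obtain B where B: "B > 0" "\<And>x. \<bar>\<eta> x\<bar> \<le> B" using test_function_bounded[OF \<eta>] by auto
  have [measurable]: "F m \<in> borel_measurable lebesgue" "F0 \<in> borel_measurable lebesgue" for m
    using F(1) by (auto simp: L1_conv_def)
  show "(\<lambda>m. \<integral>\<^sup>+x. norm (F m x * \<eta> x - F0 x * \<eta> x) \<partial>lebesgue) \<longlonglongrightarrow> 0"
  proof (rule tendsto_0_le)
    have "(\<lambda>m. \<integral>\<^sup>+x. ennreal \<bar>F m x - F0 x\<bar> \<partial>lebesgue) \<longlonglongrightarrow> 0" using F(1) by (simp add: L1_conv_def)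
    from ennreal_tendsto_cmult[OF _ this, of "ennreal B"]
    show "(\<lambda>m. ennreal B * (\<integral>\<^sup>+x. ennreal \<bar>F m x - F0 x\<bar> \<partial>lebesgue)) \<longlonglongrightarrow> 0" by simp
    fix m
    have "(\<integral>\<^sup>+x. norm (F m x * \<eta> x - F0 x * \<eta> x) \<partial>lebesgue) \<le> (\<integral>\<^sup>+x. ennreal B * ennreal \<bar>F m x - F0 x\<bar> \<partial>lebesgue)"
    proof (rule nn_integral_mono)
      fix x
      have "norm (F m x * \<eta> x - F0 x * \<eta> x) = \<bar>F m x - F0 x\<bar> * \<bar>\<eta> x\<bar>" by (simp add: left_diff_distrib[symmetric] abs_mult)
      also have "\<dots> \<le> \<bar>F m x - F0 x\<bar> * B" by (intro mult_left_mono B) simp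
      finally have "ennreal (norm (F m x * \<eta> x - F0 x * \<eta> x)) \<le> ennreal (B * \<bar>F m x - F0 x\<bar>)" by (simp add: ennreal_leI mult.commute)
      also have "\<dots> = ennreal B * ennreal \<bar>F m x - F0 x\<bar>" using B(1) by (intro ennreal_mult) auto
      finally show "ennreal (norm (F m x * \<eta> x - F0 x * \<eta> x)) \<le> ennreal B * ennreal \<bar>F m x - F0 x\<bar>" .
    qed
    also have "\<dots> = ennreal B * (\<integral>\<^sup>+x. ennreal \<bar>F m x - F0 x\<bar> \<partial>lebesgue)" by (rule nn_integral_cmult) measurable
    finally show "(\<integral>\<^sup>+x. norm (F m x * \<eta> x - F0 x * \<eta> x) \<partial>lebesgue) \<le> ennreal B * (\<integral>\<^sup>+x. ennreal \<bar>F m x - F0 x\<bar> \<partial>lebesgue)" .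
  qed
qed

text \<open>
  Weak derivatives are closed under convergence in the mean; this gives the product rule for
  \<open>|\<nabla>\<phi>|\<^sup>2\<close> from that for test functions.
\<close>

lemma L1_conv_weak_pderiv:
  assumes F: "L1_conv F u" "\<And>m. test_function (F m)" and W: "L1_conv (\<lambda>m. partial_deriv j (F m)) w"
  shows "has_weak_pderiv j u w"
  unfolding has_weak_pderiv_def
proof (intro conjI allI impI)
  show "locally_integrable u"
    by (rule integrable_pow_locally_integrable[where p=1]) (use F(1) in \<open>auto simp: L1_conv_def\<close>)
  show "locally_integrable w"
    by (rule integrable_pow_locally_integrable[where p=1]) (use W in \<open>auto simp: L1_conv_def\<close>)
  fix \<eta> :: "real^'a \<Rightarrow> real" assume \<eta>: "test_function \<eta>"
  have sm: "smooth (F m)" "smooth \<eta>" for m using test_functionD(1) F(2) \<eta> by auto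
  have eq: "(LINT x|lebesgue. F m x * partial_deriv j \<eta> x) = - (LINT x|lebesgue. partial_deriv j (F m) x * \<eta> x)" for m
  proof -
    obtain R where R: "\<And>x. norm x > R \<Longrightarrow> F m x = 0" using test_functionD(2)[OF F(2)] by auto
    have i1: "integrable lborel (\<lambda>x. F m x * partial_deriv j \<eta> x)"
      by (rule integrable_cont_compact_support[of _ R, OF continuous_on_mult[OF smoothD(3)[OF sm(1)] smoothD(3)[OF smoothD(2)[OF sm(2)]]]])
         (simp add: R)
    have i2: "integrable lborel (\<lambda>x. partial_deriv j (F m) x * \<eta> x)"
      by (rule integrable_cont_compact_support[of _ R, OF continuous_on_mult[OF smoothD(3)[OF smoothD(2)[OF sm(1)]] smoothD(3)[OF sm(2)]]])
         (simp add: partial_deriv_zero_outside[of R, OF R])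
    have "(LINT x|lborel. F m x * partial_deriv j \<eta> x + partial_deriv j (F m) x * \<eta> x) = 0"
      using integral_partial_deriv_test[OF test_function_mult_smooth[OF \<eta> sm(1)], of j m]
      unfolding partial_deriv_mult_smooth[OF sm] .
    then have "(LINT x|lborel. F m x * partial_deriv j \<eta> x) = - (LINT x|lborel. partial_deriv j (F m) x * \<eta> x)"
      using i1 i2 by simp
    moreover have "(LINT x|lebesgue. F m x * partial_deriv j \<eta> x) = (LINT x|lborel. F m x * partial_deriv j \<eta> x)"
      using borel_measurable_integrable[OF i1] by (rule integral_completion)
    moreover have "(LINT x|lebesgue. partial_deriv j (F m) x * \<eta> x) = (LINT x|lborel. partial_deriv j (F m) x * \<eta> x)"
      using borel_measurable_integrable[OF i2] by (rule integral_completion)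
    ultimately show ?thesis by simp
  qed
  have "(\<lambda>m. LINT x|lebesgue. F m x * partial_deriv j \<eta> x) \<longlonglongrightarrow> (LINT x|lebesgue. u x * partial_deriv j \<eta> x)"
    by (rule L1_conv_test_integral[OF F test_function_partial_deriv[OF \<eta>]])
  moreover have "(\<lambda>m. - (LINT x|lebesgue. partial_deriv j (F m) x * \<eta> x)) \<longlonglongrightarrow> - (LINT x|lebesgue. w x * \<eta> x)"
    by (intro tendsto_minus L1_conv_test_integral[OF W test_function_partial_deriv[OF F(2)] \<eta>])
  ultimately show "(LINT x|lebesgue. u x * partial_deriv j \<eta> x) = - (LINT x|lebesgue. w x * \<eta> x)"
    unfolding eq by (rule LIMSEQ_unique)
qed

lemma L1_conv_W1:
  fixes u :: "real^'n \<Rightarrow> real"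
  assumes t: "\<And>m. test_function (F m)" and F: "L1_conv F w" and u: "u \<in> borel_measurable lebesgue" "AE x in lebesgue. w x = u x"
    and W: "\<And>k. L1_conv (\<lambda>m. partial_deriv k (F m)) (w' k)"
  shows "sobolev 1 1 u" "tendsto_W1 1 F u"
proof -
  have wm: "w \<in> borel_measurable lebesgue" "w' k \<in> borel_measurable lebesgue" for k
    using F W[of k] by (auto simp: L1_conv_def)
  have h: "has_weak_pderiv k w (w' k)" for k by (rule L1_conv_weak_pderiv[OF F t W])
  have L: "Lp 1 w" "Lp 1 (w' k)" for k
    using F W[of k] by (auto simp: L1_conv_def Lp_def)
  have "sobolev (Suc 0) 1 w" by (rule sobolev_SucI[OF L(1) h]) (simp add: L)
  from sobolev_cong_AE[OF this u] show "sobolev 1 1 u" by (simp only: One_nat_def)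
  have e: "weak_pderiv k w = weak_pderiv k u" for k by (rule weak_pderiv_cong_AE[OF wm(1) u])
  have ae: "AE x in lebesgue. weak_pderiv k u x = w' k x" for k using weak_pderiv_eq(2)[OF h] by (simp add: e)
  have "(\<integral>\<^sup>+x. ennreal (\<bar>F m x - u x\<bar> powr 1) \<partial>lebesgue) = (\<integral>\<^sup>+x. ennreal \<bar>F m x - w x\<bar> \<partial>lebesgue)" for m
    by (rule nn_integral_cong_AE) (use u(2) in eventually_elim, simp)
  moreover have "(\<integral>\<^sup>+x. ennreal (\<bar>partial_deriv k (F m) x - weak_pderiv k u x\<bar> powr 1) \<partial>lebesgue) =
      (\<integral>\<^sup>+x. ennreal \<bar>partial_deriv k (F m) x - w' k x\<bar> \<partial>lebesgue)" for m k
    by (rule nn_integral_cong_AE) (use ae[of k] in eventually_elim, simp)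
  ultimately show "tendsto_W1 1 F u"
    using F W by (simp add: tendsto_W1_def L1_conv_def)
qed

section \<open>Passing to the limit on the graph\<close>

lemma integrable_bounded_support:
  fixes h :: "real^'n \<Rightarrow> real"
  assumes [measurable]: "h \<in> borel_measurable borel" and C: "\<And>x. \<bar>h x\<bar> \<le> C" and R: "\<And>x. norm x > R \<Longrightarrow> h x = 0"
  shows "integrable lborel h"
proof (rule Bochner_Integration.integrable_bound)
  show "integrable lborel (\<lambda>x. C * indicator (cball (0::real^'n) R) x)"
    using emeasure_bounded_finite[OF bounded_cball, of "0::real^'n" R]
    by (intro integrable_mult_right integrable_real_indicator) auto
  show "AE x in lborel. norm (h x) \<le> norm (C * indicator (cball 0 R) x)"
  proof (rule AE_I2)
    fix x :: "real^'n"
    show "norm (h x) \<le> norm (C * indicator (cball 0 R) x)"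
      using C[of x] R[of x] by (cases "norm x \<le> R") auto
  qed
qed simp

lemma continuous_support_bounded:
  fixes h :: "real^'n \<Rightarrow> real"
  assumes c: "continuous_on UNIV h" and R: "\<And>x. norm x > R \<Longrightarrow> h x = 0"
  shows "\<exists>C. \<forall>x. \<bar>h x\<bar> \<le> C"
proof -
  have "compact (h ` cball 0 R)" by (intro compact_continuous_image continuous_on_subset[OF c]) auto
  then obtain C where C: "C > 0" "\<And>x. x \<in> cball 0 R \<Longrightarrow> \<bar>h x\<bar> \<le> C"
    using compact_imp_bounded[of "h ` cball 0 R"] by (auto simp: bounded_pos)
  have "\<bar>h x\<bar> \<le> C" for x using C R[of x] by (cases "norm x \<le> R") auto
  then show ?thesis by blast
qed

text \<open>
  A bounded kernel with compact support lives over a slab, where \<open>v\<close> converges in the mean square.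
\<close>

lemma graph_integral_limit:
  fixes u g k :: "real^'n \<Rightarrow> real"
  assumes e: "norm e = 1" and \<gamma>: "C11 \<gamma>"
    and v: "\<And>m. test_function (v m)" and u: "sobolev 1 2 u" and W: "tendsto_W1 2 v u"
    and g[measurable]: "g \<in> borel_measurable borel"
    and lim: "AE z in lborel. (\<lambda>m. v m (graph_map e \<gamma> z)) \<longlonglongrightarrow> g (graph_map e \<gamma> z)"
    and k[measurable]: "k \<in> borel_measurable borel" and C: "\<And>x. \<bar>k x\<bar> \<le> C" and R: "\<And>x. norm x > R \<Longrightarrow> k x = 0"
  shows "integrable lborel (\<lambda>z. k z * g (graph_map e \<gamma> z))"
    "(\<lambda>m. LINT z|lborel. k z * v m (graph_map e \<gamma> z)) \<longlonglongrightarrow> (LINT z|lborel. k z * g (graph_map e \<gamma> z))"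
proof -
  let ?\<Phi> = "graph_map e \<gamma>"
  have [measurable]: "?\<Phi> \<in> borel_measurable borel" by (rule graph_map_measurable[OF e \<gamma>])
  have [measurable]: "v m \<in> borel_measurable borel" for m by (rule smoothD(5)[OF test_functionD(1)[OF v]])
  let ?A = "{- R..R}"
  let ?a = "\<lambda>m z. indicator ?A (z \<bullet> e) * (v m (?\<Phi> z) - g (?\<Phi> z))"
  have a0: "(\<lambda>m. \<integral>\<^sup>+z. ennreal ((?a m z)^2) \<partial>lborel) \<longlonglongrightarrow> 0"
  proof -
    have "(\<lambda>m. \<integral>\<^sup>+z. indicator ?A (z \<bullet> e) * ennreal (\<bar>v m (?\<Phi> z) - g (?\<Phi> z)\<bar> powr 2) \<partial>lborel) \<longlonglongrightarrow> 0"
      by (rule trace_conv_slab[OF e \<gamma> _ v u W lim]) (use emeasure_compact_finite[of ?A] in auto)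
    moreover have "indicator ?A (z \<bullet> e) * ennreal (\<bar>v m (?\<Phi> z) - g (?\<Phi> z)\<bar> powr 2) = ennreal ((?a m z)^2)" for m z
      by (auto simp: abs_powr_2 indicator_def)
    ultimately show ?thesis by simp
  qed
  have "integrable lborel (\<lambda>z. (k z)^2)"
  proof (rule integrable_bounded_support[where R=R])
    show "\<bar>(k z)^2\<bar> \<le> C^2" for z using C[of z] by (simp add: abs_le_square_iff[symmetric])
  qed (auto simp: R)
  then have kfin: "(\<integral>\<^sup>+z. ennreal ((k z)^2) \<partial>lborel) < \<infinity>" by (simp add: integrable_iff_bounded)
  then obtain B where B: "B \<ge> 0" "(\<integral>\<^sup>+z. ennreal ((k z)^2) \<partial>lborel) = ennreal B"
    by (cases "\<integral>\<^sup>+z. ennreal ((k z)^2) \<partial>lborel") auto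
  have "(\<lambda>m. \<integral>\<^sup>+z. ennreal (\<bar>?a m z\<bar> * \<bar>k z\<bar>) \<partial>lborel) \<longlonglongrightarrow> 0"
    by (rule nn_product_tendsto_0[where B=B, OF _ _ a0]) (use B in auto)
  moreover have "\<bar>?a m z\<bar> * \<bar>k z\<bar> = norm (k z * v m (?\<Phi> z) - k z * g (?\<Phi> z))" for m z
  proof (cases "norm z \<le> R")
    case True
    have "\<bar>z \<bullet> e\<bar> \<le> norm z" using Cauchy_Schwarz_ineq2[of z e] e by simp
    then have "z \<bullet> e \<in> ?A" using True by (auto simp: abs_le_iff)
    then show ?thesis by (simp add: right_diff_distrib[symmetric] abs_mult mult.commute)
  qed (use R in simp)
  ultimately have l0: "(\<lambda>m. \<integral>\<^sup>+z. norm (k z * v m (?\<Phi> z) - k z * g (?\<Phi> z)) \<partial>lborel) \<longlonglongrightarrow> 0" by simp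
  have iv: "integrable lborel (\<lambda>z. k z * v m (?\<Phi> z))" for m
  proof -
    obtain D where D: "D > 0" "\<And>x. \<bar>v m x\<bar> \<le> D" using test_function_bounded[OF v] by blast
    show ?thesis
    proof (rule integrable_bounded_support[where R=R])
      show "\<bar>k z * v m (?\<Phi> z)\<bar> \<le> C * D" for z
        unfolding abs_mult using order_trans[OF abs_ge_zero C] D(1) by (intro mult_mono C D) auto
    qed (auto simp: R)
  qed
  show ig: "integrable lborel (\<lambda>z. k z * g (?\<Phi> z))"
  proof -
    obtain m where m: "(\<integral>\<^sup>+z. norm (k z * v m (?\<Phi> z) - k z * g (?\<Phi> z)) \<partial>lborel) \<le> ennreal 1"
      using tendsto_0_ennrealD[OF l0 zero_less_one] by (auto simp: eventually_sequentially)
    have "integrable lborel (\<lambda>z. k z * v m (?\<Phi> z) - k z * g (?\<Phi> z))"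
      unfolding integrable_iff_bounded using m by (auto intro: le_less_trans)
    from Bochner_Integration.integrable_diff[OF iv[of m] this] show ?thesis by simp
  qed
  show "(\<lambda>m. LINT z|lborel. k z * v m (?\<Phi> z)) \<longlonglongrightarrow> (LINT z|lborel. k z * g (?\<Phi> z))"
    by (rule tendsto_L1_int[OF iv ig l0])
qed

lemma graph_tangent_continuous:
  assumes e: "norm e = 1" and \<gamma>: "C11 \<gamma>"
  shows "continuous_on UNIV (\<lambda>z. graph_tangent e \<gamma> z w)"
  unfolding graph_tangent_def graph_slope_def
  by (intro continuous_intros continuous_on_compose2[OF tangential_continuous[of UNIV]]
      continuous_on_compose2[OF C11_grad_continuous[OF \<gamma>, of UNIV]] tangential_continuous) auto

lemma grad_zero_at_min:
  assumes "f differentiable (at x)" "\<And>y. f x \<le> f y"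
  shows "grad f x = 0"
proof -
  have "(\<lambda>h. grad f x \<bullet> h) = (\<lambda>h. 0)"
    by (rule differential_zero_maxmin[OF _ open_UNIV has_derivative_grad[OF assms(1)]]) (use assms(2) in auto)
  then have "grad f x \<bullet> grad f x = 0" by meson
  then show ?thesis by simp
qed

text \<open>
  Integration by parts of \<open>f\<close> against \<open>\<theta>\<close> times the pulled back test function; the chain rule for the graph map
  produces the tangent vector, and every term passes to the limit separately.
\<close>

lemma tangential_identity_weak:
  fixes a :: "nat \<Rightarrow> real^'n \<Rightarrow> real" and f :: "real^'n \<Rightarrow> real"
  assumes e: "norm e = 1" and \<gamma>: "C11 \<gamma>"
    and f: "\<And>x y. \<bar>f x - f y\<bar> \<le> L * norm (x - y)"
    and a: "\<And>m. test_function (a m)" and u: "sobolev 1 2 u" and W: "tendsto_W1 2 a u"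
    and g: "g \<in> borel_measurable borel"
    and limg: "AE z in lborel. (\<lambda>m. a m (graph_map e \<gamma> z)) \<longlonglongrightarrow> g (graph_map e \<gamma> z)"
    and u': "\<And>j. sobolev 1 2 (u' j)" and W': "\<And>j. tendsto_W1 2 (\<lambda>m. partial_deriv j (a m)) (u' j)"
    and G: "\<And>j. G j \<in> borel_measurable borel"
    and limG: "\<And>j. AE z in lborel. (\<lambda>m. partial_deriv j (a m) (graph_map e \<gamma> z)) \<longlonglongrightarrow> G j (graph_map e \<gamma> z)"
    and \<theta>: "test_function \<theta>"
  shows "integrable lborel (\<lambda>z. (directional_limit f w z * \<theta> z) * g (graph_map e \<gamma> z))" (is ?I1)
    "integrable lborel (\<lambda>z. (f z * (grad \<theta> z \<bullet> w)) * g (graph_map e \<gamma> z))" (is ?I2)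
    "integrable lborel (\<lambda>z. \<Sum>j\<in>UNIV. (f z * \<theta> z * graph_tangent e \<gamma> z w $ j) * G j (graph_map e \<gamma> z))" (is ?I3)
    "(LINT z|lborel. (directional_limit f w z * \<theta> z) * g (graph_map e \<gamma> z)) =
      - (LINT z|lborel. (f z * (grad \<theta> z \<bullet> w)) * g (graph_map e \<gamma> z))
      - (LINT z|lborel. (\<Sum>j\<in>UNIV. (f z * \<theta> z * graph_tangent e \<gamma> z w $ j) * G j (graph_map e \<gamma> z)))" (is ?E)
proof -
  let ?\<Phi> = "graph_map e \<gamma>" and ?T = "\<lambda>z. graph_tangent e \<gamma> z w"
  have sa: "smooth (a m)" for m by (rule test_functionD[OF a])
  have s\<theta>: "smooth \<theta>" by (rule test_functionD[OF \<theta>])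
  have ta: "test_function (partial_deriv j (a m))" for j m by (rule test_function_partial_deriv[OF a])
  obtain R where R: "\<And>x. norm x > R \<Longrightarrow> \<theta> x = 0" using test_functionD(2)[OF \<theta>] by auto
  have gR: "grad \<theta> x = 0" if "norm x > R" for x
    using partial_deriv_zero_outside[of R \<theta> x, OF R that] by (simp add: grad_def vec_eq_iff)
  have fc: "continuous_on UNIV f" by (rule lipschitz_continuous[OF f])
  have \<theta>c: "continuous_on UNIV \<theta>" by (rule smoothD(3)[OF s\<theta>])
  have gc: "continuous_on UNIV (\<lambda>z. grad \<theta> z \<bullet> w)" by (intro continuous_intros smooth_grad_continuous s\<theta>)
  have Tc: "continuous_on UNIV (\<lambda>z. ?T z $ j)" for j by (intro continuous_intros graph_tangent_continuous[OF e \<gamma>])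
  have \<Phi>c: "continuous_on UNIV (\<lambda>z. h (?\<Phi> z))" if "continuous_on UNIV h" for h :: "real^'n \<Rightarrow> real"
    by (rule continuous_on_compose2[OF that graph_map_continuous[OF e \<gamma>]]) auto
  let ?K1 = "\<lambda>z. directional_limit f w z * \<theta> z" and ?K2 = "\<lambda>z. f z * (grad \<theta> z \<bullet> w)" and ?K3 = "\<lambda>j z. f z * \<theta> z * ?T z $ j"
  have c2: "continuous_on UNIV ?K2" by (rule continuous_on_mult[OF fc gc])
  have c3: "continuous_on UNIV (?K3 j)" for j by (rule continuous_on_mult[OF continuous_on_mult[OF fc \<theta>c] Tc])
  have m1: "?K1 \<in> borel_measurable borel"
    by (rule borel_measurable_times[OF directional_limit_measurable[OF f] smoothD(5)[OF s\<theta>]])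
  have m2: "?K2 \<in> borel_measurable borel" by (rule borel_measurable_continuous_onI[OF c2])
  have m3: "?K3 j \<in> borel_measurable borel" for j by (rule borel_measurable_continuous_onI[OF c3])
  have r1: "?K1 z = 0" if "norm z > R" for z using R[OF that] by simp
  have r2: "?K2 z = 0" if "norm z > R" for z using gR[OF that] by simp
  have r3: "?K3 j z = 0" if "norm z > R" for z j using R[OF that] by simp
  obtain B where B: "B > 0" "\<And>x. \<bar>\<theta> x\<bar> \<le> B" using test_function_bounded[OF \<theta>] by auto
  have b1: "\<bar>?K1 z\<bar> \<le> (L * norm w) * B" for z
    unfolding abs_mult using order_trans[OF abs_ge_zero directional_limit_bound[OF f]] B(1)
    by (intro mult_mono directional_limit_bound[OF f] B) auto
  obtain C2 where b2: "\<And>z. \<bar>?K2 z\<bar> \<le> C2" using continuous_support_bounded[OF c2 r2] by blast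
  have "\<exists>C. \<forall>z. \<bar>?K3 j z\<bar> \<le> C" for j by (rule continuous_support_bounded[OF c3 r3])
  then obtain C3 where b3: "\<And>j z. \<bar>?K3 j z\<bar> \<le> C3 j" by metis
  note L1 = graph_integral_limit[OF e \<gamma> a u W g limg m1 b1 r1]
  note L2 = graph_integral_limit[OF e \<gamma> a u W g limg m2 b2 r2]
  note L3 = graph_integral_limit[OF e \<gamma> ta u' W' G limG m3 b3 r3]
  show ?I1 by (rule L1(1))
  show ?I2 by (rule L2(1))
  show ?I3 by (intro Bochner_Integration.integrable_sum L3(1))
  have ibp: "(LINT z|lborel. ?K1 z * a m (?\<Phi> z)) =
      - (LINT z|lborel. ?K2 z * a m (?\<Phi> z)) - (\<Sum>j\<in>UNIV. LINT z|lborel. ?K3 j z * partial_deriv j (a m) (?\<Phi> z))" for m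
  proof -
    let ?\<zeta> = "\<lambda>z. \<theta> z * a m (?\<Phi> z)"
    let ?\<zeta>' = "\<lambda>z. \<theta> z * (\<Sum>j\<in>UNIV. partial_deriv j (a m) (?\<Phi> z) * ?T z $ j) + (grad \<theta> z \<bullet> w) * a m (?\<Phi> z)"
    have zc: "continuous_on UNIV ?\<zeta>" by (rule continuous_on_mult[OF \<theta>c \<Phi>c[OF smoothD(3)[OF sa]]])
    have zc': "continuous_on UNIV ?\<zeta>'"
      by (intro continuous_on_add continuous_on_mult \<theta>c gc continuous_on_sum \<Phi>c smoothD(3)[OF smoothD(2)[OF sa]] smoothD(3)[OF sa] Tc)
    have D: "((\<lambda>t. ?\<zeta> (x + t *\<^sub>R w)) has_real_derivative ?\<zeta>' (x + t *\<^sub>R w)) (at t)" for x t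
    proof -
      let ?z = "x + t *\<^sub>R w"
      have d1: "(\<theta> has_derivative (\<lambda>h. grad \<theta> ?z \<bullet> h)) (at ?z)" by (rule has_derivative_grad[OF smoothD(1)[OF s\<theta>]])
      have d2: "((\<lambda>z. a m (?\<Phi> z)) has_derivative (\<lambda>h. grad (a m) (?\<Phi> ?z) \<bullet> graph_tangent e \<gamma> ?z h)) (at ?z)"
        by (rule has_derivative_compose[OF graph_map_has_derivative[OF e \<gamma>] has_derivative_grad[OF smoothD(1)[OF sa]]])
      from has_derivative_line[OF has_derivative_mult[OF d1 d2]]
      show ?thesis by (simp add: inner_vec_def[of _ "graph_tangent e \<gamma> (x + t *\<^sub>R w) w"] grad_def[of "a m"])
    qed
    have zR: "?\<zeta> x = 0" if "norm x > R" for x using R[OF that] by simp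
    have ae: "AE x in lborel. (\<lambda>n. diff_quotient f w n x) \<longlonglongrightarrow> directional_limit f w x"
      using diff_quotient_Cauchy_AE[OF f, of w] by eventually_elim (rule directional_limit_LIMSEQ)
    have "(LINT x|lborel. directional_limit f w x * ?\<zeta> x) = - (LINT x|lborel. f x * ?\<zeta>' x)"
      by (rule lipschitz_integration_by_parts(3)[OF f directional_limit_measurable[OF f] ae zc zc' D zR])
    also have "(LINT x|lborel. f x * ?\<zeta>' x) = (LINT z|lborel. ?K2 z * a m (?\<Phi> z) + (\<Sum>j\<in>UNIV. ?K3 j z * partial_deriv j (a m) (?\<Phi> z)))"
      by (rule Bochner_Integration.integral_cong[OF refl]) (simp add: distrib_left sum_distrib_left mult_ac)
    also have "\<dots> = (LINT z|lborel. ?K2 z * a m (?\<Phi> z)) + (\<Sum>j\<in>UNIV. LINT z|lborel. ?K3 j z * partial_deriv j (a m) (?\<Phi> z))"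
    proof -
      have i2: "integrable lborel (\<lambda>z. ?K2 z * a m (?\<Phi> z))"
        by (rule integrable_cont_compact_support[OF continuous_on_mult[OF c2 \<Phi>c[OF smoothD(3)[OF sa]]], of R]) (simp add: gR)
      have i3: "integrable lborel (\<lambda>z. ?K3 j z * partial_deriv j (a m) (?\<Phi> z))" for j
        by (rule integrable_cont_compact_support[OF continuous_on_mult[OF c3 \<Phi>c[OF smoothD(3)[OF smoothD(2)[OF sa]]]], of R]) (simp add: R)
      show ?thesis
        using i2 i3 by (subst Bochner_Integration.integral_add) (auto intro!: Bochner_Integration.integrable_sum simp: Bochner_Integration.integral_sum)
    qed
    finally show ?thesis by (simp add: mult.assoc)
  qed
  have "(\<lambda>m. - (LINT z|lborel. ?K2 z * a m (?\<Phi> z)) - (\<Sum>j\<in>UNIV. LINT z|lborel. ?K3 j z * partial_deriv j (a m) (?\<Phi> z)))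
     \<longlonglongrightarrow> - (LINT z|lborel. ?K2 z * g (?\<Phi> z)) - (\<Sum>j\<in>UNIV. LINT z|lborel. ?K3 j z * G j (?\<Phi> z))"
    by (intro tendsto_diff tendsto_minus tendsto_sum L2(2) L3(2))
  from LIMSEQ_unique[OF L1(2) this[folded ibp]]
  show ?E using L3(1) by (subst Bochner_Integration.integral_sum) auto
qed

lemma AE_open_by_bumps:
  fixes w :: "real^'n \<Rightarrow> real"
  assumes U: "open U" and loc: "\<And>p q. box p q \<subseteq> U \<Longrightarrow> integrable lborel (\<lambda>z. w z * box_bump p q z)"
    and weak: "\<And>p q \<eta>. box p q \<subseteq> U \<Longrightarrow> test_function \<eta> \<Longrightarrow> (LINT z|lborel. w z * (box_bump p q z * \<eta> z)) = 0"
  shows "AE z in lborel. z \<in> U \<longrightarrow> w z = 0"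
proof -
  obtain D where D: "countable D" "\<And>X. X \<in> D \<Longrightarrow> \<exists>p q. X = box p q" "\<Union>D = U"
    using open_countable_Union_open_box[OF U] by metis
  have "AE z in lborel. z \<in> X \<longrightarrow> w z = 0" if XD: "X \<in> D" for X
  proof -
    obtain p q where X: "X = box p q" using D(2)[OF XD] by blast
    have XU: "box p q \<subseteq> U" using D(3) XD X by blast
    let ?W = "\<lambda>z. w z * box_bump p q z"
    have i: "integrable lborel ?W" by (rule loc[OF XU])
    have m: "?W \<in> borel_measurable lborel" by (rule borel_measurable_integrable[OF i])
    have il: "integrable lebesgue ?W" using i by (subst integrable_completion[OF m])
    have "AE z in lebesgue. ?W z = 0"
    proof (rule fundamental_lemma)
      show "locally_integrable ?W"
        by (rule integrable_pow_locally_integrable[where p=1]) (use il in auto)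
      fix \<eta> :: "real^'n \<Rightarrow> real" assume \<eta>: "test_function \<eta>"
      have [measurable]: "\<eta> \<in> borel_measurable borel" by (rule smoothD(5)[OF test_functionD(1)[OF \<eta>]])
      have "(LINT z|lebesgue. ?W z * \<eta> z) = (LINT z|lborel. ?W z * \<eta> z)"
        by (rule integral_completion) (use m in measurable)
      also have "\<dots> = 0" using weak[OF XU \<eta>] by (simp add: mult.assoc)
      finally show "(LINT z|lebesgue. ?W z * \<eta> z) = 0" .
    qed
    then have "AE z in lborel. ?W z = 0" by (simp add: AE_completion_iff)
    then show ?thesis
    proof eventually_elim
      case (elim z)
      then show ?case using box_bump_pos_iff[of p q z] X by auto
    qed
  qed
  then have "AE z in lborel. \<forall>X\<in>D. z \<in> X \<longrightarrow> w z = 0" by (subst AE_ball_countable[OF D(1)]) blast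
  then show ?thesis by eventually_elim (use D(3) in blast)
qed

text \<open>
  The term with the derivative of the test function contains the sum \<open>\<Sum>\<^sub>i f\<^sub>i g\<^sub>i\<close>, which
  vanishes on \<open>U\<close>. Off \<open>U\<close> the gradient of the test function vanishes: the nonnegative bump attains its minimum there.
\<close>

lemma tangential_identity:
  fixes a :: "nat \<Rightarrow> 'n \<Rightarrow> real^'n \<Rightarrow> real" and f :: "'n \<Rightarrow> real^'n \<Rightarrow> real"
  assumes e: "norm e = 1" and \<gamma>: "C11 \<gamma>" and U: "open U"
    and f: "\<And>i x y. \<bar>f i x - f i y\<bar> \<le> L * norm (x - y)"
    and a: "\<And>m i. test_function (a m i)" and u: "\<And>i. sobolev 1 2 (u i)" and W: "\<And>i. tendsto_W1 2 (\<lambda>m. a m i) (u i)"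
    and g: "\<And>i. g i \<in> borel_measurable borel"
    and limg: "\<And>i. AE z in lborel. (\<lambda>m. a m i (graph_map e \<gamma> z)) \<longlonglongrightarrow> g i (graph_map e \<gamma> z)"
    and u': "\<And>i j. sobolev 1 2 (u' i j)" and W': "\<And>i j. tendsto_W1 2 (\<lambda>m. partial_deriv j (a m i)) (u' i j)"
    and G: "\<And>i j. G i j \<in> borel_measurable borel"
    and limG: "\<And>i j. AE z in lborel. (\<lambda>m. partial_deriv j (a m i) (graph_map e \<gamma> z)) \<longlonglongrightarrow> G i j (graph_map e \<gamma> z)"
    and orth: "AE z in lborel. z \<in> U \<longrightarrow> (\<Sum>i\<in>UNIV. f i z * g i (graph_map e \<gamma> z)) = 0"
  shows "AE z in lborel. z \<in> U \<longrightarrow> (\<Sum>i\<in>UNIV. directional_limit (f i) w z * g i (graph_map e \<gamma> z) +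
      f i z * (\<Sum>j\<in>UNIV. G i j (graph_map e \<gamma> z) * graph_tangent e \<gamma> z w $ j)) = 0"
proof (rule AE_open_by_bumps[OF U])
  let ?\<Phi> = "graph_map e \<gamma>" and ?T = "\<lambda>z. graph_tangent e \<gamma> z w"
  let ?w = "\<lambda>z. \<Sum>i\<in>UNIV. directional_limit (f i) w z * g i (?\<Phi> z) + f i z * (\<Sum>j\<in>UNIV. G i j (?\<Phi> z) * ?T z $ j)"
  have w_eq: "?w z * \<theta> = (\<Sum>i\<in>UNIV. (directional_limit (f i) w z * \<theta>) * g i (?\<Phi> z) + (\<Sum>j\<in>UNIV. (f i z * \<theta> * ?T z $ j) * G i j (?\<Phi> z)))" for z \<theta>
    by (simp add: sum_distrib_left sum_distrib_right distrib_right distrib_left mult_ac)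
  note weak = tangential_identity_weak[OF e \<gamma> f a u W g limg u' W' G limG]
  fix p q :: "real^'n" assume pq: "box p q \<subseteq> U"
  note b = weak[OF test_function_box_bump[of p q]]
  show "integrable lborel (\<lambda>z. ?w z * box_bump p q z)"
    unfolding w_eq by (intro Bochner_Integration.integrable_sum Bochner_Integration.integrable_add b(1) b(3))
  fix \<eta> :: "real^'n \<Rightarrow> real" assume \<eta>: "test_function \<eta>"
  let ?\<theta> = "\<lambda>z. box_bump p q z * \<eta> z"
  have t\<theta>: "test_function ?\<theta>" by (rule test_function_mult_smooth[OF \<eta> smooth_box_bump])
  note t = weak[OF t\<theta>]
  have gz: "grad ?\<theta> z = 0" if "z \<notin> U" for z
  proof -
    have bz: "box_bump p q z = 0" using that pq box_bump_pos_iff[of p q z] box_bump_nonneg[of p q z] by force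
    have "grad (box_bump p q) z = 0"
      by (rule grad_zero_at_min[OF smoothD(1)[OF smooth_box_bump]]) (simp add: bz box_bump_nonneg)
    then have "partial_deriv i (box_bump p q) z = 0" for i by (simp add: grad_def vec_eq_iff)
    then have "partial_deriv i ?\<theta> z = 0" for i
      by (subst partial_deriv_mult) (auto intro: smoothD(1)[OF smooth_box_bump] smoothD(1)[OF test_functionD(1)[OF \<eta>]] simp: bz)
    then show ?thesis by (simp add: grad_def vec_eq_iff)
  qed
  have mid: "(\<Sum>i\<in>UNIV. LINT z|lborel. (f i z * (grad ?\<theta> z \<bullet> w)) * g i (?\<Phi> z)) = 0"
  proof -
    have "(\<Sum>i\<in>UNIV. LINT z|lborel. (f i z * (grad ?\<theta> z \<bullet> w)) * g i (?\<Phi> z)) =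
        (LINT z|lborel. (\<Sum>i\<in>UNIV. (f i z * (grad ?\<theta> z \<bullet> w)) * g i (?\<Phi> z)))"
      by (rule Bochner_Integration.integral_sum[symmetric]) (rule t(2))
    also have "\<dots> = 0"
    proof (rule integral_eq_zero_AE)
      show "AE z in lborel. (\<Sum>i\<in>UNIV. (f i z * (grad ?\<theta> z \<bullet> w)) * g i (?\<Phi> z)) = 0"
        using orth
      proof eventually_elim
        case (elim z)
        show ?case
        proof (cases "z \<in> U")
          case True
          have "(\<Sum>i\<in>UNIV. (f i z * (grad ?\<theta> z \<bullet> w)) * g i (?\<Phi> z)) = (grad ?\<theta> z \<bullet> w) * (\<Sum>i\<in>UNIV. f i z * g i (?\<Phi> z))"
            by (simp add: sum_distrib_left mult_ac)
          then show ?thesis using elim True by simp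
        next
          case False
          then show ?thesis by (simp add: gz)
        qed
      qed
    qed
    finally show ?thesis .
  qed
  have "(LINT z|lborel. ?w z * ?\<theta> z) = (\<Sum>i\<in>UNIV. (LINT z|lborel. (directional_limit (f i) w z * ?\<theta> z) * g i (?\<Phi> z)) +
      (LINT z|lborel. (\<Sum>j\<in>UNIV. (f i z * ?\<theta> z * ?T z $ j) * G i j (?\<Phi> z))))"
    unfolding w_eq using t(1,3)
    by (subst Bochner_Integration.integral_sum) (auto intro!: Bochner_Integration.integrable_add sum.cong Bochner_Integration.integral_add)
  also have "\<dots> = - (\<Sum>i\<in>UNIV. LINT z|lborel. (f i z * (grad ?\<theta> z \<bullet> w)) * g i (?\<Phi> z))"
    unfolding t(4) by (simp add: sum_negf)
  finally show "(LINT z|lborel. ?w z * ?\<theta> z) = 0" by (simp add: mid)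
qed

section \<open>The identity on the boundary\<close>

lemma sobolev_Suc_imp: "sobolev (Suc k) p u \<Longrightarrow> sobolev k p u"
proof (induction k arbitrary: u)
  case 0
  then show ?case by simp
next
  case (Suc k)
  have "\<exists>w. has_weak_pderiv i u w \<and> sobolev k p w" for i
    using Suc.prems Suc.IH by (metis sobolev.simps(2))
  then show ?case using Suc.prems by simp
qed

text \<open>
  The function is constant along \<open>e\<close>, so differentiability almost everywhere in space gives differentiability at
  almost every point of the graph.
\<close>

lemma normal_derivative_graph_map:
  assumes e: "norm e = 1" and \<gamma>: "C11 \<gamma>"
    and d: "(\<lambda>y. graph_normal e \<gamma> y $ i) differentiable (at z)"
  shows "(\<lambda>y. graph_normal e \<gamma> y $ i) differentiable (at (graph_map e \<gamma> z))"
    "grad (\<lambda>y. graph_normal e \<gamma> y $ i) (graph_map e \<gamma> z) = grad (\<lambda>y. graph_normal e \<gamma> y $ i) z"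
proof -
  let ?f = "\<lambda>y. graph_normal e \<gamma> y $ i"
  define s where "s = \<gamma> (tangential e z) - z \<bullet> e"
  have x: "graph_map e \<gamma> z + (- s) *\<^sub>R e = z"
    using tangential_decomp[of e z] by (simp add: graph_map_def s_def scaleR_diff_left)
  have "((\<lambda>y. y + (- s) *\<^sub>R e) has_derivative (\<lambda>h. h)) (at (graph_map e \<gamma> z))" by (auto intro!: derivative_eq_intros)
  moreover have "(?f has_derivative (\<lambda>h. grad ?f z \<bullet> h)) (at (graph_map e \<gamma> z + (- s) *\<^sub>R e))"
    unfolding x by (rule has_derivative_grad[OF d])
  ultimately have "((\<lambda>y. ?f (y + (- s) *\<^sub>R e)) has_derivative (\<lambda>h. grad ?f z \<bullet> h)) (at (graph_map e \<gamma> z))"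
    by (rule has_derivative_compose)
  moreover have "(\<lambda>y. ?f (y + (- s) *\<^sub>R e)) = ?f" by (simp only: normal_shift[OF e \<gamma>])
  ultimately have D: "(?f has_derivative (\<lambda>h. grad ?f z \<bullet> h)) (at (graph_map e \<gamma> z))" by simp
  then show "?f differentiable (at (graph_map e \<gamma> z))" by (rule differentiableI)
  show "grad ?f (graph_map e \<gamma> z) = grad ?f z"
    using partial_deriv_eqI[OF D] by (simp add: grad_def vec_eq_iff inner_axis)
qed

text \<open>
  The identity in the coordinate directions is linear in the direction, so it may be used in the direction \<open>s\<close>, the
  gradient, which is tangential and hence fixed by \<open>T\<close>. The symmetry of \<open>G\<close> exchanges normal and gradient.
\<close>

lemma pointwise_identity:
  fixes N s :: "real^'n" and g :: "'n \<Rightarrow> real" and G :: "'n \<Rightarrow> 'n \<Rightarrow> real" and D :: "'n \<Rightarrow> real^'n"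
  assumes T: "linear T" and s: "s = (\<chi> i. g i)" and Ts: "T s = s"
    and id: "\<And>k. (\<Sum>i\<in>UNIV. D i $ k * g i + N $ i * (\<Sum>j\<in>UNIV. G i j * T (axis k 1) $ j)) = 0"
    and sym: "\<And>i j. G i j = G j i"
  shows "(\<Sum>j\<in>UNIV. N $ j * (2 * (\<Sum>i\<in>UNIV. g i * G i j))) = - 2 * (\<Sum>i\<in>UNIV. g i * (D i \<bullet> s))"
proof -
  have Tj: "(\<Sum>k\<in>UNIV. g k * T (axis k 1) $ j) = g j" for j
  proof -
    have "s = (\<Sum>k\<in>UNIV. g k *\<^sub>R axis k 1)"
      using basis_expansion[of s] by (simp add: s scalar_mult_eq_scaleR)
    then have "T s = (\<Sum>k\<in>UNIV. g k *\<^sub>R T (axis k 1))" by (simp add: linear_sum[OF T] linear_cmul[OF T])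
    then have "T s $ j = (\<Sum>k\<in>UNIV. g k * T (axis k 1) $ j)" by (simp add: sum_component)
    then show ?thesis by (simp add: Ts) (simp add: s)
  qed
  have "0 = (\<Sum>k\<in>UNIV. g k * (\<Sum>i\<in>UNIV. D i $ k * g i + N $ i * (\<Sum>j\<in>UNIV. G i j * T (axis k 1) $ j)))"
    by (simp add: id)
  also have "\<dots> = (\<Sum>k\<in>UNIV. \<Sum>i\<in>UNIV. g i * (D i $ k * g k)) +
      (\<Sum>k\<in>UNIV. \<Sum>i\<in>UNIV. \<Sum>j\<in>UNIV. N $ i * (G i j * (g k * T (axis k 1) $ j)))"
    by (simp add: sum.distrib[symmetric] sum_distrib_left distrib_left mult_ac)
  also have "(\<Sum>k\<in>UNIV. \<Sum>i\<in>UNIV. g i * (D i $ k * g k)) = (\<Sum>i\<in>UNIV. g i * (D i \<bullet> s))"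
    by (subst sum.swap) (simp add: s inner_vec_def sum_distrib_left)
  also have "(\<Sum>k\<in>UNIV. \<Sum>i\<in>UNIV. \<Sum>j\<in>UNIV. N $ i * (G i j * (g k * T (axis k 1) $ j))) =
      (\<Sum>i\<in>UNIV. \<Sum>j\<in>UNIV. N $ i * (G i j * g j))"
  proof -
    have "(\<Sum>k\<in>UNIV. \<Sum>i\<in>UNIV. \<Sum>j\<in>UNIV. N $ i * (G i j * (g k * T (axis k 1) $ j))) =
        (\<Sum>i\<in>UNIV. \<Sum>k\<in>UNIV. \<Sum>j\<in>UNIV. N $ i * (G i j * (g k * T (axis k 1) $ j)))" by (rule sum.swap)
    also have "\<dots> = (\<Sum>i\<in>UNIV. \<Sum>j\<in>UNIV. \<Sum>k\<in>UNIV. N $ i * (G i j * (g k * T (axis k 1) $ j)))"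
      by (rule sum.cong[OF refl sum.swap])
    also have "\<dots> = (\<Sum>i\<in>UNIV. \<Sum>j\<in>UNIV. N $ i * (G i j * g j))"
      by (simp only: sum_distrib_left[symmetric] Tj)
    finally show ?thesis .
  qed
  finally have e: "(\<Sum>i\<in>UNIV. \<Sum>j\<in>UNIV. N $ i * (G i j * g j)) = - (\<Sum>i\<in>UNIV. g i * (D i \<bullet> s))" by simp
  have "(\<Sum>j\<in>UNIV. N $ j * (2 * (\<Sum>i\<in>UNIV. g i * G i j))) = 2 * (\<Sum>j\<in>UNIV. \<Sum>i\<in>UNIV. N $ j * (G j i * g i))"
    by (simp add: sum_distrib_left mult_ac sym)
  then show ?thesis using e by simp
qed

lemma inner_weingarten:
  "v \<bullet> (weingarten \<Gamma> n x *v v) = (\<Sum>i\<in>UNIV. v $ i * (tangential_grad \<Gamma> n (\<lambda>y. n y $ i) x \<bullet> v))"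
proof -
  have "v \<bullet> (weingarten \<Gamma> n x *v v) = (\<Sum>\<alpha>\<in>UNIV. \<Sum>i\<in>UNIV. v $ \<alpha> * (tangential_grad \<Gamma> n (\<lambda>y. n y $ i) x $ \<alpha> * v $ i))"
    by (simp add: inner_vec_def matrix_vector_mult_def weingarten_def sum_distrib_left)
  also have "\<dots> = (\<Sum>i\<in>UNIV. \<Sum>\<alpha>\<in>UNIV. v $ \<alpha> * (tangential_grad \<Gamma> n (\<lambda>y. n y $ i) x $ \<alpha> * v $ i))"
    by (rule sum.swap)
  finally show ?thesis by (simp add: inner_vec_def sum_distrib_left mult_ac)
qed

theorem mainTheorem1:
  fixes \<Omega> \<Gamma> :: "(real^'n) set"
    and n :: "real^'n \<Rightarrow> real^'n"
    and \<phi> :: "real^'n \<Rightarrow> real"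
  assumes "CARD('n) \<ge> 2"
    and "open \<Omega>" and "connected \<Omega>" and "\<Omega> \<noteq> {}"
    and "C11_boundary_part \<Omega> \<Gamma>"
    and "\<forall>x\<in>\<Gamma>. outward_unit_normal \<Omega> x (n x)"
    and "\<phi> \<in> sobolev_H 3"
    and "AE_boundary \<Omega> \<Gamma> (\<lambda>x. normal_deriv 2 \<Omega> \<Gamma> n \<phi> x = 0)"
  shows "AE_boundary \<Omega> \<Gamma> (\<lambda>x.
    normal_deriv 1 \<Omega> \<Gamma> n (\<lambda>y. (norm (weak_grad \<phi> y))\<^sup>2) x =
      - 2 * (sobolev_tangential_grad 2 \<Omega> \<Gamma> n \<phi> x \<bullet>
              (weingarten \<Gamma> n x *v sobolev_tangential_grad 2 \<Omega> \<Gamma> n \<phi> x)))"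
proof -
  note op = assms(2) and n = assms(6)
  have \<Gamma>: "openin (top_of_set (frontier \<Omega>)) \<Gamma>" using assms(5) by (simp add: C11_boundary_part_def)
  define u where "u = (\<lambda>i. weak_pderiv i \<phi>)"
  define u2 where "u2 = (\<lambda>i j. weak_pderiv j (u i))"
  define u3 where "u3 = (\<lambda>i j k. weak_pderiv k (u2 i j))"
  have s\<phi>: "sobolev 3 2 \<phi>" using assms(7) by (simp add: sobolev_H_def)
  then have s3: "sobolev (Suc (Suc (Suc 0))) 2 \<phi>" by (simp only: numeral_3_eq_3)
  have s2: "sobolev (Suc (Suc 0)) 2 (u i)" for i unfolding u_def by (rule sobolev_SucD(3)[OF s3])
  have s1: "sobolev (Suc 0) 2 (u2 i j)" for i j unfolding u2_def by (rule sobolev_SucD(3)[OF s2])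
  have s1u: "sobolev 1 2 (u i)" for i using sobolev_Suc_imp[OF s2] by (simp only: One_nat_def)
  have s1u2: "sobolev 1 2 (u2 i j)" for i j using s1 by (simp only: One_nat_def)
  have L1: "Lp 2 (u i)" for i by (rule sobolev_Lp[OF s2])
  have L2: "Lp 2 (u2 i j)" for i j by (rule sobolev_Lp[OF s1])
  have L3: "Lp 2 (u3 i j k)" for i j k unfolding u3_def by (rule sobolev_Lp[OF sobolev_SucD(3)[OF s1]])
  obtain F where F: "\<And>m. test_function (F m)"
    and F1: "\<And>m i. W1_distance 2 (partial_deriv i (F m)) (u i) \<le> ennreal (1 / 16 ^ m)"
    and F2: "\<And>m i j. W1_distance 2 (partial_deriv j (partial_deriv i (F m))) (u2 i j) \<le> ennreal (1 / 16 ^ m)"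
    using sobolev_fast_approximation[OF s\<phi>] unfolding u_def u2_def by blast
  define a where "a = (\<lambda>m i. partial_deriv i (F m))"
  define b where "b = (\<lambda>m i j. partial_deriv j (a m i))"
  define c where "c = (\<lambda>m i j k. partial_deriv k (b m i j))"
  have ta: "test_function (a m i)" for m i unfolding a_def by (rule test_function_partial_deriv[OF F])
  have tb: "test_function (b m i j)" for m i j unfolding b_def by (rule test_function_partial_deriv[OF ta])
  have tc: "test_function (c m i j k)" for m i j k unfolding c_def by (rule test_function_partial_deriv[OF tb])
  have sa: "smooth (a m i)" and sb: "smooth (b m i j)" and sc: "smooth (c m i j k)" for m i j k
    by (rule test_functionD[OF ta], rule test_functionD[OF tb], rule test_functionD[OF tc])
  have Wa: "tendsto_W1 2 (\<lambda>m. a m i) (u i)" for i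
    unfolding a_def by (intro W1_distance_tendsto_W1 inverse_power_16_tendsto_0 F1)
  have Wb: "tendsto_W1 2 (\<lambda>m. b m i j) (u2 i j)" for i j
    unfolding b_def a_def by (intro W1_distance_tendsto_W1 inverse_power_16_tendsto_0 F2)
  \<comment> \<open>limits taken in the whole space, hence independent of any chart\<close>
  define g where "g = (\<lambda>i x. lim (\<lambda>m. a m i x))"
  define G where "G = (\<lambda>i j x. lim (\<lambda>m. b m i j x))"
  have gm: "g i \<in> borel_measurable borel" for i
    unfolding g_def by (intro borel_measurable_lim_metric smoothD(5)[OF sa])
  have Gm: "G i j \<in> borel_measurable borel" for i j
    unfolding G_def by (intro borel_measurable_lim_metric smoothD(5)[OF sb])
  have limg: "AE z in lborel. (\<lambda>m. a m i (graph_map e \<gamma> z)) \<longlonglongrightarrow> g i (graph_map e \<gamma> z)"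
    if "norm e = 1" "C11 \<gamma>" for e \<gamma> i
    unfolding g_def by (rule fast_trace_limit[OF ta s1u[of i] _ that]) (simp add: a_def F1)
  have limG: "AE z in lborel. (\<lambda>m. b m i j (graph_map e \<gamma> z)) \<longlonglongrightarrow> G i j (graph_map e \<gamma> z)"
    if "norm e = 1" "C11 \<gamma>" for e \<gamma> i j
    unfolding G_def by (rule fast_trace_limit[OF tb s1u2[of i j] _ that]) (simp add: b_def a_def F2)
  have Gsym: "G i j x = G j i x" for i j x
    unfolding G_def b_def a_def by (simp only: partial_deriv_commute[OF test_functionD(1)[OF F], of j i])
  have trg: "AE_boundary \<Omega> \<Gamma> (\<lambda>x. boundary_trace 2 \<Omega> \<Gamma> (u i) x = g i x)" for i
    by (rule boundary_trace_eq[OF _ \<Gamma> ta s1u Wa gm limg]) auto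

  define Q where "Q = (\<lambda>y. (norm (weak_grad \<phi> y))\<^sup>2)"
  have Q_eq: "Q = (\<lambda>y. \<Sum>i\<in>UNIV. u i y * u i y)"
    by (simp add: Q_def power2_norm_eq_inner inner_vec_def weak_grad_def u_def)
  define q where "q = (\<lambda>m x. \<Sum>i\<in>UNIV. a m i x * a m i x)"
  define dq where "dq = (\<lambda>j m x. 2 * (\<Sum>i\<in>UNIV. a m i x * b m i j x))"
  define ddq where "ddq = (\<lambda>j k m x. 2 * (\<Sum>i\<in>UNIV. a m i x * c m i j k x + b m i k x * b m i j x))"
  have tq: "test_function (q m)" for m
  proof -
    have "q m = (\<lambda>x. \<Sum>i\<in>UNIV. a m i x * a m i x)" by (simp add: q_def)
    moreover obtain R where R: "\<And>x. norm x > R \<Longrightarrow> F m x = 0" using test_functionD(2)[OF F] by auto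
    have "smooth (\<lambda>x. \<Sum>i\<in>UNIV. a m i x * a m i x)" by (intro smooth_sum smooth_intros(3) sa) auto
    then have "test_function (\<lambda>x. \<Sum>i\<in>UNIV. a m i x * a m i x)"
      by (rule test_functionI[where R=R]) (simp add: a_def partial_deriv_zero_outside[of R "F m", OF R])
    ultimately show ?thesis by simp
  qed
  have pq: "partial_deriv j (q m) = dq j m" for j m
  proof
    fix x
    have "partial_deriv j (q m) x = (\<Sum>i\<in>UNIV. partial_deriv j (\<lambda>x. a m i x * a m i x) x)"
      unfolding q_def by (rule partial_deriv_sum) (auto intro: smoothD(1) smooth_intros(3) sa)
    then show "partial_deriv j (q m) x = dq j m x"
      by (simp add: partial_deriv_mult_smooth[OF sa sa] dq_def b_def sum_distrib_left mult_ac)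
  qed
  have pdq: "partial_deriv k (dq j m) = ddq j k m" for j k m
  proof
    fix x
    have sm: "smooth (\<lambda>x. \<Sum>i\<in>UNIV. a m i x * b m i j x)" by (intro smooth_sum smooth_intros(3) sa sb) auto
    have "partial_deriv k (\<lambda>x. \<Sum>i\<in>UNIV. a m i x * b m i j x) x = (\<Sum>i\<in>UNIV. partial_deriv k (\<lambda>x. a m i x * b m i j x) x)"
      by (rule partial_deriv_sum) (auto intro: smoothD(1) smooth_intros(3) sa sb)
    moreover have "partial_deriv k (\<lambda>x. a m i x * b m i j x) = (\<lambda>x. a m i x * c m i j k x + b m i k x * b m i j x)" for i
    proof -
      have "partial_deriv k (\<lambda>x. a m i x * b m i j x) = (\<lambda>x. a m i x * partial_deriv k (b m i j) x + partial_deriv k (a m i) x * b m i j x)"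
        by (rule partial_deriv_mult_smooth[OF sa sb])
      then show ?thesis by (simp only: c_def b_def)
    qed
    ultimately show "partial_deriv k (dq j m) x = ddq j k m x"
      unfolding dq_def ddq_def partial_deriv_mult_smooth[OF smooth_intros(1) sm] by simp
  qed
  have qa: "(\<lambda>m. sq_integral (\<lambda>x. a m i x - u i x)) \<longlonglongrightarrow> 0" for i
    using Wa[of i] by (simp add: tendsto_W1_def sq_integral_def abs_powr_2)
  have qb: "(\<lambda>m. sq_integral (\<lambda>x. b m i j x - u2 i j x)) \<longlonglongrightarrow> 0" for i j
    using Wb[of i j] by (simp add: tendsto_W1_def sq_integral_def abs_powr_2)
  have qc: "(\<lambda>m. sq_integral (\<lambda>x. c m i j k x - u3 i j k x)) \<longlonglongrightarrow> 0" for i j k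
    using Wb[of i j] by (simp add: tendsto_W1_def sq_integral_def abs_powr_2 c_def u3_def)
  note ma = smooth_lebesgue_measurable[OF sa] and mb = smooth_lebesgue_measurable[OF sb] and mc = smooth_lebesgue_measurable[OF sc]
  define V where "V = (\<lambda>j x. 2 * (\<Sum>i\<in>UNIV. u i x * u2 i j x))"
  define V2 where "V2 = (\<lambda>j k x. 2 * (\<Sum>i\<in>UNIV. u i x * u3 i j k x + u2 i k x * u2 i j x))"
  have lq: "L1_conv q Q"
    unfolding Q_eq q_def by (intro L1_conv_sum L1_conv_mult ma L1 qa) auto
  have ldq: "L1_conv (dq j) (V j)" for j
    unfolding dq_def V_def by (intro L1_conv_double L1_conv_sum L1_conv_mult ma mb L1 L2 qa qb) auto
  have lddq: "L1_conv (ddq j k) (V2 j k)" for j k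
    unfolding ddq_def V2_def
    by (intro L1_conv_double L1_conv_sum L1_conv_add L1_conv_mult ma mb mc L1 L2 L3 qa qb qc) auto
  have hQ: "has_weak_pderiv j Q (V j)" for j
    by (rule L1_conv_weak_pderiv[OF lq tq]) (simp add: pq ldq)
  define uQ where "uQ = (\<lambda>j. weak_pderiv j Q)"
  have uQ: "uQ j \<in> borel_measurable lebesgue" "AE x in lebesgue. V j x = uQ j x" for j
  proof -
    show "uQ j \<in> borel_measurable lebesgue"
      using weak_pderiv_eq(1)[OF hQ, of j] by (auto simp: uQ_def has_weak_pderiv_def locally_integrable_measurable)
    show "AE x in lebesgue. V j x = uQ j x" using weak_pderiv_eq(2)[OF hQ, of j] unfolding uQ_def by eventually_elim simp
  qed
  have tdq: "test_function (dq j m)" for j m unfolding pq[symmetric] by (rule test_function_partial_deriv[OF tq])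
  have lddq': "L1_conv (\<lambda>m. partial_deriv k (dq j m)) (V2 j k)" for j k
    using lddq by (simp add: pdq)
  have sQ: "sobolev 1 1 (uQ j)" for j by (rule L1_conv_W1(1)[OF tdq ldq uQ lddq'])
  have WQ: "tendsto_W1 1 (\<lambda>m. dq j m) (uQ j)" for j by (rule L1_conv_W1(2)[OF tdq ldq uQ lddq'])
  define H where "H = (\<lambda>j x. 2 * (\<Sum>i\<in>UNIV. g i x * G i j x))"
  have Hm: "H j \<in> borel_measurable borel" for j
    unfolding H_def by (intro borel_measurable_times borel_measurable_const borel_measurable_sum gm Gm)
  have limH: "AE z in lborel. (\<lambda>m. dq j m (graph_map e \<gamma> z)) \<longlonglongrightarrow> H j (graph_map e \<gamma> z)"
    if "norm e = 1" "C11 \<gamma>" for e \<gamma> j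
  proof -
    have "AE z in lborel. \<forall>i. (\<lambda>m. a m i (graph_map e \<gamma> z)) \<longlonglongrightarrow> g i (graph_map e \<gamma> z)"
      by (rule eventually_all_finite) (rule limg[OF that])
    moreover have "AE z in lborel. \<forall>i. (\<lambda>m. b m i j (graph_map e \<gamma> z)) \<longlonglongrightarrow> G i j (graph_map e \<gamma> z)"
      by (rule eventually_all_finite) (rule limG[OF that])
    ultimately show ?thesis
    proof eventually_elim
      case (elim z)
      then show ?case unfolding dq_def H_def by (intro tendsto_mult tendsto_const tendsto_sum) auto
    qed
  qed
  have trH: "AE_boundary \<Omega> \<Gamma> (\<lambda>x. boundary_trace 1 \<Omega> \<Gamma> (uQ j) x = H j x)" for j
    by (rule boundary_trace_eq[OF _ \<Gamma> tdq sQ WQ Hm limH]) auto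

  show ?thesis
    unfolding AE_boundary_def
  proof (intro allI impI)
    fix x0 r e \<gamma> assume ch: "C11_chart \<Omega> x0 r e \<gamma>"
    then have e: "norm e = 1" and \<gamma>: "C11 \<gamma>" by (auto simp: C11_chart_def)
    let ?\<Phi> = "graph_map e \<gamma>"
    define f where "f = (\<lambda>i z. graph_normal e \<gamma> z $ i)"
    obtain L where L: "\<And>i x y. \<bar>f i x - f i y\<bar> \<le> L * norm (x - y)"
      using normal_lipschitz[OF e \<gamma>] unfolding f_def by blast
    obtain T where T: "open T" "\<Gamma> = frontier \<Omega> \<inter> T" using \<Gamma> by (auto simp: openin_open)
    define U where "U = ?\<Phi> -` (T \<inter> ball x0 r)"
    have oU: "open U"
      unfolding U_def by (rule open_vimage[OF open_Int[OF T(1) open_ball] graph_map_continuous[OF e \<gamma>]])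
    have zU: "z \<in> U \<longleftrightarrow> ?\<Phi> z \<in> \<Gamma> \<inter> ball x0 r" for z
    proof -
      have "?\<Phi> z \<bullet> e = \<gamma> (tangential e (?\<Phi> z))"
        by (simp add: graph_map_inner[OF e \<gamma>] tangential_graph_map[OF e \<gamma>])
      then show ?thesis using chart_frontierI[OF ch op] by (auto simp: U_def T(2))
    qed
    have nz: "n (?\<Phi> z) = graph_normal e \<gamma> z" if "z \<in> U" for z
    proof -
      have "?\<Phi> z \<in> \<Gamma> \<inter> ball x0 r" using that zU by blast
      then have "n (?\<Phi> z) = graph_normal e \<gamma> (?\<Phi> z)" using n T(2) by (intro outward_normal_eq[OF ch op]) auto
      then show ?thesis by (simp add: normal_graph_map[OF e \<gamma>])
    qed
    have chart_AE: "AE z in lborel. z \<in> U \<longrightarrow> P (?\<Phi> z)" if "AE_boundary \<Omega> \<Gamma> P" for P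
    proof -
      have "AE x in graph_measure e \<gamma>. x \<in> \<Gamma> \<inter> ball x0 r \<longrightarrow> P x"
        using that ch unfolding AE_boundary_def by blast
      from AE_graph_measureD[OF e \<gamma> this] show ?thesis by (simp only: zU)
    qed
    have tg: "AE z in lborel. \<forall>i. z \<in> U \<longrightarrow> boundary_trace 2 \<Omega> \<Gamma> (u i) (?\<Phi> z) = g i (?\<Phi> z)"
      by (rule eventually_all_finite) (rule chart_AE[OF trg])
    have tH: "AE z in lborel. \<forall>j. z \<in> U \<longrightarrow> boundary_trace 1 \<Omega> \<Gamma> (uQ j) (?\<Phi> z) = H j (?\<Phi> z)"
      by (rule eventually_all_finite) (rule chart_AE[OF trH])
    have grad_trace: "trace_grad 2 \<Omega> \<Gamma> \<phi> x = (\<chi> i. boundary_trace 2 \<Omega> \<Gamma> (u i) x)" for x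
      by (simp add: trace_grad_def u_def)
    have orth: "AE z in lborel. z \<in> U \<longrightarrow> (\<Sum>i\<in>UNIV. f i z * g i (?\<Phi> z)) = 0"
      using chart_AE[OF assms(8)] tg
    proof eventually_elim
      case (elim z)
      show ?case
      proof
        assume z: "z \<in> U"
        then have "n (?\<Phi> z) \<bullet> (\<chi> i. g i (?\<Phi> z)) = 0"
          using elim by (simp add: normal_deriv_def grad_trace)
        then show "(\<Sum>i\<in>UNIV. f i z * g i (?\<Phi> z)) = 0" by (simp add: nz[OF z] inner_vec_def f_def)
      qed
    qed
    have rad: "AE z in lborel. \<forall>i. f i differentiable (at z)"
      by (rule eventually_all_finite) (rule rademacher[OF L])
    have ident: "AE z in lborel. \<forall>k. z \<in> U \<longrightarrow> (\<Sum>i\<in>UNIV. directional_limit (f i) (axis k 1) z * g i (?\<Phi> z) +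
      f i z * (\<Sum>j\<in>UNIV. G i j (?\<Phi> z) * graph_tangent e \<gamma> z (axis k 1) $ j)) = 0"
      by (rule eventually_all_finite)
         (rule tangential_identity[OF e \<gamma> oU L ta s1u Wa gm limg[OF e \<gamma>] s1u2 Wb[unfolded b_def] Gm limG[OF e \<gamma>, unfolded b_def] orth])
    show "AE x in graph_measure e \<gamma>. x \<in> \<Gamma> \<inter> ball x0 r \<longrightarrow>
      normal_deriv 1 \<Omega> \<Gamma> n (\<lambda>y. (norm (weak_grad \<phi> y))\<^sup>2) x =
      - 2 * (sobolev_tangential_grad 2 \<Omega> \<Gamma> n \<phi> x \<bullet> (weingarten \<Gamma> n x *v sobolev_tangential_grad 2 \<Omega> \<Gamma> n \<phi> x))"
    proof (rule AE_graph_measureI[OF e \<gamma>])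
      show "AE z in lborel. ?\<Phi> z \<in> \<Gamma> \<inter> ball x0 r \<longrightarrow>
        normal_deriv 1 \<Omega> \<Gamma> n (\<lambda>y. (norm (weak_grad \<phi> y))\<^sup>2) (?\<Phi> z) =
        - 2 * (sobolev_tangential_grad 2 \<Omega> \<Gamma> n \<phi> (?\<Phi> z) \<bullet>
          (weingarten \<Gamma> n (?\<Phi> z) *v sobolev_tangential_grad 2 \<Omega> \<Gamma> n \<phi> (?\<Phi> z)))"
        using tg tH orth rad ident
      proof eventually_elim
        case (elim z)
        show ?case
        proof
          assume x: "?\<Phi> z \<in> \<Gamma> \<inter> ball x0 r"
          then have z: "z \<in> U" using zU by blast
          let ?x = "?\<Phi> z"
          define s where "s = (\<chi> i. g i ?x)"
          have tgrad: "trace_grad 2 \<Omega> \<Gamma> \<phi> ?x = s" using elim(1) z by (simp add: grad_trace s_def)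
          have ns: "n ?x \<bullet> s = 0" using elim(3) z by (simp add: nz[OF z] s_def inner_vec_def f_def)
          have st: "sobolev_tangential_grad 2 \<Omega> \<Gamma> n \<phi> ?x = s"
            by (simp add: sobolev_tangential_grad_def normal_deriv_def tgrad ns)
          have sN: "s \<bullet> graph_normal e \<gamma> z = 0" using ns by (simp add: nz[OF z] inner_commute)
          have df: "(\<lambda>y. graph_normal e \<gamma> y $ i) differentiable (at z)" for i using elim(4) by (simp add: f_def)
          have W: "tangential_grad \<Gamma> n (\<lambda>y. n y $ i) ?x \<bullet> s = grad (f i) z \<bullet> s" for i
            using tangential_grad_normal[OF ch op \<Gamma> n x normal_derivative_graph_map(1)[OF e \<gamma> df], of s i] ns
              normal_derivative_graph_map(2)[OF e \<gamma> df, of i]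
            by (simp add: f_def inner_commute)
          have "(\<Sum>j\<in>UNIV. graph_normal e \<gamma> z $ j * (2 * (\<Sum>i\<in>UNIV. g i ?x * G i j ?x))) =
              - 2 * (\<Sum>i\<in>UNIV. g i ?x * (grad (f i) z \<bullet> s))"
          proof (rule pointwise_identity)
            show "linear (graph_tangent e \<gamma> z)" by (rule has_derivative_linear[OF graph_map_has_derivative[OF e \<gamma>]])
            show "s = (\<chi> i. g i ?x)" by (rule s_def)
            show "graph_tangent e \<gamma> z s = s" by (rule graph_tangent_orthogonal[OF e \<gamma> sN])
            show "G i j ?x = G j i ?x" for i j by (rule Gsym)
            fix k
            have "directional_limit (f i) (axis k 1) z = grad (f i) z $ k" for i
              using directional_limit_grad[OF L, of i z "axis k 1"] elim(4) by (simp add: inner_axis)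
            then show "(\<Sum>i\<in>UNIV. grad (f i) z $ k * g i ?x + graph_normal e \<gamma> z $ i *
                (\<Sum>j\<in>UNIV. G i j ?x * graph_tangent e \<gamma> z (axis k 1) $ j)) = 0"
              using elim(5)[rule_format, OF z, of k] by (simp only: f_def)
          qed
          moreover have "normal_deriv 1 \<Omega> \<Gamma> n (\<lambda>y. (norm (weak_grad \<phi> y))\<^sup>2) ?x =
              (\<Sum>j\<in>UNIV. graph_normal e \<gamma> z $ j * (2 * (\<Sum>i\<in>UNIV. g i ?x * G i j ?x)))"
          proof -
            have "normal_deriv 1 \<Omega> \<Gamma> n Q ?x = (\<Sum>j\<in>UNIV. graph_normal e \<gamma> z $ j * H j ?x)"
              using elim(2) z by (simp add: normal_deriv_def trace_grad_def inner_vec_def nz[OF z] uQ_def)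
            then show ?thesis by (simp add: Q_def H_def)
          qed
          moreover have "s \<bullet> (weingarten \<Gamma> n ?x *v s) = (\<Sum>i\<in>UNIV. g i ?x * (grad (f i) z \<bullet> s))"
            unfolding inner_weingarten W by (simp add: s_def)
          ultimately show "normal_deriv 1 \<Omega> \<Gamma> n (\<lambda>y. (norm (weak_grad \<phi> y))\<^sup>2) ?x =
            - 2 * (sobolev_tangential_grad 2 \<Omega> \<Gamma> n \<phi> ?x \<bullet>
              (weingarten \<Gamma> n ?x *v sobolev_tangential_grad 2 \<Omega> \<Gamma> n \<phi> ?x))"
            by (simp only: st)
        qed
      qed
    qed
  qed
qed

end
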